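(* Let $k\ge0$. The mixed discontinuous Galerkin scheme: find $(\boldsymbol p_h,u_h)\in\boldsymbol Q_h^{k+1}\times V_h^k$ such that $$a_h^{\rm MDG}(\boldsymbol p_h,\boldsymbol q_h)+b_h^{\rm MDG}(\boldsymbol q_h,u_h)=0\quad\forall\boldsymbol q_h\in\boldsymbol Q_h^{k+1},\qquad b_h^{\rm MDG}(\boldsymbol p_h,v_h)=-\int_\Omega f\,v_h\,dx\quad\forall v_h\in V_h^k,$$ is well-posed for $(\boldsymbol Q_h^{k+1},\|\cdot\|_{{\rm MDG},h})$ and $(V_h^k,\|\cdot\|)$, uniformly in $h$. That is, there is a constant $C$ independent of $h$ such that, for all linear functionals $F$ on $\boldsymbol Q_h^{k+1}$ and $G$ on $V_h^k$, there is exactly one $(\boldsymbol p_h,u_h)\in\boldsymbol Q_h^{k+1}\times V_h^k$ satisfying $$a_h^{\rm MDG}(\boldsymbol p_h,\boldsymbol q_h)+b_h^{\rm MDG}(\boldsymbol q_h,u_h)=F(\boldsymbol q_h)\quad\forall\boldsymbol q_h\in\boldsymbol Q_h^{k+1},\qquad b_h^{\rm MDG}(\boldsymbol p_h,v_h)=G(v_h)\quad\forall v_h\in V_h^k,$$ and $$\|\boldsymbol p_h\|_{{\rm MDG},h}+\|u_h\|\le C\Big(\sup_{0\ne\boldsymbol q_h\in\boldsymbol Q_h^{k+1}}\frac{F(\boldsymbol q_h)}{\|\boldsymbol q_h\|_{{\rm MDG},h}}+\sup_{0\ne v_h\in V_h^k}\frac{G(v_h)}{\|v_h\|}\Big).$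$
   Context: $\Omega\subset\mathbb R^d$ is a bounded polytopal (Lipschitz) domain; $\alpha$ is a bounded, symmetric, uniformly positive definite matrix-valued function on $\Omega$, $c=\alpha^{-1}$, and $f\in L^2(\Omega)$. $\{\mathcal T_h\}$ is a family of conforming simplicial triangulations of $\overline\Omega$ satisfying the minimal angle condition; $h_K=\mathrm{diam}(K)$, $h=\max_Kh_K$. $\mathcal E_h^i$ is the set of interior faces ("edges") $e$, $h_e=\mathrm{diam}(e)$. $(\cdot,\cdot)_{\mathcal T_h}=\sum_K(\cdot,\cdot)_K$ is the $L^2$ inner product, $\langle\cdot,\cdot\rangle_{\mathcal E_h^i}=\sum_{e\in\mathcal E_h^i}\langle\cdot,\cdot\rangle_e$ with $\langle\cdot,\cdot\rangle_e$ the $L^2(e)$ inner product, $\|\cdot\|$ is the $L^2(\Omega)$ norm, and $\mathrm{div}_h$ is the elementwise divergence. For an interior face shared by $K^+,K^-$ with outward normals $\boldsymbol n^\pm$: $\{v\}=\frac12(v^++v^-)$ and $[\boldsymbol q]=\boldsymbol q^+\cdot\boldsymbol n^++\boldsymbol q^-\cdot\boldsymbol n^-$. $V_h^k=\{v\in L^2(\Omega):v|_K\in\mathcal P_k(K)\ \forall K\in\mathcal T_h\}$, $\boldsymbol Q_h^{k+1}=\{\boldsymbol q\in L^2(\Omega)^d:\boldsymbol q|_K\in\mathcal P_{k+1}(K)^d\ \forall K\in\mathcal T_h\}$, where $\mathcal P_m(K)$ denotes polynomials of degree at most $m$ on $K$. The penalty parameters $\eta_e$ ($e\in\mathcal E_h^i$)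 are positive constants bounded above and below by positive constants independent of $h$. The bilinear forms and norm are $$a_h^{\rm MDG}(\boldsymbol p,\boldsymbol q)=(c\boldsymbol p,\boldsymbol q)_{\mathcal T_h}+\langle\eta_eh_e^{-1}[\boldsymbol p],[\boldsymbol q]\rangle_{\mathcal E_h^i},\qquad b_h^{\rm MDG}(\boldsymbol p,v)=-(\mathrm{div}_h\boldsymbol p,v)_{\mathcal T_h}+\langle[\boldsymbol p],\{v\}\rangle_{\mathcal E_h^i},$$ $$\|\boldsymbol q\|_{{\rm MDG},h}^2=(c\boldsymbol q,\boldsymbol q)_{\mathcal T_h}+(\mathrm{div}_h\boldsymbol q,\mathrm{div}_h\boldsymbol q)_{\mathcal T_h}+\langle\eta_eh_e^{-1}[\boldsymbol q],[\boldsymbol q]\rangle_{\mathcal E_h^i}.$$ "Independent of $h$" means depending only on shape regularity, $\Omega$, $d$, $k$, $\alpha$ and the bounds on $\eta_e$. *)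

theory Defs
  imports "HOL-Analysis.Analysis"
begin

text \<open>Near each boundary point, the domain is the set strictly below the graph of a Lipschitz
  function over the hyperplane orthogonal to a unit vector \<open>\<nu>\<close>.\<close>

definition lipschitz_boundary :: "(real ^ 'd) set \<Rightarrow> bool" where
  "lipschitz_boundary \<Omega> \<longleftrightarrow>
     (\<forall>x \<in> frontier \<Omega>. \<exists>r>0. \<exists>\<nu>. \<exists>L. \<exists>\<phi> :: real ^ 'd \<Rightarrow> real.
        norm \<nu> = 1 \<and> L-lipschitz_on UNIV \<phi> \<and>
        (\<forall>y \<in> ball x r. y \<in> \<Omega> \<longleftrightarrow> y \<bullet> \<nu> < \<phi> (y - (y \<bullet> \<nu>) *\<^sub>R \<nu>)))"

definition polytopal_lipschitz_domain :: "(real ^ 'd) set \<Rightarrow> bool" where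
  "polytopal_lipschitz_domain \<Omega> \<longleftrightarrow>
     open \<Omega> \<and> connected \<Omega> \<and> \<Omega> \<noteq> {} \<and> bounded \<Omega> \<and> lipschitz_boundary \<Omega> \<and>
     (\<exists>\<P>. finite \<P> \<and> (\<forall>P \<in> \<P>. polytope P) \<and> closure \<Omega> = \<Union>\<P>)"

definition admissible_coefficient :: "(real ^ 'd) set \<Rightarrow> (real ^ 'd \<Rightarrow> real ^ 'd ^ 'd) \<Rightarrow> bool" where
  "admissible_coefficient \<Omega> \<alpha> \<longleftrightarrow>
     \<alpha> \<in> borel_measurable (lebesgue_on \<Omega>) \<and> bounded (\<alpha> ` \<Omega>) \<and>
     (\<forall>x \<in> \<Omega>. transpose (\<alpha> x) = \<alpha> x) \<and>
     (\<exists>a>0. \<forall>x \<in> \<Omega>. \<forall>\<xi>. a * (norm \<xi>)\<^sup>2 \<le> \<xi> \<bullet> (\<alpha> x *v \<xi>))"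

definition square_integrable_on :: "(real ^ 'd) set \<Rightarrow> (real ^ 'd \<Rightarrow> real) \<Rightarrow> bool" where
  "square_integrable_on \<Omega> f \<longleftrightarrow>
     f \<in> borel_measurable (lebesgue_on \<Omega>) \<and> integrable (lebesgue_on \<Omega>) (\<lambda>x. (f x)\<^sup>2)"

text \<open>The library's \<open>triangulation\<close> provides finiteness and conformity: two simplices meet
  in a common (possibly empty) face.\<close>

definition conforming_mesh :: "(real ^ 'd) set \<Rightarrow> (real ^ 'd) set set \<Rightarrow> bool" where
  "conforming_mesh \<Omega> T \<longleftrightarrow>
     triangulation T \<and> (\<forall>K \<in> T. int CARD('d) simplex K) \<and> \<Union>T = closure \<Omega>"

definition inball_diameter :: "(real ^ 'd) set \<Rightarrow> real" where
  "inball_diameter K = Sup {2 * r | r x. 0 \<le> r \<and> cball x r \<subseteq> K}"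

text \<open>The minimal angle condition, in the form used in arbitrary dimension:
  \<open>h\<^sub>K \<le> \<sigma> \<rho>\<^sub>K\<close> with \<open>\<rho>\<^sub>K\<close> the diameter of the largest ball contained in \<open>K\<close>.\<close>

definition shape_regular :: "real \<Rightarrow> (real ^ 'd) set set \<Rightarrow> bool" where
  "shape_regular \<sigma> T \<longleftrightarrow> (\<forall>K \<in> T. diameter K \<le> \<sigma> * inball_diameter K)"

definition interior_faces :: "(real ^ 'd) set set \<Rightarrow> (real ^ 'd) set set" where
  "interior_faces T = {e. \<exists>K \<in> T. \<exists>K' \<in> T. K \<noteq> K' \<and> e facet_of K \<and> e facet_of K'}"

definition outward_normal :: "(real ^ 'd) set \<Rightarrow> (real ^ 'd) set \<Rightarrow> real ^ 'd" where
  "outward_normal K e = (THE n. norm n = 1 \<and> (\<forall>x \<in> e. \<forall>y \<in> K. n \<bullet> (y - x) \<le> 0))"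

definition polynomial_deg_le :: "nat \<Rightarrow> (real ^ 'd \<Rightarrow> real) \<Rightarrow> bool" where
  "polynomial_deg_le m P \<longleftrightarrow>
     (\<exists>a :: ('d \<Rightarrow> nat) \<Rightarrow> real. \<forall>x.
        P x = (\<Sum>s | sum s UNIV \<le> m. a s * (\<Prod>i\<in>UNIV. (x $ i) ^ s i)))"

text \<open>Elements of \<open>L\<^sup>2\<close> are classes modulo null sets. A piecewise polynomial class is
  represented by its unique member that is polynomial on each open element and zero elsewhere,
  in particular on the mesh skeleton. Thus equality of finite element functions is equality in
  HOL. Membership in \<open>L\<^sup>2(\<Omega>)\<close> is automatic, since the elements are bounded.\<close>

definition V_h :: "(real ^ 'd) set set \<Rightarrow> nat \<Rightarrow> (real ^ 'd \<Rightarrow> real) set" where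
  "V_h T k = {v. (\<forall>K \<in> T. \<exists>P. polynomial_deg_le k P \<and> (\<forall>x \<in> interior K. v x = P x)) \<and>
                 (\<forall>x. x \<notin> (\<Union>K\<in>T. interior K) \<longrightarrow> v x = 0)}"

definition Q_h :: "(real ^ 'd) set set \<Rightarrow> nat \<Rightarrow> (real ^ 'd \<Rightarrow> real ^ 'd) set" where
  "Q_h T m = {q. \<forall>i. (\<lambda>x. q x $ i) \<in> V_h T m}"

definition div_h :: "(real ^ 'd) set set \<Rightarrow> (real ^ 'd \<Rightarrow> real ^ 'd) \<Rightarrow> real ^ 'd \<Rightarrow> real" where
  "div_h T q x =
     (if x \<in> (\<Union>K\<in>T. interior K)
      then \<Sum>i\<in>UNIV. frechet_derivative q (at x) (axis i 1) $ i else 0)"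

definition trace_from ::
    "(real ^ 'd) set \<Rightarrow> (real ^ 'd \<Rightarrow> 'b::t2_space) \<Rightarrow> real ^ 'd \<Rightarrow> 'b" where
  "trace_from K v x = Lim (at x within interior K) v"

text \<open>An interior face \<open>e\<close> is a facet of exactly two elements \<open>K\<^sup>+\<close> and \<open>K\<^sup>-\<close>,
  so the sums below have two terms.\<close>

definition jump ::
    "(real ^ 'd) set set \<Rightarrow> (real ^ 'd) set \<Rightarrow> (real ^ 'd \<Rightarrow> real ^ 'd) \<Rightarrow> real ^ 'd \<Rightarrow> real" where
  "jump T e q x = (\<Sum>K | K \<in> T \<and> e facet_of K. trace_from K q x \<bullet> outward_normal K e)"

definition average ::
    "(real ^ 'd) set set \<Rightarrow> (real ^ 'd) set \<Rightarrow> (real ^ 'd \<Rightarrow> real) \<Rightarrow> real ^ 'd \<Rightarrow> real" where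
  "average T e v x = 1/2 * (\<Sum>K | K \<in> T \<and> e facet_of K. trace_from K v x)"

text \<open>Surface measure on a compact set \<open>e\<close> spanning a hyperplane: the right prism over \<open>e\<close>
  of height \<open>1\<close> (reaching \<open>1/2\<close> to either side) is projected orthogonally onto the
  hyperplane. By Fubini the image of Lebesgue measure is the \<open>d-1\<close>-dimensional measure
  restricted to \<open>e\<close>.\<close>

definition face_measure :: "(real ^ 'd) set \<Rightarrow> (real ^ 'd) measure" where
  "face_measure e =
     (let proj = closest_point (affine hull e)
      in distr (lebesgue_on {y. proj y \<in> e \<and> dist y (proj y) \<le> 1/2}) borel proj)"

definition face_inner ::
    "(real ^ 'd) set \<Rightarrow> (real ^ 'd \<Rightarrow> real) \<Rightarrow> (real ^ 'd \<Rightarrow> real) \<Rightarrow> real" where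
  "face_inner e g h = (LINT x|face_measure e. g x * h x)"

definition mesh_inner ::
    "(real ^ 'd) set set \<Rightarrow> (real ^ 'd \<Rightarrow> 'b::real_inner) \<Rightarrow> (real ^ 'd \<Rightarrow> 'b) \<Rightarrow> real" where
  "mesh_inner T g h = (\<Sum>K\<in>T. LINT x|lebesgue_on K. g x \<bullet> h x)"

definition L2_norm_on :: "(real ^ 'd) set \<Rightarrow> (real ^ 'd \<Rightarrow> real) \<Rightarrow> real" where
  "L2_norm_on \<Omega> v = sqrt (LINT x|lebesgue_on \<Omega>. (v x)\<^sup>2)"

definition weighted_jumps ::
    "(real ^ 'd) set set \<Rightarrow> ((real ^ 'd) set \<Rightarrow> real) \<Rightarrow>
     (real ^ 'd \<Rightarrow> real ^ 'd) \<Rightarrow> (real ^ 'd \<Rightarrow> real ^ 'd) \<Rightarrow> real" where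
  "weighted_jumps T \<eta> p q =
     (\<Sum>e\<in>interior_faces T. \<eta> e * inverse (diameter e) * face_inner e (jump T e p) (jump T e q))"

definition a_MDG ::
    "(real ^ 'd \<Rightarrow> real ^ 'd ^ 'd) \<Rightarrow> (real ^ 'd) set set \<Rightarrow> ((real ^ 'd) set \<Rightarrow> real) \<Rightarrow>
     (real ^ 'd \<Rightarrow> real ^ 'd) \<Rightarrow> (real ^ 'd \<Rightarrow> real ^ 'd) \<Rightarrow> real" where
  "a_MDG \<alpha> T \<eta> p q =
     mesh_inner T (\<lambda>x. matrix_inv (\<alpha> x) *v p x) q + weighted_jumps T \<eta> p q"

definition b_MDG ::
    "(real ^ 'd) set set \<Rightarrow> (real ^ 'd \<Rightarrow> real ^ 'd) \<Rightarrow> (real ^ 'd \<Rightarrow> real) \<Rightarrow> real" where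
  "b_MDG T p v =
     - mesh_inner T (div_h T p) v
     + (\<Sum>e\<in>interior_faces T. face_inner e (jump T e p) (average T e v))"

definition norm_MDG ::
    "(real ^ 'd \<Rightarrow> real ^ 'd ^ 'd) \<Rightarrow> (real ^ 'd) set set \<Rightarrow> ((real ^ 'd) set \<Rightarrow> real) \<Rightarrow>
     (real ^ 'd \<Rightarrow> real ^ 'd) \<Rightarrow> real" where
  "norm_MDG \<alpha> T \<eta> q =
     sqrt (mesh_inner T (\<lambda>x. matrix_inv (\<alpha> x) *v q x) q
           + mesh_inner T (div_h T q) (div_h T q) + weighted_jumps T \<eta> q q)"

definition linear_functional_on ::
    "('a \<Rightarrow> 'b::real_vector) set \<Rightarrow> (('a \<Rightarrow> 'b) \<Rightarrow> real) \<Rightarrow> bool" where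
  "linear_functional_on S F \<longleftrightarrow>
     (\<forall>g \<in> S. \<forall>h \<in> S. F (\<lambda>x. g x + h x) = F g + F h) \<and>
     (\<forall>r. \<forall>g \<in> S. F (\<lambda>x. r *\<^sub>R g x) = r * F g)"

definition dual_norm ::
    "('a \<Rightarrow> 'b::real_vector) set \<Rightarrow> (('a \<Rightarrow> 'b) \<Rightarrow> real) \<Rightarrow> (('a \<Rightarrow> 'b) \<Rightarrow> real) \<Rightarrow> real" where
  "dual_norm S N F = (SUP g \<in> S - {\<lambda>x. 0}. F g / N g)"

definition MDG_solution ::
    "(real ^ 'd \<Rightarrow> real ^ 'd ^ 'd) \<Rightarrow> (real ^ 'd) set set \<Rightarrow> ((real ^ 'd) set \<Rightarrow> real) \<Rightarrow> nat \<Rightarrow>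
     ((real ^ 'd \<Rightarrow> real ^ 'd) \<Rightarrow> real) \<Rightarrow> ((real ^ 'd \<Rightarrow> real) \<Rightarrow> real) \<Rightarrow>
     (real ^ 'd \<Rightarrow> real ^ 'd) \<Rightarrow> (real ^ 'd \<Rightarrow> real) \<Rightarrow> bool" where
  "MDG_solution \<alpha> T \<eta> k F G p u \<longleftrightarrow>
     p \<in> Q_h T (k + 1) \<and> u \<in> V_h T k \<and>
     (\<forall>q \<in> Q_h T (k + 1). a_MDG \<alpha> T \<eta> p q + b_MDG T q u = F q) \<and>
     (\<forall>v \<in> V_h T k. b_MDG T p v = G v)"

end

theory Submission
  imports Defs "HOL-Library.Function_Algebras"
begin

text \<open>
  The scheme is a saddle point problem in which \<open>a\<close> is an inner product on the fields.  For finite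
  dimensional spaces such a problem is solved by two applications of Riesz' theorem as soon as \<open>b\<close>
  satisfies an inf-sup condition, with explicit bounds.  The whole difficulty is therefore stability with
  constants that do not see the mesh.  Two facts carry it.

  The first (\<open>inf_sup\<close>) is an inf-sup condition for the norm given by \<open>a\<close> alone: every \<open>w\<close> in \<open>V\<^sub>h\<close>
  admits a field \<open>q\<close> with \<open>a q q \<le> C * b q w\<close> and \<open>(w, w) \<le> C * b q w\<close>.  Integrating by parts on every
  element, a field without normal jumps satisfies \<open>b q w = (q, \<nabla>\<^sub>h w) - \<Sum>\<^sub>e \<langle>q, [w]\<rangle>\<^sub>e\<close>, where \<open>[w]\<close> is the
  vector valued jump, which on the boundary is \<open>w n\<close>.  So \<open>q\<close> is built (\<open>stable_field\<close>) such that its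
  normal component on every face \<open>e\<close> is that of \<open>- h\<^sub>e\<inverse> [w]\<close>, prescribed from both sides alike, and that
  its scalar product with \<open>\<nabla>\<^sub>h w\<close> dominates \<open>\<parallel>\<nabla>\<^sub>h w\<parallel>\<^sup>2\<close> up to a small multiple of the jumps.  Since fields have one polynomial degree more
  than scalar functions, both can be done element by element and without degrees of freedom: normal traces
  are lifted by fields \<open>\<rho> (x - a)\<close> pointing away from the opposite vertex (\<open>radial_lift\<close>), and \<open>\<nabla> w\<close> is
  tested by fields along the edges which vanish in normal direction on all faces (\<open>edge_bubble\<close>).  The
  result is \<open>b q w \<ge> 1/2 (\<parallel>\<nabla>\<^sub>h w\<parallel>\<^sup>2 + \<Sum>\<^sub>e h\<^sub>e\<inverse> \<parallel>[w]\<parallel>\<^sup>2)\<close>, and a Poincare inequality for discontinuous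
  functions (\<open>discrete_Poincare\<close>) bounds \<open>\<parallel>w\<parallel>\<close> by the right-hand side.

  The second (\<open>jump_term_bound\<close>) is that \<open>b q v\<close> differs from \<open>- (div\<^sub>h q, v)\<close> by at most a multiple of
  \<open>sqrt (a q q) * \<parallel>v\<parallel>\<close>, by the trace inequality and the penalty term.  Testing the second equation with
  \<open>v = div\<^sub>h p\<close> then controls the divergence, which \<open>a\<close> does not see.  The locale \<open>saddle_point\<close> derives
  from these two facts unique solvability and the bound in the full norm.

  On one simplex no reference element is used.  The surface measure of a face is that of a prism erected on
  it, so Tonelli's theorem and translations give Cavalieri's principle (\<open>cavalieri\<close>), dilations give the
  formula for integration over a cone, and the fundamental theorem of calculus along the rays gives Gauss's
  theorem for the fields \<open>\<psi> (x - a)\<close> with \<open>a\<close> a vertex (\<open>Gauss_cone\<close>).  All other fields that occur are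
  combinations of these.  Inverse and trace inequalities compare a polynomial on the simplex with its mean
  square over an inscribed ball, where scaling is explicit (\<open>polynomial_integral_bound\<close>).

  All constants depend only on the dimension, the polynomial degree, the shape regularity, a ball that
  contains the domain, the bounds of the coefficient and the lower bound of the
  penalty.  The Lipschitz property of the boundary ensures that the interiors of the elements lie in the domain (\<open>interior_closure_lipschitz\<close>),
  where the coefficient is elliptic.
\<close>

section \<open>Inner products on finite-dimensional subspaces\<close>

text \<open>The discrete spaces are sets of functions. With the pointwise operations every function space is
  a real vector space, so they become subspaces and \<open>span\<close> is available for them.\<close>
instantiation "fun" :: (type, real_vector) real_vector
begin

definition scaleR_fun :: "real \<Rightarrow> ('a \<Rightarrow> 'b) \<Rightarrow> 'a \<Rightarrow> 'b" where
  "scaleR_fun r f = (\<lambda>x. r *\<^sub>R f x)"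

instance
  by standard (auto simp: scaleR_fun_def plus_fun_def fun_eq_iff algebra_simps)

end

lemma scaleR_fun_apply [simp]: "(r *\<^sub>R f) x = r *\<^sub>R f x"
  by (simp add: scaleR_fun_def)

text \<open>The forms of interest are bilinear on the discrete spaces but not on all functions, because integrals of
  arbitrary functions are not additive. Hence all properties are relative to a set.\<close>
definition psd_form_on :: "'v::real_vector set \<Rightarrow> ('v \<Rightarrow> 'v \<Rightarrow> real) \<Rightarrow> bool" where
  "psd_form_on S f \<longleftrightarrow>
     (\<forall>x \<in> S. \<forall>y \<in> S. f x y = f y x) \<and>
     (\<forall>x \<in> S. \<forall>y \<in> S. \<forall>z \<in> S. f (x + y) z = f x z + f y z) \<and>
     (\<forall>r. \<forall>x \<in> S. \<forall>y \<in> S. f (r *\<^sub>R x) y = r * f x y) \<and>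
     (\<forall>x \<in> S. 0 \<le> f x x)"

definition definite_on :: "'v::real_vector set \<Rightarrow> ('v \<Rightarrow> 'v \<Rightarrow> real) \<Rightarrow> bool" where
  "definite_on S f \<longleftrightarrow> (\<forall>x \<in> S. f x x = 0 \<longrightarrow> x = 0)"

definition linear_on_subspace :: "'v::real_vector set \<Rightarrow> ('v \<Rightarrow> 'w::real_vector) \<Rightarrow> bool" where
  "linear_on_subspace S F \<longleftrightarrow>
     (\<forall>x \<in> S. \<forall>y \<in> S. F (x + y) = F x + F y) \<and> (\<forall>r. \<forall>x \<in> S. F (r *\<^sub>R x) = r *\<^sub>R F x)"

lemma linear_on_subspace_0: "linear_on_subspace S F \<Longrightarrow> subspace S \<Longrightarrow> F 0 = 0"
  unfolding linear_on_subspace_def using subspace_0[of S]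
  by (metis scale_zero_left)

lemma linear_on_subspace_sum:
  assumes "linear_on_subspace S F" "subspace S" "\<And>i. i \<in> I \<Longrightarrow> x i \<in> S"
  shows "F (\<Sum>i\<in>I. x i) = (\<Sum>i\<in>I. F (x i))"
  using assms(3)
proof (induction I rule: infinite_finite_induct)
  case (insert i I)
  then have "(\<Sum>i\<in>I. x i) \<in> S" "x i \<in> S" using assms(2) by (auto intro: subspace_sum)
  then show ?case using insert assms(1) by (simp add: linear_on_subspace_def)
qed (simp_all add: linear_on_subspace_0[OF assms(1,2)])

lemma linear_on_subspace_diff:
  assumes "linear_on_subspace S F" "subspace S" "x \<in> S" "y \<in> S"
  shows "F (x - y) = F x - F y"
proof -
  have "F (x + (-1) *\<^sub>R y) = F x + (-1) *\<^sub>R F y"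
    using assms by (simp only: linear_on_subspace_def subspace_scale)
  then show ?thesis by simp
qed

context
  fixes S :: "'v::real_vector set" and f
  assumes S: "subspace S" and f: "psd_form_on S f"
begin

lemma psd_form_sym: "x \<in> S \<Longrightarrow> y \<in> S \<Longrightarrow> f x y = f y x"
  and psd_form_nonneg: "x \<in> S \<Longrightarrow> 0 \<le> f x x"
  and psd_form_linear_left: "y \<in> S \<Longrightarrow> linear_on_subspace S (\<lambda>x. f x y)"
  using f by (auto simp: psd_form_on_def linear_on_subspace_def)

lemma psd_form_linear_right: "x \<in> S \<Longrightarrow> linear_on_subspace S (f x)"
  using psd_form_linear_left[of x] psd_form_sym S unfolding linear_on_subspace_def
  by (simp add: subspace_add subspace_scale)

lemma psd_form_square_expand:
  assumes "x \<in> S" "y \<in> S"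
  shows "f (x + t *\<^sub>R y) (x + t *\<^sub>R y) = f x x + 2 * t * f x y + t\<^sup>2 * f y y"
proof -
  have "t *\<^sub>R y \<in> S" "x + t *\<^sub>R y \<in> S" using assms S by (auto intro: subspace_add subspace_scale)
  moreover from this have "f x (x + t *\<^sub>R y) = f x x + t * f x y"
    "f y (x + t *\<^sub>R y) = f x y + t * f y y"
    using psd_form_linear_right assms psd_form_sym unfolding linear_on_subspace_def by auto
  ultimately show ?thesis
    using assms f unfolding psd_form_on_def
    by (simp add: power2_eq_square algebra_simps)
qed

lemma psd_form_Cauchy_Schwarz:
  assumes "x \<in> S" "y \<in> S"
  shows "(f x y)\<^sup>2 \<le> f x x * f y y"
proof (cases "f y y = 0")
  case True
  have "f x y = 0"
  proof (rule ccontr)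
    assume ne: "f x y \<noteq> 0"
    define t where "t = - (f x x + 1) / (2 * f x y)"
    have "0 \<le> f (x + t *\<^sub>R y) (x + t *\<^sub>R y)"
      using assms S by (intro psd_form_nonneg) (auto intro: subspace_add subspace_scale)
    also have "\<dots> = -1" using True ne by (simp add: psd_form_square_expand assms t_def field_simps)
    finally show False by simp
  qed
  then show ?thesis using True by simp
next
  case False
  then have pos: "f y y > 0" using psd_form_nonneg[of y] assms by simp
  define t where "t = - f x y / f y y"
  have "0 \<le> f (x + t *\<^sub>R y) (x + t *\<^sub>R y)"
    using assms S by (intro psd_form_nonneg) (auto intro: subspace_add subspace_scale)
  also have "\<dots> = f x x - (f x y)\<^sup>2 / f y y"
    using pos unfolding psd_form_square_expand[OF assms]
    by (simp add: t_def power2_eq_square field_simps)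
  finally show ?thesis using pos by (simp add: field_simps)
qed

lemma psd_form_abs_le:
  assumes "x \<in> S" "y \<in> S"
  shows "\<bar>f x y\<bar> \<le> sqrt (f x x) * sqrt (f y y)"
  using psd_form_Cauchy_Schwarz[OF assms] by (metis real_sqrt_abs real_sqrt_le_mono real_sqrt_mult)

end

text \<open>The Gram--Schmidt process: subtracting its projection to the span of the previous vectors makes the
  next vector orthogonal to them, and either zero or a multiple of a unit vector.\<close>
lemma orthonormal_basis_exists:
  assumes S: "subspace S" and f: "psd_form_on S f" and d: "definite_on S f"
    and B: "finite B" "B \<subseteq> S"
  shows "\<exists>E. finite E \<and> E \<subseteq> S \<and> B \<subseteq> span E \<and>
           (\<forall>e \<in> E. \<forall>e' \<in> E. f e e' = (if e = e' then 1 else 0))"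
  using B
proof (induction B)
  case empty
  then show ?case by (intro exI[of _ "{}"]) auto
next
  case (insert b B)
  then obtain E where E: "finite E" "E \<subseteq> S" "B \<subseteq> span E"
    and on: "\<And>e e'. e \<in> E \<Longrightarrow> e' \<in> E \<Longrightarrow> f e e' = (if e = e' then 1 else 0)" by auto
  have bS: "b \<in> S" using insert by simp
  have spS: "span E \<subseteq> S" using E S by (simp add: span_minimal)
  define p where "p = (\<Sum>e\<in>E. f b e *\<^sub>R e)"
  have pE: "p \<in> span E" unfolding p_def by (intro span_sum span_scale span_base)
  then have pS: "p \<in> S" using spS by auto
  define u where "u = b - p"
  have uS: "u \<in> S" using bS pS S by (simp add: u_def subspace_diff)
  have ortho: "f u e = 0" if "e \<in> E" for e
  proof -
    have eS: "e \<in> S" using that E by auto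
    have "f p e = (\<Sum>e'\<in>E. f (f b e' *\<^sub>R e') e)"
      unfolding p_def using E S eS
      by (intro linear_on_subspace_sum[OF psd_form_linear_left[OF S f eS] S])
         (auto intro: subspace_scale)
    also have "\<dots> = (\<Sum>e'\<in>E. f b e' * f e' e)"
      using f E eS unfolding psd_form_on_def by (intro sum.cong) auto
    also have "\<dots> = (\<Sum>e'\<in>E. if e' = e then f b e else 0)"
      using on that by (intro sum.cong) auto
    also have "\<dots> = f b e" using that E by simp
    finally show ?thesis
      unfolding u_def using linear_on_subspace_diff[OF psd_form_linear_left[OF S f eS] S bS pS]
      by simp
  qed
  show ?case
  proof (cases "u = 0")
    case True
    then have "b \<in> span E" using pE by (simp add: u_def)
    then show ?thesis using E on by (intro exI[of _ E]) auto
  next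
    case False
    then have "f u u > 0" using d uS psd_form_nonneg[OF S f uS] unfolding definite_on_def
      by (metis order_le_less)
    define c where "c = 1 / sqrt (f u u)"
    have c2: "c * c * f u u = 1" using \<open>f u u > 0\<close> by (simp add: c_def field_simps)
    define w where "w = c *\<^sub>R u"
    have wS: "w \<in> S" using uS S by (simp add: w_def subspace_scale)
    have we: "f w e = 0 \<and> f e w = 0" if "e \<in> E" for e
    proof -
      have "e \<in> S" using that E by auto
      then show ?thesis using f ortho[OF that] uS wS unfolding w_def psd_form_on_def by auto
    qed
    have ww: "f w w = 1"
    proof -
      have "f w w = c * f u w" using f uS wS unfolding w_def psd_form_on_def by auto
      also have "f u w = f w u" using psd_form_sym[OF S f] uS wS by auto
      also have "f w u = c * f u u" using f uS unfolding w_def psd_form_on_def by auto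
      finally show ?thesis using c2 by simp
    qed
    have wE: "w \<notin> E" using we[of w] ww by auto
    have "b = p + (1/c) *\<^sub>R w" using c2 by (auto simp: w_def u_def)
    moreover have "p + (1/c) *\<^sub>R w \<in> span (insert w E)"
      by (intro span_add span_scale) (use pE span_mono[of E "insert w E"] in \<open>auto intro: span_base\<close>)
    ultimately have "insert b B \<subseteq> span (insert w E)"
      using E(3) span_mono[of E "insert w E"] by auto
    then show ?thesis using E wS wE on we ww
      by (intro exI[of _ "insert w E"]) auto
  qed
qed

lemma orthonormal_expansion:
  assumes S: "subspace S" and f: "psd_form_on S f"
    and E: "finite E" "E \<subseteq> S" "v \<in> span E"
    and on: "\<And>e e'. e \<in> E \<Longrightarrow> e' \<in> E \<Longrightarrow> f e e' = (if e = e' then 1 else (0::real))"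
  shows "v = (\<Sum>e\<in>E. f v e *\<^sub>R e)" "f v v = (\<Sum>e\<in>E. (f v e)\<^sup>2)"
proof -
  obtain c where c: "v = (\<Sum>e\<in>E. c e *\<^sub>R e)"
    using E(3) span_finite[OF E(1)] by auto
  have vS: "v \<in> S" using E S by (meson span_minimal subsetD)
  have exp: "f v y = (\<Sum>e\<in>E. c e * f e y)" if y: "y \<in> S" for y
  proof -
    have "f v y = (\<Sum>e\<in>E. f (c e *\<^sub>R e) y)"
      unfolding c using E S y
      by (intro linear_on_subspace_sum[OF psd_form_linear_left[OF S f y] S])
         (auto intro: subspace_scale)
    also have "\<dots> = (\<Sum>e\<in>E. c e * f e y)"
      using f E y unfolding psd_form_on_def by (intro sum.cong) auto
    finally show ?thesis .
  qed
  have ce: "f v e = c e" if "e \<in> E" for e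
  proof -
    have "f v e = (\<Sum>e'\<in>E. c e' * f e' e)" using exp[of e] E that by auto
    also have "\<dots> = (\<Sum>e'\<in>E. if e' = e then c e else 0)"
      using that on by (intro sum.cong) auto
    finally show ?thesis using that E by simp
  qed
  show "v = (\<Sum>e\<in>E. f v e *\<^sub>R e)" using c ce by simp
  have "f v v = (\<Sum>e\<in>E. c e * f v e)"
    using exp[OF vS] E psd_form_sym[OF S f vS] by (simp add: subset_iff)
  then show "f v v = (\<Sum>e\<in>E. (f v e)\<^sup>2)" using ce by (simp add: power2_eq_square)
qed

lemma finite_basis_of_subspace:
  assumes "subspace S" "finite B" "S \<subseteq> span B"
  obtains B' where "finite B'" "B' \<subseteq> S" "S = span B'"
proof -
  obtain B' where "B' \<subseteq> S" "independent B'" "S \<subseteq> span B'" by (metis maximal_independent_subset)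
  moreover have "finite B'"
    using independent_span_bound[of B B'] assms calculation by blast
  ultimately show ?thesis using that assms(1) by (metis span_minimal subset_antisym)
qed

lemma orthonormal_basis_of_subspace:
  assumes S: "subspace S" and f: "psd_form_on S f" and d: "definite_on S f"
    and B: "finite B" "S \<subseteq> span B"
  obtains E where "finite E" "E \<subseteq> S" 
    "\<And>v. v \<in> S \<Longrightarrow> v = (\<Sum>e\<in>E. f v e *\<^sub>R e)" "\<And>v. v \<in> S \<Longrightarrow> f v v = (\<Sum>e\<in>E. (f v e)\<^sup>2)"
proof -
  obtain B' where B': "finite B'" "B' \<subseteq> S" "S = span B'"
    using finite_basis_of_subspace[OF S B] .
  obtain E where E: "finite E" "E \<subseteq> S" "B' \<subseteq> span E"
    and on: "\<forall>e \<in> E. \<forall>e' \<in> E. f e e' = (if e = e' then 1 else (0::real))"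
    using orthonormal_basis_exists[OF S f d B'(1,2)] by blast
  have "S \<subseteq> span E" using E B' by (metis span_minimal subspace_span)
  then show ?thesis using that[OF E(1,2)] orthonormal_expansion[OF S f E(1,2)] on by blast
qed

text \<open>The representing vector is \<open>\<Sum>\<^sub>e F e *\<^sub>R e\<close> for an orthonormal basis.\<close>
lemma Riesz_on_subspace:
  assumes S: "subspace S" and f: "psd_form_on S f" and d: "definite_on S f"
    and B: "finite B" "S \<subseteq> span B" and F: "linear_on_subspace S F"
  obtains r :: "'v::real_vector" where "r \<in> S" "\<And>v. v \<in> S \<Longrightarrow> f r v = (F v :: real)"
proof -
  obtain E where E: "finite E" "E \<subseteq> S" and exp: "\<And>v. v \<in> S \<Longrightarrow> v = (\<Sum>e\<in>E. f v e *\<^sub>R e)"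
    by (rule orthonormal_basis_of_subspace[OF S f d B]) blast
  define r where "r = (\<Sum>e\<in>E. F e *\<^sub>R e)"
  have FeS: "F e *\<^sub>R e \<in> S" if "e \<in> E" for e using E S that by (auto intro: subspace_scale)
  have rS: "r \<in> S" unfolding r_def using S FeS by (intro subspace_sum) auto
  have "f r v = F v" if v: "v \<in> S" for v
  proof -
    have "f r v = (\<Sum>e\<in>E. f (F e *\<^sub>R e) v)"
      unfolding r_def using FeS
      by (intro linear_on_subspace_sum[OF psd_form_linear_left[OF S f v] S])
    also have "\<dots> = (\<Sum>e\<in>E. F e * f v e)"
      using f E v unfolding psd_form_on_def by (intro sum.cong) auto
    also have "\<dots> = (\<Sum>e\<in>E. F (f v e *\<^sub>R e))"
      using F E unfolding linear_on_subspace_def by (intro sum.cong) auto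
    also have "\<dots> = F (\<Sum>e\<in>E. f v e *\<^sub>R e)"
      using E S by (intro linear_on_subspace_sum[OF F S, symmetric]) (auto intro: subspace_scale)
    also have "\<dots> = F v" using exp[OF v] by simp
    finally show ?thesis .
  qed
  then show ?thesis using that rS by blast
qed

lemma quadratic_bound:
  fixes x a b :: real
  assumes "x\<^sup>2 \<le> a * x + b" "0 \<le> a" "0 \<le> b"
  shows "x \<le> a + sqrt b"
proof (rule ccontr)
  assume "\<not> ?thesis"
  then have l: "x > a + sqrt b" by simp
  have s: "0 \<le> sqrt b" using assms by simp
  have "x * x > (a + sqrt b) * x" using l s assms(2) by (intro mult_strict_right_mono) linarith+
  moreover have "sqrt b * x \<ge> sqrt b * sqrt b" using l s assms(2) by (intro mult_left_mono) linarith+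
  moreover have "sqrt b * sqrt b = b" using assms by simp
  ultimately show False using assms(1) by (simp add: power2_eq_square algebra_simps)
qed

section \<open>A saddle point problem with a mesh-dependent inf-sup condition\<close>

text \<open>The abstract setting of the scheme: \<open>a\<close> and \<open>m\<close> are the inner products, \<open>dv\<close> is the elementwise
  divergence. Unlike in the classical theory, the inf-sup condition involves the norm of \<open>a\<close> and not
  the graph norm \<open>N\<close>. The last condition says that \<open>b q\<close> is represented by \<open>- dv q\<close> up to a term
  that \<open>a\<close> controls, and makes up for the difference.\<close>
locale saddle_point =
  fixes Q :: "'q::real_vector set" and V :: "'v::real_vector set"
    and a :: "'q \<Rightarrow> 'q \<Rightarrow> real" and m :: "'v \<Rightarrow> 'v \<Rightarrow> real"
    and dv :: "'q \<Rightarrow> 'v" and b :: "'q \<Rightarrow> 'v \<Rightarrow> real" and BQ BV and C :: real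
  assumes Q: "subspace Q" "finite BQ" "Q \<subseteq> span BQ"
    and V: "subspace V" "finite BV" "V \<subseteq> span BV"
    and a: "psd_form_on Q a" "definite_on Q a"
    and m: "psd_form_on V m" "definite_on V m"
    and dv_in: "\<And>q. q \<in> Q \<Longrightarrow> dv q \<in> V" 
    and b_left: "\<And>v. v \<in> V \<Longrightarrow> linear_on_subspace Q (\<lambda>q. b q v)"
    and b_right: "\<And>q. q \<in> Q \<Longrightarrow> linear_on_subspace V (b q)"
    and C: "C \<ge> 1"
    and infsup: "\<And>w. w \<in> V \<Longrightarrow> \<exists>q\<in>Q. a q q \<le> C * b q w \<and> m w w \<le> C * b q w"
    and b_div: "\<And>q v. q \<in> Q \<Longrightarrow> v \<in> V \<Longrightarrow> \<bar>b q v + m (dv q) v\<bar> \<le> C * (sqrt (a q q) * sqrt (m v v))"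
begin

definition "A q = sqrt (a q q)"
definition "M v = sqrt (m v v)"
definition "N q = sqrt (a q q + m (dv q) (dv q))"

lemma A_sq: "q \<in> Q \<Longrightarrow> (A q)\<^sup>2 = a q q" and A_nonneg: "q \<in> Q \<Longrightarrow> 0 \<le> A q"
  using psd_form_nonneg[OF Q(1) a(1)] by (auto simp: A_def)

lemma M_sq: "v \<in> V \<Longrightarrow> (M v)\<^sup>2 = m v v" and M_nonneg: "v \<in> V \<Longrightarrow> 0 \<le> M v"
  using psd_form_nonneg[OF V(1) m(1)] by (auto simp: M_def)

lemma A_le_N: "q \<in> Q \<Longrightarrow> A q \<le> N q"
  using psd_form_nonneg[OF V(1) m(1) dv_in] by (auto simp: A_def N_def)

lemma N_le: "q \<in> Q \<Longrightarrow> N q \<le> A q + M (dv q)"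
  using psd_form_nonneg[OF V(1) m(1) dv_in] psd_form_nonneg[OF Q(1) a(1)]
  by (auto simp: A_def N_def M_def sqrt_add_le_add_sqrt)

lemma M_eq_0: "v \<in> V \<Longrightarrow> M v = 0 \<Longrightarrow> v = 0"
  using m(2) M_sq unfolding definite_on_def by fastforce

lemma A_eq_0: "v \<in> Q \<Longrightarrow> A v = 0 \<Longrightarrow> v = 0"
  using a(2) A_sq unfolding definite_on_def by fastforce

text \<open>Testing with \<open>dv p\<close> itself controls it by \<open>b p\<close>, at the price of the \<open>a\<close>-norm.\<close>
lemma div_bound:
  assumes p: "p \<in> Q" and G: "\<And>v. v \<in> V \<Longrightarrow> \<bar>b p v\<bar> \<le> Gn * M v" and "0 \<le> Gn"
  shows "M (dv p) \<le> Gn + C * A p"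
proof -
  let ?v = "dv p"
  have v: "?v \<in> V" using dv_in p by auto
  have "m ?v ?v \<le> \<bar>b p ?v\<bar> + C * (A p * M ?v)"
    using b_div[OF p v] unfolding A_def M_def by linarith
  then have "(M ?v)\<^sup>2 \<le> \<bar>b p ?v\<bar> + C * (A p * M ?v)" by (simp add: M_sq[OF v])
  also have "\<dots> \<le> (Gn + C * A p) * M ?v" using G[OF v] by (simp add: algebra_simps)
  finally have *: "M ?v * M ?v \<le> (Gn + C * A p) * M ?v" by (simp add: power2_eq_square)
  show ?thesis
  proof (cases "M ?v = 0")
    case True
    then show ?thesis using assms C A_nonneg[OF p] by simp
  next
    case False
    then have "M ?v > 0" using M_nonneg[OF v] by simp
    then show ?thesis using * by simp
  qed
qed

text \<open>The condition in this form also bounds \<open>a q q\<close> by \<open>b q w\<close>. If \<open>b q w \<le> R * A q\<close> then \<open>A q \<le> C * R\<close>,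
  hence \<open>(M w)\<^sup>2 \<le> C * R * A q \<le> (C * R)\<^sup>2\<close>.\<close>
lemma infsup_bound:
  assumes w: "w \<in> V" and R: "\<And>q. q \<in> Q \<Longrightarrow> b q w \<le> R * A q" and "0 \<le> R"
  shows "M w \<le> C * R"
proof -
  obtain q where q: "q \<in> Q" "a q q \<le> C * b q w" "m w w \<le> C * b q w" using infsup[OF w] by blast
  have "C * b q w \<le> C * (R * A q)" using C by (intro mult_left_mono R[OF q(1)]) auto
  then have "(A q)\<^sup>2 \<le> C * R * A q"
    using q(2) unfolding A_sq[OF q(1)] mult.assoc by linarith
  then have Aq: "A q \<le> C * R"
    using A_nonneg[OF q(1)] C assms(3)
    by (cases "A q = 0") (auto simp: power2_eq_square)
  have "(M w)\<^sup>2 \<le> C * (R * A q)"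
    using q(3) \<open>C * b q w \<le> C * (R * A q)\<close> unfolding M_sq[OF w] by linarith
  also have "\<dots> \<le> C * (R * (C * R))" using Aq assms(3) C by (intro mult_left_mono) auto
  also have "\<dots> = (C * R)\<^sup>2" by (simp add: power2_eq_square)
  finally show ?thesis using C assms(3) by (simp add: abs_le_square_iff[symmetric] M_nonneg[OF w])
qed

text \<open>Eliminating \<open>p\<close> leaves the Schur complement \<open>s u v = b (R u) v = a (R v) (R u)\<close>, where \<open>R v\<close> represents
  \<open>b _ v\<close> with respect to \<open>a\<close>. It is symmetric, and definite by the inf-sup condition, so that Riesz'
  theorem solves the equation for \<open>u\<close>.\<close>
lemma solve:
  assumes F: "linear_on_subspace Q F" and G: "linear_on_subspace V G"
  shows "\<exists>p\<in>Q. \<exists>u\<in>V. (\<forall>q\<in>Q. a p q + b q u = (F q :: real)) \<and> (\<forall>v\<in>V. b p v = (G v :: real))"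
proof -
  have "\<forall>v\<in>V. \<exists>r\<in>Q. \<forall>q\<in>Q. a r q = b q v"
    using Riesz_on_subspace[OF Q(1) a Q(2,3) b_left] by metis
  then obtain R where R: "\<And>v. v \<in> V \<Longrightarrow> R v \<in> Q" "\<And>v q. v \<in> V \<Longrightarrow> q \<in> Q \<Longrightarrow> a (R v) q = b q v"
    by metis
  obtain pF where pF: "pF \<in> Q" "\<And>q. q \<in> Q \<Longrightarrow> a pF q = F q"
    by (rule Riesz_on_subspace[OF Q(1) a Q(2,3) F]) blast
  define s where "s u v = b (R u) v" for u v
  have s_a: "s u v = a (R v) (R u)" if "u \<in> V" "v \<in> V" for u v
    using R that by (simp add: s_def)
  have s_sym: "s u v = s v u" if "u \<in> V" "v \<in> V" for u v
    using s_a[of u v] s_a[of v u] that psd_form_sym[OF Q(1) a(1), of "R u" "R v"] R by simp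
  have lin: "linear_on_subspace V (s u)" if "u \<in> V" for u
    unfolding s_def using b_right[OF R(1)[OF that]] .
  have s_psd: "psd_form_on V s"
  proof -
    have "s (x + y) z = s x z + s y z" if "x \<in> V" "y \<in> V" "z \<in> V" for x y z
      using that lin[of z] s_sym V(1) unfolding linear_on_subspace_def
      by (metis subspace_add)
    moreover have "s (r *\<^sub>R x) z = r * s x z" if "x \<in> V" "z \<in> V" for x z r
      using that lin[of z] s_sym V(1) unfolding linear_on_subspace_def
      by (metis subspace_scale real_scaleR_def)
    moreover have "0 \<le> s x x" if "x \<in> V" for x
      using s_a[of x x] that psd_form_nonneg[OF Q(1) a(1) R(1)] by metis
    ultimately show ?thesis using s_sym unfolding psd_form_on_def by blast
  qed
  have s_def: "definite_on V s"
    unfolding definite_on_def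
  proof safe
    fix w assume w: "w \<in> V" "s w w = 0"
    then have "a (R w) (R w) = 0" using s_a by simp
    then have "R w = 0" using a(2) R w unfolding definite_on_def by blast
    moreover have "a 0 q = 0" if "q \<in> Q" for q 
      using linear_on_subspace_0[OF psd_form_linear_left[OF Q(1) a(1) that] Q(1)] .
    ultimately have "b q w = 0" if "q \<in> Q" for q using R(2)[OF w(1) that] that by simp
    then have "M w \<le> C * 0" using A_nonneg by (intro infsup_bound[OF w(1)]) auto
    then show "w = 0" using M_eq_0[OF w(1)] M_nonneg[OF w(1)] by simp
  qed
  have "linear_on_subspace V (\<lambda>v. b pF v - G v)"
    using b_right[OF pF(1)] G unfolding linear_on_subspace_def by (auto simp: algebra_simps)
  then obtain u where u: "u \<in> V" "\<And>v. v \<in> V \<Longrightarrow> s u v = b pF v - G v"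
    by (rule Riesz_on_subspace[OF V(1) s_psd s_def V(2,3)]) blast
  let ?p = "pF - R u"
  have pQ: "?p \<in> Q" using pF R u Q(1) by (simp add: subspace_diff)
  have "a ?p q + b q u = F q" if "q \<in> Q" for q
    using linear_on_subspace_diff[OF psd_form_linear_left[OF Q(1) a(1) that] Q(1) pF(1) R(1)[OF u(1)]]
      pF(2)[OF that] R(2)[OF u(1) that] by simp
  moreover have "b ?p v = G v" if "v \<in> V" for v
    using linear_on_subspace_diff[OF b_left[OF that] Q(1) pF(1) R(1)[OF u(1)]] u(2)[OF that]
    unfolding \<open>s \<equiv> \<lambda>u v. b (R u) v\<close> by simp
  ultimately show ?thesis using pQ u(1) by blast
qed

text \<open>Solving the saddle point problem with data \<open>0\<close> and \<open>m u\<close> produces a field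
  whose whole graph norm, divergence included, is controlled by \<open>u\<close>.\<close>
lemma infsup_graph_norm:
  assumes u: "u \<in> V"
  shows "\<exists>q\<in>Q. b q u = (M u)\<^sup>2 \<and> N q \<le> (C + 1 + C * C) * M u"
proof -
  have "linear_on_subspace Q (\<lambda>q. 0::real)" by (simp add: linear_on_subspace_def)
  then obtain p w where p: "p \<in> Q" "w \<in> V" and eq1: "\<And>q. q \<in> Q \<Longrightarrow> a p q + b q w = 0"
    and eq2: "\<And>v. v \<in> V \<Longrightarrow> b p v = m u v"
    using solve[OF _ psd_form_linear_right[OF V(1) m(1) u]] by metis
  have "b q w \<le> A p * A q" if "q \<in> Q" for q
    using eq1[OF that] psd_form_abs_le[OF Q(1) a(1) p(1) that] by (simp add: A_def)
  then have Mw: "M w \<le> C * A p" using A_nonneg[OF p(1)] by (intro infsup_bound[OF p(2)]) auto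
  have "(A p)\<^sup>2 = - m u w" using eq1[OF p(1)] eq2[OF p(2)] unfolding A_sq[OF p(1)] by simp
  also have "\<dots> \<le> M u * M w" using psd_form_abs_le[OF V(1) m(1) u p(2)] by (simp add: M_def)
  also have "\<dots> \<le> M u * (C * A p)" using Mw M_nonneg[OF u] by (intro mult_left_mono) auto
  finally have "A p \<le> C * M u"
    using A_nonneg[OF p(1)] C M_nonneg[OF u]
    by (cases "A p = 0") (auto simp: power2_eq_square mult_ac)
  moreover have "M (dv p) \<le> M u + C * A p"
    using psd_form_abs_le[OF V(1) m(1) u] eq2 M_nonneg[OF u]
    by (intro div_bound[OF p(1)]) (auto simp: M_def)
  moreover have "C * A p \<le> C * (C * M u)" using calculation(1) C by (intro mult_left_mono) auto
  ultimately have "N p \<le> (C + 1 + C * C) * M u"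
    using N_le[OF p(1)] by (simp add: algebra_simps)
  then show ?thesis using p(1) eq2[OF u] M_sq[OF u] by (intro bexI[of _ p]) auto
qed

text \<open>The field of \<open>infsup_graph_norm\<close> bounds \<open>u\<close> by the data and \<open>A p\<close>, and \<open>div_bound\<close> does the same for
  \<open>N p\<close>. Testing the first equation with \<open>p\<close> then leaves a quadratic inequality for \<open>A p\<close>. Here only the
  power of \<open>C\<close> has a meaning; the factor is generous.\<close>
lemma a_priori_bound:
  assumes p: "p \<in> Q" and u: "u \<in> V"
    and eq1: "\<And>q. q \<in> Q \<Longrightarrow> a p q + b q u = F q" and eq2: "\<And>v. v \<in> V \<Longrightarrow> b p v = G v"
    and F: "\<And>q. q \<in> Q \<Longrightarrow> \<bar>F q\<bar> \<le> Fn * N q" and G: "\<And>v. v \<in> V \<Longrightarrow> \<bar>G v\<bar> \<le> Gn * M v"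
    and nn: "0 \<le> Fn" "0 \<le> Gn"
  shows "N p + M u \<le> 100 * C^6 * (Fn + Gn)"
proof -
  define B where "B = C + 1 + C * C"
  have "C * 1 \<le> C * C" using C by (intro mult_left_mono) auto
  then have B: "B \<ge> 1" "B \<ge> 1 + C" "B \<le> 3 * C^2" using C
    unfolding B_def power2_eq_square by linarith+
  define D where "D = Fn + Gn"
  have D: "0 \<le> D" "Fn \<le> D" "Gn \<le> D" using nn by (auto simp: D_def)
  have A0: "0 \<le> A p" and M0: "0 \<le> M u" using A_nonneg[OF p] M_nonneg[OF u] by auto
  have "M (dv p) \<le> Gn + C * A p" using div_bound[OF p] eq2 G nn by simp
  then have Np: "N p \<le> B * (A p + D)"
    using N_le[OF p] D A0 B mult_right_mono[of "1 + C" B "A p"] mult_right_mono[of 1 B D]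
    by (simp add: algebra_simps)
  have Mu: "M u \<le> B * (A p + D)"
  proof -
    obtain q where q: "q \<in> Q" "b q u = (M u)\<^sup>2" "N q \<le> B * M u"
      using infsup_graph_norm[OF u] unfolding B_def by blast
    have "\<bar>a p q\<bar> \<le> A p * A q" using psd_form_abs_le[OF Q(1) a(1) p q(1)] by (simp add: A_def)
    also have "\<dots> \<le> A p * N q" using A0 A_le_N[OF q(1)] by (intro mult_left_mono)
    finally have "(M u)\<^sup>2 \<le> Fn * N q + A p * N q" using eq1[OF q(1)] F[OF q(1)] q(2) by linarith
    also have "\<dots> \<le> (D + A p) * (B * M u)"
      using D A0 q(3) A_nonneg[OF q(1)] A_le_N[OF q(1)]
      unfolding distrib_right[symmetric] by (intro mult_mono) auto
    finally have *: "M u * M u \<le> (B * (A p + D)) * M u" by (simp add: power2_eq_square algebra_simps)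
    show ?thesis
    proof (cases "M u = 0")
      case True then show ?thesis using B A0 D by simp
    next
      case False then show ?thesis using * M0 by simp
    qed
  qed
  have "(A p)\<^sup>2 = F p - G u" using eq1[OF p] eq2[OF u] unfolding A_sq[OF p] by simp
  also have "\<dots> \<le> Fn * N p + Gn * M u" using F[OF p] G[OF u] by linarith
  also have "\<dots> \<le> Fn * (B * (A p + D)) + Gn * (B * (A p + D))"
    using Np Mu nn by (intro add_mono mult_left_mono)
  also have "\<dots> = (B * D) * A p + B * D\<^sup>2" by (simp add: D_def algebra_simps power2_eq_square)
  finally have "A p \<le> B * D + sqrt (B * D\<^sup>2)" using B D by (intro quadratic_bound) auto
  also have "sqrt (B * D\<^sup>2) \<le> B * D"
    using B D mult_right_mono[of 1 B "B * D\<^sup>2"]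
    by (intro real_le_lsqrt) (auto simp: power_mult_distrib power2_eq_square mult_ac)
  finally have "A p + D \<le> 3 * B * D" using B D mult_right_mono[of 1 B D] by simp
  then have "B * (A p + D) \<le> B * (3 * B * D)" using B by (intro mult_left_mono) auto
  then have "N p + M u \<le> (6 * B^2) * D" using Np Mu by (simp add: power2_eq_square)
  also have "\<dots> \<le> (6 * (3 * C^2)^2) * D" using B D by (intro mult_right_mono mult_left_mono power_mono) auto
  also have "\<dots> \<le> (100 * C^6) * D"
  proof (intro mult_right_mono)
    have "C^4 \<le> C^6" using C by (intro power_increasing) auto
    moreover have "0 \<le> C^6" using C by simp
    moreover have "6 * (3 * C^2)^2 = 54 * C^4" by (simp add: power_mult_distrib)
    ultimately show "6 * (3 * C^2)^2 \<le> 100 * C^6" by linarith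
  qed (use D in auto)
  finally show ?thesis by (simp add: D_def)
qed

lemma uniqueness:
  assumes "p \<in> Q" "u \<in> V" "p' \<in> Q" "u' \<in> V"
    and "\<And>q. q \<in> Q \<Longrightarrow> a p q + b q u = F q" "\<And>v. v \<in> V \<Longrightarrow> b p v = G v"
    and "\<And>q. q \<in> Q \<Longrightarrow> a p' q + b q u' = F q" "\<And>v. v \<in> V \<Longrightarrow> b p' v = G v"
  shows "p = p' \<and> u = u'"
proof -
  have pQ: "p - p' \<in> Q" and uV: "u - u' \<in> V" using assms Q(1) V(1) by (auto simp: subspace_diff)
  have "a (p - p') q + b q (u - u') = 0" if "q \<in> Q" for q
    using linear_on_subspace_diff[OF psd_form_linear_left[OF Q(1) a(1) that] Q(1) assms(1,3)]
      linear_on_subspace_diff[OF b_right[OF that] V(1) assms(2,4)] assms(5,7)[OF that] by simp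
  moreover have "b (p - p') v = 0" if "v \<in> V" for v
    using linear_on_subspace_diff[OF b_left[OF that] Q(1) assms(1,3)] assms(6,8)[OF that] by simp
  ultimately have "N (p - p') + M (u - u') \<le> 100 * C^6 * (0 + 0)"
    using pQ uV by (intro a_priori_bound[where F="\<lambda>_. 0" and G="\<lambda>_. 0"]) auto
  then have "A (p - p') = 0" "M (u - u') = 0"
    using A_le_N[OF pQ] A_nonneg[OF pQ] M_nonneg[OF uV] by auto
  then show ?thesis using A_eq_0[OF pQ] M_eq_0[OF uV] by simp
qed

end

section \<open>Polynomials in several variables\<close>

lemma sum_fun_apply [simp]: "(\<Sum>i\<in>I. f i) x = (\<Sum>i\<in>I. f i x)"
  by (induction I rule: infinite_finite_induct) auto

lemma finite_exponents: "finite {s :: 'd::finite \<Rightarrow> nat. sum s UNIV \<le> m}"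
proof -
  have "s i \<le> m" if "sum s UNIV \<le> m" for s :: "'d \<Rightarrow> nat" and i
    using that member_le_sum[of i UNIV s] by simp
  then have "{s :: 'd \<Rightarrow> nat. sum s UNIV \<le> m} \<subseteq> PiE UNIV (\<lambda>_. {..m})" by auto
  then show ?thesis by (rule finite_subset) (auto intro: finite_PiE)
qed

definition monomial :: "('d \<Rightarrow> nat) \<Rightarrow> real ^ 'd \<Rightarrow> real" where
  "monomial s x = (\<Prod>i\<in>UNIV. (x $ i) ^ s i)"

abbreviation monomials :: "nat \<Rightarrow> (real ^ 'd \<Rightarrow> real) set" where
  "monomials m \<equiv> monomial ` {s. sum s UNIV \<le> m}"

lemma subspace_polynomial_deg_le: "subspace {P :: real ^ 'd \<Rightarrow> real. polynomial_deg_le m P}"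
  unfolding subspace_def
proof safe
  show "polynomial_deg_le m (0 :: real ^ 'd \<Rightarrow> real)"
    unfolding polynomial_deg_le_def by (rule exI[of _ "\<lambda>_. 0"]) simp
next
  fix P Q :: "real ^ 'd \<Rightarrow> real" assume "polynomial_deg_le m P" "polynomial_deg_le m Q"
  then obtain a b where "\<And>x. P x = (\<Sum>s | sum s UNIV \<le> m. a s * (\<Prod>i\<in>UNIV. (x $ i) ^ s i))"
    "\<And>x. Q x = (\<Sum>s | sum s UNIV \<le> m. b s * (\<Prod>i\<in>UNIV. (x $ i) ^ s i))"
    unfolding polynomial_deg_le_def by blast
  then show "polynomial_deg_le m (P + Q)"
    unfolding polynomial_deg_le_def
    by (intro exI[of _ "\<lambda>s. a s + b s"]) (simp add: sum.distrib distrib_right)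
next
  fix P :: "real ^ 'd \<Rightarrow> real" and c :: real assume "polynomial_deg_le m P"
  then obtain a where "\<And>x. P x = (\<Sum>s | sum s UNIV \<le> m. a s * (\<Prod>i\<in>UNIV. (x $ i) ^ s i))"
    unfolding polynomial_deg_le_def by blast
  then show "polynomial_deg_le m (c *\<^sub>R P)"
    unfolding polynomial_deg_le_def
    by (intro exI[of _ "\<lambda>s. c * a s"]) (simp add: sum_distrib_left mult.assoc)
qed

lemma polynomial_deg_le_eq_span: "{P. polynomial_deg_le m P} = span (monomials m)"
proof
  show "{P. polynomial_deg_le m P} \<subseteq> span (monomials m)"
  proof safe
    fix P :: "real ^ 'd \<Rightarrow> real" assume "polynomial_deg_le m P"
    then obtain a where "\<And>x. P x = (\<Sum>s | sum s UNIV \<le> m. a s * (\<Prod>i\<in>UNIV. (x $ i) ^ s i))"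
      unfolding polynomial_deg_le_def by blast
    then have "P = (\<Sum>s | sum s UNIV \<le> m. a s *\<^sub>R monomial s)"
      by (simp add: fun_eq_iff monomial_def)
    then show "P \<in> span (monomials m)"
      by (simp only:) (intro span_sum span_scale span_base, blast)
  qed
  have "polynomial_deg_le m (monomial s)" if "sum s UNIV \<le> m" for s :: "'d::finite \<Rightarrow> nat"
    unfolding polynomial_deg_le_def
  proof (intro exI allI)
    fix x :: "real ^ 'd"
    have "monomial s x = (\<Sum>t | sum t UNIV \<le> m. if t = s then monomial s x else 0)"
      by (subst sum.delta[OF finite_exponents]) (use that in auto)
    also have "\<dots> = (\<Sum>t | sum t UNIV \<le> m. of_bool (t = s) * (\<Prod>i\<in>UNIV. (x $ i) ^ t i))"
      by (intro sum.cong) (auto simp: monomial_def)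
    finally show "monomial s x = (\<Sum>t | sum t UNIV \<le> m. of_bool (t = s) * (\<Prod>i\<in>UNIV. (x $ i) ^ t i))" .
  qed
  then show "span (monomials m) \<subseteq> {P :: real ^ 'd \<Rightarrow> real. polynomial_deg_le m P}"
    by (intro span_minimal subspace_polynomial_deg_le) auto
qed

lemma polynomial_deg_le_iff_span: "polynomial_deg_le m P \<longleftrightarrow> P \<in> span (monomials m)"
  using polynomial_deg_le_eq_span by blast

text \<open>Polynomials of degree at most \<open>m\<close> are the span of the monomials, so linear properties need to be
  checked for monomials only.\<close>
lemma polynomial_deg_le_induct [consumes 1, case_names zero add monomial]:
  assumes "polynomial_deg_le m P"
    and "X 0" and "\<And>P Q c. X P \<Longrightarrow> X Q \<Longrightarrow> X (c *\<^sub>R P + Q)"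
    and mono: "\<And>s. sum s UNIV \<le> m \<Longrightarrow> X (monomial s)"
  shows "X P"
proof -
  have "P \<in> span (monomials m)" using assms(1) polynomial_deg_le_iff_span by auto
  then show ?thesis
  proof (induction rule: span_induct_alt)
    case base
    show ?case by (fact assms(2))
  next
    case (step c x y)
    then show ?case using assms(3)[OF mono] by blast
  qed
qed

lemma polynomial_deg_le_monomial: "sum s UNIV \<le> m \<Longrightarrow> polynomial_deg_le m (monomial s)"
  unfolding polynomial_deg_le_iff_span by (auto intro: span_base)

lemma polynomial_deg_le_mono: "polynomial_deg_le m P \<Longrightarrow> m \<le> n \<Longrightarrow> polynomial_deg_le n P"
  unfolding polynomial_deg_le_iff_span by (erule rev_subsetD, intro span_mono) auto

lemma polynomial_deg_le_add: "polynomial_deg_le m P \<Longrightarrow> polynomial_deg_le m Q \<Longrightarrow>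
    polynomial_deg_le m (\<lambda>x. P x + Q x)"
  using subspace_add[OF subspace_polynomial_deg_le, of P m Q] by (simp add: plus_fun_def)

lemma polynomial_deg_le_cmult: "polynomial_deg_le m P \<Longrightarrow> polynomial_deg_le m (\<lambda>x. c * P x)"
  using subspace_scale[OF subspace_polynomial_deg_le, of P m c] by (simp add: scaleR_fun_def)

lemma polynomial_deg_le_const: "polynomial_deg_le m (\<lambda>x. c)"
proof -
  have "polynomial_deg_le m (monomial (\<lambda>_. 0))" by (intro polynomial_deg_le_monomial) simp
  then show ?thesis using polynomial_deg_le_cmult[of m "monomial (\<lambda>_. 0)" c]
    by (simp add: monomial_def)
qed

lemma polynomial_deg_le_diff: "polynomial_deg_le m P \<Longrightarrow> polynomial_deg_le m Q \<Longrightarrow>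
    polynomial_deg_le m (\<lambda>x. P x - Q x)"
  using polynomial_deg_le_add[OF _ polynomial_deg_le_cmult[of m Q "-1"]] by simp

lemma polynomial_deg_le_sum: "(\<And>i. i \<in> I \<Longrightarrow> polynomial_deg_le m (P i)) \<Longrightarrow>
    polynomial_deg_le m (\<lambda>x. \<Sum>i\<in>I. P i x)"
  by (induction I rule: infinite_finite_induct)
     (auto intro: polynomial_deg_le_add polynomial_deg_le_const)

lemma polynomial_deg_le_nth: "polynomial_deg_le 1 (\<lambda>x. x $ i)"
proof -
  define s where "s j = (if j = i then 1 else 0::nat)" for j
  have "polynomial_deg_le 1 (monomial s)" by (intro polynomial_deg_le_monomial) (simp add: s_def)
  moreover have "monomial s = (\<lambda>x. x $ i)"
  proof
    fix x
    have "monomial s x = (\<Prod>j\<in>UNIV. if j = i then x $ j else 1)"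
      unfolding monomial_def by (intro prod.cong) (auto simp: s_def)
    then show "monomial s x = x $ i" by simp
  qed
  ultimately show ?thesis by simp
qed

lemma polynomial_deg_le_mult:
  assumes P: "polynomial_deg_le m P" and Q: "polynomial_deg_le n Q"
  shows "polynomial_deg_le (m + n) (\<lambda>x. P x * Q x)"
  using P
proof (induction rule: polynomial_deg_le_induct)
  case zero
  then show ?case by (simp add: polynomial_deg_le_const)
next
  case (add P P' c)
  then show ?case
    using polynomial_deg_le_add[OF polynomial_deg_le_cmult[OF add(1)] add(2)]
    by (simp add: algebra_simps)
next
  case (monomial s)
  from Q show ?case
  proof (induction rule: polynomial_deg_le_induct)
    case zero
    then show ?case by (simp add: polynomial_deg_le_const)
  next
    case (add P P' c)
    then show ?case
      using polynomial_deg_le_add[OF polynomial_deg_le_cmult[OF add(1)] add(2)]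
      by (simp add: algebra_simps)
  next
    case (monomial t)
    have "(\<lambda>x. monomial s x * monomial t x) = monomial (\<lambda>i. s i + t i)"
      by (simp add: monomial_def fun_eq_iff power_add prod.distrib)
    moreover have "sum (\<lambda>i. s i + t i) UNIV \<le> m + n"
      using \<open>sum s UNIV \<le> m\<close> monomial by (simp add: sum.distrib)
    ultimately show ?case using polynomial_deg_le_monomial by metis
  qed
qed

lemma polynomial_deg_le_power:
  "polynomial_deg_le 1 P \<Longrightarrow> polynomial_deg_le n (\<lambda>x. P x ^ n)"
proof (induction n)
  case (Suc n)
  then show ?case using polynomial_deg_le_mult[of 1 P n "\<lambda>x. P x ^ n"] by simp
qed (simp add: polynomial_deg_le_const)

lemma polynomial_deg_le_prod:
  "(\<And>i. i \<in> I \<Longrightarrow> polynomial_deg_le (n i) (P i)) \<Longrightarrow>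
     polynomial_deg_le (sum n I) (\<lambda>x. \<Prod>i\<in>I. P i x)"
  by (induction I rule: infinite_finite_induct)
     (auto intro: polynomial_deg_le_mult polynomial_deg_le_const)

lemma polynomial_deg_le_inner: "polynomial_deg_le 1 (\<lambda>x. n \<bullet> x)"
  unfolding inner_vec_def
  by (intro polynomial_deg_le_sum) (use polynomial_deg_le_cmult[OF polynomial_deg_le_nth] in auto)

lemma polynomial_deg_le_affine_compose:
  fixes A :: "real ^ 'd \<Rightarrow> real ^ 'd"
  assumes "polynomial_deg_le m P" and A: "\<And>i. polynomial_deg_le 1 (\<lambda>x. A x $ i)"
  shows "polynomial_deg_le m (\<lambda>x. P (A x))"
  using assms(1)
proof (induction rule: polynomial_deg_le_induct)
  case zero
  then show ?case by (simp add: polynomial_deg_le_const)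
next
  case (add P P' c)
  then show ?case
    using polynomial_deg_le_add[OF polynomial_deg_le_cmult[OF add(1)] add(2)] by simp
next
  case (monomial s)
  show ?case unfolding monomial_def
    by (rule polynomial_deg_le_mono[OF polynomial_deg_le_prod monomial])
       (intro polynomial_deg_le_power A)
qed

lemma polynomial_deg_le_imp_real_polynomial_function:
  "polynomial_deg_le m P \<Longrightarrow> real_polynomial_function P"
proof (induction rule: polynomial_deg_le_induct)
  case zero
  then show ?case unfolding zero_fun_def by auto
next
  case (add P Q c)
  then show ?case unfolding plus_fun_def scaleR_fun_def real_scaleR_def
    by (intro real_polynomial_function.intros(2-4))
next
  case (monomial s)
  show ?case unfolding monomial_def
    by (intro real_polynomial_function_prod real_polynomial_function_power
          real_polynomial_function.intros(1) bounded_linear_vec_nth) auto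
qed

text \<open>Restricted to a line, a polynomial is a polynomial in one variable, which has finitely
  many roots unless it vanishes identically.\<close>
lemma polynomial_deg_le_eq_0:
  assumes P: "polynomial_deg_le m P" and U: "open U" "x0 \<in> U" "\<And>x. x \<in> U \<Longrightarrow> P x = 0"
  shows "P x = 0"
proof -
  obtain e where e: "e > 0" "ball x0 e \<subseteq> U" using U openE by blast
  define l where "l t = x0 + t *\<^sub>R (x - x0)" for t :: real
  have "polynomial_function l"
    unfolding l_def
    by (intro polynomial_function_add polynomial_function_const polynomial_function_bounded_linear
          bounded_linear_scaleR_left)
  then have "real_polynomial_function (P \<circ> l)"
    using polynomial_deg_le_imp_real_polynomial_function[OF P]
    by (rule real_polynomial_function_compose)
  then obtain a n where an: "\<And>t. P (l t) = (\<Sum>i\<le>n. a i * t ^ i)"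
    unfolding real_polynomial_function_iff_sum comp_def by metis
  define \<delta> where "\<delta> = e / (norm (x - x0) + 1)"
  have \<delta>: "\<delta> > 0" using e by (simp add: \<delta>_def add_nonneg_pos)
  have "P (l t) = 0" if "t \<in> {0<..<\<delta>}" for t
  proof -
    have "dist x0 (l t) = t * norm (x - x0)" using that by (simp add: l_def dist_norm)
    also have "\<dots> \<le> t * (norm (x - x0) + 1)" using that by simp
    also have "\<dots> < \<delta> * (norm (x - x0) + 1)"
      using that by (intro mult_strict_right_mono) (auto simp: add_nonneg_pos)
    also have "\<dots> = e"
      using add_nonneg_pos[of "norm (x - x0)" 1] by (simp add: \<delta>_def)
    finally show ?thesis using U(3) e(2) by auto
  qed
  then have "{0<..<\<delta>} \<subseteq> {t. (\<Sum>i\<le>n. a i * t ^ i) = 0}" using an by auto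
  then have "infinite {t. (\<Sum>i\<le>n. a i * t ^ i) = 0}"
    using \<delta> infinite_Ioo finite_subset by blast
  then have "\<forall>i\<le>n. a i = 0" using polyfun_finite_roots by blast
  then have "P (l 1) = 0" using an by simp
  then show ?thesis by (simp add: l_def)
qed

subsection \<open>The gradient\<close>

definition grad :: "(real ^ 'd \<Rightarrow> real) \<Rightarrow> real ^ 'd \<Rightarrow> real ^ 'd" where
  "grad P x = (\<chi> i. frechet_derivative P (at x) (axis i 1))"

lemma grad_eqI: 
  assumes "(P has_derivative (\<lambda>h. G \<bullet> h)) (at x)"
  shows "grad P x = G"
  unfolding grad_def using frechet_derivative_at[OF assms, symmetric]
  by (simp add: vec_eq_iff inner_axis)

lemma polynomial_gradient_exists:
  fixes P :: "real ^ 'd \<Rightarrow> real"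
  assumes "polynomial_deg_le m P"
  shows "\<exists>G. (\<forall>i. polynomial_deg_le (m - 1) (\<lambda>x. G x $ i)) \<and> (\<forall>x. (P has_derivative (\<lambda>h. G x \<bullet> h)) (at x))"
  using assms
proof (induction rule: polynomial_deg_le_induct)
  case zero
  then show ?case
    by (intro exI[of _ "\<lambda>_. 0"]) (auto simp: polynomial_deg_le_const zero_fun_def)
next
  case (add P Q c)
  then obtain F G where F: "\<And>i. polynomial_deg_le (m - 1) (\<lambda>x. F x $ i)" "\<And>x. (P has_derivative (\<lambda>h. F x \<bullet> h)) (at x)"
    and G: "\<And>i. polynomial_deg_le (m - 1) (\<lambda>x. G x $ i)" "\<And>x. (Q has_derivative (\<lambda>h. G x \<bullet> h)) (at x)"
    by blast
  have "((\<lambda>x. c * P x + Q x) has_derivative (\<lambda>h. c * (F x \<bullet> h) + G x \<bullet> h)) (at x)" for x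
    by (intro has_derivative_add has_derivative_mult_right F G)
  then show ?case
    using polynomial_deg_le_add[OF polynomial_deg_le_cmult[OF F(1)] G(1)]
    by (intro exI[of _ "\<lambda>x. c *\<^sub>R F x + G x"])
       (auto simp: inner_add_left plus_fun_def scaleR_fun_def)
next
  case (monomial s)
  define G :: "real ^ 'd \<Rightarrow> real ^ 'd" where
    "G x = (\<chi> i. real (s i) * monomial (s(i := s i - 1)) x)" for x
  have "polynomial_deg_le (m - 1) (\<lambda>x. G x $ i)" for i
  proof (cases "s i = 0")
    case True
    then show ?thesis by (simp add: G_def polynomial_deg_le_const)
  next
    case False
    have "sum (s(i := s i - 1)) UNIV = s i - 1 + sum s (UNIV - {i})"
      by (subst sum.remove[of _ i]) auto
    moreover have "sum s UNIV = s i + sum s (UNIV - {i})" by (subst sum.remove[of _ i]) auto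
    ultimately have "sum (s(i := s i - 1)) UNIV \<le> m - 1" using monomial False by linarith
    then show ?thesis
      unfolding G_def by (simp add: polynomial_deg_le_cmult polynomial_deg_le_monomial)
  qed
  moreover have "(monomial s has_derivative (\<lambda>h. G x \<bullet> h)) (at x)" for x
  proof -
    have "((\<lambda>x. \<Prod>i\<in>UNIV. (x $ i) ^ s i) has_derivative
       (\<lambda>h. \<Sum>i\<in>UNIV. (real (s i) * (h $ i * (x $ i) ^ (s i - 1))) * (\<Prod>j\<in>UNIV - {i}. (x $ j) ^ s j))) (at x)"
      by (intro has_derivative_prod)
         (rule has_derivative_eq_rhs[OF has_derivative_power[OF
           bounded_linear_imp_has_derivative[OF bounded_linear_vec_nth]]], simp add: fun_eq_iff mult_ac)
    moreover have "(\<Sum>i\<in>UNIV. (real (s i) * (h $ i * (x $ i) ^ (s i - 1))) * (\<Prod>j\<in>UNIV - {i}. (x $ j) ^ s j))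
        = G x \<bullet> h" for h
      unfolding inner_vec_def
    proof (intro sum.cong refl)
      fix i
      have "monomial (s(i := s i - 1)) x = (x $ i) ^ (s i - 1) * (\<Prod>j\<in>UNIV - {i}. (x $ j) ^ s j)"
        unfolding monomial_def by (subst prod.remove[of _ i]) auto
      then show "(real (s i) * (h $ i * (x $ i) ^ (s i - 1))) * (\<Prod>j\<in>UNIV - {i}. (x $ j) ^ s j) = G x $ i \<bullet> h $ i"
        by (simp add: G_def)
    qed
    ultimately show ?thesis unfolding monomial_def[abs_def] by simp
  qed
  ultimately show ?case by blast
qed

lemma polynomial_has_gradient:
  assumes "polynomial_deg_le m P"
  shows "(P has_derivative (\<lambda>h. grad P x \<bullet> h)) (at x)"
  using polynomial_gradient_exists[OF assms] grad_eqI by metis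

lemma polynomial_deg_le_grad:
  assumes "polynomial_deg_le m P"
  shows "polynomial_deg_le (m - 1) (\<lambda>x. grad P x $ i)"
proof -
  obtain G where "\<And>i. polynomial_deg_le (m - 1) (\<lambda>x. G x $ i)" "\<And>x. (P has_derivative (\<lambda>h. G x \<bullet> h)) (at x)"
    using polynomial_gradient_exists[OF assms] by blast
  moreover from this(2) have "grad P = G" using grad_eqI by blast
  ultimately show ?thesis by simp
qed

lemma continuous_on_polynomial: "polynomial_deg_le m P \<Longrightarrow> continuous_on S P"
  by (metis polynomial_has_gradient has_derivative_continuous continuous_at_imp_continuous_on)

lemma continuous_on_grad: 
  assumes "polynomial_deg_le m P"
  shows "continuous_on S (grad P)"
proof -
  have "continuous_on S (\<lambda>x. \<chi> i. grad P x $ i)"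
    by (intro continuous_on_vec_lambda continuous_on_polynomial[OF polynomial_deg_le_grad[OF assms]])
  then show ?thesis by simp
qed

section \<open>Integrals of continuous functions over compact sets\<close>

lemma set_integrable_continuous:
  fixes f :: "'a::euclidean_space \<Rightarrow> real"
  assumes "compact K" "continuous_on K f"
  shows "set_integrable lborel K f"
  unfolding set_integrable_def using borel_integrable_compact[OF assms] .

lemma set_integral_cont_add:
  fixes f g :: "'a::euclidean_space \<Rightarrow> real"
  assumes "compact K" "continuous_on K f" "continuous_on K g"
  shows "(LINT x:K|lborel. f x + g x) = (LINT x:K|lborel. f x) + (LINT x:K|lborel. g x)"
  using assms by (intro set_integral_add set_integrable_continuous)

lemma set_integral_cont_sum:
  fixes f :: "'i \<Rightarrow> 'a::euclidean_space \<Rightarrow> real"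
  assumes "compact K" "\<And>i. i \<in> I \<Longrightarrow> continuous_on K (f i)"
  shows "(LINT x:K|lborel. \<Sum>i\<in>I. f i x) = (\<Sum>i\<in>I. LINT x:K|lborel. f i x)"
  using assms(2)
  by (induction I rule: infinite_finite_induct)
     (simp_all add: set_integral_cont_add[OF assms(1)] continuous_on_sum)

lemma set_integral_cont_mono:
  fixes f g :: "'a::euclidean_space \<Rightarrow> real"
  assumes "compact K" "continuous_on K f" "continuous_on K g" "\<And>x. x \<in> K \<Longrightarrow> f x \<le> g x"
  shows "(LINT x:K|lborel. f x) \<le> (LINT x:K|lborel. g x)"
  using assms by (intro set_integral_mono set_integrable_continuous)

lemma set_integral_cont_nonneg:
  fixes f :: "'a::euclidean_space \<Rightarrow> real"
  assumes "\<And>x. x \<in> K \<Longrightarrow> 0 \<le> f x"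
  shows "0 \<le> (LINT x:K|lborel. f x)"
  unfolding set_lebesgue_integral_def using assms
  by (intro Bochner_Integration.integral_nonneg) (auto simp: indicator_def)

lemma set_integral_cont_subset:
  fixes f :: "'a::euclidean_space \<Rightarrow> real"
  assumes "compact K" "compact L" "continuous_on L f" "K \<subseteq> L" "\<And>x. x \<in> L \<Longrightarrow> 0 \<le> f x"
  shows "(LINT x:K|lborel. f x) \<le> (LINT x:L|lborel. f x)"
  unfolding set_lebesgue_integral_def
proof (rule integral_mono)
  show "integrable lborel (\<lambda>x. indicator K x *\<^sub>R f x)"
    using assms continuous_on_subset by (intro borel_integrable_compact) blast+
  show "integrable lborel (\<lambda>x. indicator L x *\<^sub>R f x)"
    using assms by (intro borel_integrable_compact)
qed (use assms in \<open>auto simp: indicator_def\<close>)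

lemma set_integral_const_compact:
  fixes c :: real
  assumes "compact (K :: 'a::euclidean_space set)"
  shows "(LINT x:K|lborel. c) = measure lborel K * c"
  using emeasure_compact_finite[OF assms] borel_compact[OF assms]
  unfolding set_lebesgue_integral_def by simp

text \<open>The set where a continuous function does not vanish is open, and a nonempty open set is not negligible.\<close>
lemma integral_0_imp_0_interior:
  fixes f :: "'a::euclidean_space \<Rightarrow> real"
  assumes K: "compact K" "continuous_on K f" "\<And>x. x \<in> K \<Longrightarrow> 0 \<le> f x"
    and 0: "(LINT x:K|lborel. f x) = 0" and x: "x \<in> interior K"
  shows "f x = 0"
proof (rule ccontr)
  assume ne: "f x \<noteq> 0"
  define U where "U = interior K \<inter> f -` (- {0})"
  have "open U" unfolding U_def
    using continuous_on_subset[OF K(2) interior_subset]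
    by (intro continuous_open_preimage) auto
  have "AE x in lborel. indicator K x *\<^sub>R f x = 0"
    using 0 unfolding set_lebesgue_integral_def
    by (subst (asm) integral_nonneg_eq_0_iff_AE[OF borel_integrable_compact[OF K(1,2)]])
       (auto intro!: AE_I2 K(3) simp: indicator_def)
  then have "AE x in lborel. x \<notin> U"
    by eventually_elim (use interior_subset in \<open>auto simp: U_def indicator_def\<close>)
  then have "U \<in> null_sets lborel"
    using \<open>open U\<close> by (subst AE_iff_null_sets) auto
  then have "negligible U" using \<open>open U\<close>
    by (simp add: negligible_iff_null_sets null_sets_completionI)
  then have "U = {}" using open_not_negligible[OF \<open>open U\<close>] by blast
  then show False using x ne by (auto simp: U_def)
qed

lemma lborel_integral_affine:
  fixes f :: "'a::euclidean_space \<Rightarrow> real" and t :: 'a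
  assumes "c \<noteq> 0" "f \<in> borel_measurable borel"
  shows "(LINT x|lborel. f x) = \<bar>c\<bar> ^ DIM('a) * (LINT x|lborel. f (t + c *\<^sub>R x))"
proof -
  have "(LINT x|lborel. f x) =
     (LINT x|density (distr lborel borel (\<lambda>x. t + c *\<^sub>R x)) (\<lambda>_. ennreal (\<bar>c\<bar> ^ DIM('a))). f x)"
    using lborel_affine[OF assms(1), of t] by (simp add: ennreal_power)
  also have "\<dots> = \<bar>c\<bar> ^ DIM('a) * (LINT x|lborel. f (t + c *\<^sub>R x))"
    using assms by (subst integral_density) (auto simp: integral_distr)
  finally show ?thesis .
qed

lemma nn_integral_lborel_affine:
  fixes f :: "'a::euclidean_space \<Rightarrow> ennreal" and t :: 'a
  assumes "c \<noteq> 0" "f \<in> borel_measurable borel"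
  shows "(\<integral>\<^sup>+x. f x \<partial>lborel) = ennreal (\<bar>c\<bar> ^ DIM('a)) * (\<integral>\<^sup>+x. f (t + c *\<^sub>R x) \<partial>lborel)"
proof -
  have "(\<integral>\<^sup>+x. f x \<partial>lborel) =
     (\<integral>\<^sup>+x. f x \<partial>density (distr lborel borel (\<lambda>x. t + c *\<^sub>R x)) (\<lambda>_. ennreal (\<bar>c\<bar> ^ DIM('a))))"
    using lborel_affine[OF assms(1), of t] by (simp add: ennreal_power)
  also have "\<dots> = ennreal (\<bar>c\<bar> ^ DIM('a)) * (\<integral>\<^sup>+x. f (t + c *\<^sub>R x) \<partial>lborel)"
    using assms by (subst nn_integral_density) (auto simp: nn_integral_distr nn_integral_cmult)
  finally show ?thesis .
qed

lemma set_integral_cball_rescale: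
  fixes f :: "real ^ 'd \<Rightarrow> real"
  assumes r: "r > 0" and f: "continuous_on UNIV f"
  shows "(LINT x:cball c r|lborel. f x) = r ^ CARD('d) * (LINT x:cball 0 1|lborel. f (c + r *\<^sub>R x))"
proof -
  have "f \<in> borel_measurable borel" using f by (rule borel_measurable_continuous_onI)
  then have "(LINT x:cball c r|lborel. f x) =
     \<bar>r\<bar> ^ DIM(real ^ 'd) * (LINT x|lborel. indicator (cball c r) (c + r *\<^sub>R x) *\<^sub>R f (c + r *\<^sub>R x))"
    unfolding set_lebesgue_integral_def using r by (intro lborel_integral_affine borel_measurable_scaleR borel_measurable_indicator) auto
  also have "(\<lambda>x. indicator (cball c r) (c + r *\<^sub>R x) :: real) = indicator (cball 0 1)"
    using r by (auto simp: fun_eq_iff indicator_def dist_norm)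
  finally show ?thesis using r by (simp add: set_lebesgue_integral_def fun_eq_iff)
qed

section \<open>Equivalence of norms on polynomials\<close>

text \<open>Expanding in an orthonormal basis of the polynomials bounds each value and each gradient by
  the mean square over the unit ball, uniformly on compact sets.\<close>
lemma polynomial_pointwise_bound_unit:
  "\<exists>C\<ge>0. \<forall>P :: real ^ 'd \<Rightarrow> real. polynomial_deg_le m P \<longrightarrow> (\<forall>y \<in> cball 0 R.
     (P y)\<^sup>2 \<le> C * (LINT x:cball 0 1|lborel. (P x)\<^sup>2) \<and>
     (norm (grad P y))\<^sup>2 \<le> C * (LINT x:cball 0 1|lborel. (P x)\<^sup>2))"
proof -
  define S where "S = {P :: real ^ 'd \<Rightarrow> real. polynomial_deg_le m P}"
  define f where "f P Q = (LINT x:cball 0 1|lborel. P x * Q x)" for P Q :: "real ^ 'd \<Rightarrow> real"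
  have S: "subspace S" unfolding S_def by (rule subspace_polynomial_deg_le)
  have cont: "continuous_on A P" if "P \<in> S" for P A
    using that continuous_on_polynomial unfolding S_def by blast
  have psd: "psd_form_on S f"
    unfolding psd_form_on_def
  proof (intro conjI ballI allI)
    fix P Q R assume "P \<in> S" "Q \<in> S" "R \<in> S"
    then show "f (P + Q) R = f P R + f Q R"
      unfolding f_def plus_fun_apply distrib_right
      by (intro set_integral_cont_add continuous_on_mult cont) auto
  next
    fix P assume "P \<in> S"
    then show "0 \<le> f P P" unfolding f_def by (intro set_integral_cont_nonneg) simp
  next
    fix P Q show "f P Q = f Q P" unfolding f_def by (simp add: mult.commute)
  next
    fix r P Q show "f (r *\<^sub>R P) Q = r * f P Q" unfolding f_def by (simp add: mult.assoc)
  qed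
  have dfn: "definite_on S f"
    unfolding definite_on_def
  proof safe
    fix P assume P: "P \<in> S" "f P P = 0"
    have "P x * P x = 0" if "x \<in> interior (cball 0 1)" for x
      using P(2) that continuous_on_mult[OF cont[OF P(1)] cont[OF P(1)]] unfolding f_def
      by (intro integral_0_imp_0_interior[of "cball 0 1" "\<lambda>x. P x * P x"]) auto
    then have "P x = 0" if "x \<in> ball 0 1" for x using that by (simp add: interior_cball)
    then have "P x = 0" for x
      using P(1) polynomial_deg_le_eq_0[of m P "ball 0 1" 0 x] unfolding S_def by simp
    then show "P = 0" by (simp add: fun_eq_iff)
  qed
  have "finite (monomials m :: (real ^ 'd \<Rightarrow> real) set)" using finite_exponents by auto
  moreover have "S \<subseteq> span (monomials m)" unfolding S_def polynomial_deg_le_eq_span by simp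
  ultimately obtain E where E: "finite E" "E \<subseteq> S"
    and exp: "\<And>P. P \<in> S \<Longrightarrow> P = (\<Sum>e\<in>E. f P e *\<^sub>R e)" "\<And>P. P \<in> S \<Longrightarrow> f P P = (\<Sum>e\<in>E. (f P e)\<^sup>2)"
    by (rule orthonormal_basis_of_subspace[OF S psd dfn]) blast
  \<comment> \<open>\<open>\<Phi>\<close> is the sum of the squares of the functions and gradients that occur in the Cauchy--Schwarz
    inequality for the expansion; on a compact set it is bounded.\<close>
  define \<Phi> where "\<Phi> y = (\<Sum>e\<in>E. (e y)\<^sup>2) + (\<Sum>e\<in>E. (norm (grad e y))\<^sup>2)" for y
  have "continuous_on A (grad e)" "continuous_on A e" if "e \<in> E" for e A
    using that E continuous_on_grad[of m e] continuous_on_polynomial[of m e] by (auto simp: S_def)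
  then have "continuous_on (cball 0 R) \<Phi>"
    unfolding \<Phi>_def by (intro continuous_intros)
  then have "compact (\<Phi> ` cball 0 R)" by (intro compact_continuous_image) auto
  then have "bounded (\<Phi> ` cball 0 R)" by (rule compact_imp_bounded)
  then obtain C where "C > 0" and "\<forall>z \<in> \<Phi> ` cball 0 R. norm z \<le> C"
    unfolding bounded_pos by blast
  then have C: "\<And>y. y \<in> cball 0 R \<Longrightarrow> \<bar>\<Phi> y\<bar> \<le> C" "C > 0" by auto
  have "(P y)\<^sup>2 \<le> C * f P P \<and> (norm (grad P y))\<^sup>2 \<le> C * f P P"
    if P: "P \<in> S" and y: "y \<in> cball 0 R" for P y
  proof -
    have fP: "0 \<le> f P P" using psd_form_nonneg[OF S psd P] .
    have le: "(\<Sum>e\<in>E. (e y)\<^sup>2) \<le> C" "(\<Sum>e\<in>E. (norm (grad e y))\<^sup>2) \<le> C"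
      using C(1)[OF y] sum_nonneg[of E "\<lambda>e. (e y)\<^sup>2"] sum_nonneg[of E "\<lambda>e. (norm (grad e y))\<^sup>2"]
      unfolding \<Phi>_def by (simp_all add: abs_le_iff)
    have "P y = (\<Sum>e\<in>E. f P e * e y)" by (subst exp(1)[OF P]) simp
    then have "(P y)\<^sup>2 \<le> f P P * (\<Sum>e\<in>E. (e y)\<^sup>2)"
      using Cauchy_Schwarz_ineq_sum[of "\<lambda>e. f P e" "\<lambda>e. e y" E] exp(2)[OF P] by simp
    also have "\<dots> \<le> f P P * C" using le fP by (intro mult_left_mono)
    finally have 1: "(P y)\<^sup>2 \<le> C * f P P" by (simp add: mult.commute)
    have "((\<lambda>x. \<Sum>e\<in>E. f P e * e x) has_derivative (\<lambda>h. \<Sum>e\<in>E. f P e * (grad e y \<bullet> h))) (at y)"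
      using E unfolding S_def
      by (intro has_derivative_sum has_derivative_mult_right polynomial_has_gradient) auto
    moreover have "(\<lambda>x. \<Sum>e\<in>E. f P e * e x) = P" using arg_cong[OF exp(1)[OF P, symmetric], of "\<lambda>F y. F y"] by (simp add: fun_eq_iff)
    ultimately have "grad P y = (\<Sum>e\<in>E. f P e *\<^sub>R grad e y)"
      by (intro grad_eqI) (simp add: inner_sum_left)
    then have "norm (grad P y) \<le> (\<Sum>e\<in>E. \<bar>f P e\<bar> * norm (grad e y))"
      by (simp add: sum_norm_le)
    then have "(norm (grad P y))\<^sup>2 \<le> (\<Sum>e\<in>E. \<bar>f P e\<bar> * norm (grad e y))\<^sup>2"
      by (intro power_mono) auto
    also have "\<dots> \<le> f P P * (\<Sum>e\<in>E. (norm (grad e y))\<^sup>2)"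
      using Cauchy_Schwarz_ineq_sum[of "\<lambda>e. \<bar>f P e\<bar>" "\<lambda>e. norm (grad e y)" E] exp(2)[OF P] by simp
    also have "\<dots> \<le> f P P * C" using le fP by (intro mult_left_mono)
    finally show ?thesis using 1 by (simp add: mult.commute)
  qed
  then show ?thesis using C(2) unfolding S_def f_def power2_eq_square
    by (intro exI[of _ C]) auto
qed

lemma polynomial_deg_le_rescale:
  "polynomial_deg_le m P \<Longrightarrow> polynomial_deg_le m (\<lambda>y. P (c + r *\<^sub>R y))"
  by (rule polynomial_deg_le_affine_compose)
     (auto intro!: polynomial_deg_le_add polynomial_deg_le_const polynomial_deg_le_cmult polynomial_deg_le_nth[unfolded One_nat_def])

lemma grad_rescale:
  assumes "polynomial_deg_le m P"
  shows "grad (\<lambda>y. P (c + r *\<^sub>R y)) y = r *\<^sub>R grad P (c + r *\<^sub>R y)"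
proof (rule grad_eqI)
  have "((\<lambda>y. c + r *\<^sub>R y) has_derivative (\<lambda>h. r *\<^sub>R h)) (at y)"
    by (auto intro!: derivative_eq_intros)
  from has_derivative_compose[OF this polynomial_has_gradient[OF assms]]
  show "((\<lambda>y. P (c + r *\<^sub>R y)) has_derivative (\<lambda>h. (r *\<^sub>R grad P (c + r *\<^sub>R y)) \<bullet> h)) (at y)"
    by simp
qed

text \<open>The ball of radius \<open>r\<close> is scaled to the unit ball: values are invariant, gradients gain a factor \<open>r\<close>,
  and the volume of the ball gives \<open>r\<^sup>d\<close>.\<close>
lemma polynomial_pointwise_bound:
  "\<exists>C\<ge>0. \<forall>(P :: real ^ 'd \<Rightarrow> real) c r y. polynomial_deg_le m P \<longrightarrow> 0 < r \<longrightarrow> y \<in> cball c (R * r) \<longrightarrow>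
     r ^ CARD('d) * (P y)\<^sup>2 \<le> C * (LINT x:cball c r|lborel. (P x)\<^sup>2) \<and>
     r ^ CARD('d) * (r * norm (grad P y))\<^sup>2 \<le> C * (LINT x:cball c r|lborel. (P x)\<^sup>2)"
proof -
  obtain C where C: "C \<ge> 0" "\<And>P y. polynomial_deg_le m P \<Longrightarrow> y \<in> cball (0 :: real ^ 'd) R \<Longrightarrow>
     (P y)\<^sup>2 \<le> C * (LINT x:cball 0 1|lborel. (P x)\<^sup>2) \<and>
     (norm (grad P y))\<^sup>2 \<le> C * (LINT x:cball 0 1|lborel. (P x)\<^sup>2)"
    using polynomial_pointwise_bound_unit[of m R] by blast
  have "r ^ CARD('d) * (P y)\<^sup>2 \<le> C * (LINT x:cball c r|lborel. (P x)\<^sup>2) \<and>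
     r ^ CARD('d) * (r * norm (grad P y))\<^sup>2 \<le> C * (LINT x:cball c r|lborel. (P x)\<^sup>2)"
    if P: "polynomial_deg_le m P" and r: "r > 0" and y: "y \<in> cball c (R * r)"
    for P c r and y :: "real ^ 'd"
  proof -
    define z where "z = (1/r) *\<^sub>R (y - c)"
    have yz: "y = c + r *\<^sub>R z" using r by (simp add: z_def)
    have "norm (y - c) \<le> R * r" using y by (simp add: dist_norm norm_minus_commute)
    then have z: "z \<in> cball 0 R" using r by (simp add: z_def divide_le_eq)
    have I: "(LINT x:cball c r|lborel. (P x)\<^sup>2) = r ^ CARD('d) * (LINT x:cball 0 1|lborel. (P (c + r *\<^sub>R x))\<^sup>2)"
      using r by (intro set_integral_cball_rescale continuous_intros continuous_on_polynomial[OF P])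
    have gr: "r * norm (grad P y) = norm (grad (\<lambda>y. P (c + r *\<^sub>R y)) z)"
      using r unfolding grad_rescale[OF P] yz by simp
    show ?thesis
      using C(2)[OF polynomial_deg_le_rescale[OF P] z, of c r] r
      unfolding I gr yz[symmetric]
      by (auto simp: mult.left_commute[of C] intro!: mult_left_mono)
  qed
  then show ?thesis using C(1) by blast
qed

text \<open>Integrating the pointwise bound over \<open>K\<close> turns the factor \<open>r\<^sup>d\<close> into a constant, because \<open>K\<close> has at most
  the volume of the ball of radius \<open>R r\<close>. This replaces the usual passage to a reference element.\<close>
lemma polynomial_integral_bound:
  "\<exists>C\<ge>0. \<forall>(P :: real ^ 'd \<Rightarrow> real) c r K. polynomial_deg_le m P \<longrightarrow> 0 < r \<longrightarrow> compact K \<longrightarrow>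
     K \<subseteq> cball c (R * r) \<longrightarrow>
     (LINT x:K|lborel. (P x)\<^sup>2) \<le> C * (LINT x:cball c r|lborel. (P x)\<^sup>2) \<and>
     r\<^sup>2 * (LINT x:K|lborel. (norm (grad P x))\<^sup>2) \<le> C * (LINT x:cball c r|lborel. (P x)\<^sup>2)"
proof -
  obtain C where C: "C \<ge> 0" "\<And>P c r y. polynomial_deg_le m P \<Longrightarrow> 0 < r \<Longrightarrow> y \<in> cball c (R * r) \<Longrightarrow>
     r ^ CARD('d) * (P y)\<^sup>2 \<le> C * (LINT x:cball c r|lborel. (P x)\<^sup>2) \<and>
     r ^ CARD('d) * (r * norm (grad P (y :: real ^ 'd)))\<^sup>2 \<le> C * (LINT x:cball c r|lborel. (P x)\<^sup>2)"
    using polynomial_pointwise_bound[of m R] by blast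
  define M where "M = measure lborel (cball (0 :: real ^ 'd) \<bar>R\<bar>)"
  have "(LINT x:K|lborel. (P x)\<^sup>2) \<le> M * C * (LINT x:cball c r|lborel. (P x)\<^sup>2) \<and>
     r\<^sup>2 * (LINT x:K|lborel. (norm (grad P x))\<^sup>2) \<le> M * C * (LINT x:cball c r|lborel. (P x)\<^sup>2)"
    if P: "polynomial_deg_le m P" and r: "r > 0" and K: "compact K" "K \<subseteq> cball c (R * r)"
    for P c r and K :: "(real ^ 'd) set"
  proof -
    define I where "I = (LINT x:cball c r|lborel. (P x)\<^sup>2)"
    have I: "I \<ge> 0" unfolding I_def by (intro set_integral_cont_nonneg) simp
    define V where "V = measure lborel K"
    have V: "0 \<le> V" "V \<le> r ^ CARD('d) * M"
    proof -
      have "V \<le> measure lborel (cball c (\<bar>R\<bar> * r))"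
        unfolding V_def
      proof (rule measure_mono_fmeasurable)
        have "R * r \<le> \<bar>R\<bar> * r" using r by (intro mult_right_mono) auto
        then show "K \<subseteq> cball c (\<bar>R\<bar> * r)" using K(2) by (meson subset_cball subset_trans)
      qed (use borel_compact[OF K(1)] emeasure_compact_finite[of "cball c (\<bar>R\<bar> * r)"]
             in \<open>auto simp: fmeasurable_def\<close>)
      also have "\<dots> = (LINT x:cball c (\<bar>R\<bar> * r)|lborel. 1)"
        by (simp add: set_integral_const_compact)
      also have "\<dots> = r ^ CARD('d) * M"
      proof (cases "R = 0")
        case True
        then show ?thesis by (simp add: set_integral_const_compact M_def)
      next
        case False
        then show ?thesis
          using r set_integral_cball_rescale[of "\<bar>R\<bar> * r" "\<lambda>_. 1" c] set_integral_cball_rescale[of "\<bar>R\<bar>" "\<lambda>_. 1" "0 :: real ^ 'd"]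
          by (simp add: set_integral_const_compact M_def power_mult_distrib)
      qed
      finally show "V \<le> r ^ CARD('d) * M" .
    qed (simp add: V_def)
    have main: "(LINT x:K|lborel. g x) \<le> M * C * I"
      if g: "continuous_on K g" "\<And>y. y \<in> K \<Longrightarrow> r ^ CARD('d) * g y \<le> C * I" for g
    proof -
      have "(LINT x:K|lborel. g x) \<le> (LINT x:K|lborel. C * I / r ^ CARD('d))"
        using g r by (intro set_integral_cont_mono K continuous_intros) (auto simp: field_simps)
      also have "\<dots> = V * (C * I / r ^ CARD('d))" by (simp add: set_integral_const_compact K V_def)
      also have "\<dots> \<le> (r ^ CARD('d) * M) * (C * I / r ^ CARD('d))"
        using V r C I by (intro mult_right_mono) auto
      also have "\<dots> = M * C * I" using r by simp
      finally show ?thesis .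
    qed
    have "(LINT x:K|lborel. (P x)\<^sup>2) \<le> M * C * I"
      using K C(2)[OF P r, of _ c] unfolding I_def[symmetric]
      by (intro main continuous_intros continuous_on_polynomial[OF P]) auto
    moreover have "(LINT x:K|lborel. (r * norm (grad P x))\<^sup>2) \<le> M * C * I"
      using K C(2)[OF P r, of _ c] unfolding I_def[symmetric]
      by (intro main continuous_intros continuous_on_grad[OF P]) auto
    ultimately show ?thesis unfolding I_def by (simp add: power_mult_distrib)
  qed
  moreover have "M * C \<ge> 0" using C(1) by (simp add: M_def)
  ultimately show ?thesis by blast
qed

section \<open>Integration over hyperplanes\<close>

definition hyper_proj :: "'a::euclidean_space \<Rightarrow> real \<Rightarrow> 'a \<Rightarrow> 'a" where
  "hyper_proj n \<beta> y = y - (n \<bullet> y - \<beta>) *\<^sub>R n"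

text \<open>The integral of \<open>\<phi>\<close> over the hyperplane \<open>n \<bullet> x = \<beta>\<close>, as the volume integral over the slab of thickness one
  around it of the function that is constant along \<open>n\<close>.\<close>
definition hyper_nn_integral :: "'a::euclidean_space \<Rightarrow> real \<Rightarrow> ('a \<Rightarrow> ennreal) \<Rightarrow> ennreal" where
  "hyper_nn_integral n \<beta> \<phi> =
     (\<integral>\<^sup>+y. indicator {- 1/2..1/2} (n \<bullet> y - \<beta>) * \<phi> (hyper_proj n \<beta> y) \<partial>lborel)"

lemma hyper_proj_measurable [measurable]: "hyper_proj n \<beta> \<in> borel_measurable borel"
  unfolding hyper_proj_def by measurable

lemma continuous_on_hyper_proj: "continuous_on S (hyper_proj n \<beta>)"
  unfolding hyper_proj_def by (intro continuous_intros)

context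
  fixes n :: "'a::euclidean_space" and \<beta> :: real
  assumes n: "norm n = 1"
begin

lemma n_dot_n: "n \<bullet> n = 1"
  using n by (simp add: norm_eq_1)

lemma hyper_proj_in: "n \<bullet> hyper_proj n \<beta> y = \<beta>"
  by (simp add: hyper_proj_def inner_diff_right n_dot_n)

lemma hyper_proj_shift: "n \<bullet> z = \<beta> \<Longrightarrow> hyper_proj n \<beta> (z + s *\<^sub>R n) = z"
  by (simp add: hyper_proj_def inner_add_right n_dot_n)

lemma hyper_nn_integral_cong:
  "(\<And>z. n \<bullet> z = \<beta> \<Longrightarrow> \<phi> z = \<psi> z) \<Longrightarrow> hyper_nn_integral n \<beta> \<phi> = hyper_nn_integral n \<beta> \<psi>"
  unfolding hyper_nn_integral_def using hyper_proj_in by (intro nn_integral_cong) auto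

lemma hyper_nn_integral_mono:
  "(\<And>z. n \<bullet> z = \<beta> \<Longrightarrow> \<phi> z \<le> \<psi> z) \<Longrightarrow> hyper_nn_integral n \<beta> \<phi> \<le> hyper_nn_integral n \<beta> \<psi>"
  unfolding hyper_nn_integral_def using hyper_proj_in by (intro nn_integral_mono mult_left_mono) auto

lemma hyper_nn_integral_cmult:
  assumes [measurable]: "\<phi> \<in> borel_measurable borel"
  shows "hyper_nn_integral n \<beta> (\<lambda>z. c * \<phi> z) = c * hyper_nn_integral n \<beta> \<phi>"
  unfolding hyper_nn_integral_def by (subst nn_integral_cmult[symmetric]) (auto simp: mult_ac)

text \<open>Cavalieri's principle needs neither coordinates nor rotations: by Tonelli's theorem and
  translations along \<open>n\<close>, the slab can be moved from the argument of the projection to that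
  of the integrand, where it has length one.\<close>
lemma cavalieri:
  fixes \<phi> :: "'a \<Rightarrow> ennreal"
  assumes \<phi>[measurable]: "\<phi> \<in> borel_measurable borel"
  shows "(\<integral>\<^sup>+x. \<phi> x \<partial>lborel) = (\<integral>\<^sup>+s. hyper_nn_integral n \<beta> (\<lambda>z. \<phi> (z + s *\<^sub>R n)) \<partial>lborel)"
proof -
  define I :: "real \<Rightarrow> ennreal" where "I = indicator {- 1/2..1/2}"
  have [measurable]: "I \<in> borel_measurable borel" unfolding I_def by measurable
  have "(\<integral>\<^sup>+s. hyper_nn_integral n \<beta> (\<lambda>z. \<phi> (z + s *\<^sub>R n)) \<partial>lborel)
    = (\<integral>\<^sup>+y. (\<integral>\<^sup>+s. I (n \<bullet> y - \<beta>) * \<phi> (hyper_proj n \<beta> y + s *\<^sub>R n) \<partial>lborel) \<partial>lborel)"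
    unfolding hyper_nn_integral_def I_def[symmetric]
    by (rule lborel_pair.Fubini') measurable
  also have "\<dots> = (\<integral>\<^sup>+y. (\<integral>\<^sup>+s. I (n \<bullet> y - \<beta>) * \<phi> (y + s *\<^sub>R n) \<partial>lborel) \<partial>lborel)"
  proof (rule nn_integral_cong)
    fix y :: 'a
    show "(\<integral>\<^sup>+s. I (n \<bullet> y - \<beta>) * \<phi> (hyper_proj n \<beta> y + s *\<^sub>R n) \<partial>lborel)
      = (\<integral>\<^sup>+s. I (n \<bullet> y - \<beta>) * \<phi> (y + s *\<^sub>R n) \<partial>lborel)"
      by (subst nn_integral_lborel_affine[of 1 _ "n \<bullet> y - \<beta>"])
         (auto simp: hyper_proj_def algebra_simps)
  qed
  also have "\<dots> = (\<integral>\<^sup>+s. (\<integral>\<^sup>+y. I (n \<bullet> y - \<beta>) * \<phi> (y + s *\<^sub>R n) \<partial>lborel) \<partial>lborel)"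
    by (rule lborel_pair.Fubini') measurable
  also have "\<dots> = (\<integral>\<^sup>+s. (\<integral>\<^sup>+y. I (n \<bullet> y - \<beta> - s) * \<phi> y \<partial>lborel) \<partial>lborel)"
  proof (rule nn_integral_cong)
    fix s :: real
    show "(\<integral>\<^sup>+y. I (n \<bullet> y - \<beta>) * \<phi> (y + s *\<^sub>R n) \<partial>lborel) = (\<integral>\<^sup>+y. I (n \<bullet> y - \<beta> - s) * \<phi> y \<partial>lborel)"
      by (subst nn_integral_lborel_affine[of 1 _ "- s *\<^sub>R n"])
         (auto simp: inner_diff_right n_dot_n algebra_simps)
  qed
  also have "\<dots> = (\<integral>\<^sup>+y. (\<integral>\<^sup>+s. I (n \<bullet> y - \<beta> - s) * \<phi> y \<partial>lborel) \<partial>lborel)"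
    by (rule lborel_pair.Fubini') measurable
  also have "\<dots> = (\<integral>\<^sup>+y. \<phi> y \<partial>lborel)"
  proof (rule nn_integral_cong)
    fix y :: 'a
    have "(\<integral>\<^sup>+s. I (n \<bullet> y - \<beta> - s) * \<phi> y \<partial>lborel) = (\<integral>\<^sup>+s. I (n \<bullet> y - \<beta> - s) \<partial>lborel) * \<phi> y"
      by (rule nn_integral_multc) measurable
    moreover have "(\<lambda>s. I (n \<bullet> y - \<beta> - s)) = indicator {n \<bullet> y - \<beta> - 1/2..n \<bullet> y - \<beta> + 1/2}"
      by (auto simp: I_def indicator_def fun_eq_iff)
    then have "(\<integral>\<^sup>+s. I (n \<bullet> y - \<beta> - s) \<partial>lborel) = 1" by simp
    ultimately show "(\<integral>\<^sup>+s. I (n \<bullet> y - \<beta> - s) * \<phi> y \<partial>lborel) = \<phi> y" by simp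
  qed
  finally show ?thesis by simp
qed

text \<open>Homothetic images: dilate the slab as well, and compare its thickness \<open>t\<close> with \<open>1\<close> by
  Cavalieri's principle.\<close>
lemma hyper_nn_integral_homothety:
  assumes \<kappa>[measurable]: "\<kappa> \<in> borel_measurable borel" and c: "n \<bullet> c = \<beta>" and t: "t > 0"
  shows "hyper_nn_integral n \<beta> \<kappa> =
    ennreal (t ^ (DIM('a) - 1)) * hyper_nn_integral n \<beta> (\<lambda>z. \<kappa> (c + t *\<^sub>R (z - c)))"
proof -
  define g :: "'a \<Rightarrow> ennreal" where
    "g y = indicator {- t/2..t/2} (n \<bullet> y - \<beta>) * \<kappa> (hyper_proj n \<beta> y)" for y
  have [measurable]: "g \<in> borel_measurable borel" unfolding g_def by measurable
  have "(\<integral>\<^sup>+y. g y \<partial>lborel) = ennreal (\<bar>t\<bar> ^ DIM('a)) * (\<integral>\<^sup>+y. g ((c - t *\<^sub>R c) + t *\<^sub>R y) \<partial>lborel)"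
    using t by (intro nn_integral_lborel_affine) auto
  also have "(\<integral>\<^sup>+y. g ((c - t *\<^sub>R c) + t *\<^sub>R y) \<partial>lborel) = hyper_nn_integral n \<beta> (\<lambda>z. \<kappa> (c + t *\<^sub>R (z - c)))"
    unfolding hyper_nn_integral_def
  proof (rule nn_integral_cong)
    fix y :: 'a
    have *: "n \<bullet> ((c - t *\<^sub>R c) + t *\<^sub>R y) - \<beta> = t * (n \<bullet> y - \<beta>)"
      using c by (simp add: inner_add_right inner_diff_right algebra_simps)
    have "hyper_proj n \<beta> ((c - t *\<^sub>R c) + t *\<^sub>R y) = c + t *\<^sub>R (hyper_proj n \<beta> y - c)"
      unfolding hyper_proj_def * by (simp add: algebra_simps)
    moreover have "- t/2 \<le> t * (n \<bullet> y - \<beta>) \<longleftrightarrow> - 1/2 \<le> n \<bullet> y - \<beta>"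
      "t * (n \<bullet> y - \<beta>) \<le> t/2 \<longleftrightarrow> n \<bullet> y - \<beta> \<le> 1/2"
      using mult_le_cancel_left_pos[OF t, of "-1/2" "n \<bullet> y - \<beta>"]
        mult_le_cancel_left_pos[OF t, of "n \<bullet> y - \<beta>" "1/2"] by simp_all
    ultimately show "g ((c - t *\<^sub>R c) + t *\<^sub>R y) =
        indicator {- 1/2..1/2} (n \<bullet> y - \<beta>) * \<kappa> (c + t *\<^sub>R (hyper_proj n \<beta> y - c))"
      unfolding g_def * by (simp add: indicator_def)
  qed
  finally have 1: "(\<integral>\<^sup>+y. g y \<partial>lborel) =
    ennreal (t ^ DIM('a)) * hyper_nn_integral n \<beta> (\<lambda>z. \<kappa> (c + t *\<^sub>R (z - c)))" using t by simp
  have "(\<integral>\<^sup>+y. g y \<partial>lborel) = (\<integral>\<^sup>+s. hyper_nn_integral n \<beta> (\<lambda>z. g (z + s *\<^sub>R n)) \<partial>lborel)"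
    by (rule cavalieri) measurable
  also have "\<dots> = (\<integral>\<^sup>+s. indicator {- t/2..t/2} s * hyper_nn_integral n \<beta> \<kappa> \<partial>lborel)"
  proof (rule nn_integral_cong)
    fix s :: real
    have "hyper_nn_integral n \<beta> (\<lambda>z. g (z + s *\<^sub>R n)) =
      hyper_nn_integral n \<beta> (\<lambda>z. indicator {- t/2..t/2} s * \<kappa> z)"
      by (rule hyper_nn_integral_cong) (simp add: g_def hyper_proj_shift inner_add_right n_dot_n)
    then show "hyper_nn_integral n \<beta> (\<lambda>z. g (z + s *\<^sub>R n)) = indicator {- t/2..t/2} s * hyper_nn_integral n \<beta> \<kappa>"
      by (simp add: hyper_nn_integral_cmult)
  qed
  also have "\<dots> = ennreal t * hyper_nn_integral n \<beta> \<kappa>"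
    using t by (subst nn_integral_multc) auto
  finally have 2: "(\<integral>\<^sup>+y. g y \<partial>lborel) = ennreal t * hyper_nn_integral n \<beta> \<kappa>" .
  have "t ^ DIM('a) = t * t ^ (DIM('a) - 1)"
    using DIM_positive[where 'a='a] by (cases "DIM('a)") auto
  then have "ennreal (t ^ DIM('a)) = ennreal t * ennreal (t ^ (DIM('a) - 1))"
    using t by (simp add: ennreal_mult)
  then have "ennreal t * hyper_nn_integral n \<beta> \<kappa> =
    ennreal t * (ennreal (t ^ (DIM('a) - 1)) * hyper_nn_integral n \<beta> (\<lambda>z. \<kappa> (c + t *\<^sub>R (z - c))))"
    using 1 2 by (simp add: mult.assoc)
  then show ?thesis using t by (simp add: ennreal_mult_cancel_left)
qed

end

section \<open>The surface measure of a face\<close>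

text \<open>In this setting the surface measure of \<open>e\<close> is the image under the orthogonal projection of the volume on
  the prism of height one over \<open>e\<close>.\<close>
locale flat_face =
  fixes n :: "real ^ 'd" and \<beta> :: real and e :: "(real ^ 'd) set"
  assumes n: "norm n = 1" and e: "compact e" and hull: "affine hull e = {x. n \<bullet> x = \<beta>}"
begin

lemma eH: "x \<in> e \<Longrightarrow> n \<bullet> x = \<beta>"
  using hull hull_subset[of e affine] by auto

lemma closest_point_hull: "closest_point (affine hull e) = hyper_proj n \<beta>"
proof
  fix y
  have "hyper_proj n \<beta> y = closest_point {x. n \<bullet> x = \<beta>} y"
  proof (rule closest_point_unique)
    show "\<forall>z\<in>{x. n \<bullet> x = \<beta>}. dist y (hyper_proj n \<beta> y) \<le> dist y z"
    proof safe
      fix z assume "\<beta> = n \<bullet> z"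
      then have "n \<bullet> y - \<beta> = n \<bullet> (y - z)" by (simp add: inner_diff_right)
      also have "\<bar>\<dots>\<bar> \<le> norm (y - z)" using Cauchy_Schwarz_ineq2[of n "y - z"] n by simp
      finally show "dist y (hyper_proj (n) (n \<bullet> z) y) \<le> dist y z"
        using n \<open>\<beta> = n \<bullet> z\<close> by (simp add: hyper_proj_def dist_norm)
    qed
  qed (use hyper_proj_in[OF n] in \<open>auto simp: convex_hyperplane closed_hyperplane\<close>)
  then show "closest_point (affine hull e) y = hyper_proj n \<beta> y" unfolding hull ..
qed

definition prism :: "(real ^ 'd) set" where
  "prism = {y. hyper_proj n \<beta> y \<in> e \<and> \<bar>n \<bullet> y - \<beta>\<bar> \<le> 1/2}"

lemma compact_prism: "compact prism"
proof -
  obtain B where B: "\<And>x. x \<in> e \<Longrightarrow> norm x \<le> B"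
    using compact_imp_bounded[OF e] unfolding bounded_iff by blast
  have "norm y \<le> B + 1" if "y \<in> prism" for y
  proof -
    have "y = hyper_proj n \<beta> y + (n \<bullet> y - \<beta>) *\<^sub>R n" by (simp add: hyper_proj_def)
    then have "norm y \<le> norm (hyper_proj n \<beta> y) + norm ((n \<bullet> y - \<beta>) *\<^sub>R n)"
      by (metis norm_triangle_ineq)
    then show ?thesis using that B[of "hyper_proj n \<beta> y"] n by (simp add: prism_def)
  qed
  then have "bounded prism" unfolding bounded_iff by blast
  moreover have "closed prism"
  proof -
    have "closed (hyper_proj n \<beta> -` e)"
      by (intro closed_vimage compact_imp_closed e continuous_on_hyper_proj)
    moreover have "closed {y. \<bar>n \<bullet> y - \<beta>\<bar> \<le> 1/2}" by (intro closed_Collect_le continuous_intros)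
    ultimately show ?thesis unfolding prism_def by (auto simp: Collect_conj_eq vimage_def intro: closed_Int)
  qed
  ultimately show ?thesis by (simp add: compact_eq_bounded_closed)
qed

lemma face_measure_eq: "face_measure e = distr (lebesgue_on prism) borel (hyper_proj n \<beta>)"
proof -
  have "{y. hyper_proj n \<beta> y \<in> e \<and> dist y (hyper_proj n \<beta> y) \<le> 1/2} = prism"
    using n by (auto simp: prism_def hyper_proj_def dist_norm)
  then show ?thesis unfolding face_measure_def Let_def closest_point_hull by simp
qed

lemma prism_sets: "prism \<in> sets lborel" "prism \<in> sets lebesgue"
  using borel_compact[OF compact_prism] by auto

lemma hyper_proj_measurable_prism: "hyper_proj n \<beta> \<in> measurable (lebesgue_on prism) borel"
  by (intro measurable_restrict_space1 measurable_completion) simp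

lemma sets_face_measure [measurable_cong]: "sets (face_measure e) = sets borel"
  and space_face_measure [simp]: "space (face_measure e) = UNIV"
  by (auto simp: face_measure_eq)

lemma nn_integral_face_measure:
  assumes [measurable]: "g \<in> borel_measurable borel"
  shows "(\<integral>\<^sup>+x. g x \<partial>face_measure e) = hyper_nn_integral n \<beta> (\<lambda>z. indicator e z * g z)"
proof -
  have "(\<integral>\<^sup>+x. g x \<partial>face_measure e) = (\<integral>\<^sup>+y. g (hyper_proj n \<beta> y) \<partial>lebesgue_on prism)"
    unfolding face_measure_eq by (rule nn_integral_distr[OF hyper_proj_measurable_prism]) measurable
  also have "\<dots> = (\<integral>\<^sup>+y. g (hyper_proj n \<beta> y) * indicator prism y \<partial>lebesgue)"
    using prism_sets by (intro nn_integral_restrict_space) auto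
  also have "\<dots> = (\<integral>\<^sup>+y. g (hyper_proj n \<beta> y) * indicator prism y \<partial>lborel)"
    by (rule nn_integral_completion)
  also have "\<dots> = hyper_nn_integral n \<beta> (\<lambda>z. indicator e z * g z)"
    unfolding hyper_nn_integral_def
  proof (rule nn_integral_cong)
    fix y
    have "y \<in> prism \<longleftrightarrow> n \<bullet> y - \<beta> \<in> {- 1/2..1/2} \<and> hyper_proj n \<beta> y \<in> e"
    proof -
      have "\<bar>t\<bar> \<le> 1/2 \<longleftrightarrow> - 1/2 \<le> t \<and> t \<le> 1/2" for t :: real by linarith
      then show ?thesis unfolding prism_def atLeastAtMost_iff mem_Collect_eq by blast
    qed
    then have "(indicator prism y :: ennreal) =
        indicator {- 1/2..1/2} (n \<bullet> y - \<beta>) * indicator e (hyper_proj n \<beta> y)"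
      by (simp only: indicator_def of_bool_conj)
    then show "g (hyper_proj n \<beta> y) * indicator prism y =
        indicator {- 1/2..1/2} (n \<bullet> y - \<beta>) * (indicator e (hyper_proj n \<beta> y) * g (hyper_proj n \<beta> y))"
      by (simp only: mult_ac)
  qed
  finally show ?thesis .
qed

lemma finite_face_measure: "finite_measure (face_measure e)"
proof
  have "emeasure (face_measure e) UNIV = emeasure lborel prism"
    unfolding face_measure_eq using prism_sets
    by (subst emeasure_distr[OF hyper_proj_measurable_prism])
       (simp_all add: emeasure_restrict_space space_restrict_space)
  also have "\<dots> < \<infinity>" using emeasure_compact_finite[OF compact_prism] .
  finally show "emeasure (face_measure e) (space (face_measure e)) \<noteq> \<infinity>" by simp
qed

lemma AE_face_measure: "AE x in face_measure e. x \<in> e"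
  unfolding face_measure_eq
  using e borel_compact[OF e] prism_sets
  by (subst AE_distr_iff[OF hyper_proj_measurable_prism])
     (auto simp: AE_restrict_space_iff prism_def)

text \<open>The surface measure lives on the Borel sets of the whole space but charges only \<open>e\<close>, so that continuity
  of the integrand is required on \<open>e\<close> alone.\<close>
lemma integrable_face:
  assumes [measurable]: "G \<in> borel_measurable borel" and g: "continuous_on e g"
    and eq: "\<And>x. x \<in> e \<Longrightarrow> G x = g x"
  shows "integrable (face_measure e) (G :: _ \<Rightarrow> real)"
proof -
  interpret finite_measure "face_measure e" by (rule finite_face_measure)
  have "bounded (g ` e)" using e g by (intro compact_imp_bounded compact_continuous_image)
  then obtain B where "\<And>x. x \<in> e \<Longrightarrow> norm (g x) \<le> B" unfolding bounded_iff by auto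
  then show ?thesis
    using AE_face_measure eq
    by (intro integrable_const_bound[where B=B]) (auto elim!: eventually_mono)
qed

lemma face_integral_cong:
  assumes "G \<in> borel_measurable borel" "H \<in> borel_measurable borel" "\<And>x. x \<in> e \<Longrightarrow> G x = H x"
  shows "(LINT x|face_measure e. G x) = (LINT x|face_measure e. (H x :: real))"
  using AE_face_measure assms
  by (intro integral_cong_AE) (auto elim!: eventually_mono)

lemma ennreal_face_integral:
  assumes [measurable]: "g \<in> borel_measurable borel" and "continuous_on e g" "\<And>x. x \<in> e \<Longrightarrow> 0 \<le> g x"
  shows "ennreal (LINT x|face_measure e. g x) = hyper_nn_integral n \<beta> (\<lambda>z. indicator e z * ennreal (g z))"
  using AE_face_measure assms
  by (subst nn_integral_face_measure[symmetric])
     (auto intro!: nn_integral_eq_integral[symmetric] integrable_face elim!: eventually_mono)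

end

text \<open>The cone with apex \<open>a\<close>, base \<open>e\<close> and height \<open>h\<close>. The assumption \<open>ray\<close> describes its slices at height
  \<open>t * h\<close> above the apex as homothetic images of \<open>e\<close>, which is what Cavalieri's principle needs.\<close>
locale cone_over_face = flat_face n \<beta> e for n :: "real ^ 'd" and \<beta> e +
  fixes a :: "real ^ 'd" and h :: real and K :: "(real ^ 'd) set"
  assumes h: "0 < h" and na: "n \<bullet> a = \<beta> - h" and K: "compact K"
    and below: "\<And>x. x \<in> K \<Longrightarrow> \<beta> - h \<le> n \<bullet> x"
    and ray: "\<And>z t. n \<bullet> z = \<beta> \<Longrightarrow> 0 < t \<Longrightarrow> a + t *\<^sub>R (z - a) \<in> K \<longleftrightarrow> t \<le> 1 \<and> z \<in> e"
begin

lemma sets_borel [measurable]: "K \<in> sets borel" "e \<in> sets borel"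
  using K e borel_compact by auto

text \<open>Cavalieri's principle slices the cone by hyperplanes parallel to the base. The slice with parameter \<open>t\<close> is
  \<open>e\<close> dilated by the factor \<open>t\<close>, which contributes \<open>t\<^sup>d\<^sup>-\<^sup>1\<close>.\<close>
lemma cone_formula:
  fixes \<phi> :: "real ^ 'd \<Rightarrow> ennreal"
  assumes \<phi>[measurable]: "\<phi> \<in> borel_measurable borel"
  shows "(\<integral>\<^sup>+x. indicator K x * \<phi> x \<partial>lborel) =
    (\<integral>\<^sup>+t. indicator {0..1} t * (ennreal (h * t ^ (CARD('d) - 1)) *
         hyper_nn_integral n \<beta> (\<lambda>z. indicator e z * \<phi> (a + t *\<^sub>R (z - a)))) \<partial>lborel)"
proof -
  define \<psi> :: "real ^ 'd \<Rightarrow> ennreal" where "\<psi> x = indicator K x * \<phi> x" for x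
  have [measurable]: "\<psi> \<in> borel_measurable borel" unfolding \<psi>_def by measurable
  have meas: "(\<lambda>s. hyper_nn_integral n \<beta> (\<lambda>z. \<psi> (z + s *\<^sub>R n))) \<in> borel_measurable borel"
    unfolding hyper_nn_integral_def by measurable
  have "(\<integral>\<^sup>+x. \<psi> x \<partial>lborel) = (\<integral>\<^sup>+s. hyper_nn_integral n \<beta> (\<lambda>z. \<psi> (z + s *\<^sub>R n)) \<partial>lborel)"
    by (rule cavalieri[OF n]) measurable
  also have "\<dots> = ennreal (\<bar>h\<bar> ^ DIM(real)) *
      (\<integral>\<^sup>+t. hyper_nn_integral n \<beta> (\<lambda>z. \<psi> (z + (- h + h *\<^sub>R t) *\<^sub>R n)) \<partial>lborel)"
    using h meas by (intro nn_integral_lborel_affine) auto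
  also have "\<dots> = (\<integral>\<^sup>+t. ennreal h * hyper_nn_integral n \<beta> (\<lambda>z. \<psi> (z + (- h + h * t) *\<^sub>R n)) \<partial>lborel)"
    using h meas by (subst nn_integral_cmult) auto
  also have "\<dots> = (\<integral>\<^sup>+t. indicator {0..1} t * (ennreal (h * t ^ (CARD('d) - 1)) *
         hyper_nn_integral n \<beta> (\<lambda>z. indicator e z * \<phi> (a + t *\<^sub>R (z - a)))) \<partial>lborel)"
  proof (rule nn_integral_cong_AE)
    have "AE t in lborel. t \<noteq> (0::real)" by (rule AE_lborel_singleton)
    then show "AE t in lborel. ennreal h * hyper_nn_integral n \<beta> (\<lambda>z. \<psi> (z + (- h + h * t) *\<^sub>R n)) =
       indicator {0..1} t * (ennreal (h * t ^ (CARD('d) - 1)) *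
         hyper_nn_integral n \<beta> (\<lambda>z. indicator e z * \<phi> (a + t *\<^sub>R (z - a))))"
    proof eventually_elim
      fix t :: real assume t0: "t \<noteq> 0"
      show "ennreal h * hyper_nn_integral n \<beta> (\<lambda>z. \<psi> (z + (- h + h * t) *\<^sub>R n)) =
       indicator {0..1} t * (ennreal (h * t ^ (CARD('d) - 1)) *
         hyper_nn_integral n \<beta> (\<lambda>z. indicator e z * \<phi> (a + t *\<^sub>R (z - a))))"
      proof (cases "t > 0")
        case False
        then have "h * t < 0" using t0 h by (simp add: mult_pos_neg)
        then have "z + (- h + h * t) *\<^sub>R n \<notin> K" if "n \<bullet> z = \<beta>" for z
          using below[of "z + (- h + h * t) *\<^sub>R n"] that n_dot_n[OF n]
          by (auto simp: inner_add_right inner_diff_right)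
        then have "hyper_nn_integral n \<beta> (\<lambda>z. \<psi> (z + (- h + h * t) *\<^sub>R n)) = hyper_nn_integral n \<beta> (\<lambda>z. 0)"
          by (intro hyper_nn_integral_cong[OF n]) (simp add: \<psi>_def)
        then show ?thesis using False t0 by (simp add: hyper_nn_integral_def)
      next
        case True
        \<comment> \<open>The dilation with centre \<open>a\<close>, followed by a translation along \<open>n\<close>, is the dilation within the
          hyperplane of the base whose centre is the foot of the altitude.\<close>
        define a' where "a' = a + h *\<^sub>R n"
        have a': "n \<bullet> a' = \<beta>" using na n_dot_n[OF n] by (simp add: a'_def inner_add_right)
        have "hyper_nn_integral n \<beta> (\<lambda>z. \<psi> (z + (- h + h * t) *\<^sub>R n)) = ennreal (t ^ (CARD('d) - 1)) *
            hyper_nn_integral n \<beta> (\<lambda>z. \<psi> ((a' + t *\<^sub>R (z - a')) + (- h + h * t) *\<^sub>R n))"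
          by (subst hyper_nn_integral_homothety[OF n _ a' True]) auto
        also have "hyper_nn_integral n \<beta> (\<lambda>z. \<psi> ((a' + t *\<^sub>R (z - a')) + (- h + h * t) *\<^sub>R n)) =
            hyper_nn_integral n \<beta> (\<lambda>z. indicator {0..1} t * (indicator e z * \<phi> (a + t *\<^sub>R (z - a))))"
        proof (rule hyper_nn_integral_cong[OF n])
          fix z assume z: "n \<bullet> z = \<beta>"
          have "(a' + t *\<^sub>R (z - a')) + (- h + h * t) *\<^sub>R n = a + t *\<^sub>R (z - a)"
            by (simp add: a'_def algebra_simps)
          then show "\<psi> ((a' + t *\<^sub>R (z - a')) + (- h + h * t) *\<^sub>R n) =
              indicator {0..1} t * (indicator e z * \<phi> (a + t *\<^sub>R (z - a)))"
            unfolding \<psi>_def using ray[OF z True] True by (simp add: indicator_def)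
        qed
        also have "\<dots> = indicator {0..1} t * hyper_nn_integral n \<beta> (\<lambda>z. indicator e z * \<phi> (a + t *\<^sub>R (z - a)))"
          by (rule hyper_nn_integral_cmult[OF n]) measurable
        finally show ?thesis using h True by (simp add: ennreal_mult mult_ac)
      qed
    qed
  qed
  finally show ?thesis unfolding \<psi>_def .
qed

text \<open>The divergence of \<open>\<psi>(x)(x - a)\<close> restricted to a ray from \<open>a\<close> is the derivative of
  \<open>t\<^sup>d \<psi>\<close>, up to the weight of the cone formula.\<close>
lemma Gauss_cone_nonneg:
  fixes \<psi> :: "real ^ 'd \<Rightarrow> real"
  assumes \<psi>: "polynomial_deg_le m \<psi>"
    and pos: "\<And>x. x \<in> K \<Longrightarrow> 0 \<le> CARD('d) * \<psi> x + grad \<psi> x \<bullet> (x - a)" "\<And>x. x \<in> e \<Longrightarrow> 0 \<le> \<psi> x"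
  shows "(\<integral>\<^sup>+x. indicator K x * ennreal (CARD('d) * \<psi> x + grad \<psi> x \<bullet> (x - a)) \<partial>lborel) =
    ennreal h * hyper_nn_integral n \<beta> (\<lambda>z. indicator e z * ennreal (\<psi> z))"
proof -
  define d where "d = CARD('d)"
  have d: "d \<ge> 1" unfolding d_def using zero_less_card_finite[where 'a='d] by linarith
  define \<phi> where "\<phi> x = d * \<psi> x + grad \<psi> x \<bullet> (x - a)" for x
  have c: "continuous_on UNIV \<psi>" "continuous_on UNIV (grad \<psi>)"
    using continuous_on_polynomial[OF \<psi>] continuous_on_grad[OF \<psi>] by auto
  have "continuous_on UNIV \<phi>" unfolding \<phi>_def by (intro continuous_intros c)
  then have [measurable]: "\<phi> \<in> borel_measurable borel" "\<psi> \<in> borel_measurable borel"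
    using c by (auto intro: borel_measurable_continuous_onI)
  define I where "I = (indicator {- 1/2..1/2} :: real \<Rightarrow> ennreal)"
  have [measurable]: "I \<in> borel_measurable borel" unfolding I_def by measurable
  define W where "W t z = indicator {0..1} t * ennreal (h * t ^ (d - 1) * \<phi> (a + t *\<^sub>R (z - a)))" for t z
  have [measurable]: "(\<lambda>(t, z). W t z) \<in> borel_measurable (borel \<Otimes>\<^sub>M borel)" unfolding W_def by measurable
  have "(\<integral>\<^sup>+x. indicator K x * ennreal (\<phi> x) \<partial>lborel) =
    (\<integral>\<^sup>+t. indicator {0..1} t * (ennreal (h * t ^ (d - 1)) *
         hyper_nn_integral n \<beta> (\<lambda>z. indicator e z * ennreal (\<phi> (a + t *\<^sub>R (z - a))))) \<partial>lborel)"
    unfolding d_def by (rule cone_formula) measurable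
  also have "\<dots> = (\<integral>\<^sup>+t. (\<integral>\<^sup>+y. I (n \<bullet> y - \<beta>) * (indicator e (hyper_proj n \<beta> y) * W t (hyper_proj n \<beta> y)) \<partial>lborel) \<partial>lborel)"
  proof (rule nn_integral_cong)
    fix t :: real
    show "indicator {0..1} t * (ennreal (h * t ^ (d - 1)) *
         hyper_nn_integral n \<beta> (\<lambda>z. indicator e z * ennreal (\<phi> (a + t *\<^sub>R (z - a))))) =
      (\<integral>\<^sup>+y. I (n \<bullet> y - \<beta>) * (indicator e (hyper_proj n \<beta> y) * W t (hyper_proj n \<beta> y)) \<partial>lborel)"
    proof (cases "t \<in> {0..1}")
      case True
      then have t: "0 \<le> h * t ^ (d - 1)" using h by simp
      show ?thesis
        unfolding hyper_nn_integral_def W_def I_def[symmetric] ennreal_mult'[OF t] using True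
        by (subst nn_integral_cmult[symmetric]) (auto simp: mult_ac)
    qed (simp add: W_def)
  qed
  also have "\<dots> = (\<integral>\<^sup>+y. (\<integral>\<^sup>+t. I (n \<bullet> y - \<beta>) * (indicator e (hyper_proj n \<beta> y) * W t (hyper_proj n \<beta> y)) \<partial>lborel) \<partial>lborel)"
    by (rule lborel_pair.Fubini') measurable
  also have "\<dots> = (\<integral>\<^sup>+y. ennreal h * (I (n \<bullet> y - \<beta>) * (indicator e (hyper_proj n \<beta> y) * ennreal (\<psi> (hyper_proj n \<beta> y)))) \<partial>lborel)"
  proof (rule nn_integral_cong)
    fix y :: "real ^ 'd"
    define z where "z = hyper_proj n \<beta> y"
    have nz: "n \<bullet> z = \<beta>" unfolding z_def by (rule hyper_proj_in[OF n])
    have "(\<integral>\<^sup>+t. W t z \<partial>lborel) = ennreal (h * \<psi> z)" if ze: "z \<in> e"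
    proof -
      define F where "F t = h * (t ^ d * \<psi> (a + t *\<^sub>R (z - a)))" for t :: real
      have "(\<integral>\<^sup>+t. ennreal (h * t ^ (d - 1) * \<phi> (a + t *\<^sub>R (z - a))) * indicator {0..1} t \<partial>lborel) = F 1 - F 0"
      proof (rule nn_integral_FTC_Icc)
        fix t :: real assume t: "t \<in> {0..1}"
        have "((\<lambda>t. \<psi> (a + t *\<^sub>R (z - a))) has_derivative (\<lambda>s. grad \<psi> (a + t *\<^sub>R (z - a)) \<bullet> (s *\<^sub>R (z - a)))) (at t)"
          by (rule has_derivative_compose[OF _ polynomial_has_gradient[OF \<psi>]])
             (auto intro!: derivative_eq_intros)
        then have D: "((\<lambda>t. \<psi> (a + t *\<^sub>R (z - a))) has_field_derivative (grad \<psi> (a + t *\<^sub>R (z - a)) \<bullet> (z - a))) (at t)"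
          by (rule has_derivative_imp_has_field_derivative) simp
        have td: "t * t ^ (d - 1) = t ^ d" using d by (cases d) auto
        have "(F has_field_derivative h * (t ^ d * (grad \<psi> (a + t *\<^sub>R (z - a)) \<bullet> (z - a)) + real d * t ^ (d - Suc 0) * \<psi> (a + t *\<^sub>R (z - a)))) (at t)"
          unfolding F_def using d
          by (auto intro!: derivative_eq_intros D)
        also have "h * (t ^ d * (grad \<psi> (a + t *\<^sub>R (z - a)) \<bullet> (z - a)) + real d * t ^ (d - Suc 0) * \<psi> (a + t *\<^sub>R (z - a)))
          = h * t ^ (d - 1) * \<phi> (a + t *\<^sub>R (z - a))"
          unfolding \<phi>_def td[symmetric] by (simp add: algebra_simps)
        finally show "(F has_real_derivative h * t ^ (d - 1) * \<phi> (a + t *\<^sub>R (z - a))) (at t)" .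
        show "0 \<le> h * t ^ (d - 1) * \<phi> (a + t *\<^sub>R (z - a))"
        proof (cases "t = 0")
          case True
          then show ?thesis
          \<comment> \<open>In dimension one the weight \<open>t\<^sup>d\<^sup>-\<^sup>1\<close> does not vanish at \<open>t = 0\<close>, and the apex is in \<open>K\<close> as a
            limit of points on the ray.\<close>
          proof (cases "d = 1")
            case True
            have "a + t *\<^sub>R (z - a) = a" using \<open>t = 0\<close> by simp
            have "\<And>s. 0 < s \<Longrightarrow> s \<le> 1 \<Longrightarrow> a + s *\<^sub>R (z - a) \<in> K" using ray[OF nz] ze by simp
            have "((\<lambda>s. a + s *\<^sub>R (z - a)) \<longlongrightarrow> a + 0 *\<^sub>R (z - a)) (at_right 0)" by (intro tendsto_intros)
            moreover have "\<forall>\<^sub>F s in at_right 0. a + s *\<^sub>R (z - a) \<in> K"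
              unfolding eventually_at_right_field by (intro exI[of _ 1]) (use ray[OF nz] ze in auto)
            ultimately have "a \<in> K"
              using Lim_in_closed_set[OF compact_imp_closed[OF K]] by fastforce
            then show ?thesis using pos(1)[of a] \<open>t = 0\<close> h unfolding \<phi>_def d_def by simp
          qed (use d in \<open>simp add: power_0_left\<close>)
        next
          case False
          then have "a + t *\<^sub>R (z - a) \<in> K" using ray[OF nz, of t] ze t by simp
          from pos(1)[OF this] show ?thesis
            using h t unfolding \<phi>_def d_def by (intro mult_nonneg_nonneg) auto
        qed
      qed measurable
      moreover have "F 1 - F 0 = h * \<psi> z" using d by (simp add: F_def power_0_left)
      ultimately show ?thesis unfolding W_def by (simp add: mult.commute)
    qed
    moreover have "ennreal (h * \<psi> z) = ennreal h * ennreal (\<psi> z)" using h by (intro ennreal_mult') simp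
    moreover have [measurable]: "(\<lambda>t. W t z) \<in> borel_measurable borel" unfolding W_def by measurable
    ultimately show "(\<integral>\<^sup>+t. I (n \<bullet> y - \<beta>) * (indicator e (hyper_proj n \<beta> y) * W t (hyper_proj n \<beta> y)) \<partial>lborel) =
      ennreal h * (I (n \<bullet> y - \<beta>) * (indicator e (hyper_proj n \<beta> y) * ennreal (\<psi> (hyper_proj n \<beta> y))))"
      unfolding z_def[symmetric]
      by (cases "z \<in> e") (auto simp: nn_integral_cmult nn_integral_multc mult_ac)
  qed
  also have "\<dots> = ennreal h * hyper_nn_integral n \<beta> (\<lambda>z. indicator e z * ennreal (\<psi> z))"
    unfolding hyper_nn_integral_def I_def[symmetric] by (rule nn_integral_cmult) measurable
  finally show ?thesis unfolding \<phi>_def d_def .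
qed

text \<open>Moved along \<open>c - a\<close> onto the base, a point \<open>a + t (z - a)\<close> of the cone lands on the image of \<open>z\<close> under
  the dilation by \<open>t\<close> with centre \<open>c \<in> e\<close>. The Jacobian of this dilation is exactly the weight of the cone
  formula.\<close>
lemma cone_extension_bound:
  fixes g :: "real ^ 'd \<Rightarrow> ennreal"
  assumes [measurable]: "g \<in> borel_measurable borel" and c: "c \<in> e" and conv: "convex e"
  shows "(\<integral>\<^sup>+x. indicator K x * g (x + ((\<beta> - n \<bullet> x) / h) *\<^sub>R (c - a)) \<partial>lborel)
    \<le> ennreal h * hyper_nn_integral n \<beta> (\<lambda>z. indicator e z * g z)"
proof -
  define d where "d = CARD('d)"
  have nc: "n \<bullet> c = \<beta>" using eH[OF c] .
  have "(\<integral>\<^sup>+x. indicator K x * g (x + ((\<beta> - n \<bullet> x) / h) *\<^sub>R (c - a)) \<partial>lborel) =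
    (\<integral>\<^sup>+t. indicator {0..1} t * (ennreal (h * t ^ (d - 1)) *
         hyper_nn_integral n \<beta> (\<lambda>z. indicator e z * g (a + t *\<^sub>R (z - a) + ((\<beta> - n \<bullet> (a + t *\<^sub>R (z - a))) / h) *\<^sub>R (c - a)))) \<partial>lborel)"
    unfolding d_def by (rule cone_formula) measurable
  also have "\<dots> \<le> (\<integral>\<^sup>+t. indicator {0..1::real} t * (ennreal h * hyper_nn_integral n \<beta> (\<lambda>z. indicator e z * g z)) \<partial>lborel)"
  proof (rule nn_integral_mono_AE)
    have "AE t in lborel. t \<noteq> (0::real)" by (rule AE_lborel_singleton)
    then show "AE t in lborel. indicator {0..1} t * (ennreal (h * t ^ (d - 1)) *
         hyper_nn_integral n \<beta> (\<lambda>z. indicator e z * g (a + t *\<^sub>R (z - a) + ((\<beta> - n \<bullet> (a + t *\<^sub>R (z - a))) / h) *\<^sub>R (c - a))))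
       \<le> indicator {0..1} t * (ennreal h * hyper_nn_integral n \<beta> (\<lambda>z. indicator e z * g z))"
    proof eventually_elim
      fix t :: real assume t0: "t \<noteq> 0"
      show "indicator {0..1} t * (ennreal (h * t ^ (d - 1)) *
         hyper_nn_integral n \<beta> (\<lambda>z. indicator e z * g (a + t *\<^sub>R (z - a) + ((\<beta> - n \<bullet> (a + t *\<^sub>R (z - a))) / h) *\<^sub>R (c - a))))
       \<le> indicator {0..1} t * (ennreal h * hyper_nn_integral n \<beta> (\<lambda>z. indicator e z * g z))"
      proof (cases "t \<in> {0..1}")
        case True
        then have t: "0 < t" "t \<le> 1" using t0 by auto
        have "hyper_nn_integral n \<beta> (\<lambda>z. indicator e z * g (a + t *\<^sub>R (z - a) + ((\<beta> - n \<bullet> (a + t *\<^sub>R (z - a))) / h) *\<^sub>R (c - a)))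
          \<le> hyper_nn_integral n \<beta> (\<lambda>z. indicator e (c + t *\<^sub>R (z - c)) * g (c + t *\<^sub>R (z - c)))"
        proof (rule hyper_nn_integral_mono[OF n])
          fix z assume z: "n \<bullet> z = \<beta>"
          have "\<beta> - n \<bullet> (a + t *\<^sub>R (z - a)) = (1 - t) * h"
            by (simp add: inner_add_right inner_diff_right z na algebra_simps)
          then have c1: "(\<beta> - n \<bullet> (a + t *\<^sub>R (z - a))) / h = 1 - t" using h by simp
          have eq: "a + t *\<^sub>R (z - a) + ((\<beta> - n \<bullet> (a + t *\<^sub>R (z - a))) / h) *\<^sub>R (c - a) = c + t *\<^sub>R (z - c)"
            unfolding c1 by (simp add: algebra_simps)
          have "c + t *\<^sub>R (z - c) \<in> e" if "z \<in> e"
          proof -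
            have "(1 - t) *\<^sub>R c + t *\<^sub>R z \<in> e" using conv c that t by (simp add: convexD)
            then show ?thesis by (simp add: algebra_simps)
          qed
          then show "indicator e z * g (a + t *\<^sub>R (z - a) + ((\<beta> - n \<bullet> (a + t *\<^sub>R (z - a))) / h) *\<^sub>R (c - a))
            \<le> indicator e (c + t *\<^sub>R (z - c)) * g (c + t *\<^sub>R (z - c))"
            unfolding eq by (auto simp: indicator_def)
        qed
        then have "ennreal (t ^ (d - 1)) * hyper_nn_integral n \<beta> (\<lambda>z. indicator e z * g (a + t *\<^sub>R (z - a) + ((\<beta> - n \<bullet> (a + t *\<^sub>R (z - a))) / h) *\<^sub>R (c - a)))
          \<le> ennreal (t ^ (d - 1)) * hyper_nn_integral n \<beta> (\<lambda>z. indicator e (c + t *\<^sub>R (z - c)) * g (c + t *\<^sub>R (z - c)))"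
          by (rule mult_left_mono) simp
        also have "\<dots> = hyper_nn_integral n \<beta> (\<lambda>z. indicator e z * g z)"
          using hyper_nn_integral_homothety[OF n _ nc t(1), of "\<lambda>z. indicator e z * g z"] unfolding d_def by simp
        finally show ?thesis
          using True h t by (simp add: ennreal_mult mult.assoc mult_left_mono)
      qed simp
    qed
  qed
  also have "\<dots> = ennreal h * hyper_nn_integral n \<beta> (\<lambda>z. indicator e z * g z)"
    by (subst nn_integral_multc) auto
  finally show ?thesis .
qed

lemma ennreal_cone_integral:
  fixes g :: "real ^ 'd \<Rightarrow> real"
  assumes "continuous_on UNIV g" "\<And>x. x \<in> K \<Longrightarrow> 0 \<le> g x"
  shows "ennreal (LINT x:K|lborel. g x) = (\<integral>\<^sup>+x. indicator K x * ennreal (g x) \<partial>lborel)"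
proof -
  have "(\<integral>\<^sup>+x. indicator K x * ennreal (g x) \<partial>lborel) = (\<integral>\<^sup>+x. ennreal (indicator K x *\<^sub>R g x) \<partial>lborel)"
    by (intro nn_integral_cong) (auto simp: indicator_def)
  also have "\<dots> = ennreal (LINT x:K|lborel. g x)"
    unfolding set_lebesgue_integral_def using assms continuous_on_subset[OF assms(1) subset_UNIV]
    by (intro nn_integral_eq_integral borel_integrable_compact K) (auto simp: indicator_def)
  finally show ?thesis by simp
qed

text \<open>Adding a large constant to \<open>\<psi>\<close> reduces Gauss's formula to nonnegative integrands.\<close>
lemma Gauss_cone:
  fixes \<psi> :: "real ^ 'd \<Rightarrow> real"
  assumes \<psi>: "polynomial_deg_le m \<psi>"
  shows "(LINT x:K|lborel. CARD('d) * \<psi> x + grad \<psi> x \<bullet> (x - a)) = h * (LINT x|face_measure e. \<psi> x)"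
proof -
  define dv where "dv \<psi> x = CARD('d) * \<psi> x + grad \<psi> x \<bullet> (x - a)" for \<psi> :: "real ^ 'd \<Rightarrow> real" and x
  have cdv: "continuous_on S (dv \<psi>)" if "polynomial_deg_le m \<psi>" for \<psi> S
    unfolding dv_def
    by (intro continuous_intros continuous_on_polynomial[OF that] continuous_on_grad[OF that])
  have pos: "(LINT x:K|lborel. dv \<psi> x) = h * (LINT x|face_measure e. \<psi> x)"
    if \<psi>: "polynomial_deg_le m \<psi>" and p: "\<And>x. x \<in> K \<Longrightarrow> 0 \<le> dv \<psi> x" "\<And>x. x \<in> e \<Longrightarrow> 0 \<le> \<psi> x" for \<psi>
  proof -
    have c: "continuous_on S \<psi>" for S using \<psi> by (rule continuous_on_polynomial)
    have "ennreal (LINT x:K|lborel. dv \<psi> x) = (\<integral>\<^sup>+x. indicator K x * ennreal (dv \<psi> x) \<partial>lborel)"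
      using p cdv[OF \<psi>] by (intro ennreal_cone_integral)
    also have "\<dots> = ennreal h * hyper_nn_integral n \<beta> (\<lambda>z. indicator e z * ennreal (\<psi> z))"
      unfolding dv_def using p unfolding dv_def by (intro Gauss_cone_nonneg[OF \<psi>]) auto
    also have "\<dots> = ennreal h * ennreal (LINT x|face_measure e. \<psi> x)"
      using p(2) c by (subst ennreal_face_integral) (auto intro: borel_measurable_continuous_onI)
    also have "\<dots> = ennreal (h * (LINT x|face_measure e. \<psi> x))"
      using h by (simp add: ennreal_mult')
    finally have eq: "ennreal (LINT x:K|lborel. dv \<psi> x) = ennreal (h * (LINT x|face_measure e. \<psi> x))" .
    have "0 \<le> (LINT x|face_measure e. \<psi> x)"
      using AE_face_measure p(2) by (intro integral_nonneg_AE) (auto elim!: eventually_mono)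
    then show ?thesis using eq h p(1) by (subst (asm) ennreal_inj) (auto intro!: set_integral_cont_nonneg)
  qed
  have c: "continuous_on S \<psi>" for S using \<psi> by (rule continuous_on_polynomial)
  have "bounded (\<psi> ` e)" "bounded (dv \<psi> ` K)"
    using e K c cdv[OF \<psi>] by (auto intro!: compact_imp_bounded compact_continuous_image)
  then obtain B1 B2 where B: "\<And>x. x \<in> e \<Longrightarrow> \<bar>\<psi> x\<bar> \<le> B1" "\<And>x. x \<in> K \<Longrightarrow> \<bar>dv \<psi> x\<bar> \<le> B2"
    unfolding bounded_iff by auto
  define M where "M = max (max B1 B2) 0"
  have d1: "1 \<le> real CARD('d)" using zero_less_card_finite[where 'a='d] by linarith
  have "M \<le> CARD('d) * M" using mult_right_mono[OF d1, of M] by (simp add: M_def)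
  then have M: "0 \<le> M" "B1 \<le> M" "B2 \<le> CARD('d) * M" by (auto simp: M_def)
  have PM: "polynomial_deg_le m (\<lambda>x. M)" and PS: "polynomial_deg_le m (\<lambda>x. \<psi> x + M)"
    by (auto intro!: polynomial_deg_le_add \<psi> polynomial_deg_le_const)
  have gM: "grad (\<lambda>x. M) x = 0" for x :: "real ^ 'd"
    by (rule grad_eqI) (simp add: has_derivative_const)
  have gS: "grad (\<lambda>x. \<psi> x + M) x = grad \<psi> x" for x
    using has_derivative_add[OF polynomial_has_gradient[OF \<psi>] has_derivative_const[of M "at x"]]
    by (intro grad_eqI) simp
  have dS: "dv (\<lambda>x. \<psi> x + M) x = dv \<psi> x + dv (\<lambda>x. M) x" for x
    unfolding dv_def gM gS by (simp add: algebra_simps)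
  have dM: "dv (\<lambda>x. M) x = CARD('d) * M" for x unfolding dv_def gM by simp
  have "(LINT x:K|lborel. dv \<psi> x + dv (\<lambda>x. M) x) = h * (LINT x|face_measure e. \<psi> x + M)"
    unfolding dS[symmetric]
  proof (rule pos[OF PS])
    fix x assume "x \<in> K"
    then show "0 \<le> dv (\<lambda>x. \<psi> x + M) x" using B(2)[of x] M unfolding dS dM by (auto simp: abs_le_iff)
  next
    fix x assume "x \<in> e"
    then show "0 \<le> \<psi> x + M" using B(1)[of x] M by (auto simp: abs_le_iff)
  qed
  moreover have "(LINT x:K|lborel. dv (\<lambda>x. M) x) = h * (LINT x|face_measure e. M)"
    using M by (intro pos[OF PM]) (auto simp: dM)
  moreover have "(LINT x:K|lborel. dv \<psi> x + dv (\<lambda>x. M) x) = (LINT x:K|lborel. dv \<psi> x) + (LINT x:K|lborel. dv (\<lambda>x. M) x)"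
    by (intro set_integral_cont_add K cdv \<psi> PM)
  moreover have "(LINT x|face_measure e. \<psi> x + M) = (LINT x|face_measure e. \<psi> x) + (LINT x|face_measure e. M)"
    using c by (intro Bochner_Integration.integral_add integrable_face[where g=\<psi>] integrable_face[where g="\<lambda>_. M"])
      (auto intro: borel_measurable_continuous_onI)
  ultimately show ?thesis unfolding dv_def by (simp add: algebra_simps)
qed

lemma cone_extension_integral_bound:
  fixes g :: "real ^ 'd \<Rightarrow> real"
  assumes g: "continuous_on UNIV g" "\<And>x. 0 \<le> g x" and c: "c \<in> e" "convex e"
  shows "(LINT x:K|lborel. g (x + ((\<beta> - n \<bullet> x) / h) *\<^sub>R (c - a))) \<le> h * (LINT x|face_measure e. g x)"
proof -
  have [measurable]: "g \<in> borel_measurable borel" using g by (auto intro: borel_measurable_continuous_onI)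
  have "ennreal (LINT x:K|lborel. g (x + ((\<beta> - n \<bullet> x) / h) *\<^sub>R (c - a))) =
    (\<integral>\<^sup>+x. indicator K x * ennreal (g (x + ((\<beta> - n \<bullet> x) / h) *\<^sub>R (c - a))) \<partial>lborel)"
    using g h by (intro ennreal_cone_integral continuous_on_compose2[OF g(1)] continuous_intros) auto
  also have "\<dots> \<le> ennreal h * hyper_nn_integral n \<beta> (\<lambda>z. indicator e z * ennreal (g z))"
    using c by (intro cone_extension_bound) auto
  also have "\<dots> = ennreal h * ennreal (LINT x|face_measure e. g x)"
    using g continuous_on_subset[OF g(1)] by (subst ennreal_face_integral) auto
  also have "\<dots> = ennreal (h * (LINT x|face_measure e. g x))"
    using h by (simp add: ennreal_mult')
  finally show ?thesis using h g(2) by (subst (asm) ennreal_le_iff) auto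
qed

end

section \<open>Full-dimensional simplices\<close>

definition verts :: "(real ^ 'd) set \<Rightarrow> (real ^ 'd) set" where
  "verts K = {v. v extreme_point_of K}"

definition opp_face :: "(real ^ 'd) set \<Rightarrow> real ^ 'd \<Rightarrow> (real ^ 'd) set" where
  "opp_face K a = convex hull (verts K - {a})"

definition nrm :: "(real ^ 'd) set \<Rightarrow> real ^ 'd \<Rightarrow> real ^ 'd" where
  "nrm K a = outward_normal K (opp_face K a)"

text \<open>The faces of a simplex are flat, so any point of the face serves. The face opposite \<open>a\<close> lies in the
  hyperplane \<open>nrm K a \<bullet> x = offs K a\<close>.\<close>
definition offs :: "(real ^ 'd) set \<Rightarrow> real ^ 'd \<Rightarrow> real" where
  "offs K a = nrm K a \<bullet> (SOME z. z \<in> opp_face K a)"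

definition hgt :: "(real ^ 'd) set \<Rightarrow> real ^ 'd \<Rightarrow> real" where
  "hgt K a = offs K a - nrm K a \<bullet> a"

text \<open>The barycentric coordinates, extended to affine functions on the whole space.\<close>
definition lam :: "(real ^ 'd) set \<Rightarrow> real ^ 'd \<Rightarrow> real ^ 'd \<Rightarrow> real" where
  "lam K a x = (offs K a - nrm K a \<bullet> x) / hgt K a"

text \<open>Identifies the outward normal of a face, and compares the normals of two elements at a common face.\<close>
lemma normal_unique:
  fixes n n' :: "'a::euclidean_space"
  assumes n: "norm n = 1" "norm n' = 1" and hull: "affine hull e = {x. n \<bullet> x = \<beta>}"
    and n': "\<forall>x \<in> e. \<forall>y \<in> e. n' \<bullet> (y - x) = 0"
  shows "n' = n \<or> n' = - n"
proof -
  have "e \<noteq> {}"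
  proof
    assume "e = {}"
    then have "{x. n \<bullet> x = \<beta>} = {}" using hull by simp
    moreover have "n \<bullet> (\<beta> *\<^sub>R n) = \<beta>" using n(1) by (simp add: norm_eq_1)
    ultimately show False by blast
  qed
  then obtain x0 where x0: "x0 \<in> e" by blast
  have "n' \<bullet> x = n' \<bullet> x0" if "x \<in> e" for x
    using bspec[OF bspec[OF n' x0] that] unfolding inner_diff_right by linarith
  then have "e \<subseteq> {x. n' \<bullet> x = n' \<bullet> x0}" by blast
  then have sub: "affine hull e \<subseteq> {x. n' \<bullet> x = n' \<bullet> x0}"
    by (intro hull_minimal affine_hyperplane)
  have nx0: "n \<bullet> x0 = \<beta>" using hull hull_subset[of e affine] x0 by auto
  define w where "w = n' - (n' \<bullet> n) *\<^sub>R n"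
  have nw: "n \<bullet> w = 0" using n(1) by (simp add: w_def inner_diff_right norm_eq_1 inner_commute)
  then have "x0 + w \<in> affine hull e" using nx0 by (simp add: hull inner_add_right)
  then have "n' \<bullet> w = 0" using sub by (auto simp: inner_add_right)
  then have "w \<bullet> w = 0" using nw by (simp add: w_def inner_diff_left)
  then have w: "n' = (n' \<bullet> n) *\<^sub>R n" by (simp add: w_def)
  then have "\<bar>n' \<bullet> n\<bar> = 1" using n by (metis norm_scaleR mult.right_neutral)
  then have "n' \<bullet> n = 1 \<or> n' \<bullet> n = -1" by linarith
  then show ?thesis using w by (metis scaleR_one scaleR_minus1_left)
qed

locale full_simplex =
  fixes K :: "(real ^ 'd) set"
  assumes simplex: "int CARD('d) simplex K"
begin

lemma verts_props: "\<not> affine_dependent (verts K)" "card (verts K) = CARD('d) + 1"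
    "K = convex hull (verts K)"
proof -
  obtain C where C: "\<not> affine_dependent C" "int (card C) = int CARD('d) + 1" "K = convex hull C"
    using simplex unfolding simplex_def by blast
  then have "verts K = C" unfolding verts_def using extreme_point_of_convex_hull_affine_independent by blast
  then show "\<not> affine_dependent (verts K)" "card (verts K) = CARD('d) + 1" "K = convex hull (verts K)"
    using C by auto
qed

lemma finite_verts [simp]: "finite (verts K)"
  using verts_props(1) aff_independent_finite by blast

lemma compact: "compact K" and convex: "convex K"
proof -
  have "compact (convex hull (verts K))" by (intro compact_convex_hull finite_imp_compact finite_verts)
  then show "compact K" by (simp only: verts_props(3)[symmetric])
  have "convex (convex hull (verts K))" by (rule convex_convex_hull)
  then show "convex K" by (simp only: verts_props(3)[symmetric])
qed

lemma verts_in: "a \<in> verts K \<Longrightarrow> a \<in> K"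
  using hull_inc[of a "verts K" convex] by (simp only: verts_props(3)[symmetric])

lemma affine_hull_verts: "affine hull (verts K) = UNIV"
proof -
  have "aff_dim (verts K) = int CARD('d)"
    using verts_props(2) aff_dim_affine_independent[OF verts_props(1)] by simp
  then show ?thesis using aff_dim_eq_full[of "verts K"] by simp
qed

lemma normal_exists:
  assumes a: "a \<in> verts K"
  shows "\<exists>n \<beta>. norm n = 1 \<and> affine hull (opp_face K a) = {x. n \<bullet> x = \<beta>} \<and> n \<bullet> a < \<beta>"
proof -
  have dim: "aff_dim (verts K - {a}) = int CARD('d) - 1"
    using a verts_props(2) aff_dim_affine_independent[OF affine_independent_Diff[OF verts_props(1)], of "{a}"]
    by simp
  have "\<exists>v b. v \<noteq> 0 \<and> affine hull (verts K - {a}) = {x. v \<bullet> x = b}"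
    by (rule aff_dim_eq_hyperplane[THEN iffD1]) (simp add: dim)
  then obtain v b where v: "v \<noteq> 0" "affine hull (verts K - {a}) = {x. v \<bullet> x = b}"
    by blast
  have "a \<notin> affine hull (verts K - {a})" using a verts_props(1) unfolding affine_dependent_def by blast
  then have ne: "v \<bullet> a \<noteq> b" using v by simp
  define s where "s = (if v \<bullet> a < b then 1 else -1) / norm v"
  have s: "s \<noteq> 0" "norm (s *\<^sub>R v) = 1" using v by (auto simp: s_def)
  have "{x. v \<bullet> x = b} = {x. (s *\<^sub>R v) \<bullet> x = s * b}" using s by auto
  moreover have "(s *\<^sub>R v) \<bullet> a < s * b"
    using ne v by (auto simp: s_def divide_strict_right_mono)
  moreover have "affine hull (opp_face K a) = {x. v \<bullet> x = b}"
    unfolding opp_face_def affine_hull_convex_hull by (rule v(2))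
  ultimately show ?thesis using s(2) by (intro exI[of _ "s *\<^sub>R v"] exI[of _ "s * b"]) metis
qed

text \<open>The outward normal is defined by a description operator. It exists and is unique because the
  vertices of the face span a hyperplane which has the remaining vertex, hence the simplex, on one side.\<close>
lemma nrm_props:
  assumes a: "a \<in> verts K"
  shows "norm (nrm K a) = 1" "affine hull (opp_face K a) = {x. nrm K a \<bullet> x = offs K a}" "hgt K a > 0"
proof -
  obtain n \<beta> where n: "norm n = 1" "affine hull (opp_face K a) = {x. n \<bullet> x = \<beta>}" "n \<bullet> a < \<beta>"
    using normal_exists[OF a] by blast
  have on: "n \<bullet> x = \<beta>" if "x \<in> opp_face K a" for x
    using that n(2) hull_subset[of "opp_face K a" affine] by auto
  have sub: "opp_face K a \<subseteq> K"
    unfolding opp_face_def by (subst (2) verts_props(3)) (intro hull_mono, auto)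
  have "v \<in> {y. n \<bullet> y \<le> \<beta>}" if "v \<in> verts K" for v
  proof (cases "v = a")
    case False
    then have "v \<in> opp_face K a" unfolding opp_face_def using that by (intro hull_inc) auto
    then show ?thesis using on by simp
  qed (use n in auto)
  then have "convex hull (verts K) \<subseteq> {y. n \<bullet> y \<le> \<beta>}"
    by (intro hull_minimal convex_halfspace_le) auto
  then have "K \<subseteq> {y. n \<bullet> y \<le> \<beta>}" by (simp only: verts_props(3)[symmetric])
  then have below: "n \<bullet> y \<le> \<beta>" if "y \<in> K" for y using that by auto
  have ne: "opp_face K a \<noteq> {}"
  proof
    assume "opp_face K a = {}"
    then have "{x. n \<bullet> x = \<beta>} = {}" using n(2) by simp
    moreover have "n \<bullet> (\<beta> *\<^sub>R n) = \<beta>" using n(1) by (simp add: norm_eq_1)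
    ultimately show False by blast
  qed
  have "outward_normal K (opp_face K a) = n"
    unfolding outward_normal_def
  proof (rule the_equality)
    show "norm n = 1 \<and> (\<forall>x\<in>opp_face K a. \<forall>y\<in>K. n \<bullet> (y - x) \<le> 0)"
      using n below on by (auto simp: inner_diff_right)
  next
    fix n' assume n': "norm n' = 1 \<and> (\<forall>x\<in>opp_face K a. \<forall>y\<in>K. n' \<bullet> (y - x) \<le> 0)"
    have eq0: "\<forall>x\<in>opp_face K a. \<forall>y\<in>opp_face K a. n' \<bullet> (y - x) = 0"
    proof (intro ballI)
      fix x y assume "x \<in> opp_face K a" "y \<in> opp_face K a"
      then have "n' \<bullet> (y - x) \<le> 0" "n' \<bullet> (x - y) \<le> 0" using n' sub by auto
      then show "n' \<bullet> (y - x) = 0" by (simp add: inner_diff_right)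
    qed
    obtain x where x: "x \<in> opp_face K a" using ne by blast
    have "n' \<bullet> (a - x) \<le> 0" using n' x verts_in[OF a] by auto
    then have "n' \<noteq> - n" using n(3) on[OF x] by (auto simp: inner_diff_right)
    then show "n' = n" using normal_unique[OF n(1) _ n(2) eq0] n' by blast
  qed
  then have nn: "nrm K a = n" by (simp add: nrm_def)
  have "(SOME z. z \<in> opp_face K a) \<in> opp_face K a" using ne by (simp add: some_in_eq)
  then have "offs K a = \<beta>" unfolding offs_def nn by (rule on)
  then show "norm (nrm K a) = 1" "affine hull (opp_face K a) = {x. nrm K a \<bullet> x = offs K a}" "hgt K a > 0"
    using n nn by (auto simp: hgt_def)
qed

lemma flat_face: "a \<in> verts K \<Longrightarrow> flat_face (nrm K a) (offs K a) (opp_face K a)"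
  unfolding flat_face_def using nrm_props
  by (simp add: opp_face_def compact_convex_hull finite_imp_compact)

lemma lam_affine: "lam K a (x + t *\<^sub>R (y - x)) = (1 - t) * lam K a x + t * lam K a y"
  by (simp add: lam_def inner_add_right inner_diff_right diff_divide_distrib add_divide_distrib algebra_simps)

lemma lam_verts:
  assumes "a \<in> verts K" "b \<in> verts K"
  shows "lam K a b = (if a = b then 1 else 0)"
proof (cases "a = b")
  case True
  then show ?thesis using nrm_props(3)[OF assms(1)] by (simp add: lam_def hgt_def)
next
  case False
  then have "b \<in> opp_face K a" unfolding opp_face_def using assms by (intro hull_inc) auto
  then have "nrm K a \<bullet> b = offs K a"
    using nrm_props(2)[OF assms(1)] hull_subset[of "opp_face K a" affine] by auto
  then show ?thesis using False by (simp add: lam_def)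
qed

lemma lam_combination:
  assumes "sum u (verts K) = 1" "b \<in> verts K"
  shows "lam K b (\<Sum>v\<in>verts K. u v *\<^sub>R v) = u b"
proof -
  have "lam K b (\<Sum>v\<in>verts K. u v *\<^sub>R v) = (\<Sum>v\<in>verts K. u v * lam K b v)"
    unfolding lam_def times_divide_eq_right sum_divide_distrib[symmetric]
    using assms(1) by (simp add: right_diff_distrib sum_subtractf inner_sum_right sum_distrib_right[symmetric])
  also have "\<dots> = (\<Sum>v\<in>verts K. if v = b then u v else 0)"
    using lam_verts[OF assms(2)] by (intro sum.cong) auto
  finally show ?thesis using assms(2) by simp
qed

lemma sum_lam: "(\<Sum>a\<in>verts K. lam K a x) = 1" and sum_lam_vert: "(\<Sum>a\<in>verts K. lam K a x *\<^sub>R a) = x"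
proof -
  have "x \<in> affine hull (verts K)" using affine_hull_verts by simp
  then obtain u where u: "sum u (verts K) = 1" "(\<Sum>v\<in>verts K. u v *\<^sub>R v) = x"
    unfolding affine_hull_finite[OF finite_verts] by blast
  have "lam K b x = u b" if "b \<in> verts K" for b using lam_combination[OF _ that, of u] u by simp
  then show "(\<Sum>a\<in>verts K. lam K a x) = 1" "(\<Sum>a\<in>verts K. lam K a x *\<^sub>R a) = x" using u by auto
qed

lemma in_simplex_iff: "x \<in> K \<longleftrightarrow> (\<forall>a\<in>verts K. 0 \<le> lam K a x)"
proof
  assume "x \<in> K"
  then have "x \<in> convex hull (verts K)" by (simp only: verts_props(3)[symmetric])
  then obtain u where u: "\<forall>v\<in>verts K. 0 \<le> u v" "sum u (verts K) = 1" "(\<Sum>v\<in>verts K. u v *\<^sub>R v) = x"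
    unfolding convex_hull_finite[OF finite_verts] by blast
  have "lam K b x = u b" if "b \<in> verts K" for b using lam_combination[OF _ that, of u] u by simp
  then show "\<forall>a\<in>verts K. 0 \<le> lam K a x" using u by simp
next
  assume "\<forall>a\<in>verts K. 0 \<le> lam K a x"
  then have "x \<in> convex hull (verts K)"
    unfolding convex_hull_finite[OF finite_verts] mem_Collect_eq
    by (intro exI[of _ "\<lambda>a. lam K a x"]) (simp add: sum_lam sum_lam_vert)
  then show "x \<in> K" by (simp only: verts_props(3)[symmetric])
qed

lemma opp_face_iff:
  assumes a: "a \<in> verts K"
  shows "x \<in> opp_face K a \<longleftrightarrow> x \<in> K \<and> lam K a x = 0"
proof
  assume x: "x \<in> opp_face K a"
  have "opp_face K a \<subseteq> K" unfolding opp_face_def by (subst (2) verts_props(3)) (intro hull_mono, auto)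
  moreover have "nrm K a \<bullet> x = offs K a"
    using nrm_props(2)[OF a] hull_subset[of "opp_face K a" affine] x by auto
  ultimately show "x \<in> K \<and> lam K a x = 0" using x by (auto simp: lam_def)
next
  assume x: "x \<in> K \<and> lam K a x = 0"
  have "\<forall>b\<in>verts K - {a}. 0 \<le> lam K b x" using x in_simplex_iff by auto
  moreover have "sum (\<lambda>b. lam K b x) (verts K - {a}) = 1" "(\<Sum>b\<in>verts K - {a}. lam K b x *\<^sub>R b) = x"
    using sum_lam[of x] sum_lam_vert[of x] x a by (simp_all add: sum.remove[of "verts K" a])
  ultimately show "x \<in> opp_face K a"
    unfolding opp_face_def convex_hull_finite[OF finite_Diff[OF finite_verts]] mem_Collect_eq
    by (intro exI[of _ "\<lambda>b. lam K b x"] conjI)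
qed

lemma opp_face_subset: "a \<in> verts K \<Longrightarrow> opp_face K a \<subseteq> K"
  using opp_face_iff by blast

lemma opp_face_dot: "a \<in> verts K \<Longrightarrow> x \<in> opp_face K a \<Longrightarrow> nrm K a \<bullet> x = offs K a"
  using nrm_props(2) hull_subset[of "opp_face K a" affine] by auto

lemma verts_opp_face: "b \<in> verts K \<Longrightarrow> b \<noteq> a \<Longrightarrow> b \<in> opp_face K a"
  unfolding opp_face_def by (intro hull_inc) auto

lemma cone: 
  assumes a: "a \<in> verts K"
  shows "cone_over_face (nrm K a) (offs K a) (opp_face K a) a (hgt K a) K"
proof -
  interpret flat_face "nrm K a" "offs K a" "opp_face K a" using flat_face[OF a] .
  have h: "hgt K a > 0" using nrm_props[OF a] by simp
  show ?thesis
  proof unfold_locales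
    fix x assume "x \<in> K"
    then have le: "lam K a x \<le> 1"
      using sum_lam[of x] member_le_sum[of a "verts K" "\<lambda>a. lam K a x"] in_simplex_iff a by auto
    then show "offs K a - hgt K a \<le> nrm K a \<bullet> x" using h by (simp add: lam_def divide_le_eq)
  next
    fix z and t :: real assume z: "nrm K a \<bullet> z = offs K a" and t: "0 < t"
    have z0: "lam K a z = 0" using z by (simp add: lam_def)
    have l: "lam K b (a + t *\<^sub>R (z - a)) = (if b = a then 1 - t else t * lam K b z)" if "b \<in> verts K" for b
      using that a lam_verts[OF that a] z0 by (simp add: lam_affine)
    have "a + t *\<^sub>R (z - a) \<in> K \<longleftrightarrow> t \<le> 1 \<and> (\<forall>b\<in>verts K. b \<noteq> a \<longrightarrow> 0 \<le> lam K b z)"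
      unfolding in_simplex_iff using l a t by (auto simp: zero_le_mult_iff)
    also have "(\<forall>b\<in>verts K. b \<noteq> a \<longrightarrow> 0 \<le> lam K b z) \<longleftrightarrow> z \<in> opp_face K a"
      unfolding opp_face_iff[OF a] in_simplex_iff using z0 by auto
    finally show "a + t *\<^sub>R (z - a) \<in> K \<longleftrightarrow> t \<le> 1 \<and> z \<in> opp_face K a" .
  qed (use h compact in \<open>auto simp: hgt_def\<close>)
qed

lemma continuous_on_lam: "continuous_on S (lam K a)"
  unfolding lam_def divide_inverse by (intro continuous_intros)

lemma lam_pos_interior:
  assumes "\<And>a. a \<in> verts K \<Longrightarrow> 0 < lam K a x"
  shows "x \<in> interior K"
proof (rule interiorI)
  show "open (\<Inter>a\<in>verts K. {x. 0 < lam K a x})"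
    by (intro open_INT ballI finite_verts open_Collect_less continuous_on_lam continuous_intros)
  show "(\<Inter>a\<in>verts K. {x. 0 < lam K a x}) \<subseteq> K" using in_simplex_iff by (auto simp: less_imp_le)
qed (use assms in auto)

lemma verts_nonempty: "verts K \<noteq> {}"
  using verts_props(2) by (metis card.empty add_is_0 one_neq_zero)

lemma interior_nonempty: "interior K \<noteq> {}"
proof -
  define x where "x = (\<Sum>v\<in>verts K. (1 / card (verts K)) *\<^sub>R v)"
  have c: "card (verts K) > 0" using verts_props(2) by simp
  have "lam K b x = 1 / card (verts K)" if "b \<in> verts K" for b
    unfolding x_def using c by (intro lam_combination that) auto
  then have "x \<in> interior K" using c by (intro lam_pos_interior) simp
  then show ?thesis by blast
qed

lemma closure_interior: "closure (interior K) = K"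
  using convex_closure_interior[OF convex interior_nonempty] compact_imp_closed[OF compact] by simp

lemma card_opp: "a \<in> verts K \<Longrightarrow> card (verts K - {a}) = CARD('d)"
  using verts_props(2) by simp

lemma facet_iff: "F facet_of K \<longleftrightarrow> (\<exists>a\<in>verts K. F = opp_face K a)"
proof -
  have "opp_face K a \<noteq> {}" if "a \<in> verts K" for a
  proof -
    have "card (verts K - {a}) \<noteq> 0" using card_opp[OF that] by simp
    then have "verts K - {a} \<noteq> {}" by (metis card.empty)
    then show ?thesis unfolding opp_face_def convex_hull_eq_empty .
  qed
  then show ?thesis
    using facet_of_convex_hull_affine_independent[OF verts_props(1), of F]
    unfolding verts_props(3)[symmetric] opp_face_def[symmetric] by blast
qed

lemma opp_face_inj: "a \<in> verts K \<Longrightarrow> b \<in> verts K \<Longrightarrow> opp_face K a = opp_face K b \<Longrightarrow> a = b"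
  using verts_opp_face[of b a] opp_face_iff[of b b] lam_verts[of b b] by fastforce

lemma Gauss_vertex:
  fixes \<psi> :: "real ^ 'd \<Rightarrow> real"
  assumes "a \<in> verts K" "polynomial_deg_le m \<psi>"
  shows "(LINT x:K|lborel. CARD('d) * \<psi> x + grad \<psi> x \<bullet> (x - a)) = hgt K a * (LINT x|face_measure (opp_face K a). \<psi> x)"
proof -
  interpret cone_over_face "nrm K a" "offs K a" "opp_face K a" a "hgt K a" K using cone[OF assms(1)] .
  show ?thesis by (rule Gauss_cone[OF assms(2)])
qed

text \<open>The field \<open>x - x0\<close> is the combination of the fields \<open>x - a\<close> with the barycentric coordinates of \<open>x0\<close>
  as weights. As \<open>x0\<close> may lie outside the simplex, some weights may be negative.\<close>
lemma Gauss_point: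
  fixes \<psi> :: "real ^ 'd \<Rightarrow> real"
  assumes \<psi>: "polynomial_deg_le m \<psi>"
  shows "(LINT x:K|lborel. CARD('d) * \<psi> x + grad \<psi> x \<bullet> (x - x0)) =
    (\<Sum>a\<in>verts K. (offs K a - nrm K a \<bullet> x0) * (LINT x|face_measure (opp_face K a). \<psi> x))"
proof -
  have c: "continuous_on K \<psi>" "continuous_on K (grad \<psi>)"
    using continuous_on_polynomial[OF \<psi>] continuous_on_grad[OF \<psi>] by auto
  have "CARD('d) * \<psi> x + grad \<psi> x \<bullet> (x - x0) =
      (\<Sum>a\<in>verts K. lam K a x0 * (CARD('d) * \<psi> x + grad \<psi> x \<bullet> (x - a)))" for x
  proof -
    have "(\<Sum>a\<in>verts K. lam K a x0 *\<^sub>R (x - a)) = x - x0"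
      using sum_lam[of x0] sum_lam_vert[of x0]
      by (simp add: scaleR_diff_right sum_subtractf scaleR_sum_left[symmetric])
    then have "grad \<psi> x \<bullet> (x - x0) = grad \<psi> x \<bullet> (\<Sum>a\<in>verts K. lam K a x0 *\<^sub>R (x - a))" by simp
    then have "grad \<psi> x \<bullet> (x - x0) = (\<Sum>a\<in>verts K. lam K a x0 * (grad \<psi> x \<bullet> (x - a)))"
      by (simp only: inner_sum_right inner_scaleR_right)
    then show ?thesis
      using sum_lam[of x0] by (simp add: distrib_left sum.distrib sum_distrib_right[symmetric])
  qed
  then have "(LINT x:K|lborel. CARD('d) * \<psi> x + grad \<psi> x \<bullet> (x - x0)) =
    (LINT x:K|lborel. \<Sum>a\<in>verts K. lam K a x0 * (CARD('d) * \<psi> x + grad \<psi> x \<bullet> (x - a)))" by simp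
  also have "\<dots> = (\<Sum>a\<in>verts K. lam K a x0 * (LINT x:K|lborel. CARD('d) * \<psi> x + grad \<psi> x \<bullet> (x - a)))"
    using c by (subst set_integral_cont_sum[OF compact]) (auto intro!: continuous_intros)
  also have "\<dots> = (\<Sum>a\<in>verts K. (offs K a - nrm K a \<bullet> x0) * (LINT x|face_measure (opp_face K a). \<psi> x))"
  proof (intro sum.cong refl)
    fix a assume a: "a \<in> verts K"
    then show "lam K a x0 * (LINT x:K|lborel. CARD('d) * \<psi> x + grad \<psi> x \<bullet> (x - a)) =
      (offs K a - nrm K a \<bullet> x0) * (LINT x|face_measure (opp_face K a). \<psi> x)"
      using Gauss_vertex[OF a \<psi>] nrm_props(3)[OF a] by (simp add: lam_def)
  qed
  finally show ?thesis .
qed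

end

section \<open>Polynomial vector fields\<close>

definition dvg :: "(real ^ 'd \<Rightarrow> real ^ 'd) \<Rightarrow> real ^ 'd \<Rightarrow> real" where
  "dvg q x = (\<Sum>i\<in>UNIV. grad (\<lambda>y. q y $ i) x $ i)"

definition poly_field :: "nat \<Rightarrow> (real ^ 'd \<Rightarrow> real ^ 'd) \<Rightarrow> bool" where
  "poly_field m q \<longleftrightarrow> (\<forall>i. polynomial_deg_le m (\<lambda>x. q x $ i))"

lemma grad_add:
  assumes "polynomial_deg_le m P" "polynomial_deg_le n Q"
  shows "grad (\<lambda>x. P x + Q x) x = grad P x + grad Q x"
  using has_derivative_add[OF assms[THEN polynomial_has_gradient], of x]
  by (intro grad_eqI) (simp add: inner_add_left)

lemma grad_cmult:
  assumes "polynomial_deg_le m P"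
  shows "grad (\<lambda>x. c * P x) x = c *\<^sub>R grad P x"
  using has_derivative_mult_right[OF polynomial_has_gradient[OF assms], of c x]
  by (intro grad_eqI) simp

lemma grad_mult:
  assumes "polynomial_deg_le m P" "polynomial_deg_le n Q"
  shows "grad (\<lambda>x. P x * Q x) x = P x *\<^sub>R grad Q x + Q x *\<^sub>R grad P x"
  using has_derivative_mult[OF assms[THEN polynomial_has_gradient], of x]
  by (intro grad_eqI) (simp add: inner_add_left mult.commute)

lemma grad_const [simp]: "grad (\<lambda>x. c) x = 0"
  by (rule grad_eqI) simp

lemma grad_nth: "grad (\<lambda>x. x $ i) x = axis i 1"
  by (rule grad_eqI) (auto simp: inner_axis' intro!: derivative_eq_intros bounded_linear_imp_has_derivative bounded_linear_vec_nth)

lemma poly_fieldD: "poly_field m q \<Longrightarrow> polynomial_deg_le m (\<lambda>x. q x $ i)"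
  by (simp add: poly_field_def)

lemma poly_field_add: "poly_field m p \<Longrightarrow> poly_field m q \<Longrightarrow> poly_field m (\<lambda>x. p x + q x)"
  by (simp add: poly_field_def polynomial_deg_le_add)

lemma poly_field_scaleR: "poly_field m p \<Longrightarrow> poly_field m (\<lambda>x. c *\<^sub>R p x)"
  by (simp add: poly_field_def polynomial_deg_le_cmult)

lemma poly_field_0: "poly_field m (\<lambda>x. 0)"
  by (simp add: poly_field_def polynomial_deg_le_const)

lemma poly_field_sum: "(\<And>i. i \<in> I \<Longrightarrow> poly_field m (q i)) \<Longrightarrow> poly_field m (\<lambda>x. \<Sum>i\<in>I. q i x)"
  by (simp add: poly_field_def polynomial_deg_le_sum)

lemma poly_field_radial:
  "polynomial_deg_le m \<rho> \<Longrightarrow> poly_field (m + 1) (\<lambda>x. \<rho> x *\<^sub>R (x - a))"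
  unfolding poly_field_def
  by (auto intro!: polynomial_deg_le_mult[where n=1, simplified] polynomial_deg_le_diff
        polynomial_deg_le_nth[simplified] polynomial_deg_le_const)

lemma poly_field_const_dir: "polynomial_deg_le m \<rho> \<Longrightarrow> poly_field m (\<lambda>x. \<rho> x *\<^sub>R t)"
  unfolding poly_field_def using polynomial_deg_le_cmult[of m \<rho> "t $ _"] by (simp add: mult.commute[of _ "t $ _"])

lemma continuous_on_poly_field: 
  assumes "poly_field m q" shows "continuous_on S q"
proof -
  have "continuous_on S (\<lambda>x. \<chi> i. q x $ i)"
    by (intro continuous_on_vec_lambda continuous_on_polynomial[OF poly_fieldD[OF assms]])
  then show ?thesis by simp
qed

lemma polynomial_deg_le_dvg: "poly_field m q \<Longrightarrow> polynomial_deg_le (m - 1) (dvg q)"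
  unfolding dvg_def[abs_def] by (intro polynomial_deg_le_sum polynomial_deg_le_grad poly_fieldD)

lemma continuous_on_dvg: "poly_field m q \<Longrightarrow> continuous_on S (dvg q)"
  using continuous_on_polynomial[OF polynomial_deg_le_dvg] .

lemma dvg_add:
  "poly_field m p \<Longrightarrow> poly_field n q \<Longrightarrow> dvg (\<lambda>x. p x + q x) x = dvg p x + dvg q x"
  unfolding dvg_def by (simp add: grad_add[OF poly_fieldD poly_fieldD] sum.distrib)

lemma dvg_scaleR: "poly_field m p \<Longrightarrow> dvg (\<lambda>x. c *\<^sub>R p x) x = c * dvg p x"
  unfolding dvg_def by (simp add: grad_cmult[OF poly_fieldD] sum_distrib_left)

lemma dvg_0 [simp]: "dvg (\<lambda>x. 0) x = 0"
  by (simp add: dvg_def)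

lemma dvg_sum: "(\<And>i. i \<in> I \<Longrightarrow> poly_field m (q i)) \<Longrightarrow> dvg (\<lambda>x. \<Sum>i\<in>I. q i x) x = (\<Sum>i\<in>I. dvg (q i) x)"
proof (induction I rule: infinite_finite_induct)
  case (insert i I)
  then show ?case by (simp add: dvg_add[of m _ m] poly_field_sum)
qed simp_all

lemma dvg_radial:
  fixes \<rho> :: "real ^ 'd \<Rightarrow> real"
  assumes "polynomial_deg_le m \<rho>"
  shows "dvg (\<lambda>x. \<rho> x *\<^sub>R (x - a)) x = CARD('d) * \<rho> x + grad \<rho> x \<bullet> (x - a)"
proof -
  have "grad (\<lambda>y. (\<rho> y *\<^sub>R (y - a)) $ i) x = \<rho> x *\<^sub>R axis i 1 + (x $ i - a $ i) *\<^sub>R grad \<rho> x" for i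
  proof -
    have 1: "polynomial_deg_le 1 (\<lambda>y. y $ i - a $ i)"
      by (intro polynomial_deg_le_diff polynomial_deg_le_nth polynomial_deg_le_const)
    have "grad (\<lambda>y. y $ i - a $ i) x = axis i 1"
      using grad_add[OF polynomial_deg_le_nth[of i] polynomial_deg_le_const[of 0 "- a $ i"]]
      by (simp add: grad_nth)
    then show ?thesis using grad_mult[OF assms 1, of x] by simp
  qed
  then show ?thesis
    unfolding dvg_def by (simp add: sum.distrib inner_vec_def mult.commute)
qed

lemma dvg_const_dir:
  assumes "polynomial_deg_le m \<rho>"
  shows "dvg (\<lambda>x. \<rho> x *\<^sub>R t) x = grad \<rho> x \<bullet> t"
proof -
  have "grad (\<lambda>y. (\<rho> y *\<^sub>R t) $ i) x = t $ i *\<^sub>R grad \<rho> x" for i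
    using grad_cmult[OF assms, of "t $ i" x] by (simp add: mult.commute)
  then show ?thesis unfolding dvg_def by (simp add: inner_vec_def mult.commute)
qed

section \<open>Scale-invariant estimates on one simplex\<close>

text \<open>Shape regularity with an inscribed ball as a witness, which is more convenient than the supremum over all
  inscribed balls.\<close>
definition regular :: "real \<Rightarrow> (real ^ 'd) set \<Rightarrow> bool" where
  "regular s K \<longleftrightarrow> int CARD('d) simplex K \<and> (\<exists>c r. 0 < r \<and> cball c r \<subseteq> K \<and> diameter K \<le> s * r)"

locale regular_simplex = full_simplex K for K :: "(real ^ 'd) set" +
  fixes s r :: real and c :: "real ^ 'd"
  assumes r: "0 < r" and cball_sub: "cball c r \<subseteq> K" and diam_le: "diameter K \<le> s * r"
begin

lemma c_in: "c \<in> K" using cball_sub r by auto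

lemma dist_le_diam: "x \<in> K \<Longrightarrow> y \<in> K \<Longrightarrow> norm (x - y) \<le> diameter K"
  using diameter_bounded_bound[OF compact_imp_bounded[OF compact]] by (simp add: dist_norm)

lemma r_le_diam: "r \<le> diameter K"
proof -
  obtain u :: "real ^ 'd" where u: "norm u = 1" using vector_choose_size[of 1] by auto
  have "c + r *\<^sub>R u \<in> K" using cball_sub r u by (auto simp: dist_norm)
  from dist_le_diam[OF this c_in] show ?thesis using u r by simp
qed

lemma diam_pos: "0 < diameter K" using r r_le_diam by simp

lemma s_ge_1: "1 \<le> s"
proof -
  have "1 * r \<le> s * r" using r_le_diam diam_le by simp
  then show ?thesis using r by (simp only: mult_le_cancel_right_pos)
qed

lemma sub_cball: "K \<subseteq> cball c (s * r)"
  using dist_le_diam[OF c_in] diam_le by (force simp: dist_norm)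

lemma lam_bounds: "a \<in> verts K \<Longrightarrow> x \<in> K \<Longrightarrow> 0 \<le> lam K a x \<and> lam K a x \<le> 1"
  using sum_lam[of x] member_le_sum[of a "verts K" "\<lambda>a. lam K a x"] in_simplex_iff by auto

lemma lam_shift: 
  assumes a: "a \<in> verts K"
  shows "lam K a (x + t *\<^sub>R nrm K a) = lam K a x - t / hgt K a"
  using nrm_props(1)[OF a] by (simp add: lam_def inner_add_right norm_eq_1 diff_divide_distrib add_divide_distrib)

lemma r_le_hgt:
  assumes a: "a \<in> verts K"
  shows "r \<le> hgt K a"
proof -
  have h: "hgt K a > 0" using nrm_props[OF a] by simp
  have "c + r *\<^sub>R nrm K a \<in> K" using cball_sub r nrm_props(1)[OF a] by (auto simp: dist_norm)
  then have "r / hgt K a \<le> 1" using lam_bounds[OF a c_in] lam_bounds[OF a] lam_shift[OF a, of c r] by force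
  then show ?thesis using h by simp
qed

lemma other_vertex: "a \<in> verts K \<Longrightarrow> \<exists>b. b \<in> verts K \<and> b \<noteq> a"
proof -
  assume "a \<in> verts K"
  then have "card (verts K - {a}) \<noteq> 0" using card_opp by simp
  then have "verts K - {a} \<noteq> {}" by (metis card.empty)
  then show ?thesis by blast
qed

lemma hgt_le_diam:
  assumes a: "a \<in> verts K"
  shows "hgt K a \<le> diameter K"
proof -
  obtain b where b: "b \<in> verts K" "b \<noteq> a" using other_vertex[OF a] by blast
  have "hgt K a = nrm K a \<bullet> (b - a)"
    using opp_face_dot[OF a verts_opp_face[OF b]] by (simp add: hgt_def inner_diff_right)
  also have "\<dots> \<le> norm (b - a)" using norm_cauchy_schwarz[of "nrm K a" "b - a"] nrm_props(1)[OF a] by simp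
  also have "\<dots> \<le> diameter K" using verts_in a b by (intro dist_le_diam) auto
  finally show ?thesis .
qed

lemma diam_le_s_hgt: "a \<in> verts K \<Longrightarrow> diameter K \<le> s * hgt K a"
  using diam_le r_le_hgt[of a] s_ge_1 by (smt (verit) mult_left_mono)

lemma lam_lower:
  assumes a: "a \<in> verts K" and x: "x \<in> cball c (r/2)"
  shows "1 / (2 * s) \<le> lam K a x"
proof -
  have h: "hgt K a > 0" "hgt K a \<le> s * r" using nrm_props[OF a] hgt_le_diam[OF a] diam_le by auto
  have "dist c (x + (r/2) *\<^sub>R nrm K a) \<le> dist c x + dist x (x + (r/2) *\<^sub>R nrm K a)" by (rule dist_triangle)
  also have "\<dots> \<le> r" using x r nrm_props(1)[OF a] by (simp add: dist_norm)
  finally have "x + (r/2) *\<^sub>R nrm K a \<in> K" using cball_sub by auto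
  then have "(r/2) / hgt K a \<le> lam K a x" using lam_bounds[OF a] lam_shift[OF a, of x "r/2"] by force
  moreover have "1 / (2 * s) \<le> (r/2) / hgt K a" using h r s_ge_1 by (simp add: field_simps)
  ultimately show ?thesis by linarith
qed

text \<open>Faces are as large as elements: two points of the inscribed ball at the same height over the face are
  projected from the opposite vertex onto points of the face that are at least as far apart. The direction
  in which they are displaced exists only in dimension at least two.\<close>
lemma r_le_diam_face:
  assumes a: "a \<in> verts K" and d: "CARD('d) \<ge> 2"
  shows "r \<le> diameter (opp_face K a)"
proof -
  interpret cone_over_face "nrm K a" "offs K a" "opp_face K a" a "hgt K a" K using cone[OF a] .
  have "DIM(real ^ 'd) \<ge> 2" using d by simp
  then obtain t where t: "t \<noteq> 0" "orthogonal (nrm K a) t"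
    by (rule orthogonal_to_vector_exists)
  define u where "u = (1 / norm t) *\<^sub>R t"
  have u: "norm u = 1" "nrm K a \<bullet> u = 0" using t by (auto simp: u_def orthogonal_def)
  have "c - r *\<^sub>R nrm K a \<in> K" using cball_sub r n by (auto simp: dist_norm)
  then have "lam K a c + r / hgt K a \<le> 1" using lam_bounds[OF a] lam_shift[OF a, of c "- r"] by force
  moreover have "0 < r / hgt K a" using r h by simp
  ultimately have lc: "lam K a c < 1" "0 \<le> lam K a c" using lam_bounds[OF a c_in] by linarith+
  define \<tau> where "\<tau> = 1 - lam K a c"
  have \<tau>: "0 < \<tau>" "\<tau> \<le> 1" using lc by (auto simp: \<tau>_def)
  have in_face: "a + (1/\<tau>) *\<^sub>R (x - a) \<in> opp_face K a" if x: "x \<in> K" "lam K a x = lam K a c" for x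
  proof -
    define z where "z = a + (1/\<tau>) *\<^sub>R (x - a)"
    have "offs K a - nrm K a \<bullet> x = (1 - \<tau>) * hgt K a" using x(2) h by (simp add: lam_def \<tau>_def)
    then have "nrm K a \<bullet> (x - a) = \<tau> * hgt K a" by (simp add: inner_diff_right hgt_def algebra_simps)
    then have "nrm K a \<bullet> z = offs K a" using \<tau> by (simp add: z_def inner_add_right hgt_def)
    moreover have "a + \<tau> *\<^sub>R (z - a) = x" using \<tau> by (simp add: z_def)
    ultimately show ?thesis using ray[of z \<tau>] \<tau> x(1) by (simp add: z_def)
  qed
  have c2: "c + r *\<^sub>R u \<in> K" using cball_sub r u by (auto simp: dist_norm)
  have "lam K a (c + r *\<^sub>R u) = lam K a c" using u by (simp add: lam_def inner_add_right)
  then have f: "a + (1/\<tau>) *\<^sub>R (c + r *\<^sub>R u - a) \<in> opp_face K a" "a + (1/\<tau>) *\<^sub>R (c - a) \<in> opp_face K a"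
    using in_face[OF c2] in_face[OF c_in] by auto
  have "dist (a + (1/\<tau>) *\<^sub>R (c + r *\<^sub>R u - a)) (a + (1/\<tau>) *\<^sub>R (c - a)) = norm ((1/\<tau>) *\<^sub>R (r *\<^sub>R u))"
    unfolding dist_norm by (simp add: algebra_simps)
  also have "\<dots> = r / \<tau>" using u r \<tau> by simp
  finally have "r / \<tau> \<le> diameter (opp_face K a)"
    using diameter_bounded_bound[OF compact_imp_bounded[OF e] f] by simp
  moreover have "r \<le> r / \<tau>" using r \<tau> by (simp add: le_divide_eq mult_left_le)
  ultimately show ?thesis by linarith
qed

text \<open>A linear form attains its maximum and its minimum over the simplex at vertices, and on the inscribed ball
  it already varies by \<open>2 * r\<close> times its norm. So every gradient is seen by some edge.\<close>
lemma edge_width: "\<exists>a\<in>verts K. \<exists>b\<in>verts K. 2 * r * norm g \<le> g \<bullet> (b - a)"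
proof -
  have max: "\<exists>b\<in>verts K. \<forall>y\<in>K. g \<bullet> y \<le> g \<bullet> b" for g
  proof -
    have "Max ((\<bullet>) g ` verts K) \<in> (\<bullet>) g ` verts K" using verts_nonempty by (intro Max_in) auto
    then obtain b where b: "b \<in> verts K" "g \<bullet> b = Max ((\<bullet>) g ` verts K)" by auto
    have "verts K \<subseteq> {y. g \<bullet> y \<le> g \<bullet> b}" unfolding b(2) by auto
    then have "convex hull (verts K) \<subseteq> {y. g \<bullet> y \<le> g \<bullet> b}" by (intro hull_minimal convex_halfspace_le)
    then have "K \<subseteq> {y. g \<bullet> y \<le> g \<bullet> b}" by (simp only: verts_props(3)[symmetric])
    then show ?thesis using b(1) by blast
  qed
  obtain b where b: "b \<in> verts K" "\<And>y. y \<in> K \<Longrightarrow> g \<bullet> y \<le> g \<bullet> b" using max[of g] by blast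
  obtain a where a: "a \<in> verts K" "\<And>y. y \<in> K \<Longrightarrow> - g \<bullet> y \<le> - g \<bullet> a" using max[of "- g"] by blast
  define u where "u = (if g = 0 then 0 else (r / norm g) *\<^sub>R g)"
  have u: "norm u \<le> r" "g \<bullet> u = r * norm g"
    using r by (auto simp: u_def dot_square_norm power2_eq_square)
  have "c + u \<in> K" "c - u \<in> K" using cball_sub u by (auto simp: dist_norm)
  then have "g \<bullet> (c + u) \<le> g \<bullet> b" "g \<bullet> a \<le> g \<bullet> (c - u)" using b(2) a(2)[of "c - u"] by auto
  then have "2 * r * norm g \<le> g \<bullet> (b - a)" using u(2) by (simp add: inner_add_right inner_diff_right)
  then show ?thesis using a b by blast
qed

end

lemma regularE:
  assumes "regular s K"
  obtains r c where "regular_simplex K s r c"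
  using assms unfolding regular_def
  by (metis full_simplex.intro regular_simplex.intro regular_simplex_axioms.intro)

text \<open>A simplex lies between its inscribed ball and a concentric ball of comparable radius, so the bounds for
  balls apply.\<close>
lemma inverse_inequality:
  "\<exists>C\<ge>0. \<forall>(K :: (real ^ 'd) set) P. regular s K \<longrightarrow> polynomial_deg_le m P \<longrightarrow>
    (diameter K)\<^sup>2 * (LINT x:K|lborel. (norm (grad P x))\<^sup>2) \<le> C * (LINT x:K|lborel. (P x)\<^sup>2)"
proof -
  obtain C where C: "C \<ge> 0" "\<And>(P :: real ^ 'd \<Rightarrow> real) c r K. polynomial_deg_le m P \<Longrightarrow> 0 < r \<Longrightarrow> compact K \<Longrightarrow>
     K \<subseteq> cball c (s * r) \<Longrightarrow>
     r\<^sup>2 * (LINT x:K|lborel. (norm (grad P x))\<^sup>2) \<le> C * (LINT x:cball c r|lborel. (P x)\<^sup>2)"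
    using polynomial_integral_bound[of m s] by blast
  show ?thesis
  proof (intro exI[of _ "s\<^sup>2 * C"] conjI allI impI)
    fix K :: "(real ^ 'd) set" and P :: "real ^ 'd \<Rightarrow> real" assume K: "regular s K" and P: "polynomial_deg_le m P"
    from K obtain r c where "regular_simplex K s r c" by (rule regularE)
    then interpret regular_simplex K s r c .
    have I: "0 \<le> (LINT x:K|lborel. (norm (grad P x))\<^sup>2)" by (intro set_integral_cont_nonneg) simp
    have "(diameter K)\<^sup>2 \<le> (s * r)\<^sup>2" using diam_le diam_pos by (intro power_mono) auto
    then have "(diameter K)\<^sup>2 * (LINT x:K|lborel. (norm (grad P x))\<^sup>2)
        \<le> (s * r)\<^sup>2 * (LINT x:K|lborel. (norm (grad P x))\<^sup>2)"
      using I by (rule mult_right_mono)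
    also have "\<dots> = s\<^sup>2 * (r\<^sup>2 * (LINT x:K|lborel. (norm (grad P x))\<^sup>2))" by (simp add: power_mult_distrib)
    also have "\<dots> \<le> s\<^sup>2 * (C * (LINT x:cball c r|lborel. (P x)\<^sup>2))"
      by (intro mult_left_mono C(2)[OF P r compact sub_cball]) simp
    also have "\<dots> \<le> s\<^sup>2 * (C * (LINT x:K|lborel. (P x)\<^sup>2))"
      using C(1) cball_sub continuous_on_polynomial[OF P]
      by (intro mult_left_mono set_integral_cont_subset compact) (auto intro!: continuous_intros)
    finally show "(diameter K)\<^sup>2 * (LINT x:K|lborel. (norm (grad P x))\<^sup>2) \<le> s\<^sup>2 * C * (LINT x:K|lborel. (P x)\<^sup>2)"
      by simp
  qed (use C in simp)
qed

text \<open>Gauss's formula for the field \<open>P\<^sup>2 (x - a)\<close> bounds the trace by the volume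
  integral, up to a gradient term which the inverse inequality absorbs.\<close>
lemma trace_inequality:
  "\<exists>C\<ge>0. \<forall>(K :: (real ^ 'd) set) a P. regular s K \<longrightarrow> a \<in> verts K \<longrightarrow> polynomial_deg_le m P \<longrightarrow>
    diameter K * (LINT x|face_measure (opp_face K a). (P x)\<^sup>2) \<le> C * (LINT x:K|lborel. (P x)\<^sup>2)"
proof -
  obtain C where C: "C \<ge> 0" "\<And>(K :: (real ^ 'd) set) P. regular s K \<Longrightarrow> polynomial_deg_le m P \<Longrightarrow>
    (diameter K)\<^sup>2 * (LINT x:K|lborel. (norm (grad P x))\<^sup>2) \<le> C * (LINT x:K|lborel. (P x)\<^sup>2)"
    using inverse_inequality[of s m] by blast
  show ?thesis
  proof (intro exI[of _ "\<bar>s\<bar> * (CARD('d) + 1 + C)"] conjI allI impI)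
    fix K :: "(real ^ 'd) set" and a and P :: "real ^ 'd \<Rightarrow> real"
    assume K: "regular s K" and a: "a \<in> verts K" and P: "polynomial_deg_le m P"
    from K obtain r c where "regular_simplex K s r c" by (rule regularE)
    then interpret regular_simplex K s r c .
    define D where "D = diameter K"
    define I where "I = (LINT x:K|lborel. (P x)\<^sup>2)"
    define F where "F = (LINT x|face_measure (opp_face K a). (P x)\<^sup>2)"
    have c: "continuous_on K P" "continuous_on K (grad P)"
      using continuous_on_polynomial[OF P] continuous_on_grad[OF P] by auto
    have P2: "polynomial_deg_le (m + m) (\<lambda>x. P x * P x)" using polynomial_deg_le_mult[OF P P] .
    have "hgt K a * F = (LINT x:K|lborel. CARD('d) * (P x * P x) + grad (\<lambda>x. P x * P x) x \<bullet> (x - a))"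
      using Gauss_vertex[OF a P2] unfolding F_def power2_eq_square by simp
    also have "\<dots> \<le> (LINT x:K|lborel. (CARD('d) + 1) * (P x)\<^sup>2 + D\<^sup>2 * (norm (grad P x))\<^sup>2)"
    proof (rule set_integral_cont_mono[OF compact])
      fix x assume x: "x \<in> K"
      have "grad P x \<bullet> (x - a) \<le> norm (grad P x) * norm (x - a)" by (rule norm_cauchy_schwarz)
      have "P x * (grad P x \<bullet> (x - a)) \<le> \<bar>P x\<bar> * \<bar>grad P x \<bullet> (x - a)\<bar>" by (metis abs_ge_self abs_mult)
      also have "\<dots> \<le> \<bar>P x\<bar> * (norm (grad P x) * norm (x - a))"
        by (intro mult_left_mono Cauchy_Schwarz_ineq2) simp
      also have "\<dots> \<le> \<bar>P x\<bar> * (norm (grad P x) * D)"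
        using dist_le_diam[OF x verts_in[OF a]] by (intro mult_left_mono) (auto simp: D_def)
      finally have "2 * (P x * (grad P x \<bullet> (x - a))) \<le> 2 * \<bar>P x\<bar> * (D * norm (grad P x))" by (simp add: mult_ac)
      also have "\<dots> \<le> (P x)\<^sup>2 + D\<^sup>2 * (norm (grad P x))\<^sup>2"
        using sum_squares_bound[of "\<bar>P x\<bar>" "D * norm (grad P x)"] by (simp add: power_mult_distrib)
      finally have *: "2 * (P x * (grad P x \<bullet> (x - a))) \<le> (P x)\<^sup>2 + D\<^sup>2 * (norm (grad P x))\<^sup>2" .
      have "grad (\<lambda>x. P x * P x) x \<bullet> (x - a) = 2 * (P x * (grad P x \<bullet> (x - a)))"
        unfolding grad_mult[OF P P] inner_add_left by simp
      moreover have "(CARD('d) + 1) * (P x)\<^sup>2 = CARD('d) * (P x * P x) + (P x)\<^sup>2"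
        by (simp add: power2_eq_square distrib_right)
      ultimately show "CARD('d) * (P x * P x) + grad (\<lambda>x. P x * P x) x \<bullet> (x - a)
          \<le> (CARD('d) + 1) * (P x)\<^sup>2 + D\<^sup>2 * (norm (grad P x))\<^sup>2"
        using * by linarith
    qed (auto intro!: continuous_intros c continuous_on_grad[OF P2])
    also have "\<dots> = (CARD('d) + 1) * I + D\<^sup>2 * (LINT x:K|lborel. (norm (grad P x))\<^sup>2)"
      unfolding I_def using c
      by (subst set_integral_cont_add[OF compact]) (auto intro!: continuous_intros)
    also have "\<dots> \<le> (CARD('d) + 1) * I + C * I"
      using C(2)[OF K P] unfolding D_def I_def by simp
    finally have hF: "hgt K a * F \<le> (CARD('d) + 1 + C) * I" by (simp add: algebra_simps)
    have "0 \<le> F" unfolding F_def by (intro Bochner_Integration.integral_nonneg) simp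
    then have "D * F \<le> s * hgt K a * F"
      using diam_le_s_hgt[OF a] unfolding D_def by (intro mult_right_mono)
    also have "\<dots> \<le> s * ((CARD('d) + 1 + C) * I)"
      unfolding mult.assoc[of s] using hF s_ge_1 by (intro mult_left_mono) auto
    finally show "D * F \<le> \<bar>s\<bar> * (CARD('d) + 1 + C) * I" using s_ge_1 by (simp add: mult.assoc)
  qed (use C in simp)
qed

text \<open>On the inscribed ball of half the radius all barycentric coordinates are bounded below, and
  there some edge sees a fixed fraction of the gradient. The polynomial is controlled on the
  whole simplex by its values on that ball.\<close>
lemma edge_bubble_inequality:
  "\<exists>C>0. \<forall>(K :: (real ^ 'd) set) (P :: real ^ 'd \<Rightarrow> real). regular s K \<longrightarrow> polynomial_deg_le m P \<longrightarrow>
    (diameter K)\<^sup>2 * (LINT x:K|lborel. (norm (grad P x))\<^sup>2) \<le>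
      C * (\<Sum>a\<in>verts K. \<Sum>b\<in>verts K. LINT x:K|lborel. lam K a x * lam K b x * (grad P x \<bullet> (b - a))\<^sup>2)"
proof -
  obtain C where C: "C \<ge> 0" "\<And>(P :: real ^ 'd \<Rightarrow> real) c r K. polynomial_deg_le (m - 1) P \<Longrightarrow> 0 < r \<Longrightarrow> compact K \<Longrightarrow>
     K \<subseteq> cball c (2 * s * r) \<Longrightarrow>
     (LINT x:K|lborel. (P x)\<^sup>2) \<le> C * (LINT x:cball c r|lborel. (P x)\<^sup>2)"
    using polynomial_integral_bound[of "m - 1" "2 * s"] by blast
  define C' where "C' = (C + 1) * s ^ 4 + 1"
  have C': "C' > 0" using C(1) by (simp add: C'_def add_nonneg_pos)
  show ?thesis
  proof (intro exI[of _ C'] conjI allI impI C')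
    fix K :: "(real ^ 'd) set" and P :: "real ^ 'd \<Rightarrow> real"
    assume K: "regular s K" and P: "polynomial_deg_le m P"
    from K obtain r c where "regular_simplex K s r c" by (rule regularE)
    then interpret regular_simplex K s r c .
    define B where "B = cball c (r/2)"
    have B: "compact B" "B \<subseteq> K" using cball_sub r unfolding B_def by auto
    have cg: "continuous_on S (grad P)" for S using continuous_on_grad[OF P] .
    define S where "S x = (\<Sum>a\<in>verts K. \<Sum>b\<in>verts K. lam K a x * lam K b x * (grad P x \<bullet> (b - a))\<^sup>2)" for x
    have cS: "continuous_on K S" unfolding S_def by (intro continuous_intros continuous_on_lam cg)
    have S0: "0 \<le> S x" if "x \<in> K" for x
      unfolding S_def using lam_bounds[OF _ that] by (intro sum_nonneg mult_nonneg_nonneg) auto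
    have norm_sum: "(norm v)\<^sup>2 = (\<Sum>i\<in>UNIV. (v $ i)\<^sup>2)" for v :: "real ^ 'd"
      unfolding power2_norm_eq_inner inner_vec_def by (simp add: power2_eq_square)
    have grad_ball: "(LINT x:K|lborel. (norm (grad P x))\<^sup>2) \<le> C * (LINT x:B|lborel. (norm (grad P x))\<^sup>2)"
    proof -
      have sub: "K \<subseteq> cball c (2 * s * (r/2))" using sub_cball by simp
      have cgi: "continuous_on S (\<lambda>x. grad P x $ i)" for S i
        using continuous_on_polynomial[OF polynomial_deg_le_grad[OF P]] .
      have "(LINT x:K|lborel. (norm (grad P x))\<^sup>2) = (\<Sum>i\<in>UNIV. LINT x:K|lborel. (grad P x $ i)\<^sup>2)"
        unfolding norm_sum by (intro set_integral_cont_sum compact continuous_intros cgi)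
      also have "\<dots> \<le> (\<Sum>i\<in>UNIV. C * (LINT x:B|lborel. (grad P x $ i)\<^sup>2))"
        unfolding B_def using r by (intro sum_mono C(2) polynomial_deg_le_grad[OF P] compact sub) auto
      also have "\<dots> = C * (LINT x:B|lborel. (norm (grad P x))\<^sup>2)"
        unfolding norm_sum sum_distrib_left[symmetric]
        by (subst set_integral_cont_sum[OF B(1)]) (intro continuous_intros cgi, simp)
      finally show ?thesis .
    qed
    have low: "(r/s)\<^sup>2 * (norm (grad P x))\<^sup>2 \<le> S x" if x: "x \<in> B" for x
    proof -
      have xK: "x \<in> K" using x B by auto
      obtain a b where ab: "a \<in> verts K" "b \<in> verts K" "2 * r * norm (grad P x) \<le> grad P x \<bullet> (b - a)"
        using edge_width by blast
      have s: "s > 0" using s_ge_1 by simp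
      have "(r/s)\<^sup>2 * (norm (grad P x))\<^sup>2 = (1 / (2 * s) * (1 / (2 * s))) * (2 * r * norm (grad P x))\<^sup>2"
        using s by (simp add: power2_eq_square field_simps)
      also have "\<dots> \<le> (lam K a x * lam K b x) * (grad P x \<bullet> (b - a))\<^sup>2"
        using lam_lower[OF ab(1)] lam_lower[OF ab(2)] x r s ab(3) lam_bounds[OF ab(1) xK] lam_bounds[OF ab(2) xK]
        unfolding B_def by (intro mult_mono power_mono) auto
      also have "\<dots> \<le> (\<Sum>b\<in>verts K. lam K a x * lam K b x * (grad P x \<bullet> (b - a))\<^sup>2)"
        using lam_bounds[OF _ xK] ab by (intro member_le_sum) auto
      also have "\<dots> \<le> S x"
        unfolding S_def using lam_bounds[OF _ xK] ab
        by (intro member_le_sum[of a "verts K" "\<lambda>a. \<Sum>b\<in>verts K. lam K a x * lam K b x * (grad P x \<bullet> (b - a))\<^sup>2"])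
           (auto intro!: sum_nonneg)
      finally show ?thesis .
    qed
    define G where "G = (LINT x:B|lborel. (norm (grad P x))\<^sup>2)"
    define IS where "IS = (LINT x:K|lborel. S x)"
    have G0: "0 \<le> G" unfolding G_def by (intro set_integral_cont_nonneg) simp
    have IS0: "0 \<le> IS" unfolding IS_def using S0 by (intro set_integral_cont_nonneg)
    have "(r/s)\<^sup>2 * G = (LINT x:B|lborel. (r/s)\<^sup>2 * (norm (grad P x))\<^sup>2)" by (simp add: G_def)
    also have "\<dots> \<le> (LINT x:B|lborel. S x)"
      using low continuous_on_subset[OF cS B(2)]
      by (intro set_integral_cont_mono B continuous_intros cg) auto
    also have "\<dots> \<le> IS" unfolding IS_def using S0 by (intro set_integral_cont_subset B compact cS)
    finally have G: "(r/s)\<^sup>2 * G \<le> IS" .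
    have s: "s > 0" using s_ge_1 by simp
    have "(diameter K)\<^sup>2 * (LINT x:K|lborel. (norm (grad P x))\<^sup>2) \<le> (s * r)\<^sup>2 * (C * G)"
      using diam_le diam_pos grad_ball C(1) G0 unfolding G_def[symmetric]
      by (intro mult_mono power_mono set_integral_cont_nonneg) auto
    also have "\<dots> = C * s ^ 4 * ((r/s)\<^sup>2 * G)"
      using s by (simp add: power2_eq_square power4_eq_xxxx)
    also have "\<dots> \<le> C * s ^ 4 * IS" using G C(1) by (intro mult_left_mono) auto
    also have "\<dots> \<le> C' * IS"
    proof (rule mult_right_mono[OF _ IS0])
      have "0 \<le> s ^ 4" by simp
      then show "C * s ^ 4 \<le> C'" unfolding C'_def by (simp add: distrib_right)
    qed
    also have "IS = (\<Sum>a\<in>verts K. \<Sum>b\<in>verts K. LINT x:K|lborel. lam K a x * lam K b x * (grad P x \<bullet> (b - a))\<^sup>2)"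
      unfolding IS_def S_def
      by (subst set_integral_cont_sum[OF compact], intro continuous_intros continuous_on_lam cg)
         (intro sum.cong refl set_integral_cont_sum compact continuous_intros continuous_on_lam cg)
    finally show "(diameter K)\<^sup>2 * (LINT x:K|lborel. (norm (grad P x))\<^sup>2) \<le>
      C' * (\<Sum>a\<in>verts K. \<Sum>b\<in>verts K. LINT x:K|lborel. lam K a x * lam K b x * (grad P x \<bullet> (b - a))\<^sup>2)" .
  qed
qed

section \<open>Local vector fields with prescribed normal traces\<close>

context regular_simplex
begin

lemma polynomial_deg_le_lam: "polynomial_deg_le 1 (lam K a)"
proof -
  have eq: "lam K a = (\<lambda>x. (1 / hgt K a) * (offs K a - nrm K a \<bullet> x))"
    by (simp add: lam_def fun_eq_iff)
  show ?thesis
    unfolding eq by (intro polynomial_deg_le_cmult polynomial_deg_le_diff polynomial_deg_le_const polynomial_deg_le_inner)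
qed

text \<open>Normal traces are lifted radially from the opposite vertex: \<open>x - a\<close> is tangential to the faces
  through \<open>a\<close> and has constant normal component on the opposite one. The data are extended by
  collapsing the simplex onto that face along the edge from \<open>a\<close> to another vertex.\<close>
lemma radial_lift:
  fixes \<rho> :: "real ^ 'd \<Rightarrow> real"
  assumes a: "a \<in> verts K" and \<rho>: "polynomial_deg_le k \<rho>"
  shows "\<exists>q. poly_field (k + 1) q \<and>
    (\<forall>b\<in>verts K. \<forall>x\<in>opp_face K b. q x \<bullet> nrm K b = (if b = a then \<rho> x else 0)) \<and>
    (LINT x:K|lborel. (norm (q x))\<^sup>2) \<le> s * diameter K * (LINT x|face_measure (opp_face K a). (\<rho> x)\<^sup>2) \<and>
    (\<forall>m w. polynomial_deg_le m w \<longrightarrow> (LINT x:K|lborel. dvg q x * w x) =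
       (LINT x|face_measure (opp_face K a). \<rho> x * w x) - (LINT x:K|lborel. q x \<bullet> grad w x))"
proof -
  interpret C: cone_over_face "nrm K a" "offs K a" "opp_face K a" a "hgt K a" K using cone[OF a] .
  have h: "hgt K a > 0" using nrm_props[OF a] by simp
  obtain b where b: "b \<in> verts K" "b \<noteq> a" using other_vertex[OF a] by blast
  \<comment> \<open>The collapse onto the face opposite \<open>a\<close>: it is affine, so it preserves polynomials of degree \<open>k\<close>,
    and it is the identity on the face.\<close>
  define E where "E x = x + lam K a x *\<^sub>R (b - a)" for x
  have E1: "polynomial_deg_le 1 (\<lambda>x. E x $ i)" for i
  proof -
    have "polynomial_deg_le 1 (\<lambda>x. x $ i + (b $ i - a $ i) * lam K a x)"
      by (intro polynomial_deg_le_add polynomial_deg_le_nth polynomial_deg_le_cmult polynomial_deg_le_lam)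
    then show ?thesis by (simp add: E_def mult.commute)
  qed
  have Ef: "E x = x" if "x \<in> opp_face K a" for x
    using that by (simp add: E_def opp_face_iff[OF a])
  define R where "R x = (1 / hgt K a) * \<rho> (E x)" for x
  have R: "polynomial_deg_le k R"
    unfolding R_def[abs_def] by (intro polynomial_deg_le_cmult polynomial_deg_le_affine_compose[OF \<rho>] E1)
  define q where "q x = R x *\<^sub>R (x - a)" for x
  have q: "poly_field (k + 1) q" unfolding q_def[abs_def] by (rule poly_field_radial[OF R])
  have trace: "q x \<bullet> nrm K v = (if v = a then \<rho> x else 0)" if v: "v \<in> verts K" and x: "x \<in> opp_face K v" for v x
  proof -
    have xv: "x \<bullet> nrm K v = offs K v" using opp_face_dot[OF v x] by (simp add: inner_commute)
    show ?thesis
    proof (cases "v = a")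
      case True
      then show ?thesis using xv h Ef x by (simp add: q_def R_def inner_diff_left hgt_def inner_commute[of a])
    next
      case False
      then have "a \<bullet> nrm K v = offs K v"
        using opp_face_dot[OF v verts_opp_face[OF a]] by (simp add: inner_commute)
      then show ?thesis using False xv by (simp add: q_def inner_diff_left)
    qed
  qed
  have c\<rho>: "continuous_on S \<rho>" for S using continuous_on_polynomial[OF \<rho>] .
  have cE: "continuous_on S E" for S unfolding E_def by (intro continuous_intros continuous_on_lam)
  define F where "F = (LINT x|face_measure (opp_face K a). (\<rho> x)\<^sup>2)"
  have F0: "0 \<le> F" unfolding F_def by (intro Bochner_Integration.integral_nonneg) simp
  have bound: "(LINT x:K|lborel. (norm (q x))\<^sup>2) \<le> s * diameter K * F"
  proof -
    define D where "D = diameter K"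
    have D: "0 < D" "D \<le> s * hgt K a" using diam_pos diam_le_s_hgt[OF a] by (auto simp: D_def)
    have "(LINT x:K|lborel. (norm (q x))\<^sup>2) \<le> (LINT x:K|lborel. (D / hgt K a)\<^sup>2 * (\<rho> (E x))\<^sup>2)"
    proof (rule set_integral_cont_mono[OF compact])
      fix x assume x: "x \<in> K"
      have "(norm (x - a))\<^sup>2 \<le> D\<^sup>2"
        using dist_le_diam[OF x verts_in[OF a]] by (intro power_mono) (auto simp: D_def)
      then have "((1 / hgt K a) * \<rho> (E x))\<^sup>2 * (norm (x - a))\<^sup>2 \<le> ((1 / hgt K a) * \<rho> (E x))\<^sup>2 * D\<^sup>2"
        by (intro mult_left_mono) auto
      then show "(norm (q x))\<^sup>2 \<le> (D / hgt K a)\<^sup>2 * (\<rho> (E x))\<^sup>2"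
        by (simp add: q_def R_def power_mult_distrib power_divide mult_ac)
    qed (intro continuous_intros continuous_on_poly_field[OF q] continuous_on_compose2[OF c\<rho>[of UNIV] cE]; simp)+
    also have "\<dots> = (D / hgt K a)\<^sup>2 * (LINT x:K|lborel. (\<rho> (E x))\<^sup>2)" by simp
    also have "(LINT x:K|lborel. (\<rho> (E x))\<^sup>2) \<le> hgt K a * F"
      using C.cone_extension_integral_bound[of "\<lambda>x. (\<rho> x)\<^sup>2" b] verts_opp_face[OF b]
      unfolding F_def E_def lam_def by (auto simp: opp_face_def intro!: continuous_intros c\<rho>)
    then have "(D / hgt K a)\<^sup>2 * (LINT x:K|lborel. (\<rho> (E x))\<^sup>2) \<le> (D / hgt K a)\<^sup>2 * (hgt K a * F)"
      by (intro mult_left_mono) auto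
    also have "\<dots> = D * F * (D / hgt K a)" using h by (simp add: power2_eq_square)
    also have "\<dots> \<le> D * F * s"
      using D F0 h by (intro mult_left_mono) (auto simp: divide_le_eq)
    finally show ?thesis by (simp add: D_def mult_ac)
  qed
  have Gauss: "(LINT x:K|lborel. dvg q x * w x) =
       (LINT x|face_measure (opp_face K a). \<rho> x * w x) - (LINT x:K|lborel. q x \<bullet> grad w x)"
    if w: "polynomial_deg_le m w" for m w
  proof -
    have cw: "continuous_on S w" "continuous_on S (grad w)" for S
      using continuous_on_polynomial[OF w] continuous_on_grad[OF w] .
    have Rw: "polynomial_deg_le (k + m) (\<lambda>x. R x * w x)" using polynomial_deg_le_mult[OF R w] .
    have "dvg q x * w x + q x \<bullet> grad w x = CARD('d) * (R x * w x) + grad (\<lambda>x. R x * w x) x \<bullet> (x - a)" for x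
      unfolding q_def[abs_def] dvg_radial[OF R] grad_mult[OF R w]
      by (simp add: inner_add_left algebra_simps inner_commute)
    then have "(LINT x:K|lborel. dvg q x * w x + q x \<bullet> grad w x) = hgt K a * (LINT x|face_measure (opp_face K a). R x * w x)"
      using Gauss_vertex[OF a Rw] by simp
    also have "\<dots> = (LINT x|face_measure (opp_face K a). hgt K a * (R x * w x))" by simp
    also have "\<dots> = (LINT x|face_measure (opp_face K a). \<rho> x * w x)"
      using h Ef continuous_on_polynomial[OF Rw, of UNIV] 
      by (intro C.face_integral_cong borel_measurable_continuous_onI continuous_intros c\<rho> cw
            continuous_on_polynomial[OF R])
         (auto simp: R_def)
    finally have "(LINT x:K|lborel. dvg q x * w x) + (LINT x:K|lborel. q x \<bullet> grad w x) =
        (LINT x|face_measure (opp_face K a). \<rho> x * w x)"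
      by (subst (asm) set_integral_cont_add[OF compact])
         (auto intro!: continuous_intros cw continuous_on_dvg[OF q] continuous_on_poly_field[OF q])
    then show ?thesis by simp
  qed
  show ?thesis using q trace bound Gauss unfolding F_def by (intro exI[of _ q]) auto
qed

text \<open>A field \<open>\<lambda>\<^sub>a \<lambda>\<^sub>b g (b - a)\<close> has no normal component on any face: on the faces opposite
  \<open>a\<close> and \<open>b\<close> a factor vanishes, and all other faces contain the edge from \<open>a\<close> to \<open>b\<close>.\<close>
lemma edge_bubble:
  fixes g :: "real ^ 'd \<Rightarrow> real"
  assumes a: "a \<in> verts K" and b: "b \<in> verts K" and g: "polynomial_deg_le m g"
  defines "q \<equiv> \<lambda>x. (lam K a x * lam K b x * g x) *\<^sub>R (b - a)"
  shows "poly_field (m + 2) q"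
    and "v \<in> verts K \<Longrightarrow> x \<in> opp_face K v \<Longrightarrow> q x \<bullet> nrm K v = 0"
    and "polynomial_deg_le n w \<Longrightarrow> (LINT x:K|lborel. dvg q x * w x) = - (LINT x:K|lborel. q x \<bullet> grad w x)"
proof -
  define R where "R x = lam K a x * lam K b x * g x" for x
  have R: "polynomial_deg_le (m + 2) R"
    using polynomial_deg_le_mult[OF polynomial_deg_le_mult[OF polynomial_deg_le_lam polynomial_deg_le_lam] g]
    unfolding R_def by (simp add: add.commute)
  have q: "q = (\<lambda>x. R x *\<^sub>R (b - a))" by (simp add: q_def R_def)
  show pf: "poly_field (m + 2) q" unfolding q by (rule poly_field_const_dir[OF R])
  show "q x \<bullet> nrm K v = 0" if v: "v \<in> verts K" and x: "x \<in> opp_face K v"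
  proof (cases "v = a \<or> v = b")
    case True
    then have "R x = 0" using x v by (auto simp: R_def opp_face_iff)
    then show ?thesis by (simp add: q)
  next
    case False
    then have "nrm K v \<bullet> a = offs K v" "nrm K v \<bullet> b = offs K v"
      using opp_face_dot[OF v] verts_opp_face a b by auto
    then show ?thesis by (simp add: q inner_diff_left inner_commute)
  qed
  show "(LINT x:K|lborel. dvg q x * w x) = - (LINT x:K|lborel. q x \<bullet> grad w x)" if w: "polynomial_deg_le n w"
  proof -
    have cw: "continuous_on S w" "continuous_on S (grad w)" for S
      using continuous_on_polynomial[OF w] continuous_on_grad[OF w] .
    define \<psi> where "\<psi> x = R x * w x" for x
    have \<psi>: "polynomial_deg_le (m + 2 + n) \<psi>" using polynomial_deg_le_mult[OF R w] by (simp add: \<psi>_def[abs_def])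
    have cd: "continuous_on S \<psi>" "continuous_on S (grad \<psi>)" for S
      using continuous_on_polynomial[OF \<psi>] continuous_on_grad[OF \<psi>] .
    have zero: "(LINT x:K|lborel. CARD('d) * \<psi> x + grad \<psi> x \<bullet> (x - v)) = 0" if v: "v = a \<or> v = b" for v
    proof -
      have vK: "v \<in> verts K" using v a b by auto
      interpret C: cone_over_face "nrm K v" "offs K v" "opp_face K v" v "hgt K v" K using cone[OF vK] .
      have "(LINT x|face_measure (opp_face K v). \<psi> x) = (LINT x|face_measure (opp_face K v). 0)"
        using v a b by (intro C.face_integral_cong borel_measurable_continuous_onI cd)
           (auto simp: \<psi>_def R_def opp_face_iff)
      then show ?thesis using Gauss_vertex[OF vK \<psi>] by simp
    qed
    \<comment> \<open>Up to sign the constant direction is the difference of two radial fields, for both of which the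
      boundary term vanishes.\<close>
    have "grad \<psi> x \<bullet> (b - a) = (CARD('d) * \<psi> x + grad \<psi> x \<bullet> (x - a)) + (-1) * (CARD('d) * \<psi> x + grad \<psi> x \<bullet> (x - b))" for x
      by (simp add: inner_diff_right)
    then have "(LINT x:K|lborel. grad \<psi> x \<bullet> (b - a)) =
      (LINT x:K|lborel. CARD('d) * \<psi> x + grad \<psi> x \<bullet> (x - a)) + (LINT x:K|lborel. (-1) * (CARD('d) * \<psi> x + grad \<psi> x \<bullet> (x - b)))"
      by (simp only:) (intro set_integral_cont_add compact continuous_intros cd)
    also have "\<dots> = 0"
      using zero[of a] zero[of b] by (subst set_integral_mult_right) simp
    finally have "(LINT x:K|lborel. grad \<psi> x \<bullet> (b - a)) = 0" .
    moreover have "dvg q x * w x + q x \<bullet> grad w x = grad \<psi> x \<bullet> (b - a)" for x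
      unfolding q dvg_const_dir[OF R] \<psi>_def[abs_def] grad_mult[OF R w]
      by (simp add: inner_add_left algebra_simps inner_commute)
    ultimately have "(LINT x:K|lborel. dvg q x * w x) + (LINT x:K|lborel. q x \<bullet> grad w x) = 0"
      by (subst set_integral_cont_add[OF compact, symmetric])
         (auto intro!: continuous_intros cw continuous_on_dvg[OF pf] continuous_on_poly_field[OF pf])
    then show ?thesis by simp
  qed
qed

end

lemma polynomial_deg_le_0_const:
  fixes P :: "real ^ 'd \<Rightarrow> real"
  assumes "polynomial_deg_le 0 P"
  shows "\<exists>c. P = (\<lambda>x. c)"
  using assms
proof (induction rule: polynomial_deg_le_induct)
  case (add P Q c)
  then show ?case by (auto simp: fun_eq_iff)
next
  case (monomial s)
  then have "s i = 0" for i by simp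
  then have "monomial s = (\<lambda>x :: real ^ 'd. 1)" by (simp add: monomial_def fun_eq_iff)
  then show ?case by blast
qed auto

lemma sum_squares_le_card: 
  fixes f :: "'a \<Rightarrow> real"
  shows "(\<Sum>a\<in>A. f a)\<^sup>2 \<le> card A * (\<Sum>a\<in>A. (f a)\<^sup>2)"
  using Cauchy_Schwarz_ineq_sum[of "\<lambda>_. 1" f A] by simp

lemma norm_sum_squares_le_card: "(norm (\<Sum>a\<in>A. f a))\<^sup>2 \<le> card A * (\<Sum>a\<in>A. (norm (f a))\<^sup>2)"
proof -
  have "(norm (\<Sum>a\<in>A. f a))\<^sup>2 \<le> (\<Sum>a\<in>A. norm (f a))\<^sup>2" by (intro power_mono norm_sum) simp
  then show ?thesis using sum_squares_le_card[of "\<lambda>a. norm (f a)" A] by linarith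
qed

text \<open>The local building block. Its divergence tested with \<open>w\<close> produces the gradient of \<open>w\<close>, by edge bubbles,
  and the face terms of the prescribed normal traces \<open>\<rho>\<close>, by radial lifts. The lifts also interact with the
  gradient; this is absorbed with arbitrarily small weight \<open>\<theta>\<close> in the traces, at the price of a larger
  multiple of the bubbles and hence of a larger constant \<open>C\<close>.\<close>
lemma element_field:
  assumes "\<theta> > 0" "s \<ge> 1"
  shows "\<exists>C\<ge>0. \<forall>(K :: (real ^ 'd) set) w \<rho>. regular s K \<longrightarrow> polynomial_deg_le k w \<longrightarrow>
     (\<forall>a\<in>verts K. polynomial_deg_le k (\<rho> a)) \<longrightarrow>
     (\<exists>q. poly_field (k + 1) q \<and>
        (\<forall>a\<in>verts K. \<forall>x\<in>opp_face K a. q x \<bullet> nrm K a = \<rho> a x) \<and>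
        (LINT x:K|lborel. (norm (q x))\<^sup>2) \<le> C * ((LINT x:K|lborel. (norm (grad w x))\<^sup>2) +
            (\<Sum>a\<in>verts K. diameter K * (LINT x|face_measure (opp_face K a). (\<rho> a x)\<^sup>2))) \<and>
        (LINT x:K|lborel. (norm (grad w x))\<^sup>2)
          - (\<Sum>a\<in>verts K. LINT x|face_measure (opp_face K a). \<rho> a x * w x)
          - \<theta> * (\<Sum>a\<in>verts K. diameter K * (LINT x|face_measure (opp_face K a). (\<rho> a x)\<^sup>2))
        \<le> - (LINT x:K|lborel. dvg q x * w x))"
proof -
  obtain C3 where C3: "C3 > 0" "\<And>(K :: (real ^ 'd) set) P. regular s K \<Longrightarrow> polynomial_deg_le k P \<Longrightarrow>
    (diameter K)\<^sup>2 * (LINT x:K|lborel. (norm (grad P x))\<^sup>2) \<le>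
      C3 * (\<Sum>a\<in>verts K. \<Sum>b\<in>verts K. LINT x:K|lborel. lam K a x * lam K b x * (grad P x \<bullet> (b - a))\<^sup>2)"
    using edge_bubble_inequality[of s k] by blast
  define N where "N = real (CARD('d) + 1)"
  have N: "N \<ge> 1" by (simp add: N_def)
  \<comment> \<open>The weight in Young's inequality is chosen such that the lifts, whose mean square is at most
    \<open>N * s * S\<close> below, cost exactly \<open>\<theta> * S\<close>.\<close>
  define \<epsilon> where "\<epsilon> = 2 * \<theta> / (N * s)"
  have \<epsilon>: "\<epsilon> > 0" "\<epsilon> / 2 * (N * s) = \<theta>" using assms N by (auto simp: \<epsilon>_def)
  \<comment> \<open>The multiple of the bubbles that yields the gradient once for the result and \<open>1 / (2 * \<epsilon>)\<close> times
    for the absorption of the lifts.\<close>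
  define \<mu> where "\<mu> = C3 * (1 + 1 / (2 * \<epsilon>))"
  have \<mu>: "\<mu> > 0" using C3 \<epsilon> by (simp add: \<mu>_def add_pos_pos)
  define C where "C = 2 * N * s + 2 * \<mu>\<^sup>2 * N ^ 4"
  have C0: "C \<ge> 0" using N assms by (simp add: C_def)
  show ?thesis
  proof (intro exI[of _ C] conjI allI impI C0)
    fix K :: "(real ^ 'd) set" and w :: "real ^ 'd \<Rightarrow> real" and \<rho> :: "real ^ 'd \<Rightarrow> real ^ 'd \<Rightarrow> real"
    assume K: "regular s K" and w: "polynomial_deg_le k w" and \<rho>: "\<forall>a\<in>verts K. polynomial_deg_le k (\<rho> a)"
    from K obtain r c where "regular_simplex K s r c" by (rule regularE)
    then interpret regular_simplex K s r c .
    define D where "D = diameter K"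
    have D: "D > 0" using diam_pos by (simp add: D_def)
    have card: "real (card (verts K)) = N" using verts_props(2) by (simp add: N_def)
    define F where "F a = (LINT x|face_measure (opp_face K a). (\<rho> a x)\<^sup>2)" for a
    define S where "S = (\<Sum>a\<in>verts K. D * F a)"
    define G where "G = (LINT x:K|lborel. (norm (grad w x))\<^sup>2)"
    have S0: "0 \<le> S" unfolding S_def F_def using D by (intro sum_nonneg mult_nonneg_nonneg Bochner_Integration.integral_nonneg) auto
    have G0: "0 \<le> G" unfolding G_def by (intro set_integral_cont_nonneg) simp
    have cw: "continuous_on S w" "continuous_on S (grad w)" for S
      using continuous_on_polynomial[OF w] continuous_on_grad[OF w] .
    have "\<forall>a\<in>verts K. \<exists>q. poly_field (k + 1) q \<and>
      (\<forall>b\<in>verts K. \<forall>x\<in>opp_face K b. q x \<bullet> nrm K b = (if b = a then \<rho> a x else 0)) \<and>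
      (LINT x:K|lborel. (norm (q x))\<^sup>2) \<le> s * D * F a \<and>
      (\<forall>m w. polynomial_deg_le m w \<longrightarrow> (LINT x:K|lborel. dvg q x * w x) =
         (LINT x|face_measure (opp_face K a). \<rho> a x * w x) - (LINT x:K|lborel. q x \<bullet> grad w x))"
      using radial_lift \<rho> unfolding D_def F_def by blast
    then obtain l where l: "\<And>a. a \<in> verts K \<Longrightarrow> poly_field (k + 1) (l a)"
      "\<And>a b x. a \<in> verts K \<Longrightarrow> b \<in> verts K \<Longrightarrow> x \<in> opp_face K b \<Longrightarrow> l a x \<bullet> nrm K b = (if b = a then \<rho> a x else 0)"
      "\<And>a. a \<in> verts K \<Longrightarrow> (LINT x:K|lborel. (norm (l a x))\<^sup>2) \<le> s * D * F a"
      "\<And>a. a \<in> verts K \<Longrightarrow> (LINT x:K|lborel. dvg (l a) x * w x) =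
         (LINT x|face_measure (opp_face K a). \<rho> a x * w x) - (LINT x:K|lborel. l a x \<bullet> grad w x)"
      using w unfolding bchoice_iff by blast
    define q1 where "q1 x = (\<Sum>a\<in>verts K. l a x)" for x
    have pf1: "poly_field (k + 1) q1" unfolding q1_def[abs_def] by (intro poly_field_sum l)
    define bb where "bb a b x = (lam K a x * lam K b x * (grad w x \<bullet> (b - a))) *\<^sub>R (b - a)" for a b x
    have gd: "polynomial_deg_le (k - 1) (\<lambda>x. grad w x \<bullet> t)" for t
      unfolding inner_vec_def using polynomial_deg_le_cmult[OF polynomial_deg_le_grad[OF w], of "t $ _"]
      by (intro polynomial_deg_le_sum) (simp add: mult.commute[of _ "t $ _"])
    have pfb: "poly_field (k + 1) (bb a b)" if "a \<in> verts K" "b \<in> verts K" for a b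
    proof (cases k)
      case 0
      \<comment> \<open>The degree \<open>k - 1\<close> of the gradient is truncated here, and the bubbles of degree \<open>(k - 1) + 2\<close>
        would be too large; but they vanish.\<close>
      then obtain c where "w = (\<lambda>x. c)" using polynomial_deg_le_0_const w by blast
      then have "grad w x = 0" for x by simp
      then have "bb a b = (\<lambda>x. 0)" by (simp add: bb_def fun_eq_iff)
      then show ?thesis by (simp add: poly_field_0)
    next
      case (Suc j)
      then show ?thesis using edge_bubble(1)[OF that gd[of "b - a"]] unfolding bb_def[abs_def] by simp
    qed
    define q2 where "q2 x = (\<Sum>a\<in>verts K. \<Sum>b\<in>verts K. bb a b x)" for x
    have pf2: "poly_field (k + 1) q2" unfolding q2_def[abs_def] by (intro poly_field_sum pfb)
    define q where "q x = q1 x + (\<mu> / D\<^sup>2) *\<^sub>R q2 x" for x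
    have pf2': "poly_field (k + 1) (\<lambda>x. (\<mu> / D\<^sup>2) *\<^sub>R q2 x)" by (rule poly_field_scaleR[OF pf2])
    have pf: "poly_field (k + 1) q" unfolding q_def[abs_def] by (intro poly_field_add pf1 pf2')
    have trace: "q x \<bullet> nrm K a = \<rho> a x" if a: "a \<in> verts K" and x: "x \<in> opp_face K a" for a x
    proof -
      have "q1 x \<bullet> nrm K a = (\<Sum>b\<in>verts K. if a = b then \<rho> b x else 0)"
        unfolding q1_def inner_sum_left using l(2)[OF _ a x] by (intro sum.cong) auto
      moreover have "q2 x \<bullet> nrm K a = 0"
        unfolding q2_def inner_sum_left bb_def using edge_bubble(2)[OF _ _ gd a x]
        by (intro sum.neutral ballI) auto
      ultimately show ?thesis using a by (simp add: q_def inner_add_left)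
    qed
    have c1: "continuous_on S q1" "continuous_on S q2" "continuous_on S q" "continuous_on S (dvg q1)" "continuous_on S (dvg q2)" for S
      using continuous_on_poly_field[OF pf1] continuous_on_poly_field[OF pf2] continuous_on_poly_field[OF pf]
        continuous_on_dvg[OF pf1] continuous_on_dvg[OF pf2] by auto
    have q1_bound: "(LINT x:K|lborel. (norm (q1 x))\<^sup>2) \<le> N * s * S"
    proof -
      have cl: "continuous_on A (l a)" if "a \<in> verts K" for a A using continuous_on_poly_field[OF l(1)[OF that]] .
      have "(LINT x:K|lborel. (norm (q1 x))\<^sup>2) \<le> (LINT x:K|lborel. \<Sum>a\<in>verts K. N * (norm (l a x))\<^sup>2)"
        unfolding card[symmetric] q1_def sum_distrib_left[symmetric]
        by (intro set_integral_cont_mono compact norm_sum_squares_le_card continuous_intros cl) auto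
      also have "\<dots> = (\<Sum>a\<in>verts K. N * (LINT x:K|lborel. (norm (l a x))\<^sup>2))"
        by (subst set_integral_cont_sum[OF compact]) (auto intro!: continuous_intros cl)
      also have "\<dots> \<le> (\<Sum>a\<in>verts K. N * (s * D * F a))"
        using l(3) N by (intro sum_mono mult_left_mono) auto
      also have "\<dots> = N * s * S" unfolding S_def by (simp add: sum_distrib_left mult_ac)
      finally show ?thesis .
    qed
    have q2_pt: "norm (q2 x) \<le> N\<^sup>2 * D\<^sup>2 * norm (grad w x)" if x: "x \<in> K" for x
    proof -
      have bb: "norm (bb a b x) \<le> D\<^sup>2 * norm (grad w x)" if ab: "a \<in> verts K" "b \<in> verts K" for a b
      proof -
        have nab: "norm (b - a) \<le> D" using dist_le_diam verts_in ab by (simp add: D_def)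
        have "norm (bb a b x) = (lam K a x * lam K b x) * (\<bar>grad w x \<bullet> (b - a)\<bar> * norm (b - a))"
          using lam_bounds[OF ab(1) x] lam_bounds[OF ab(2) x] by (simp add: bb_def abs_mult)
        also have "\<dots> \<le> 1 * (\<bar>grad w x \<bullet> (b - a)\<bar> * norm (b - a))"
          using lam_bounds[OF ab(1) x] lam_bounds[OF ab(2) x] by (intro mult_right_mono mult_le_one) auto
        also have "\<dots> \<le> (norm (grad w x) * norm (b - a)) * norm (b - a)"
          using Cauchy_Schwarz_ineq2[of "grad w x" "b - a"] by (simp add: mult_right_mono)
        also have "\<dots> \<le> (norm (grad w x) * D) * D"
          using nab D by (intro mult_mono) auto
        finally show ?thesis by (simp add: power2_eq_square mult_ac)
      qed
      have "norm (q2 x) \<le> (\<Sum>a\<in>verts K. \<Sum>b\<in>verts K. D\<^sup>2 * norm (grad w x))"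
        unfolding q2_def by (intro sum_norm_le bb)
      also have "\<dots> = N\<^sup>2 * D\<^sup>2 * norm (grad w x)" using card by (simp add: power2_eq_square)
      finally show ?thesis .
    qed
    have q_bound: "(LINT x:K|lborel. (norm (q x))\<^sup>2) \<le> C * (G + S)"
    proof -
      have "(LINT x:K|lborel. (norm (q x))\<^sup>2) \<le> (LINT x:K|lborel. 2 * (norm (q1 x))\<^sup>2 + (2 * \<mu>\<^sup>2 * N ^ 4) * (norm (grad w x))\<^sup>2)"
      proof (intro set_integral_cont_mono compact continuous_intros c1 cw)
        fix x assume x: "x \<in> K"
        define z where "z = (\<mu> / D\<^sup>2) *\<^sub>R q2 x"
        have "norm z = (\<mu> / D\<^sup>2) * norm (q2 x)" using \<mu> by (simp add: z_def)
        also have "\<dots> \<le> (\<mu> / D\<^sup>2) * (N\<^sup>2 * D\<^sup>2 * norm (grad w x))"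
          using q2_pt[OF x] \<mu> by (intro mult_left_mono) auto
        also have "\<dots> = \<mu> * N\<^sup>2 * norm (grad w x)" using D by simp
        finally have "(norm z)\<^sup>2 \<le> (\<mu> * N\<^sup>2 * norm (grad w x))\<^sup>2" by (intro power_mono) auto
        then have z: "(norm z)\<^sup>2 \<le> (\<mu>\<^sup>2 * N ^ 4) * (norm (grad w x))\<^sup>2" by (simp add: power_mult_distrib flip: power_mult)
        have "(norm (q x))\<^sup>2 \<le> (norm (q1 x) + norm z)\<^sup>2"
          unfolding q_def z_def by (intro power_mono norm_triangle_ineq) auto
        also have "\<dots> \<le> 2 * (norm (q1 x))\<^sup>2 + 2 * (norm z)\<^sup>2"
          using sum_squares_bound[of "norm (q1 x)" "norm z"] by (simp add: power2_sum)
        finally show "(norm (q x))\<^sup>2 \<le> 2 * (norm (q1 x))\<^sup>2 + (2 * \<mu>\<^sup>2 * N ^ 4) * (norm (grad w x))\<^sup>2"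
          using z by simp
      qed
      also have "\<dots> = 2 * (LINT x:K|lborel. (norm (q1 x))\<^sup>2) + (2 * \<mu>\<^sup>2 * N ^ 4) * G"
        unfolding G_def by (subst set_integral_cont_add[OF compact]) (auto intro!: continuous_intros c1 cw)
      also have "\<dots> \<le> 2 * (N * s * S) + (2 * \<mu>\<^sup>2 * N ^ 4) * G" using q1_bound by simp
      also have "\<dots> \<le> C * (G + S)"
        unfolding C_def using S0 G0 N assms by (simp add: algebra_simps)
      finally show ?thesis .
    qed
    have div1: "(LINT x:K|lborel. dvg q1 x * w x) =
        (\<Sum>a\<in>verts K. LINT x|face_measure (opp_face K a). \<rho> a x * w x) - (LINT x:K|lborel. q1 x \<bullet> grad w x)"
    proof -
      have cl: "continuous_on A (l a)" "continuous_on A (dvg (l a))" if "a \<in> verts K" for a A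
        using continuous_on_poly_field[OF l(1)[OF that]] continuous_on_dvg[OF l(1)[OF that]] .
      have "dvg q1 x = (\<Sum>a\<in>verts K. dvg (l a) x)" for x
        unfolding q1_def[abs_def] using l(1) by (rule dvg_sum)
      then have "(LINT x:K|lborel. dvg q1 x * w x) = (\<Sum>a\<in>verts K. LINT x:K|lborel. dvg (l a) x * w x)"
        by (simp only: sum_distrib_right) (intro set_integral_cont_sum compact continuous_intros cl cw)
      also have "\<dots> = (\<Sum>a\<in>verts K. LINT x|face_measure (opp_face K a). \<rho> a x * w x) - (\<Sum>a\<in>verts K. LINT x:K|lborel. l a x \<bullet> grad w x)"
        unfolding sum_subtractf[symmetric] by (intro sum.cong refl l(4))
      also have "(\<Sum>a\<in>verts K. LINT x:K|lborel. l a x \<bullet> grad w x) = (LINT x:K|lborel. q1 x \<bullet> grad w x)"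
        unfolding q1_def inner_sum_left by (intro set_integral_cont_sum[symmetric] compact continuous_intros cl cw)
      finally show ?thesis .
    qed
    define E where "E = (\<Sum>a\<in>verts K. \<Sum>b\<in>verts K. LINT x:K|lborel. lam K a x * lam K b x * (grad w x \<bullet> (b - a))\<^sup>2)"
    have div2: "(LINT x:K|lborel. dvg q2 x * w x) = - E"
    proof -
      have cb: "continuous_on A (dvg (bb a b))" if "a \<in> verts K" "b \<in> verts K" for a b A
        using continuous_on_dvg[OF pfb[OF that]] .
      have "dvg q2 x = (\<Sum>a\<in>verts K. \<Sum>b\<in>verts K. dvg (bb a b) x)" for x
      proof -
        have "dvg q2 x = (\<Sum>a\<in>verts K. dvg (\<lambda>x. \<Sum>b\<in>verts K. bb a b x) x)"
          unfolding q2_def[abs_def] by (rule dvg_sum) (rule poly_field_sum[OF pfb])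
        also have "\<dots> = (\<Sum>a\<in>verts K. \<Sum>b\<in>verts K. dvg (bb a b) x)"
          by (intro sum.cong refl) (rule dvg_sum[OF pfb])
        finally show ?thesis .
      qed
      then have "(LINT x:K|lborel. dvg q2 x * w x) = (\<Sum>a\<in>verts K. LINT x:K|lborel. \<Sum>b\<in>verts K. dvg (bb a b) x * w x)"
        by (simp only: sum_distrib_right) (intro set_integral_cont_sum compact continuous_intros cb cw)
      also have "\<dots> = (\<Sum>a\<in>verts K. \<Sum>b\<in>verts K. LINT x:K|lborel. dvg (bb a b) x * w x)"
        by (intro sum.cong refl set_integral_cont_sum compact continuous_intros cb cw)
      also have "\<dots> = (\<Sum>a\<in>verts K. \<Sum>b\<in>verts K. - (LINT x:K|lborel. lam K a x * lam K b x * (grad w x \<bullet> (b - a))\<^sup>2))"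
      proof (intro sum.cong refl)
        fix a b assume ab: "a \<in> verts K" "b \<in> verts K"
        show "(LINT x:K|lborel. dvg (bb a b) x * w x) = - (LINT x:K|lborel. lam K a x * lam K b x * (grad w x \<bullet> (b - a))\<^sup>2)"
          using edge_bubble(3)[OF ab gd[of "b - a"] w]
          unfolding bb_def[abs_def] by (simp add: power2_eq_square inner_commute mult_ac)
      qed
      finally show ?thesis unfolding E_def by (simp add: sum_negf)
    qed
    have "dvg q x = dvg q1 x + (\<mu> / D\<^sup>2) * dvg q2 x" for x
      unfolding q_def[abs_def] dvg_add[OF pf1 pf2'] dvg_scaleR[OF pf2] ..
    then have "(LINT x:K|lborel. dvg q x * w x) = (LINT x:K|lborel. dvg q1 x * w x + (\<mu> / D\<^sup>2) * (dvg q2 x * w x))"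
      by (simp add: algebra_simps)
    also have "\<dots> = (LINT x:K|lborel. dvg q1 x * w x) + (\<mu> / D\<^sup>2) * (LINT x:K|lborel. dvg q2 x * w x)"
      using D by (subst set_integral_cont_add[OF compact]) (auto intro!: continuous_intros c1 cw)
    finally have total: "- (LINT x:K|lborel. dvg q x * w x) = (LINT x:K|lborel. q1 x \<bullet> grad w x)
        - (\<Sum>a\<in>verts K. LINT x|face_measure (opp_face K a). \<rho> a x * w x) + (\<mu> / D\<^sup>2) * E"
      unfolding div1 div2 by simp
    have "(\<mu> / D\<^sup>2) * E \<ge> (1 + 1 / (2 * \<epsilon>)) * G"
    proof -
      have "(\<mu> / D\<^sup>2) * E = (1 + 1 / (2 * \<epsilon>)) / D\<^sup>2 * (C3 * E)" by (simp add: \<mu>_def)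
      also have "\<dots> \<ge> (1 + 1 / (2 * \<epsilon>)) / D\<^sup>2 * (D\<^sup>2 * G)"
        using C3(2)[OF K w] \<epsilon> unfolding D_def G_def E_def
        by (intro mult_left_mono divide_nonneg_nonneg add_nonneg_nonneg) auto
      finally show ?thesis using D by simp
    qed
    moreover have "- \<theta> * S - 1 / (2 * \<epsilon>) * G \<le> (LINT x:K|lborel. q1 x \<bullet> grad w x)"
    proof -
      have "(LINT x:K|lborel. (- (\<epsilon> / 2)) * (norm (q1 x))\<^sup>2 + (- (1 / (2 * \<epsilon>))) * (norm (grad w x))\<^sup>2)
          \<le> (LINT x:K|lborel. q1 x \<bullet> grad w x)"
      proof (intro set_integral_cont_mono compact continuous_intros c1 cw)
        fix x
        have "0 \<le> (\<epsilon> * norm (q1 x) - norm (grad w x))\<^sup>2 / (2 * \<epsilon>)" using \<epsilon> by simp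
        also have "\<dots> = (\<epsilon> / 2) * (norm (q1 x))\<^sup>2 + (1 / (2 * \<epsilon>)) * (norm (grad w x))\<^sup>2 - norm (q1 x) * norm (grad w x)"
          using \<epsilon>(1) by (simp add: power2_eq_square field_simps)
        finally have "norm (q1 x) * norm (grad w x) \<le> (\<epsilon> / 2) * (norm (q1 x))\<^sup>2 + (1 / (2 * \<epsilon>)) * (norm (grad w x))\<^sup>2"
          by simp
        moreover have "- (q1 x \<bullet> grad w x) \<le> norm (q1 x) * norm (grad w x)"
          using Cauchy_Schwarz_ineq2[of "q1 x" "grad w x"] by linarith
        ultimately show "(- (\<epsilon> / 2)) * (norm (q1 x))\<^sup>2 + (- (1 / (2 * \<epsilon>))) * (norm (grad w x))\<^sup>2 \<le> q1 x \<bullet> grad w x"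
          by linarith
      qed
      moreover have "(LINT x:K|lborel. (- (\<epsilon> / 2)) * (norm (q1 x))\<^sup>2 + (- (1 / (2 * \<epsilon>))) * (norm (grad w x))\<^sup>2)
          = (- (\<epsilon> / 2)) * (LINT x:K|lborel. (norm (q1 x))\<^sup>2) + (- (1 / (2 * \<epsilon>))) * G"
        unfolding G_def set_integral_mult_right[symmetric]
        by (intro set_integral_cont_add compact continuous_intros c1 cw)
      moreover have "(\<epsilon> / 2) * (LINT x:K|lborel. (norm (q1 x))\<^sup>2) \<le> \<theta> * S"
      proof -
        have "(\<epsilon> / 2) * (LINT x:K|lborel. (norm (q1 x))\<^sup>2) \<le> (\<epsilon> / 2) * (N * s * S)"
          using q1_bound \<epsilon>(1) by (intro mult_left_mono) auto
        also have "\<dots> = (\<epsilon> / 2 * (N * s)) * S" by simp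
        finally show ?thesis unfolding \<epsilon>(2) .
      qed
      ultimately show ?thesis by linarith
    qed
    ultimately have "G - (\<Sum>a\<in>verts K. LINT x|face_measure (opp_face K a). \<rho> a x * w x) - \<theta> * S
        \<le> - (LINT x:K|lborel. dvg q x * w x)"
      unfolding total by (simp add: distrib_right)
    then show "\<exists>q. poly_field (k + 1) q \<and>
        (\<forall>a\<in>verts K. \<forall>x\<in>opp_face K a. q x \<bullet> nrm K a = \<rho> a x) \<and>
        (LINT x:K|lborel. (norm (q x))\<^sup>2) \<le> C * ((LINT x:K|lborel. (norm (grad w x))\<^sup>2) +
            (\<Sum>a\<in>verts K. diameter K * (LINT x|face_measure (opp_face K a). (\<rho> a x)\<^sup>2))) \<and>
        (LINT x:K|lborel. (norm (grad w x))\<^sup>2)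
          - (\<Sum>a\<in>verts K. LINT x|face_measure (opp_face K a). \<rho> a x * w x)
          - \<theta> * (\<Sum>a\<in>verts K. diameter K * (LINT x|face_measure (opp_face K a). (\<rho> a x)\<^sup>2))
        \<le> - (LINT x:K|lborel. dvg q x * w x)"
      using pf trace q_bound unfolding G_def S_def F_def D_def by (intro exI[of _ q]) blast
  qed
qed

section \<open>Finite element functions and their polynomial pieces\<close>

text \<open>The polynomial that a piecewise polynomial function agrees with inside the element. It lives on the whole
  space, so it also has values on the faces, where the function itself does not.\<close>
definition piece :: "(real ^ 'd) set \<Rightarrow> (real ^ 'd \<Rightarrow> real) \<Rightarrow> real ^ 'd \<Rightarrow> real" where
  "piece K v = (SOME P. (\<exists>m. polynomial_deg_le m P) \<and> (\<forall>x\<in>interior K. v x = P x))"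

definition vpiece :: "(real ^ 'd) set \<Rightarrow> (real ^ 'd \<Rightarrow> real ^ 'd) \<Rightarrow> real ^ 'd \<Rightarrow> real ^ 'd" where
  "vpiece K q x = (\<chi> i. piece K (\<lambda>x. q x $ i) x)"

definition glue :: "(real ^ 'd) set set \<Rightarrow> ((real ^ 'd) set \<Rightarrow> real ^ 'd \<Rightarrow> 'b::real_vector) \<Rightarrow> real ^ 'd \<Rightarrow> 'b" where
  "glue T P x = (\<Sum>K\<in>T. indicator (interior K) x *\<^sub>R P K x)"

text \<open>This makes the polynomial piece of a function on an element unique.\<close>
lemma polynomial_eqI:
  assumes "polynomial_deg_le m P" "polynomial_deg_le n Q" "open U" "U \<noteq> {}" "\<And>x. x \<in> U \<Longrightarrow> P x = Q x"
  shows "P = Q"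
proof
  fix x
  obtain x0 where x0: "x0 \<in> U" using assms(4) by blast
  have pd: "polynomial_deg_le (max m n) (\<lambda>x. P x - Q x)"
    by (intro polynomial_deg_le_diff polynomial_deg_le_mono[OF assms(1)] polynomial_deg_le_mono[OF assms(2)]) auto
  have "P x - Q x = 0" by (rule polynomial_deg_le_eq_0[OF pd assms(3) x0]) (simp add: assms(5))
  then show "P x = Q x" by simp
qed

text \<open>A shape regular triangulation, as yet without a domain.\<close>
locale regular_mesh =
  fixes T :: "(real ^ 'd) set set" and s :: real
  assumes T: "triangulation T" and reg: "\<And>K. K \<in> T \<Longrightarrow> regular s K"
    and d2: "CARD('d) \<ge> 2" and s1: "s \<ge> 1"
begin

lemma finite_T [simp]: "finite T" using T by (simp add: triangulation_def)

lemma simplexT: "K \<in> T \<Longrightarrow> full_simplex K"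
  using reg unfolding regular_def by (simp add: full_simplex_def)

lemma compactT: "K \<in> T \<Longrightarrow> compact K" and interiorT: "K \<in> T \<Longrightarrow> interior K \<noteq> {}"
  and closureT: "K \<in> T \<Longrightarrow> closure (interior K) = K" and convexT: "K \<in> T \<Longrightarrow> convex K"
  by (simp_all add: full_simplex.compact[OF simplexT] full_simplex.interior_nonempty[OF simplexT]
        full_simplex.closure_interior[OF simplexT] full_simplex.convex[OF simplexT])

text \<open>The intersection of two elements is a face of both, and a proper face misses the interior.\<close>
lemma disjoint_interior:
  assumes K: "K \<in> T" "K' \<in> T" "K \<noteq> K'"
  shows "K \<inter> interior K' = {}"
proof -
  have f: "(K \<inter> K') face_of K" "(K' \<inter> K) face_of K'" using T K unfolding triangulation_def by blast+
  show ?thesis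
  proof (cases "K' \<inter> K = K'")
    case True
    then have "K' face_of K" using f(1) by (simp add: Int_commute)
    then have "K' \<inter> interior K = {}" using K(3) by (intro face_of_disjoint_interior) auto
    moreover have "interior K' \<subseteq> K'" "interior K' \<subseteq> interior K" using True interior_subset interior_mono[of K' K] by auto
    ultimately show ?thesis using interiorT[OF K(2)] by blast
  next
    case False
    from face_of_disjoint_interior[OF f(2) False] show ?thesis using interior_subset by blast
  qed
qed

lemma interior_unique: "K \<in> T \<Longrightarrow> K' \<in> T \<Longrightarrow> x \<in> interior K \<Longrightarrow> x \<in> interior K' \<Longrightarrow> K = K'"
  using disjoint_interior[of K K'] interior_subset by blast

lemma glue_interior: "K \<in> T \<Longrightarrow> x \<in> interior K \<Longrightarrow> glue T P x = P K x"
proof -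
  assume K: "K \<in> T" and x: "x \<in> interior K"
  have "glue T P x = (\<Sum>K'\<in>T. if K' = K then P K x else 0)"
    unfolding glue_def
  proof (intro sum.cong refl)
    fix K' assume K': "K' \<in> T"
    show "indicator (interior K') x *\<^sub>R P K' x = (if K' = K then P K x else 0)"
    proof (cases "K' = K")
      case False
      then have "x \<notin> interior K'" using interior_unique[OF K' K _ x] by blast
      then show ?thesis using False by simp
    qed (simp add: x)
  qed
  then show ?thesis using K by simp
qed

lemma glue_outside: "x \<notin> (\<Union>K\<in>T. interior K) \<Longrightarrow> glue T P x = 0"
  unfolding glue_def by (intro sum.neutral) auto

lemma piece_eqI:
  assumes K: "K \<in> T" and "polynomial_deg_le m P" "\<And>x. x \<in> interior K \<Longrightarrow> v x = P x"
  shows "piece K v = P"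
proof -
  have "\<exists>P. (\<exists>m. polynomial_deg_le m P) \<and> (\<forall>x\<in>interior K. v x = P x)" using assms by blast
  from someI_ex[OF this] obtain n where "polynomial_deg_le n (piece K v)" "\<forall>x\<in>interior K. v x = piece K v x"
    unfolding piece_def by blast
  then show ?thesis using assms interiorT[OF K] by (intro polynomial_eqI[of n _ m _ "interior K"]) auto
qed

lemma piece_props:
  assumes "v \<in> V_h T k" "K \<in> T"
  shows "polynomial_deg_le k (piece K v)" "x \<in> interior K \<Longrightarrow> v x = piece K v x"
proof -
  obtain P where "polynomial_deg_le k P" "\<forall>x\<in>interior K. v x = P x"
    using assms unfolding V_h_def by blast
  moreover from this have "piece K v = P" using assms by (intro piece_eqI) auto
  ultimately show "polynomial_deg_le k (piece K v)" "x \<in> interior K \<Longrightarrow> v x = piece K v x" by auto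
qed

lemma V_h_outside: "v \<in> V_h T k \<Longrightarrow> x \<notin> (\<Union>K\<in>T. interior K) \<Longrightarrow> v x = 0"
  unfolding V_h_def by blast

lemma Q_h_outside: "q \<in> Q_h T k \<Longrightarrow> x \<notin> (\<Union>K\<in>T. interior K) \<Longrightarrow> q x = 0"
  using V_h_outside unfolding Q_h_def by (fastforce simp: vec_eq_iff)

lemma vpiece_props:
  assumes "q \<in> Q_h T k" "K \<in> T"
  shows "poly_field k (vpiece K q)" "x \<in> interior K \<Longrightarrow> q x = vpiece K q x"
proof -
  have V: "(\<lambda>x. q x $ i) \<in> V_h T k" for i using assms(1) by (simp add: Q_h_def)
  show "poly_field k (vpiece K q)"
    using piece_props(1)[OF V assms(2)] by (simp add: poly_field_def vpiece_def)
  show "x \<in> interior K \<Longrightarrow> q x = vpiece K q x"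
    using piece_props(2)[OF V assms(2)] by (simp add: vec_eq_iff vpiece_def)
qed

lemma vpiece_eqI:
  assumes K: "K \<in> T" and "poly_field m P" "\<And>x. x \<in> interior K \<Longrightarrow> q x = P x"
  shows "vpiece K q = P"
  using piece_eqI[OF K poly_fieldD[OF assms(2)]] assms(3) by (auto simp: vpiece_def fun_eq_iff vec_eq_iff)

lemma glue_in_V_h:
  assumes "\<And>K. K \<in> T \<Longrightarrow> polynomial_deg_le k (P K)"
  shows "glue T P \<in> V_h T k"
  unfolding V_h_def using assms glue_interior[of _ _ P] glue_outside[of _ P] by blast

lemma piece_glue: "(\<And>K. K \<in> T \<Longrightarrow> polynomial_deg_le k (P K)) \<Longrightarrow> K \<in> T \<Longrightarrow> piece K (glue T P) = P K"
  by (rule piece_eqI) (auto simp: glue_interior)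

lemma glue_in_Q_h:
  assumes "\<And>K. K \<in> T \<Longrightarrow> poly_field k (P K)"
  shows "glue T P \<in> Q_h T k"
proof -
  have "(\<lambda>x. glue T P x $ i) = glue T (\<lambda>K x. P K x $ i)" for i by (simp add: glue_def fun_eq_iff)
  then show ?thesis unfolding Q_h_def using glue_in_V_h[of k "\<lambda>K x. P K x $ _"] assms poly_fieldD by fastforce
qed

lemma vpiece_glue: "(\<And>K. K \<in> T \<Longrightarrow> poly_field k (P K)) \<Longrightarrow> K \<in> T \<Longrightarrow> vpiece K (glue T P) = P K"
  by (rule vpiece_eqI) (auto simp: glue_interior)

lemma glue_piece: "v \<in> V_h T k \<Longrightarrow> glue T (\<lambda>K. piece K v) = v"
  using glue_interior[of _ _ "\<lambda>K. piece K v"] glue_outside[of _ "\<lambda>K. piece K v"] piece_props(2) V_h_outside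
  by (metis (no_types, lifting) UN_E ext)

lemma piece_add: "v \<in> V_h T k \<Longrightarrow> w \<in> V_h T k \<Longrightarrow> K \<in> T \<Longrightarrow> piece K (v + w) = (\<lambda>x. piece K v x + piece K w x)"
  using piece_props by (intro piece_eqI polynomial_deg_le_add) auto

lemma piece_scaleR: "v \<in> V_h T k \<Longrightarrow> K \<in> T \<Longrightarrow> piece K (c *\<^sub>R v) = (\<lambda>x. c * piece K v x)"
  using piece_props by (intro piece_eqI polynomial_deg_le_cmult) auto

lemma vpiece_add: "p \<in> Q_h T k \<Longrightarrow> q \<in> Q_h T k \<Longrightarrow> K \<in> T \<Longrightarrow> vpiece K (p + q) = (\<lambda>x. vpiece K p x + vpiece K q x)"
  using vpiece_props by (intro vpiece_eqI poly_field_add) auto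

lemma vpiece_scaleR: "p \<in> Q_h T k \<Longrightarrow> K \<in> T \<Longrightarrow> vpiece K (c *\<^sub>R p) = (\<lambda>x. c *\<^sub>R vpiece K p x)"
  using vpiece_props by (intro vpiece_eqI poly_field_scaleR) auto

lemma subspace_V_h: "subspace (V_h T k)"
  unfolding subspace_def
proof safe
  show "0 \<in> V_h T k"
    unfolding V_h_def by (auto intro!: exI[of _ "\<lambda>_. 0"] simp: polynomial_deg_le_const)
next
  fix v w assume *: "v \<in> V_h T k" "w \<in> V_h T k"
  then have "v + w = glue T (\<lambda>K x. piece K v x + piece K w x)"
    using glue_piece[OF *(1)] glue_piece[OF *(2)]
    by (simp add: fun_eq_iff glue_def sum.distrib distrib_left)
  then show "v + w \<in> V_h T k" using * piece_props(1) by (auto intro!: glue_in_V_h polynomial_deg_le_add)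
next
  fix c :: real and v assume *: "v \<in> V_h T k"
  have "c *\<^sub>R glue T (\<lambda>K. piece K v) = glue T (\<lambda>K x. c * piece K v x)"
    unfolding fun_eq_iff glue_def scaleR_fun_apply scaleR_sum_right
    by (intro allI sum.cong refl) simp
  then have "c *\<^sub>R v = glue T (\<lambda>K x. c * piece K v x)" unfolding glue_piece[OF *] .
  then show "c *\<^sub>R v \<in> V_h T k" using * piece_props(1) by (auto intro!: glue_in_V_h polynomial_deg_le_cmult)
qed

lemma subspace_Q_h: "subspace (Q_h T k)"
proof -
  have "(\<lambda>x. (p + q) x $ i) = (\<lambda>x. p x $ i) + (\<lambda>x. q x $ i)" "(\<lambda>x. (c *\<^sub>R p) x $ i) = c *\<^sub>R (\<lambda>x. p x $ i)"
    "(\<lambda>x. 0 x $ i) = 0" for p q :: "real ^ 'd \<Rightarrow> real ^ 'd" and c i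
    by (auto simp: fun_eq_iff)
  moreover have "(\<lambda>x. 0) \<in> V_h T k" using subspace_0[OF subspace_V_h[of k]] by (simp add: zero_fun_def)
  ultimately show ?thesis
    unfolding subspace_def Q_h_def using subspace_V_h[of k] unfolding subspace_def by simp
qed

lemma V_h_finite_dim: "\<exists>B. finite B \<and> V_h T k \<subseteq> span B"
proof (intro exI conjI subsetI)
  define B where "B = (\<lambda>(K, P). \<lambda>x. indicator (interior K) x *\<^sub>R P x) ` (T \<times> monomials k)"
  show "finite B" unfolding B_def
    by (intro finite_imageI finite_cartesian_product finite_T finite_exponents)
  fix v assume v: "v \<in> V_h T k"
  have lin: "(\<lambda>x. indicator (interior K) x *\<^sub>R P x) \<in> span B" if K: "K \<in> T" and P: "polynomial_deg_le k P" for K and P :: "real ^ 'd \<Rightarrow> real"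
    using P
  proof (induction rule: polynomial_deg_le_induct)
    case zero
    have "(\<lambda>x. indicator (interior K) x *\<^sub>R (0 :: real ^ 'd \<Rightarrow> real) x) = 0" by (simp add: fun_eq_iff)
    then show ?case by (simp add: span_zero)
  next
    case (add P Q c)
    have "(\<lambda>x. indicator (interior K) x *\<^sub>R (c *\<^sub>R P + Q) x) =
      c *\<^sub>R (\<lambda>x. indicator (interior K) x *\<^sub>R P x) + (\<lambda>x. indicator (interior K) x *\<^sub>R Q x)"
      by (simp add: fun_eq_iff algebra_simps)
    then show ?case using add by (simp only: span_add span_scale)
  next
    case (monomial t)
    then show ?case using K by (intro span_base) (auto simp: B_def image_iff intro!: bexI[of _ K])
  qed
  have "v = (\<Sum>K\<in>T. (\<lambda>x. indicator (interior K) x *\<^sub>R piece K v x))"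
    using glue_piece[OF v] by (simp add: fun_eq_iff glue_def)
  also have "\<dots> \<in> span B" by (intro span_sum lin piece_props(1)[OF v])
  finally show "v \<in> span B" .
qed

lemma Q_h_finite_dim: "\<exists>B. finite B \<and> Q_h T k \<subseteq> span B"
proof -
  obtain B where B: "finite B" "V_h T k \<subseteq> span B" using V_h_finite_dim by blast
  define B' where "B' = (\<lambda>(v, i). \<lambda>x. v x *\<^sub>R axis i (1::real)) ` (B \<times> (UNIV :: 'd set))"
  have "q \<in> span B'" if q: "q \<in> Q_h T k" for q
  proof -
    have lin: "(\<lambda>x. v x *\<^sub>R axis i (1::real)) \<in> span B'" if "v \<in> span B" for v and i :: 'd
      using that
    proof (induction rule: span_induct_alt)
      case base
      have "(\<lambda>x. (0 :: real ^ 'd \<Rightarrow> real) x *\<^sub>R axis i (1::real)) = (0 :: real ^ 'd \<Rightarrow> real ^ 'd)" by (simp add: fun_eq_iff)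
      then show ?case by (simp add: span_zero)
    next
      case (step c v w)
      have "(\<lambda>x. (c *\<^sub>R v + w) x *\<^sub>R axis i (1::real)) = c *\<^sub>R (\<lambda>x. v x *\<^sub>R axis i 1) + (\<lambda>x. w x *\<^sub>R axis i (1::real))"
        by (simp add: fun_eq_iff algebra_simps)
      moreover have "(\<lambda>x. v x *\<^sub>R axis i 1) \<in> span B'" using step by (intro span_base) (auto simp: B'_def)
      ultimately show ?case using step by (simp only: span_add span_scale)
    qed
    have "q = (\<Sum>i\<in>UNIV. (\<lambda>x. (q x $ i) *\<^sub>R axis i 1))"
      by (simp add: fun_eq_iff basis_expansion[symmetric] vec_eq_iff axis_def if_distrib cong: if_cong)
    also have "\<dots> \<in> span B'"
      using q B(2) unfolding Q_h_def by (intro span_sum lin) blast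
    finally show ?thesis .
  qed
  moreover have "finite B'" using B by (simp add: B'_def)
  ultimately show ?thesis by blast
qed

lemma measurable_glue:
  fixes P :: "(real ^ 'd) set \<Rightarrow> real ^ 'd \<Rightarrow> real"
  assumes "\<And>K. K \<in> T \<Longrightarrow> continuous_on UNIV (P K)"
  shows "glue T P \<in> borel_measurable borel"
proof -
  have "P K \<in> borel_measurable borel" if "K \<in> T" for K using assms[OF that] by (rule borel_measurable_continuous_onI)
  then show ?thesis unfolding glue_def
    by (intro borel_measurable_sum borel_measurable_scaleR borel_measurable_indicator) auto
qed

lemma measurable_V_h: "v \<in> V_h T k \<Longrightarrow> v \<in> borel_measurable borel"
  using measurable_glue[of "\<lambda>K. piece K v"] glue_piece[of v k] continuous_on_polynomial[OF piece_props(1)] by metis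

text \<open>Integrals over an element only see the interior, because the boundary of a convex set is negligible.
  Hence functions can be replaced by their polynomial pieces.\<close>
lemma integral_element:
  fixes g G :: "real ^ 'd \<Rightarrow> real"
  assumes K: "K \<in> T" and g: "g \<in> borel_measurable borel" and G: "continuous_on K G"
    and eq: "\<And>x. x \<in> interior K \<Longrightarrow> g x = G x"
  shows "(LINT x|lebesgue_on K. g x) = (LINT x:K|lborel. G x)"
proof -
  have Ks: "K \<in> sets borel" using borel_compact[OF compactT[OF K]] .
  note [measurable] = g Ks
  have [measurable]: "(\<lambda>x. indicator K x *\<^sub>R g x) \<in> borel_measurable borel" by measurable
  have "(LINT x|lebesgue_on K. g x) = (LINT x|lebesgue. indicator K x *\<^sub>R g x)"
    using Ks by (subst integral_restrict_space) auto
  also have "\<dots> = (LINT x|lborel. indicator K x *\<^sub>R g x)"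
    by (rule integral_completion) simp
  also have "\<dots> = (LINT x|lborel. indicator K x *\<^sub>R G x)"
  proof (rule integral_cong_AE)
    have "negligible (frontier K)" by (intro negligible_convex_frontier convexT K)
    then have "frontier K \<in> null_sets lborel"
      using null_sets_completion_iff[of "frontier K" lborel] by (simp add: negligible_iff_null_sets)
    then have "AE x in lborel. x \<notin> frontier K" by (rule AE_not_in)
    then show "AE x in lborel. indicator K x *\<^sub>R g x = indicator K x *\<^sub>R G x"
    proof eventually_elim
      case (elim x)
      then have "x \<in> K \<Longrightarrow> x \<in> interior K"
        using compact_imp_closed[OF compactT[OF K]] by (simp add: frontier_def)
      then show ?case using eq by (auto simp: indicator_def)
    qed
  qed (use borel_integrable_compact[OF compactT[OF K] G] in auto)
  finally show ?thesis unfolding set_lebesgue_integral_def .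
qed

lemma mesh_inner_V_h:
  assumes "v \<in> V_h T k" "w \<in> V_h T l"
  shows "mesh_inner T v w = (\<Sum>K\<in>T. LINT x:K|lborel. piece K v x * piece K w x)"
  unfolding mesh_inner_def inner_real_def
  using piece_props assms measurable_V_h
  by (intro sum.cong refl integral_element borel_measurable_times continuous_intros continuous_on_polynomial[OF piece_props(1)]) auto

text \<open>The Frechet derivative at an interior point is that of the polynomial piece, since the two functions agree
  nearby.\<close>
lemma div_h_interior:
  assumes q: "q \<in> Q_h T k" and K: "K \<in> T" and x: "x \<in> interior K"
  shows "div_h T q x = dvg (vpiece K q) x"
proof -
  have pf: "poly_field k (vpiece K q)" using vpiece_props(1)[OF q K] .
  define D where "D h = (\<chi> j. grad (\<lambda>y. vpiece K q y $ j) x \<bullet> h)" for h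
  have "((\<lambda>y. \<chi> j. vpiece K q y $ j) has_derivative D) (at x)"
    by (rule has_derivative_componentwise_within[THEN iffD2])
       (auto simp: D_def Basis_vec_def inner_axis intro!: polynomial_has_gradient[OF poly_fieldD[OF pf]])
  then have "(vpiece K q has_derivative D) (at x)" by simp
  then have "(q has_derivative D) (at x)"
    by (rule has_derivative_transform_within_open[OF _ open_interior x])
       (use vpiece_props(2)[OF q K] in auto)
  then have "frechet_derivative q (at x) = D" by (rule frechet_derivative_at[symmetric])
  then show ?thesis
    using x K unfolding div_h_def dvg_def by (auto simp: D_def inner_axis)
qed

lemma div_h_eq_glue: "q \<in> Q_h T k \<Longrightarrow> div_h T q = glue T (\<lambda>K. dvg (vpiece K q))"
proof
  fix x assume q: "q \<in> Q_h T k"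
  show "div_h T q x = glue T (\<lambda>K. dvg (vpiece K q)) x"
  proof (cases "x \<in> (\<Union>K\<in>T. interior K)")
    case True
    then obtain K where K: "K \<in> T" "x \<in> interior K" by blast
    show ?thesis using div_h_interior[OF q K] glue_interior[OF K, of "\<lambda>K. dvg (vpiece K q)"] by simp
  next
    case False
    then show ?thesis using glue_outside[OF False] unfolding div_h_def by auto
  qed
qed

lemma polynomial_deg_le_dvg_vpiece:
  assumes "q \<in> Q_h T (k + 1)" "K \<in> T"
  shows "polynomial_deg_le k (dvg (vpiece K q))"
  using polynomial_deg_le_dvg[OF vpiece_props(1)[OF assms]] by simp

lemma div_h_in: 
  assumes "q \<in> Q_h T (k + 1)"
  shows "div_h T q \<in> V_h T k"
  unfolding div_h_eq_glue[OF assms] by (intro glue_in_V_h polynomial_deg_le_dvg_vpiece[OF assms])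

lemma piece_div_h: 
  assumes "q \<in> Q_h T (k + 1)" "K \<in> T"
  shows "piece K (div_h T q) = dvg (vpiece K q)"
  unfolding div_h_eq_glue[OF assms(1)]
  by (rule piece_glue[OF polynomial_deg_le_dvg_vpiece[OF assms(1)] assms(2)])

text \<open>Every point of an element is a limit point of its interior, so the limit from inside is the value of the
  polynomial piece.\<close>
lemma trace_from_in:
  fixes v :: "real ^ 'd \<Rightarrow> 'b::t2_space"
  assumes K: "K \<in> T" and x: "x \<in> K" and P: "continuous_on UNIV P" and eq: "\<And>y. y \<in> interior K \<Longrightarrow> v y = P y"
  shows "trace_from K v x = P x"
proof -
  have "x islimpt interior K"
  proof (cases "x \<in> interior K")
    case True
    then show ?thesis using interior_limit_point[of x "interior K"] by simp
  next
    case False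
    then show ?thesis using closureT[OF K] x unfolding closure_def by auto
  qed
  then have nt: "\<not> trivial_limit (at x within interior K)" by (simp add: trivial_limit_within)
  have "isCont P x" using P by (simp add: continuous_on_eq_continuous_at)
  then have "(P \<longlongrightarrow> P x) (at x within interior K)" unfolding isCont_def by (rule tendsto_within_subset) simp
  then have "(v \<longlongrightarrow> P x) (at x within interior K)"
    by (rule Lim_transform_eventually) (use eq in \<open>auto simp: eventually_at_filter\<close>)
  then show ?thesis unfolding trace_from_def using tendsto_Lim[OF nt] by blast
qed

text \<open>Away from the element the limit is taken along the trivial filter, hence the trace is some
  constant there. This makes it a Borel function.\<close>
lemma trace_from_out:
  fixes v :: "real ^ 'd \<Rightarrow> 'b::t2_space"
  assumes K: "K \<in> T" and x: "x \<notin> K"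
  shows "trace_from K v x = (THE l. True)"
proof -
  have "\<not> x islimpt interior K" using closureT[OF K] x unfolding closure_def by auto
  then have "at x within interior K = bot" by (simp add: trivial_limit_within[symmetric] trivial_limit_def)
  then show ?thesis unfolding trace_from_def by (simp add: t2_space_class.Lim_def)
qed

lemma measurable_trace_from:
  fixes v P :: "real ^ 'd \<Rightarrow> 'b::{second_countable_topology, t2_space}"
  assumes K: "K \<in> T" and P: "continuous_on UNIV P" and eq: "\<And>y. y \<in> interior K \<Longrightarrow> v y = P y"
  shows "trace_from K v \<in> borel_measurable borel"
proof -
  have "trace_from K v = (\<lambda>x. if x \<in> K then P x else (THE l. True))"
    using trace_from_in[OF K _ P eq] trace_from_out[OF K, of _ v] by (intro ext) simp
  moreover have "P \<in> borel_measurable borel" using P by (rule borel_measurable_continuous_onI)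
  ultimately show ?thesis using borel_compact[OF compactT[OF K]] by (simp add: measurable_If_set)
qed

end

context regular_mesh
begin

section \<open>Faces of the mesh\<close>

definition faces :: "(real ^ 'd) set set" where
  "faces = {e. \<exists>K\<in>T. e facet_of K}"

definition sides :: "(real ^ 'd) set \<Rightarrow> (real ^ 'd) set set" where
  "sides e = {K \<in> T. e facet_of K}"

abbreviation nml :: "(real ^ 'd) set \<Rightarrow> (real ^ 'd) set \<Rightarrow> real ^ 'd" where
  "nml \<equiv> outward_normal"

lemma finite_sides [simp]: "finite (sides e)" by (simp add: sides_def)

lemma sides_sub: "K \<in> sides e \<Longrightarrow> K \<in> T" "K \<in> sides e \<Longrightarrow> e facet_of K" by (auto simp: sides_def)

lemma interior_faces_sub: "e \<in> interior_faces T \<Longrightarrow> e \<in> faces"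
  unfolding interior_faces_def faces_def by blast

lemma facets_eq: "K \<in> T \<Longrightarrow> {e. e facet_of K} = opp_face K ` verts K"
  using full_simplex.facet_iff[OF simplexT] by auto

lemma finite_faces [simp]: "finite faces"
proof -
  have "faces = (\<Union>K\<in>T. {e. e facet_of K})" unfolding faces_def by blast
  then have "faces = (\<Union>K\<in>T. opp_face K ` verts K)" by (simp add: facets_eq cong: SUP_cong)
  then show ?thesis using full_simplex.finite_verts[OF simplexT] by simp
qed

lemma finite_interior_faces [simp]: "finite (interior_faces T)"
  by (rule finite_subset[OF _ finite_faces]) (use interior_faces_sub in auto)

text \<open>The bookkeeping behind all global estimates: boundary terms are summed over elements and their faces,
  and regrouped by faces and their adjacent elements.\<close>
lemma sum_elements_faces:
  "(\<Sum>K\<in>T. \<Sum>a\<in>verts K. f K (opp_face K a)) = (\<Sum>e\<in>faces. \<Sum>K\<in>sides e. (f K e :: real))"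
proof -
  have "(\<Sum>a\<in>verts K. f K (opp_face K a)) = (\<Sum>e\<in>{e\<in>faces. e facet_of K}. f K e)" if K: "K \<in> T" for K
  proof -
    have "{e\<in>faces. e facet_of K} = opp_face K ` verts K"
      using facets_eq[OF K] K unfolding faces_def by blast
    moreover have "inj_on (opp_face K) (verts K)"
      by (intro inj_onI full_simplex.opp_face_inj[OF simplexT[OF K]])
    ultimately show ?thesis by (simp add: sum.reindex)
  qed
  then have "(\<Sum>K\<in>T. \<Sum>a\<in>verts K. f K (opp_face K a)) = (\<Sum>K\<in>T. \<Sum>e\<in>{e\<in>faces. e facet_of K}. f K e)"
    by simp
  also have "\<dots> = (\<Sum>e\<in>faces. \<Sum>K\<in>{K\<in>T. e facet_of K}. f K e)"
    by (rule sum.swap_restrict) auto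
  finally show ?thesis by (simp add: sides_def)
qed

lemma side_vertex:
  assumes "K \<in> sides e"
  obtains a where "a \<in> verts K" "e = opp_face K a"
  using full_simplex.facet_iff[OF simplexT[OF sides_sub(1)[OF assms]], of e] sides_sub(2)[OF assms] that
  by blast

lemma side_flat:
  assumes K: "K \<in> sides e"
  obtains \<beta> where "flat_face (nml K e) \<beta> e"
proof -
  obtain a where a: "a \<in> verts K" "e = opp_face K a" using side_vertex[OF K] .
  have "flat_face (nml K e) (offs K a) e"
    using full_simplex.flat_face[OF simplexT[OF sides_sub(1)[OF K]] a(1)] unfolding nrm_def a(2) .
  then show ?thesis by (rule that)
qed

lemma norm_nml: "K \<in> sides e \<Longrightarrow> norm (nml K e) = 1"
  by (erule side_flat) (rule flat_face.n)

lemma side_subset: 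
  assumes K: "K \<in> sides e"
  shows "e \<subseteq> K"
proof -
  obtain a where a: "a \<in> verts K" "e = opp_face K a" using side_vertex[OF K] .
  show ?thesis
    using full_simplex.opp_face_subset[OF simplexT[OF sides_sub(1)[OF K]] a(1)] unfolding a(2) .
qed

lemma face_flat:
  assumes "e \<in> faces"
  obtains n \<beta> where "flat_face n \<beta> e"
proof -
  obtain K where "K \<in> sides e" using assms by (auto simp: faces_def sides_def)
  then obtain \<beta> where "flat_face (nml K e) \<beta> e" by (rule side_flat)
  then show ?thesis using that by blast
qed

text \<open>If two elements lay on the same side of a common facet, then points just below the barycentre of the
  facet would be interior to both.\<close>
lemma opposite_normals:
  assumes K: "K \<in> sides e" "K' \<in> sides e" "K \<noteq> K'"
  shows "nml K' e = - nml K e"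
proof (rule ccontr)
  assume ne: "nml K' e \<noteq> - nml K e"
  interpret S: full_simplex K using simplexT K sides_sub by blast
  interpret S': full_simplex K' using simplexT K sides_sub by blast
  obtain a where a: "a \<in> verts K" "e = opp_face K a" using side_vertex[OF K(1)] .
  obtain a' where a': "a' \<in> verts K'" "e = opp_face K' a'" using side_vertex[OF K(2)] .
  define n where "n = nml K e"
  have n: "n = nrm K a" "norm n = 1" using a norm_nml[OF K(1)] by (auto simp: n_def nrm_def)
  have hull: "affine hull e = {x. n \<bullet> x = offs K a}" using S.nrm_props(2)[OF a(1)] a(2) n by simp
  obtain \<beta>' where ff: "flat_face (nml K' e) \<beta>' e" using side_flat[OF K(2)] .
  have "\<forall>x\<in>e. \<forall>y\<in>e. nml K' e \<bullet> (y - x) = 0" by (simp add: inner_diff_right flat_face.eH[OF ff])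
  then have n': "nrm K' a' = n"
    using normal_unique[OF n(2) norm_nml[OF K(2)] hull] ne a'(2) by (simp add: n_def nrm_def)
  have "verts K - {a} = {v. v extreme_point_of e}"
    unfolding a(2) opp_face_def
    using extreme_point_of_convex_hull_affine_independent[OF affine_independent_Diff[OF S.verts_props(1)], of _ "{a}"] by blast
  moreover have "verts K' - {a'} = {v. v extreme_point_of e}"
    unfolding a'(2) opp_face_def
    using extreme_point_of_convex_hull_affine_independent[OF affine_independent_Diff[OF S'.verts_props(1)], of _ "{a'}"] by blast
  ultimately have V: "verts K' - {a'} = verts K - {a}" by simp
  define d where "d = real CARD('d)"
  have d: "d > 0" by (simp add: d_def)
  define x where "x = (\<Sum>v\<in>verts K - {a}. (1 / d) *\<^sub>R v)"
  have near: "\<forall>\<^sub>F t in at_right 0. x - t *\<^sub>R n \<in> interior L"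
    if L: "full_simplex L" "b \<in> verts L" "nrm L b = n" "verts L - {b} = verts K - {a}" for L b
  proof -
    interpret L: full_simplex L by (rule L(1))
    have card: "card (verts L - {b}) = CARD('d)" using L.card_opp[OF L(2)] .
    define u where "u v = (if v = b then 0 else 1 / d)" for v
    have "sum u (verts L - {b}) = (\<Sum>v\<in>verts L - {b}. 1 / d)"
      by (intro sum.cong) (auto simp: u_def)
    also have "\<dots> = d * (1 / d)" by (simp only: sum_constant card d_def)
    also have "\<dots> = 1" using d by simp
    finally have s1: "sum u (verts L - {b}) = 1" .
    have ub: "u b = 0" by (simp add: u_def)
    have u1: "sum u (verts L) = 1"
      unfolding sum.remove[OF L.finite_verts L(2), of u] s1 ub by simp
    have "(\<Sum>v\<in>verts L - {b}. u v *\<^sub>R v) = (\<Sum>v\<in>verts L - {b}. (1 / d) *\<^sub>R v)"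
      by (intro sum.cong) (auto simp: u_def)
    then have "(\<Sum>v\<in>verts L. u v *\<^sub>R v) = (\<Sum>v\<in>verts L - {b}. (1 / d) *\<^sub>R v)"
      unfolding sum.remove[OF L.finite_verts L(2), of "\<lambda>v. u v *\<^sub>R v"] ub by simp
    then have x: "(\<Sum>v\<in>verts L. u v *\<^sub>R v) = x" unfolding x_def L(4) .
    have lx: "lam L v x = u v" if "v \<in> verts L" for v
      using L.lam_combination[OF u1 that] unfolding x .
    have "\<forall>\<^sub>F t in at_right 0. 0 < lam L v (x - t *\<^sub>R n)" if v: "v \<in> verts L" for v
    proof (cases "v = b")
      case True
      have "lam L b (x - t *\<^sub>R n) = t / hgt L b" for t
        using lx[OF L(2)] L(3) n(2) L.nrm_props(3)[OF L(2)]
        by (simp add: lam_def u_def inner_diff_right norm_eq_1 diff_divide_distrib)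
      moreover have "\<forall>\<^sub>F t in at_right 0. 0 < t / hgt L b"
        using eventually_at_right_less[of "0 :: real"]
        by eventually_elim (use L.nrm_props(3)[OF L(2)] in simp)
      ultimately show ?thesis using True by simp
    next
      case False
      have "((\<lambda>t. lam L v (x - t *\<^sub>R n)) \<longlongrightarrow> lam L v (x - 0 *\<^sub>R n)) (at_right 0)"
        unfolding lam_def divide_inverse by (intro tendsto_intros)
      moreover have "0 < lam L v (x - 0 *\<^sub>R n)" using lx[OF v] False d by (simp add: u_def)
      ultimately show ?thesis by (rule order_tendstoD(1))
    qed
    then have "\<forall>\<^sub>F t in at_right 0. \<forall>v\<in>verts L. 0 < lam L v (x - t *\<^sub>R n)"
      by (intro eventually_ball_finite) auto
    then show ?thesis by eventually_elim (use L.lam_pos_interior in blast)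
  qed
  have "\<forall>\<^sub>F t in at_right 0. x - t *\<^sub>R n \<in> interior K \<and> x - t *\<^sub>R n \<in> interior K'"
    using near[OF S.full_simplex_axioms a(1) n(1)[symmetric] refl]
      near[OF S'.full_simplex_axioms a'(1) n' V] by eventually_elim simp
  then obtain t :: real where "x - t *\<^sub>R n \<in> interior K \<and> x - t *\<^sub>R n \<in> interior K'"
    using eventually_happens trivial_limit_at_right_real by blast
  then show False using interior_unique K sides_sub by blast
qed

text \<open>A third element at a face would have a normal opposite to two opposite vectors.\<close>
lemma sides_cases:
  assumes e: "e \<in> faces"
  obtains (boundary) K where "sides e = {K}" "e \<notin> interior_faces T"
    | (inner) K K' where "K \<noteq> K'" "sides e = {K, K'}" "nml K' e = - nml K e" "e \<in> interior_faces T"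
proof -
  obtain K where K: "K \<in> sides e" using e by (auto simp: faces_def sides_def)
  show ?thesis
  proof (cases "sides e = {K}")
    case True
    then have "e \<notin> interior_faces T" unfolding interior_faces_def sides_def by blast
    then show ?thesis using True boundary by blast
  next
    case False
    then obtain K' where K': "K' \<in> sides e" "K' \<noteq> K" using K by blast
    have "K'' = K \<or> K'' = K'" if K'': "K'' \<in> sides e" for K''
    proof (rule ccontr)
      assume ne: "\<not> (K'' = K \<or> K'' = K')"
      have "nml K' e = - nml K e" "nml K'' e = - nml K e" "nml K'' e = - nml K' e"
        using opposite_normals[OF K K'(1)] opposite_normals[OF K K''] opposite_normals[OF K'(1) K''] K' ne by auto
      then have "nml K e = - nml K e" by simp
      then have "nml K e = 0" by (simp add: eq_neg_iff_add_eq_0 flip: scaleR_2)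
      then show False using norm_nml[OF K] by simp
    qed
    then have "sides e = {K, K'}" using K K' by blast
    moreover have "e \<in> interior_faces T" unfolding interior_faces_def using K K' sides_sub by blast
    ultimately show ?thesis using inner[of K K'] opposite_normals[OF K K'(1)] K' by blast
  qed
qed

lemma card_sides: "e \<in> faces \<Longrightarrow> card (sides e) \<le> 2"
  by (cases e rule: sides_cases) auto

section \<open>Integrals over faces\<close>

abbreviation fint :: "(real ^ 'd) set \<Rightarrow> (real ^ 'd \<Rightarrow> real) \<Rightarrow> real" where
  "fint e g \<equiv> (LINT x|face_measure e. g x)"

lemma fint_integrable: "e \<in> faces \<Longrightarrow> continuous_on UNIV g \<Longrightarrow> integrable (face_measure e) (g :: _ \<Rightarrow> real)"
  by (erule face_flat, rule flat_face.integrable_face[where g=g])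
     (auto intro: borel_measurable_continuous_onI continuous_on_subset)

lemma fint_add: "e \<in> faces \<Longrightarrow> continuous_on UNIV f \<Longrightarrow> continuous_on UNIV g \<Longrightarrow>
    fint e (\<lambda>x. f x + g x) = fint e f + fint e g"
  by (intro Bochner_Integration.integral_add fint_integrable)

lemma fint_sum: "e \<in> faces \<Longrightarrow> (\<And>i. i \<in> I \<Longrightarrow> continuous_on UNIV (f i)) \<Longrightarrow>
    fint e (\<lambda>x. \<Sum>i\<in>I. f i x) = (\<Sum>i\<in>I. fint e (f i))"
  by (intro Bochner_Integration.integral_sum fint_integrable)

lemma fint_cong: 
  assumes "e \<in> faces" "f \<in> borel_measurable borel" "g \<in> borel_measurable borel" "\<And>x. x \<in> e \<Longrightarrow> f x = g x"
  shows "fint e f = fint e g"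
proof -
  obtain n \<beta> where "flat_face n \<beta> e" using face_flat[OF assms(1)] .
  then show ?thesis using assms(2-4) by (rule flat_face.face_integral_cong)
qed

lemma fint_mono:
  assumes e: "e \<in> faces" and c: "continuous_on UNIV f" "continuous_on UNIV g" and le: "\<And>x. x \<in> e \<Longrightarrow> f x \<le> g x"
  shows "fint e f \<le> fint e g"
proof -
  obtain n \<beta> where "flat_face n \<beta> e" using face_flat[OF e] .
  then interpret flat_face n \<beta> e .
  show ?thesis using AE_face_measure le
    by (intro integral_mono_AE fint_integrable assms(1) c) (auto elim!: eventually_mono)
qed

lemma fint_nonneg: "(\<And>x. 0 \<le> f x) \<Longrightarrow> 0 \<le> fint e f"
  by (intro Bochner_Integration.integral_nonneg)

definition njump :: "(real ^ 'd) set \<Rightarrow> (real ^ 'd \<Rightarrow> real ^ 'd) \<Rightarrow> real ^ 'd \<Rightarrow> real" where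
  "njump e q x = (\<Sum>K\<in>sides e. vpiece K q x \<bullet> nml K e)"

definition avg :: "(real ^ 'd) set \<Rightarrow> (real ^ 'd \<Rightarrow> real) \<Rightarrow> real ^ 'd \<Rightarrow> real" where
  "avg e v x = 1/2 * (\<Sum>K\<in>sides e. piece K v x)"

text \<open>The jump of a scalar function is the vector \<open>v\<^sup>+ n\<^sup>+ + v\<^sup>- n\<^sup>-\<close>, and \<open>v n\<close> on the boundary.\<close>
definition vjump :: "(real ^ 'd) set \<Rightarrow> (real ^ 'd \<Rightarrow> real) \<Rightarrow> real ^ 'd \<Rightarrow> real ^ 'd" where
  "vjump e v x = (\<Sum>K\<in>sides e. piece K v x *\<^sub>R nml K e)"

lemma continuous_piece: "v \<in> V_h T k \<Longrightarrow> K \<in> T \<Longrightarrow> continuous_on S (piece K v)"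
  using continuous_on_polynomial[OF piece_props(1)] .

lemma continuous_vpiece: "q \<in> Q_h T k \<Longrightarrow> K \<in> T \<Longrightarrow> continuous_on S (vpiece K q)"
  using continuous_on_poly_field[OF vpiece_props(1)] .

lemma continuous_njump: "q \<in> Q_h T k \<Longrightarrow> continuous_on S (njump e q)"
  unfolding njump_def by (intro continuous_intros continuous_vpiece) (auto dest: sides_sub)

lemma continuous_avg: "v \<in> V_h T k \<Longrightarrow> continuous_on S (avg e v)"
  unfolding avg_def by (intro continuous_intros continuous_piece) (auto dest: sides_sub)

lemma continuous_vjump: "v \<in> V_h T k \<Longrightarrow> continuous_on S (vjump e v)"
  unfolding vjump_def by (intro continuous_intros continuous_piece) (auto dest: sides_sub)

lemma jump_eq: 
  assumes q: "q \<in> Q_h T k" and x: "x \<in> e"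
  shows "jump T e q x = njump e q x"
  unfolding jump_def njump_def sides_def[symmetric]
proof (intro sum.cong refl)
  fix K assume K: "K \<in> sides e"
  then have KT: "K \<in> T" "x \<in> K" using subsetD[OF side_subset[OF K] x] sides_sub(1)[OF K] by auto
  show "trace_from K q x \<bullet> nml K e = vpiece K q x \<bullet> nml K e"
    using trace_from_in[OF KT continuous_vpiece[OF q KT(1)] vpiece_props(2)[OF q KT(1)]] by simp
qed

lemma measurable_jump: "q \<in> Q_h T k \<Longrightarrow> jump T e q \<in> borel_measurable borel"
  unfolding jump_def sides_def[symmetric]
  by (intro borel_measurable_sum borel_measurable_inner borel_measurable_const
        measurable_trace_from[OF _ continuous_vpiece])
     (auto dest: sides_sub intro: vpiece_props(2)[OF _ sides_sub(1)])

lemma average_eq: 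
  assumes v: "v \<in> V_h T k" and x: "x \<in> e"
  shows "average T e v x = avg e v x"
  unfolding average_def avg_def sides_def[symmetric]
proof (intro arg_cong2[of _ _ _ _ "(*)"] sum.cong refl)
  fix K assume K: "K \<in> sides e"
  then have KT: "K \<in> T" "x \<in> K" using subsetD[OF side_subset[OF K] x] sides_sub(1)[OF K] by auto
  show "trace_from K v x = piece K v x"
    using trace_from_in[OF KT continuous_piece[OF v KT(1)] piece_props(2)[OF v KT(1)]] by simp
qed

lemma measurable_average: "v \<in> V_h T k \<Longrightarrow> average T e v \<in> borel_measurable borel"
  unfolding average_def sides_def[symmetric]
  by (intro borel_measurable_sum borel_measurable_times borel_measurable_const
        measurable_trace_from[OF _ continuous_piece])
     (auto dest: sides_sub intro: piece_props(2)[OF _ sides_sub(1)])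

lemma face_inner_jump_jump:
  assumes "e \<in> faces" "p \<in> Q_h T k" "q \<in> Q_h T l"
  shows "face_inner e (jump T e p) (jump T e q) = fint e (\<lambda>x. njump e p x * njump e q x)"
  unfolding face_inner_def using assms
  by (intro fint_cong borel_measurable_times measurable_jump borel_measurable_continuous_onI continuous_intros continuous_njump)
     (auto simp: jump_eq)

lemma face_inner_jump_average:
  assumes "e \<in> faces" "p \<in> Q_h T k" "v \<in> V_h T l"
  shows "face_inner e (jump T e p) (average T e v) = fint e (\<lambda>x. njump e p x * avg e v x)"
  unfolding face_inner_def using assms
  by (intro fint_cong borel_measurable_times measurable_jump measurable_average borel_measurable_continuous_onI continuous_intros continuous_njump continuous_avg)
     (auto simp: jump_eq average_eq)

lemma weighted_jumps_eq:
  assumes "p \<in> Q_h T k" "q \<in> Q_h T l"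
  shows "weighted_jumps T \<eta> p q = (\<Sum>e\<in>interior_faces T. \<eta> e * inverse (diameter e) * fint e (\<lambda>x. njump e p x * njump e q x))"
  unfolding weighted_jumps_def using face_inner_jump_jump[OF interior_faces_sub assms] by simp

lemma b_MDG_eq:
  assumes "q \<in> Q_h T (k + 1)" "v \<in> V_h T k"
  shows "b_MDG T q v = - (\<Sum>K\<in>T. LINT x:K|lborel. dvg (vpiece K q) x * piece K v x)
    + (\<Sum>e\<in>interior_faces T. fint e (\<lambda>x. njump e q x * avg e v x))"
  unfolding b_MDG_def mesh_inner_V_h[OF div_h_in[OF assms(1)] assms(2)]
  using face_inner_jump_average[OF interior_faces_sub assms] piece_div_h[OF assms(1)] by simp

lemma side_sizes:
  assumes K: "K \<in> sides e"
  shows "0 < diameter e" "diameter e \<le> diameter K" "diameter K \<le> s * diameter e"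
proof -
  have KT: "K \<in> T" using K sides_sub by blast
  obtain r c where "regular_simplex K s r c" using regularE[OF reg[OF KT]] .
  then interpret regular_simplex K s r c .
  obtain a where a: "a \<in> verts K" "e = opp_face K a" using side_vertex[OF K] .
  have re: "r \<le> diameter e" using r_le_diam_face[OF a(1) d2] a by simp
  then show "0 < diameter e" using r by simp
  show "diameter e \<le> diameter K"
    using side_subset[OF K] compact by (intro diameter_subset compact_imp_bounded)
  show "diameter K \<le> s * diameter e"
    using diam_le mult_left_mono[OF re, of s] s1 by linarith
qed

lemma face_diameter_pos: "e \<in> faces \<Longrightarrow> 0 < diameter e"
  using side_sizes(1) unfolding faces_def sides_def by blast

end

context regular_mesh
begin

section \<open>Stability on a mesh\<close>

definition mass :: "(real ^ 'd \<Rightarrow> real) \<Rightarrow> real" where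
  "mass w = (\<Sum>K\<in>T. LINT x:K|lborel. (piece K w x)\<^sup>2)"

definition gsq :: "(real ^ 'd \<Rightarrow> real) \<Rightarrow> real" where
  "gsq w = (\<Sum>K\<in>T. LINT x:K|lborel. (norm (grad (piece K w) x))\<^sup>2)"

text \<open>The sum runs over all faces, also those on the boundary. The scheme imposes the boundary condition
  \<open>u = 0\<close> weakly, so the values on the boundary count as jumps.\<close>
definition jsq :: "(real ^ 'd \<Rightarrow> real) \<Rightarrow> real" where
  "jsq w = (\<Sum>e\<in>faces. 1 / diameter e * fint e (\<lambda>x. (norm (vjump e w x))\<^sup>2))"

lemma mass_nonneg: "0 \<le> mass w" and gsq_nonneg: "0 \<le> gsq w"
  unfolding mass_def gsq_def by (intro sum_nonneg set_integral_cont_nonneg; simp)+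

lemma jsq_nonneg: "0 \<le> jsq w"
  unfolding jsq_def using face_diameter_pos
  by (intro sum_nonneg mult_nonneg_nonneg fint_nonneg) (auto simp: less_imp_le)

text \<open>Every element has \<open>N\<close> vertices, and as many faces.\<close>
definition N :: real where "N = real (CARD('d) + 1)"

text \<open>The constant of the trace inequality is a parameter, so that it can be chosen before the mesh.\<close>
context
  fixes Ct :: real and k :: nat
  assumes Ct: "Ct \<ge> 0" "\<And>(K :: (real ^ 'd) set) a P. regular s K \<Longrightarrow> a \<in> verts K \<Longrightarrow> polynomial_deg_le k P \<Longrightarrow>
    diameter K * (LINT x|face_measure (opp_face K a). (P x)\<^sup>2) \<le> Ct * (LINT x:K|lborel. (P x)\<^sup>2)"
begin

lemma face_mass_bound:
  assumes w: "w \<in> V_h T k"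
  shows "(\<Sum>e\<in>faces. diameter e * (\<Sum>K\<in>sides e. fint e (\<lambda>x. (piece K w x)\<^sup>2))) \<le> N * Ct * mass w"
proof -
  have "(\<Sum>e\<in>faces. diameter e * (\<Sum>K\<in>sides e. fint e (\<lambda>x. (piece K w x)\<^sup>2)))
      \<le> (\<Sum>e\<in>faces. \<Sum>K\<in>sides e. diameter K * fint e (\<lambda>x. (piece K w x)\<^sup>2))"
    unfolding sum_distrib_left
    by (intro sum_mono mult_right_mono side_sizes fint_nonneg) auto
  also have "\<dots> = (\<Sum>K\<in>T. \<Sum>a\<in>verts K. diameter K * fint (opp_face K a) (\<lambda>x. (piece K w x)\<^sup>2))"
    by (rule sum_elements_faces[symmetric])
  also have "\<dots> \<le> (\<Sum>K\<in>T. \<Sum>a\<in>verts K. Ct * (LINT x:K|lborel. (piece K w x)\<^sup>2))"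
    by (intro sum_mono Ct(2) reg piece_props(1)[OF w])
  also have "\<dots> = N * Ct * mass w"
    unfolding mass_def sum_distrib_left
    using full_simplex.verts_props(2)[OF simplexT] by (intro sum.cong) (auto simp: N_def)
  finally show ?thesis .
qed

text \<open>Young's inequality with weights \<open>\<eta>\<^sub>e / h\<^sub>e\<close> separates the jump from the average. The first part is the
  penalty term; in the second the trace inequality compensates the factor \<open>h\<^sub>e\<close>.\<close>
lemma jump_average_bound:
  assumes q: "q \<in> Q_h T l" and v: "v \<in> V_h T k" and \<eta>: "\<And>e. e \<in> interior_faces T \<Longrightarrow> \<eta>0 \<le> \<eta> e" "0 < \<eta>0" and t: "0 < t"
  shows "\<bar>\<Sum>e\<in>interior_faces T. fint e (\<lambda>x. njump e q x * avg e v x)\<bar>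
    \<le> t * weighted_jumps T \<eta> q q + N * Ct / \<eta>0 * mass v / t"
proof -
  have cj: "continuous_on UNIV (njump e q)" and ca: "continuous_on UNIV (avg e v)" for e
    using continuous_njump[OF q] continuous_avg[OF v] .
  have cp: "continuous_on UNIV (piece K v)" if "K \<in> sides e" for K e using continuous_piece[OF v sides_sub(1)[OF that]] .
  have one: "\<bar>fint e (\<lambda>x. njump e q x * avg e v x)\<bar> \<le>
      t * (\<eta> e * inverse (diameter e) * fint e (\<lambda>x. njump e q x * njump e q x))
      + 1 / (t * \<eta>0) * (diameter e * (\<Sum>K\<in>sides e. fint e (\<lambda>x. (piece K v x)\<^sup>2)))"
    if e: "e \<in> interior_faces T" for e
  proof -
    have eF: "e \<in> faces" using interior_faces_sub[OF e] .
    define D where "D = diameter e"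
    have D: "D > 0" unfolding D_def by (rule face_diameter_pos[OF eF])
    define \<kappa> where "\<kappa> = t * \<eta> e * inverse D"
    have \<eta>e: "0 < \<eta> e" "\<eta>0 \<le> \<eta> e" using \<eta>(1)[OF e] \<eta>(2) by auto
    have \<kappa>: "\<kappa> > 0" using t D \<eta>e by (simp add: \<kappa>_def)
    have i\<kappa>: "1 / \<kappa> \<le> D / (t * \<eta>0)"
    proof -
      have "1 / \<kappa> = D / (t * \<eta> e)" using D t \<eta>e by (simp add: \<kappa>_def field_simps)
      also have "\<dots> \<le> D / (t * \<eta>0)" using D t \<eta>e \<eta> by (intro divide_left_mono mult_left_mono) auto
      finally show ?thesis .
    qed
    have avg2: "(avg e v x)\<^sup>2 \<le> (\<Sum>K\<in>sides e. (piece K v x)\<^sup>2)" for x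
    proof -
      have "(\<Sum>K\<in>sides e. piece K v x)\<^sup>2 \<le> card (sides e) * (\<Sum>K\<in>sides e. (piece K v x)\<^sup>2)"
        by (rule sum_squares_le_card)
      also have "\<dots> \<le> 2 * (\<Sum>K\<in>sides e. (piece K v x)\<^sup>2)"
        using card_sides[OF eF] by (intro mult_right_mono sum_nonneg) auto
      also have "\<dots> \<le> 4 * (\<Sum>K\<in>sides e. (piece K v x)\<^sup>2)" by (intro mult_right_mono sum_nonneg) auto
      finally show ?thesis by (simp add: avg_def power_divide)
    qed
    have pt: "\<bar>njump e q x * avg e v x\<bar> \<le> \<kappa> * (njump e q x * njump e q x) + D / (t * \<eta>0) * (\<Sum>K\<in>sides e. (piece K v x)\<^sup>2)" for x
    proof -
      define a b where "a = \<bar>njump e q x\<bar>" and "b = \<bar>avg e v x\<bar>"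
      have ab0: "0 \<le> a" "0 \<le> b" by (auto simp: a_def b_def)
      have "0 \<le> (\<kappa> * a - b)\<^sup>2 / \<kappa>" using \<kappa> by simp
      also have "\<dots> = \<kappa> * (a * a) + 1 / \<kappa> * b\<^sup>2 - 2 * (a * b)" using \<kappa> by (simp add: power2_eq_square field_simps)
      finally have "a * b \<le> \<kappa> * (a * a) + 1 / \<kappa> * b\<^sup>2" using mult_nonneg_nonneg[OF ab0] by linarith
      moreover have "1 / \<kappa> * b\<^sup>2 \<le> D / (t * \<eta>0) * (\<Sum>K\<in>sides e. (piece K v x)\<^sup>2)"
        using i\<kappa> avg2[of x] \<kappa> D t \<eta> by (intro mult_mono) (auto simp: b_def)
      ultimately have "a * b \<le> \<kappa> * (a * a) + D / (t * \<eta>0) * (\<Sum>K\<in>sides e. (piece K v x)\<^sup>2)" by linarith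
      then show ?thesis by (simp add: a_def b_def abs_mult)
    qed
    have "\<bar>fint e (\<lambda>x. njump e q x * avg e v x)\<bar> \<le> fint e (\<lambda>x. \<bar>njump e q x * avg e v x\<bar>)"
      using integral_norm_bound[of "face_measure e" "\<lambda>x. njump e q x * avg e v x"] by simp
    also have "\<dots> \<le> fint e (\<lambda>x. \<kappa> * (njump e q x * njump e q x) + D / (t * \<eta>0) * (\<Sum>K\<in>sides e. (piece K v x)\<^sup>2))"
      by (intro fint_mono eF pt continuous_intros cj ca cp)
    also have "\<dots> = \<kappa> * fint e (\<lambda>x. njump e q x * njump e q x) + D / (t * \<eta>0) * (\<Sum>K\<in>sides e. fint e (\<lambda>x. (piece K v x)\<^sup>2))"
      by (subst fint_add[OF eF], intro continuous_intros cj, intro continuous_intros cp)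
         (simp_all add: fint_sum[OF eF] continuous_on_power cp)
    finally show ?thesis by (simp add: \<kappa>_def D_def mult_ac)
  qed
  have "\<bar>\<Sum>e\<in>interior_faces T. fint e (\<lambda>x. njump e q x * avg e v x)\<bar> \<le>
    (\<Sum>e\<in>interior_faces T. \<bar>fint e (\<lambda>x. njump e q x * avg e v x)\<bar>)" by (rule sum_abs)
  also have "\<dots> \<le> (\<Sum>e\<in>interior_faces T. t * (\<eta> e * inverse (diameter e) * fint e (\<lambda>x. njump e q x * njump e q x))
      + 1 / (t * \<eta>0) * (diameter e * (\<Sum>K\<in>sides e. fint e (\<lambda>x. (piece K v x)\<^sup>2))))"
    by (intro sum_mono one)
  also have "\<dots> = t * weighted_jumps T \<eta> q q
      + 1 / (t * \<eta>0) * (\<Sum>e\<in>interior_faces T. diameter e * (\<Sum>K\<in>sides e. fint e (\<lambda>x. (piece K v x)\<^sup>2)))"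
    unfolding weighted_jumps_eq[OF q q] by (simp add: sum.distrib sum_distrib_left)
  finally have 1: "\<bar>\<Sum>e\<in>interior_faces T. fint e (\<lambda>x. njump e q x * avg e v x)\<bar> \<le> t * weighted_jumps T \<eta> q q
      + 1 / (t * \<eta>0) * (\<Sum>e\<in>interior_faces T. diameter e * (\<Sum>K\<in>sides e. fint e (\<lambda>x. (piece K v x)\<^sup>2)))" .
  have "(\<Sum>e\<in>interior_faces T. diameter e * (\<Sum>K\<in>sides e. fint e (\<lambda>x. (piece K v x)\<^sup>2)))
      \<le> (\<Sum>e\<in>faces. diameter e * (\<Sum>K\<in>sides e. fint e (\<lambda>x. (piece K v x)\<^sup>2)))"
    using interior_faces_sub face_diameter_pos
    by (intro sum_mono2 mult_nonneg_nonneg sum_nonneg fint_nonneg) (auto simp: less_imp_le)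
  also have "\<dots> \<le> N * Ct * mass v" by (rule face_mass_bound[OF v])
  finally have "1 / (t * \<eta>0) * (\<Sum>e\<in>interior_faces T. diameter e * (\<Sum>K\<in>sides e. fint e (\<lambda>x. (piece K v x)\<^sup>2)))
      \<le> 1 / (t * \<eta>0) * (N * Ct * mass v)"
    using t \<eta>(2) by (intro mult_left_mono) auto
  also have "\<dots> = N * Ct / \<eta>0 * mass v / t" by simp
  finally show ?thesis using 1 by linarith
qed

text \<open>Gauss's formula for \<open>w\<^sup>2 (x - x0)\<close> on every element: on interior faces the two boundary
  terms combine to the jump of \<open>w\<^sup>2\<close>, the product of the jump and the sum of the two traces.
  The traces are absorbed by the trace inequality, the gradient of \<open>w\<^sup>2\<close> by Young's inequality.\<close>
lemma discrete_Poincare: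
  assumes w: "w \<in> V_h T k" and R: "\<And>K. K \<in> T \<Longrightarrow> K \<subseteq> cball x0 R" "R \<ge> 0"
  shows "mass w \<le> (16 * R\<^sup>2 * (N * Ct + 1)) * (gsq w + jsq w)"
proof -
  \<comment> \<open>The weight of the traces. It is so small that by the trace inequality they cost at most \<open>mass w / 2\<close>.\<close>
  define t where "t = 1 / (4 * (N * Ct + 1))"
  have NC: "0 \<le> N * Ct" using Ct by (simp add: N_def)
  have t: "t > 0" "2 * t * (N * Ct) \<le> 1 / 2" using NC by (auto simp: t_def field_simps)
  have vol: "CARD('d) * mass w \<le> (1/4 * mass w + 4 * R\<^sup>2 * gsq w) +
      (\<Sum>K\<in>T. LINT x:K|lborel. CARD('d) * (piece K w x * piece K w x) + grad (\<lambda>x. piece K w x * piece K w x) x \<bullet> (x - x0))"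
  proof -
    have "CARD('d) * (LINT x:K|lborel. (piece K w x)\<^sup>2) \<le>
        (1/4 * (LINT x:K|lborel. (piece K w x)\<^sup>2) + 4 * R\<^sup>2 * (LINT x:K|lborel. (norm (grad (piece K w) x))\<^sup>2))
        + (LINT x:K|lborel. CARD('d) * (piece K w x * piece K w x) + grad (\<lambda>x. piece K w x * piece K w x) x \<bullet> (x - x0))"
      if K: "K \<in> T" for K
    proof -
      have P: "polynomial_deg_le k (piece K w)" by (rule piece_props(1)[OF w K])
      note P2 = polynomial_deg_le_mult[OF P P]
      have c: "continuous_on K (piece K w)" "continuous_on K (grad (piece K w))"
        "continuous_on K (grad (\<lambda>x. piece K w x * piece K w x))"
        using continuous_on_polynomial[OF P] continuous_on_grad[OF P] continuous_on_grad[OF P2] by auto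
      note cK = compactT[OF K]
      have "(LINT x:K|lborel. CARD('d) * (piece K w x)\<^sup>2) \<le>
        (LINT x:K|lborel. (1/4 * (piece K w x)\<^sup>2 + 4 * R\<^sup>2 * (norm (grad (piece K w) x))\<^sup>2)
          + (CARD('d) * (piece K w x * piece K w x) + grad (\<lambda>x. piece K w x * piece K w x) x \<bullet> (x - x0)))"
      proof (intro set_integral_cont_mono cK continuous_intros c)
        fix x assume x: "x \<in> K"
        define p g where "p = piece K w x" and "g = grad (piece K w) x"
        have "norm (x - x0) \<le> R" using R(1)[OF K] x by (auto simp: dist_norm norm_minus_commute)
        then have "\<bar>g \<bullet> (x - x0)\<bar> \<le> norm g * R"
          using Cauchy_Schwarz_ineq2[of g "x - x0"] by (meson mult_left_mono norm_ge_zero order_trans)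
        then have "\<bar>p\<bar> * \<bar>g \<bullet> (x - x0)\<bar> \<le> \<bar>p\<bar> * (norm g * R)" by (intro mult_left_mono) auto
        moreover have "- (p * (g \<bullet> (x - x0))) \<le> \<bar>p\<bar> * \<bar>g \<bullet> (x - x0)\<bar>"
          unfolding abs_mult[symmetric] by (rule abs_ge_minus_self)
        ultimately have "- (2 * (p * (g \<bullet> (x - x0)))) \<le> 2 * (\<bar>p\<bar> * (norm g * R))" by linarith
        also have "\<dots> = 2 * ((1/2 * \<bar>p\<bar>) * (2 * (norm g * R)))" by simp
        also have "\<dots> \<le> (1/2 * \<bar>p\<bar>)\<^sup>2 + (2 * (norm g * R))\<^sup>2"
          using sum_squares_bound[of "1/2 * \<bar>p\<bar>" "2 * (norm g * R)"] by (simp only: mult.assoc)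
        also have "\<dots> = 1/4 * p\<^sup>2 + 4 * R\<^sup>2 * (norm g)\<^sup>2" by (simp add: power_mult_distrib power_divide)
        finally have "0 \<le> (1/4 * p\<^sup>2 + 4 * R\<^sup>2 * (norm g)\<^sup>2) + 2 * (p * (g \<bullet> (x - x0)))" by simp
        moreover have "grad (\<lambda>x. piece K w x * piece K w x) x \<bullet> (x - x0) = 2 * (p * (g \<bullet> (x - x0)))"
          unfolding grad_mult[OF P P] inner_add_left by (simp add: p_def g_def)
        ultimately show "CARD('d) * (piece K w x)\<^sup>2 \<le> (1/4 * (piece K w x)\<^sup>2 + 4 * R\<^sup>2 * (norm (grad (piece K w) x))\<^sup>2)
          + (CARD('d) * (piece K w x * piece K w x) + grad (\<lambda>x. piece K w x * piece K w x) x \<bullet> (x - x0))"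
          unfolding p_def[symmetric] g_def[symmetric] by (simp add: power2_eq_square)
      qed
      also have "\<dots> = (LINT x:K|lborel. 1/4 * (piece K w x)\<^sup>2 + 4 * R\<^sup>2 * (norm (grad (piece K w) x))\<^sup>2)
        + (LINT x:K|lborel. CARD('d) * (piece K w x * piece K w x) + grad (\<lambda>x. piece K w x * piece K w x) x \<bullet> (x - x0))"
        by (intro set_integral_cont_add cK continuous_intros c)
      also have "(LINT x:K|lborel. 1/4 * (piece K w x)\<^sup>2 + 4 * R\<^sup>2 * (norm (grad (piece K w) x))\<^sup>2) =
        (LINT x:K|lborel. 1/4 * (piece K w x)\<^sup>2) + (LINT x:K|lborel. 4 * R\<^sup>2 * (norm (grad (piece K w) x))\<^sup>2)"
        by (intro set_integral_cont_add cK continuous_intros c)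
      finally show ?thesis by simp
    qed
    then have "(\<Sum>K\<in>T. CARD('d) * (LINT x:K|lborel. (piece K w x)\<^sup>2)) \<le>
        (\<Sum>K\<in>T. (1/4 * (LINT x:K|lborel. (piece K w x)\<^sup>2) + 4 * R\<^sup>2 * (LINT x:K|lborel. (norm (grad (piece K w) x))\<^sup>2))
        + (LINT x:K|lborel. CARD('d) * (piece K w x * piece K w x) + grad (\<lambda>x. piece K w x * piece K w x) x \<bullet> (x - x0)))"
      by (intro sum_mono)
    then show ?thesis unfolding mass_def gsq_def by (simp only: sum.distrib sum_distrib_left)
  qed
  have surf: "(\<Sum>K\<in>T. LINT x:K|lborel. CARD('d) * (piece K w x * piece K w x) + grad (\<lambda>x. piece K w x * piece K w x) x \<bullet> (x - x0))
      \<le> R\<^sup>2 / (4 * t) * jsq w + 2 * t * (N * Ct * mass w)"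
  proof -
    define f where "f K e = fint e (\<lambda>x. (nml K e \<bullet> (x - x0)) * (piece K w x * piece K w x))" for K e
    have "(LINT x:K|lborel. CARD('d) * (piece K w x * piece K w x) + grad (\<lambda>x. piece K w x * piece K w x) x \<bullet> (x - x0))
        = (\<Sum>a\<in>verts K. f K (opp_face K a))" if K: "K \<in> T" for K
    proof -
      interpret full_simplex K by (rule simplexT[OF K])
      have P: "polynomial_deg_le k (piece K w)" by (rule piece_props(1)[OF w K])
      have "(offs K a - nrm K a \<bullet> x0) * fint (opp_face K a) (\<lambda>x. piece K w x * piece K w x) = f K (opp_face K a)"
        if a: "a \<in> verts K" for a
      proof -
        have "K \<in> sides (opp_face K a)" using K a facet_iff by (auto simp: sides_def)
        then have "opp_face K a \<in> faces" by (auto simp: faces_def sides_def)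
        then have "fint (opp_face K a) (\<lambda>x. (offs K a - nrm K a \<bullet> x0) * (piece K w x * piece K w x)) = f K (opp_face K a)"
          unfolding f_def nrm_def[symmetric]
          by (intro fint_cong borel_measurable_continuous_onI continuous_intros continuous_on_polynomial[OF P])
             (auto simp: inner_diff_right opp_face_dot[OF a])
        then show ?thesis by simp
      qed
      then show ?thesis unfolding Gauss_point[OF polynomial_deg_le_mult[OF P P]] by simp
    qed
    then have "(\<Sum>K\<in>T. LINT x:K|lborel. CARD('d) * (piece K w x * piece K w x) + grad (\<lambda>x. piece K w x * piece K w x) x \<bullet> (x - x0))
        = (\<Sum>K\<in>T. \<Sum>a\<in>verts K. f K (opp_face K a))" by simp
    also have "\<dots> = (\<Sum>e\<in>faces. \<Sum>K\<in>sides e. f K e)" by (rule sum_elements_faces)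
    also have "\<dots> \<le> (\<Sum>e\<in>faces. R\<^sup>2 / (4 * t) * (1 / diameter e * fint e (\<lambda>x. (norm (vjump e w x))\<^sup>2))
        + 2 * t * (diameter e * (\<Sum>K\<in>sides e. fint e (\<lambda>x. (piece K w x)\<^sup>2))))"
    proof (rule sum_mono)
      fix e assume e: "e \<in> faces"
      define D where "D = diameter e"
      have D: "D > 0" unfolding D_def by (rule face_diameter_pos[OF e])
      have cp: "continuous_on UNIV (piece K w)" if "K \<in> sides e" for K using continuous_piece[OF w sides_sub(1)[OF that]] .
      have cv: "continuous_on UNIV (vjump e w)" using continuous_vjump[OF w] .
      have "(\<Sum>K\<in>sides e. f K e) = fint e (\<lambda>x. \<Sum>K\<in>sides e. (nml K e \<bullet> (x - x0)) * (piece K w x * piece K w x))"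
        unfolding f_def by (intro fint_sum[symmetric] e continuous_intros cp)
      also have "\<dots> \<le> fint e (\<lambda>x. (R\<^sup>2 / (4 * t) * (1 / D)) * (norm (vjump e w x))\<^sup>2 + (2 * t * D) * (\<Sum>K\<in>sides e. (piece K w x)\<^sup>2))"
      proof (intro fint_mono e continuous_intros cp cv)
        fix x assume x: "x \<in> e"
        define S where "S = (\<Sum>K\<in>sides e. piece K w x)"
        obtain K0 where "K0 \<in> sides e" using e by (auto simp: faces_def sides_def)
        then have "x \<in> cball x0 R" using x side_subset[of K0 e] R(1)[of K0] sides_sub[of K0 e] by blast
        then have nx: "norm (x - x0) \<le> R" by (simp add: dist_norm norm_minus_commute)
        have eq: "(\<Sum>K\<in>sides e. (nml K e \<bullet> (x - x0)) * (piece K w x * piece K w x)) = S * (vjump e w x \<bullet> (x - x0))"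
          using e
        proof (cases e rule: sides_cases)
          case (boundary K)
          then show ?thesis by (simp add: S_def vjump_def)
        next
          case (inner K K')
          then show ?thesis by (simp add: S_def vjump_def inner_add_left inner_diff_left algebra_simps)
        qed
        have S2: "S\<^sup>2 \<le> 2 * (\<Sum>K\<in>sides e. (piece K w x)\<^sup>2)"
        proof -
          have "S\<^sup>2 \<le> card (sides e) * (\<Sum>K\<in>sides e. (piece K w x)\<^sup>2)"
            unfolding S_def by (rule sum_squares_le_card)
          also have "\<dots> \<le> 2 * (\<Sum>K\<in>sides e. (piece K w x)\<^sup>2)"
            using card_sides[OF e] by (intro mult_right_mono sum_nonneg) auto
          finally show ?thesis .
        qed
        define u where "u = norm (vjump e w x) * R"
        have "S * (vjump e w x \<bullet> (x - x0)) \<le> \<bar>S\<bar> * \<bar>vjump e w x \<bullet> (x - x0)\<bar>" by (metis abs_ge_self abs_mult)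
        also have "\<dots> \<le> \<bar>S\<bar> * u"
          unfolding u_def
          by (intro mult_left_mono order_trans[OF Cauchy_Schwarz_ineq2 mult_left_mono[OF nx norm_ge_zero]]) auto
        also have "\<dots> \<le> u\<^sup>2 / (4 * (t * D)) + (t * D) * S\<^sup>2"
        proof -
          have tD: "t * D > 0" using t D by simp
          have "0 \<le> (u - 2 * (t * D) * \<bar>S\<bar>)\<^sup>2 / (4 * (t * D))" using tD by simp
          also have "\<dots> = u\<^sup>2 / (4 * (t * D)) + (t * D) * \<bar>S\<bar>\<^sup>2 - \<bar>S\<bar> * u"
            using tD t D by (simp add: power2_eq_square field_simps)
          finally show ?thesis by simp
        qed
        finally have "S * (vjump e w x \<bullet> (x - x0)) \<le> u\<^sup>2 / (4 * (t * D)) + (t * D) * S\<^sup>2" .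
        moreover have "(t * D) * S\<^sup>2 \<le> (t * D) * (2 * (\<Sum>K\<in>sides e. (piece K w x)\<^sup>2))"
          using S2 t D by (intro mult_left_mono) auto
        ultimately have "S * (vjump e w x \<bullet> (x - x0)) \<le> u\<^sup>2 / (4 * (t * D)) + (t * D) * (2 * (\<Sum>K\<in>sides e. (piece K w x)\<^sup>2))"
          by linarith
        moreover have "u\<^sup>2 / (4 * (t * D)) = (R\<^sup>2 / (4 * t) * (1 / D)) * (norm (vjump e w x))\<^sup>2"
          unfolding u_def by (simp add: power_mult_distrib mult_ac)
        moreover have "(t * D) * (2 * (\<Sum>K\<in>sides e. (piece K w x)\<^sup>2)) = (2 * t * D) * (\<Sum>K\<in>sides e. (piece K w x)\<^sup>2)"
          by simp
        ultimately show "(\<Sum>K\<in>sides e. (nml K e \<bullet> (x - x0)) * (piece K w x * piece K w x)) \<le>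
            (R\<^sup>2 / (4 * t) * (1 / D)) * (norm (vjump e w x))\<^sup>2 + (2 * t * D) * (\<Sum>K\<in>sides e. (piece K w x)\<^sup>2)"
          unfolding eq by linarith
      qed
      also have "\<dots> = (R\<^sup>2 / (4 * t) * (1 / D)) * fint e (\<lambda>x. (norm (vjump e w x))\<^sup>2)
          + (2 * t * D) * (\<Sum>K\<in>sides e. fint e (\<lambda>x. (piece K w x)\<^sup>2))"
        by (subst fint_add[OF e], intro continuous_intros cv, intro continuous_intros cp)
           (simp_all add: fint_sum[OF e] continuous_on_power cp)
      finally show "(\<Sum>K\<in>sides e. f K e) \<le> R\<^sup>2 / (4 * t) * (1 / diameter e * fint e (\<lambda>x. (norm (vjump e w x))\<^sup>2))
        + 2 * t * (diameter e * (\<Sum>K\<in>sides e. fint e (\<lambda>x. (piece K w x)\<^sup>2)))"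
        by (simp add: D_def mult.assoc)
    qed
    also have "\<dots> = R\<^sup>2 / (4 * t) * jsq w + 2 * t * (\<Sum>e\<in>faces. diameter e * (\<Sum>K\<in>sides e. fint e (\<lambda>x. (piece K w x)\<^sup>2)))"
      unfolding jsq_def by (simp only: sum.distrib sum_distrib_left)
    also have "\<dots> \<le> R\<^sup>2 / (4 * t) * jsq w + 2 * t * (N * Ct * mass w)"
      using face_mass_bound[OF w] t by simp
    finally show ?thesis .
  qed
  have d1: "2 \<le> real CARD('d)" using d2 by simp
  have "2 * mass w \<le> CARD('d) * mass w" using d1 mass_nonneg by (intro mult_right_mono)
  moreover have "2 * t * (N * Ct * mass w) \<le> 1/2 * mass w"
    using mult_right_mono[OF t(2) mass_nonneg[of w]] by (simp add: mult.assoc)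
  ultimately have "mass w \<le> 4 * R\<^sup>2 * gsq w + R\<^sup>2 / (4 * t) * jsq w" using vol surf mass_nonneg[of w] by linarith
  also have "\<dots> \<le> (16 * R\<^sup>2 * (N * Ct + 1)) * gsq w + (16 * R\<^sup>2 * (N * Ct + 1)) * jsq w"
  proof (intro add_mono mult_right_mono gsq_nonneg jsq_nonneg)
    have "4 * R\<^sup>2 * 1 \<le> 16 * R\<^sup>2 * (N * Ct + 1)" using NC by (intro mult_mono) auto
    then show "4 * R\<^sup>2 \<le> 16 * R\<^sup>2 * (N * Ct + 1)" by simp
    have "R\<^sup>2 / (4 * t) = 1 * R\<^sup>2 * (N * Ct + 1)" using NC by (simp add: t_def)
    also have "\<dots> \<le> 16 * R\<^sup>2 * (N * Ct + 1)" using NC by (intro mult_right_mono) auto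
    finally show "R\<^sup>2 / (4 * t) \<le> 16 * R\<^sup>2 * (N * Ct + 1)" .
  qed
  finally show ?thesis by (simp add: distrib_left)
qed

end

text \<open>Prescribing the normal component of \<open>- h\<^sub>e\<inverse> [w]\<close> from both sides of every face produces a field
  without normal jumps whose divergence tested with \<open>w\<close> reproduces the scaled jumps of \<open>w\<close>. On boundary
  faces the normal trace of a field is free, so the jumps there are reproduced as well. The weight
  \<open>1 / (4 * s)\<close> in the assumption makes the error of the local construction at most half of the jumps.\<close>
lemma stable_field:
  assumes w: "w \<in> V_h T k" and Cf: "Cf \<ge> 0"
    and EF: "\<And>(K :: (real ^ 'd) set) w \<rho>. regular s K \<Longrightarrow> polynomial_deg_le k w \<Longrightarrow>
     (\<forall>a\<in>verts K. polynomial_deg_le k (\<rho> a)) \<Longrightarrow>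
     (\<exists>q. poly_field (k + 1) q \<and>
        (\<forall>a\<in>verts K. \<forall>x\<in>opp_face K a. q x \<bullet> nrm K a = \<rho> a x) \<and>
        (LINT x:K|lborel. (norm (q x))\<^sup>2) \<le> Cf * ((LINT x:K|lborel. (norm (grad w x))\<^sup>2) +
            (\<Sum>a\<in>verts K. diameter K * (LINT x|face_measure (opp_face K a). (\<rho> a x)\<^sup>2))) \<and>
        (LINT x:K|lborel. (norm (grad w x))\<^sup>2)
          - (\<Sum>a\<in>verts K. LINT x|face_measure (opp_face K a). \<rho> a x * w x)
          - 1 / (4 * s) * (\<Sum>a\<in>verts K. diameter K * (LINT x|face_measure (opp_face K a). (\<rho> a x)\<^sup>2))
        \<le> - (LINT x:K|lborel. dvg q x * w x))"
  shows "\<exists>q\<in>Q_h T (k + 1). (\<forall>e\<in>interior_faces T. \<forall>x\<in>e. njump e q x = 0) \<and>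
    (\<Sum>K\<in>T. LINT x:K|lborel. (norm (vpiece K q x))\<^sup>2) \<le> 2 * s * Cf * (gsq w + jsq w) \<and>
    1/2 * (gsq w + jsq w) \<le> - (\<Sum>K\<in>T. LINT x:K|lborel. dvg (vpiece K q) x * piece K w x)"
proof -
  define \<tau> where "\<tau> K e x = - (1 / diameter e) * (vjump e w x \<bullet> nml K e)" for K e x
  have \<tau>_poly: "polynomial_deg_le k (\<tau> K e)" for K e
  proof -
    have "\<tau> K e = (\<lambda>x. \<Sum>K'\<in>sides e. (- (1 / diameter e) * (nml K' e \<bullet> nml K e)) * piece K' w x)"
      unfolding \<tau>_def vjump_def inner_sum_left by (simp add: fun_eq_iff sum_distrib_left mult_ac)
    then show ?thesis
      by (simp only:) (intro polynomial_deg_le_sum polynomial_deg_le_cmult piece_props(1)[OF w] sides_sub(1))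
  qed
  define SK where "SK K = (\<Sum>a\<in>verts K. diameter K * fint (opp_face K a) (\<lambda>x. (\<tau> K (opp_face K a) x)\<^sup>2))" for K
  define XK where "XK K = (\<Sum>a\<in>verts K. fint (opp_face K a) (\<lambda>x. \<tau> K (opp_face K a) x * piece K w x))" for K
  define GK where "GK K = (LINT x:K|lborel. (norm (grad (piece K w) x))\<^sup>2)" for K
  have "\<forall>K\<in>T. \<exists>q. poly_field (k + 1) q \<and>
        (\<forall>a\<in>verts K. \<forall>x\<in>opp_face K a. q x \<bullet> nrm K a = \<tau> K (opp_face K a) x) \<and>
        (LINT x:K|lborel. (norm (q x))\<^sup>2) \<le> Cf * (GK K + SK K) \<and>
        GK K - XK K - 1 / (4 * s) * SK K \<le> - (LINT x:K|lborel. dvg q x * piece K w x)"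
  proof
    fix K assume K: "K \<in> T"
    show "\<exists>q. poly_field (k + 1) q \<and>
        (\<forall>a\<in>verts K. \<forall>x\<in>opp_face K a. q x \<bullet> nrm K a = \<tau> K (opp_face K a) x) \<and>
        (LINT x:K|lborel. (norm (q x))\<^sup>2) \<le> Cf * (GK K + SK K) \<and>
        GK K - XK K - 1 / (4 * s) * SK K \<le> - (LINT x:K|lborel. dvg q x * piece K w x)"
      unfolding GK_def SK_def XK_def
      by (rule EF[OF reg[OF K] piece_props(1)[OF w K], of "\<lambda>a. \<tau> K (opp_face K a)"]) (simp add: \<tau>_poly)
  qed
  then obtain qq where qq: "\<And>K. K \<in> T \<Longrightarrow> poly_field (k + 1) (qq K)"
    "\<And>K a x. K \<in> T \<Longrightarrow> a \<in> verts K \<Longrightarrow> x \<in> opp_face K a \<Longrightarrow> qq K x \<bullet> nrm K a = \<tau> K (opp_face K a) x"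
    "\<And>K. K \<in> T \<Longrightarrow> (LINT x:K|lborel. (norm (qq K x))\<^sup>2) \<le> Cf * (GK K + SK K)"
    "\<And>K. K \<in> T \<Longrightarrow> GK K - XK K - 1 / (4 * s) * SK K \<le> - (LINT x:K|lborel. dvg (qq K) x * piece K w x)"
    unfolding bchoice_iff by blast
  define q where "q = glue T qq"
  have qQ: "q \<in> Q_h T (k + 1)" unfolding q_def by (rule glue_in_Q_h[OF qq(1)])
  have vq: "vpiece K q = qq K" if "K \<in> T" for K unfolding q_def by (rule vpiece_glue[OF qq(1) that])
  have trace: "vpiece K q x \<bullet> nml K e = \<tau> K e x" if K: "K \<in> sides e" and x: "x \<in> e" for K e x
  proof -
    obtain a where a: "a \<in> verts K" "e = opp_face K a" using side_vertex[OF K] .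
    show ?thesis
      using qq(2)[OF sides_sub(1)[OF K] a(1)] x unfolding vq[OF sides_sub(1)[OF K]] a(2) nrm_def by blast
  qed
  have nj: "njump e q x = 0" if e: "e \<in> interior_faces T" and x: "x \<in> e" for e x
  proof -
    have "njump e q x = (\<Sum>K\<in>sides e. \<tau> K e x)" unfolding njump_def using trace x by (intro sum.cong) auto
    also have "\<dots> = 0"
      using interior_faces_sub[OF e]
    proof (cases e rule: sides_cases)
      case (boundary K)
      then show ?thesis using e by blast
    next
      case (inner K K')
      then show ?thesis by (simp add: \<tau>_def)
    qed
    finally show ?thesis .
  qed
  have cv: "continuous_on UNIV (vjump e w)" for e using continuous_vjump[OF w] .
  have ct: "continuous_on UNIV (\<tau> K e)" for K e using continuous_on_polynomial[OF \<tau>_poly] .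
  have S: "(\<Sum>K\<in>T. SK K) \<le> 2 * s * jsq w"
  proof -
    have "(\<Sum>K\<in>T. SK K) = (\<Sum>e\<in>faces. \<Sum>K\<in>sides e. diameter K * fint e (\<lambda>x. (\<tau> K e x)\<^sup>2))"
      unfolding SK_def by (rule sum_elements_faces)
    also have "\<dots> \<le> (\<Sum>e\<in>faces. 2 * s * (1 / diameter e * fint e (\<lambda>x. (norm (vjump e w x))\<^sup>2)))"
    proof (rule sum_mono)
      fix e assume e: "e \<in> faces"
      define D where "D = diameter e"
      have D: "D > 0" unfolding D_def by (rule face_diameter_pos[OF e])
      define J where "J = fint e (\<lambda>x. (norm (vjump e w x))\<^sup>2)"
      have J: "0 \<le> J" unfolding J_def by (intro fint_nonneg) simp
      have "diameter K * fint e (\<lambda>x. (\<tau> K e x)\<^sup>2) \<le> s / D * J" if K: "K \<in> sides e" for K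
      proof -
        have "fint e (\<lambda>x. (\<tau> K e x)\<^sup>2) \<le> fint e (\<lambda>x. (1 / D)\<^sup>2 * (norm (vjump e w x))\<^sup>2)"
        proof (intro fint_mono e continuous_intros ct cv)
          fix x
          have "\<bar>vjump e w x \<bullet> nml K e\<bar> \<le> norm (vjump e w x)"
            using Cauchy_Schwarz_ineq2[of "vjump e w x" "nml K e"] norm_nml[OF K] by simp
          then have "(vjump e w x \<bullet> nml K e)\<^sup>2 \<le> (norm (vjump e w x))\<^sup>2"
            by (metis abs_le_square_iff abs_norm_cancel)
          then show "(\<tau> K e x)\<^sup>2 \<le> (1 / D)\<^sup>2 * (norm (vjump e w x))\<^sup>2"
            unfolding \<tau>_def D_def power_mult_distrib power2_minus by (intro mult_left_mono) auto
        qed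
        then have "fint e (\<lambda>x. (\<tau> K e x)\<^sup>2) \<le> (1 / D)\<^sup>2 * J" unfolding J_def by simp
        then have "diameter K * fint e (\<lambda>x. (\<tau> K e x)\<^sup>2) \<le> (s * D) * ((1 / D)\<^sup>2 * J)"
          using side_sizes[OF K] J s1 D unfolding D_def[symmetric]
          by (intro mult_mono fint_nonneg) auto
        then show ?thesis using D by (simp add: power2_eq_square)
      qed
      then have "(\<Sum>K\<in>sides e. diameter K * fint e (\<lambda>x. (\<tau> K e x)\<^sup>2)) \<le> (\<Sum>K\<in>sides e. s / D * J)" by (intro sum_mono)
      also have "\<dots> = card (sides e) * (s / D * J)" by simp
      also have "\<dots> \<le> 2 * (s / D * J)" using card_sides[OF e] s1 D J by (intro mult_right_mono) auto
      finally show "(\<Sum>K\<in>sides e. diameter K * fint e (\<lambda>x. (\<tau> K e x)\<^sup>2)) \<le>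
          2 * s * (1 / diameter e * fint e (\<lambda>x. (norm (vjump e w x))\<^sup>2))"
        by (simp add: D_def J_def)
    qed
    also have "\<dots> = 2 * s * jsq w" unfolding jsq_def sum_distrib_left ..
    finally show ?thesis .
  qed
  have X: "(\<Sum>K\<in>T. XK K) = - jsq w"
  proof -
    have "(\<Sum>K\<in>T. XK K) = (\<Sum>e\<in>faces. \<Sum>K\<in>sides e. fint e (\<lambda>x. \<tau> K e x * piece K w x))"
      unfolding XK_def by (rule sum_elements_faces)
    also have "\<dots> = (\<Sum>e\<in>faces. - (1 / diameter e * fint e (\<lambda>x. (norm (vjump e w x))\<^sup>2)))"
    proof (intro sum.cong refl)
      fix e assume e: "e \<in> faces"
      have "(\<Sum>K\<in>sides e. fint e (\<lambda>x. \<tau> K e x * piece K w x)) = fint e (\<lambda>x. \<Sum>K\<in>sides e. \<tau> K e x * piece K w x)"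
        using continuous_piece[OF w sides_sub(1)] by (intro fint_sum[symmetric] e continuous_intros ct)
      also have "(\<lambda>x. \<Sum>K\<in>sides e. \<tau> K e x * piece K w x) = (\<lambda>x. - (1 / diameter e) * (norm (vjump e w x))\<^sup>2)"
      proof
        fix x
        have "(\<Sum>K\<in>sides e. \<tau> K e x * piece K w x) = - (1 / diameter e) * (\<Sum>K\<in>sides e. vjump e w x \<bullet> (piece K w x *\<^sub>R nml K e))"
          unfolding \<tau>_def sum_distrib_left by (intro sum.cong) auto
        also have "(\<Sum>K\<in>sides e. vjump e w x \<bullet> (piece K w x *\<^sub>R nml K e)) = vjump e w x \<bullet> vjump e w x"
          unfolding inner_sum_right[symmetric] vjump_def[symmetric] ..
        finally show "(\<Sum>K\<in>sides e. \<tau> K e x * piece K w x) = - (1 / diameter e) * (norm (vjump e w x))\<^sup>2"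
          by (simp add: power2_norm_eq_inner)
      qed
      finally show "(\<Sum>K\<in>sides e. fint e (\<lambda>x. \<tau> K e x * piece K w x)) = - (1 / diameter e * fint e (\<lambda>x. (norm (vjump e w x))\<^sup>2))"
        by simp
    qed
    finally show ?thesis by (simp add: jsq_def sum_negf)
  qed
  have G: "(\<Sum>K\<in>T. GK K) = gsq w" by (simp add: GK_def gsq_def)
  have "(\<Sum>K\<in>T. LINT x:K|lborel. (norm (vpiece K q x))\<^sup>2) \<le> (\<Sum>K\<in>T. Cf * (GK K + SK K))"
    using qq(3) by (intro sum_mono) (simp add: vq)
  also have "\<dots> = Cf * (gsq w + (\<Sum>K\<in>T. SK K))" by (simp add: sum_distrib_left[symmetric] sum.distrib G)
  also have "\<dots> \<le> Cf * (2 * s * gsq w + 2 * s * jsq w)"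
  proof -
    have "1 * gsq w \<le> 2 * s * gsq w" using s1 gsq_nonneg by (intro mult_right_mono) auto
    then show ?thesis using S Cf by (intro mult_left_mono add_mono) auto
  qed
  finally have bound: "(\<Sum>K\<in>T. LINT x:K|lborel. (norm (vpiece K q x))\<^sup>2) \<le> 2 * s * Cf * (gsq w + jsq w)"
    by (simp add: algebra_simps)
  have "gsq w + jsq w - 1 / (4 * s) * (\<Sum>K\<in>T. SK K) = (\<Sum>K\<in>T. GK K - XK K - 1 / (4 * s) * SK K)"
    by (simp only: sum_subtractf sum_distrib_left[symmetric] G X diff_minus_eq_add)
  also have "\<dots> \<le> (\<Sum>K\<in>T. - (LINT x:K|lborel. dvg (vpiece K q) x * piece K w x))"
    using qq(4) by (intro sum_mono) (simp add: vq)
  finally have main: "gsq w + jsq w - 1 / (4 * s) * (\<Sum>K\<in>T. SK K) \<le> - (\<Sum>K\<in>T. LINT x:K|lborel. dvg (vpiece K q) x * piece K w x)"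
    by (simp add: sum_negf)
  have "1 / (4 * s) * (\<Sum>K\<in>T. SK K) \<le> 1 / (4 * s) * (2 * s * jsq w)" using S s1 by (intro mult_left_mono) auto
  also have "\<dots> = 1/2 * jsq w" using s1 by simp
  finally have z: "1 / (4 * s) * (\<Sum>K\<in>T. SK K) \<le> 1/2 * jsq w" .
  have "1/2 * (g + j) \<le> g + j - z" if "z \<le> 1/2 * j" "0 \<le> g" for g j z :: real using that by simp
  then have "1/2 * (gsq w + jsq w) \<le> - (\<Sum>K\<in>T. LINT x:K|lborel. dvg (vpiece K q) x * piece K w x)"
    using order_trans[OF _ main] z gsq_nonneg[of w] by blast
  then show ?thesis using qQ nj bound by blast
qed

end

section \<open>Dual norms\<close>

text \<open>The dual norm is a supremum without absolute values over nonzero functions. By Riesz' theorem the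
  supremum is finite, so that it is an upper bound, and replacing \<open>v\<close> by \<open>- v\<close> gives the absolute value.
  A nonzero element is needed because the supremum of the empty set is unspecified.\<close>
lemma dual_norm_bound:
  fixes S :: "('a \<Rightarrow> 'b::real_vector) set"
  assumes S: "subspace S" "finite B" "S \<subseteq> span B" and f: "psd_form_on S f" "definite_on S f"
    and F: "linear_on_subspace S F" and Nf: "\<And>v. v \<in> S \<Longrightarrow> Nf v = sqrt (f v v)" and nontrivial: "\<exists>g\<in>S. g \<noteq> 0"
  shows "v \<in> S \<Longrightarrow> \<bar>F v\<bar> \<le> dual_norm S Nf F * Nf v" and "0 \<le> dual_norm S Nf F"
proof -
  obtain r where r: "r \<in> S" "\<And>v. v \<in> S \<Longrightarrow> f r v = F v"
    by (rule Riesz_on_subspace[OF S(1) f S(2,3) F]) blast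
  have pos: "0 < Nf v" if "v \<in> S" "v \<noteq> 0" for v
    using that f(2) psd_form_nonneg[OF S(1) f(1) that(1)] Nf[OF that(1)] unfolding definite_on_def
    by (metis order_le_less real_sqrt_gt_0_iff)
  have bdd: "bdd_above ((\<lambda>g. F g / Nf g) ` (S - {\<lambda>x. 0}))"
  proof (rule bdd_aboveI2)
    fix g assume g: "g \<in> S - {\<lambda>x. 0}"
    then have gS: "g \<in> S" "g \<noteq> 0" by (auto simp: zero_fun_def)
    have "F g \<le> Nf r * Nf g" using psd_form_abs_le[OF S(1) f(1) r(1) gS(1)] r(2)[OF gS(1)] Nf r gS by simp
    then show "F g / Nf g \<le> Nf r" using pos[OF gS] by (simp add: divide_le_eq)
  qed
  have up: "F v \<le> dual_norm S Nf F * Nf v" if v: "v \<in> S" "v \<noteq> 0" for v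
  proof -
    have "F v / Nf v \<le> dual_norm S Nf F"
      unfolding dual_norm_def using v by (intro cSUP_upper bdd) (auto simp: zero_fun_def)
    then show ?thesis using pos[OF v] by (simp add: divide_le_eq)
  qed
  have abs: "\<bar>F v\<bar> \<le> dual_norm S Nf F * Nf v" if v: "v \<in> S" for v
  proof (cases "v = 0")
    case True
    have "f 0 0 = 0" using linear_on_subspace_0[OF psd_form_linear_left[OF S(1) f(1) subspace_0[OF S(1)]] S(1)] .
    then show ?thesis using True linear_on_subspace_0[OF F S(1)] Nf[OF v] by simp
  next
    case False
    have mv: "(-1) *\<^sub>R v \<in> S" using v S(1) by (rule subspace_scale[rotated])
    have "F ((-1) *\<^sub>R v) = (-1) *\<^sub>R F v" using F v unfolding linear_on_subspace_def by blast
    then have F': "F ((-1) *\<^sub>R v) = - F v" by (simp only: real_scaleR_def mult_minus1)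
    have "f ((-1) *\<^sub>R v) ((-1) *\<^sub>R v) = f v v"
    proof -
      have "f ((-1) *\<^sub>R v) ((-1) *\<^sub>R v) = (-1) * f v ((-1) *\<^sub>R v)" using f(1) v mv unfolding psd_form_on_def by blast
      moreover have "f v ((-1) *\<^sub>R v) = (-1) *\<^sub>R f v v"
        using psd_form_linear_right[OF S(1) f(1) v] v unfolding linear_on_subspace_def by blast
      ultimately show ?thesis by (simp only: real_scaleR_def)
    qed
    then have "Nf ((-1) *\<^sub>R v) = Nf v" using Nf v mv by simp
    then have "- F v \<le> dual_norm S Nf F * Nf v" using up[OF mv] False F' by simp
    then show ?thesis using up[OF v False] by linarith
  qed
  then show "v \<in> S \<Longrightarrow> \<bar>F v\<bar> \<le> dual_norm S Nf F * Nf v" .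
  obtain g where g: "g \<in> S" "g \<noteq> 0" using nontrivial by blast
  have "0 \<le> dual_norm S Nf F * Nf g" using abs[OF g(1)] by linarith
  then show "0 \<le> dual_norm S Nf F" using pos[OF g] by (simp add: zero_le_mult_iff)
qed

section \<open>Domain and mesh\<close>

text \<open>The inball diameter is a supremum over inscribed balls; some ball has at least half of it, which
  accounts for the factor \<open>4\<close>. The summand \<open>1\<close> makes the constant positive.\<close>
lemma shape_regular_imp_regular:
  fixes K :: "(real ^ 'd) set"
  assumes simp: "int CARD('d) simplex K" and sr: "diameter K \<le> \<sigma> * inball_diameter K"
  shows "regular (4 * \<bar>\<sigma>\<bar> + 1) K"
proof -
  interpret full_simplex K by unfold_locales (rule simp)
  define X where "X = {2 * r | r x. 0 \<le> r \<and> cball x r \<subseteq> K}"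
  have bdd: "bdd_above X"
  proof (rule bdd_aboveI[of _ "2 * diameter K"])
    fix y assume "y \<in> X"
    then obtain r x where rx: "y = 2 * r" "0 \<le> r" "cball x r \<subseteq> K" by (auto simp: X_def)
    obtain u :: "real ^ 'd" where u: "norm u = 1" using vector_choose_size[of 1] by auto
    have "x + r *\<^sub>R u \<in> K" "x \<in> K" using rx u by (auto simp: dist_norm)
    then have "dist (x + r *\<^sub>R u) x \<le> diameter K"
      by (intro diameter_bounded_bound compact_imp_bounded[OF compact])
    then show "y \<le> 2 * diameter K" using u rx by (simp add: dist_norm)
  qed
  obtain x0 where "x0 \<in> interior K" using interior_nonempty by blast
  then obtain r0 where r0: "r0 > 0" "cball x0 r0 \<subseteq> K" by (meson mem_interior_cball)
  then have X0: "2 * r0 \<in> X" by (auto simp: X_def intro: less_imp_le)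
  then have "2 * r0 \<le> Sup X" by (intro cSup_upper bdd)
  then have pos: "0 < Sup X" using r0 by linarith
  then have "Sup X / 2 < Sup X" by simp
  then obtain y where y: "y \<in> X" "Sup X / 2 < y" using less_cSup_iff[OF _ bdd] X0 by blast
  then obtain r x where rx: "y = 2 * r" "cball x r \<subseteq> K" by (auto simp: X_def)
  have r: "0 < r" "Sup X \<le> 4 * r" using y rx pos by auto
  have "diameter K \<le> \<sigma> * Sup X" using sr unfolding inball_diameter_def X_def .
  also have "\<dots> \<le> \<bar>\<sigma>\<bar> * (4 * r)" using r pos by (intro mult_mono) auto
  also have "\<dots> \<le> (4 * \<bar>\<sigma>\<bar> + 1) * r" using r by (simp add: algebra_simps)
  finally show ?thesis unfolding regular_def using simp r rx by blast
qed

text \<open>A Lipschitz domain lies on one side of its boundary: arbitrarily close to a boundary point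
  there are points above the graph, which are exterior. So the closure has no interior points outside the
  domain, unlike that of a slit disc.\<close>
lemma interior_closure_lipschitz:
  fixes \<Omega> :: "(real ^ 'd) set"
  assumes op: "open \<Omega>" and lip: "lipschitz_boundary \<Omega>"
  shows "interior (closure \<Omega>) \<subseteq> \<Omega>"
proof (rule ccontr)
  assume "\<not> interior (closure \<Omega>) \<subseteq> \<Omega>"
  then obtain x where x: "x \<in> interior (closure \<Omega>)" "x \<notin> \<Omega>" by blast
  then have "x \<in> frontier \<Omega>" using interior_subset interior_open[OF op] by (auto simp: frontier_def)
  then obtain r \<nu> L \<phi> where r: "r > 0" and \<nu>: "norm \<nu> = 1" and \<phi>: "L-lipschitz_on UNIV (\<phi> :: real ^ 'd \<Rightarrow> real)"
    and graph: "\<And>y. y \<in> ball x r \<Longrightarrow> y \<in> \<Omega> \<longleftrightarrow> y \<bullet> \<nu> < \<phi> (y - (y \<bullet> \<nu>) *\<^sub>R \<nu>)"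
    using lip unfolding lipschitz_boundary_def by blast
  have c\<phi>: "continuous_on UNIV \<phi>" using \<phi> by (rule lipschitz_on_continuous_on)
  define U where "U = ball x r \<inter> {y. \<phi> (y - (y \<bullet> \<nu>) *\<^sub>R \<nu>) < y \<bullet> \<nu>}"
  have "open U" unfolding U_def
    by (intro open_Int open_ball open_Collect_less continuous_on_compose2[OF c\<phi>] continuous_intros) auto
  moreover have "U \<inter> \<Omega> = {}" unfolding U_def using graph by force
  ultimately have U: "U \<inter> closure \<Omega> = {}" by (simp add: open_Int_closure_eq_empty)
  obtain \<delta> where \<delta>: "\<delta> > 0" "ball x \<delta> \<subseteq> closure \<Omega>" using x(1) by (meson mem_interior)
  define t where "t = min r \<delta> / 2"
  have t: "0 < t" "t < r" "t < \<delta>" using r \<delta> by (auto simp: t_def)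
  define y where "y = x + t *\<^sub>R \<nu>"
  have yb: "y \<in> ball x r" "y \<in> ball x \<delta>" using t \<nu> by (auto simp: y_def dist_norm)
  have yn: "y \<bullet> \<nu> = x \<bullet> \<nu> + t" using \<nu> by (simp add: y_def inner_add_left norm_eq_1)
  have "y - (y \<bullet> \<nu>) *\<^sub>R \<nu> = x - (x \<bullet> \<nu>) *\<^sub>R \<nu>" unfolding yn by (simp add: y_def algebra_simps)
  moreover have "\<phi> (x - (x \<bullet> \<nu>) *\<^sub>R \<nu>) \<le> x \<bullet> \<nu>" using graph[of x] x(2) r by simp
  ultimately have "y \<in> U" unfolding U_def using yb yn t by auto
  then show False using U yb(2) \<delta>(2) by blast
qed

section \<open>The inverse coefficient\<close>

lemma norm_matrix_vector_le: "norm (A *v x) \<le> CARD('n) * norm A * norm (x :: real ^ 'm)"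
  for A :: "real ^ 'm ^ 'n"
proof -
  have "\<bar>(A *v x) $ i\<bar> \<le> norm A * norm x" for i
  proof -
    have "(A *v x) $ i = A $ i \<bullet> x" by (simp add: matrix_vector_mult_def inner_vec_def)
    then have "\<bar>(A *v x) $ i\<bar> \<le> norm (A $ i) * norm x" using Cauchy_Schwarz_ineq2[of "A $ i" x] by simp
    also have "\<dots> \<le> norm A * norm x" by (intro mult_right_mono Finite_Cartesian_Product.norm_nth_le norm_ge_zero)
    finally show ?thesis .
  qed
  then have "(\<Sum>i\<in>UNIV. \<bar>(A *v x) $ i\<bar>) \<le> (\<Sum>i\<in>(UNIV::'n set). norm A * norm x)" by (intro sum_mono)
  then show ?thesis using norm_le_l1_cart[of "A *v x"] by simp
qed

lemma matrix_mult_matrix_inv: "invertible A \<Longrightarrow> A ** matrix_inv A = mat 1"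
  unfolding invertible_def matrix_inv_def by (rule someI2_ex) auto

text \<open>Ellipticity and boundedness of \<open>A\<close> are exchanged for the inverse: put \<open>y = A\<inverse> \<xi>\<close> in the bounds for \<open>A\<close>.\<close>
lemma inverse_coefficient:
  fixes A :: "real ^ 'd ^ 'd"
  assumes sym: "transpose A = A" and a: "a > 0" "\<And>\<xi>. a * (norm \<xi>)\<^sup>2 \<le> \<xi> \<bullet> (A *v \<xi>)"
    and M: "M > 0" "\<And>\<xi>. norm (A *v \<xi>) \<le> M * norm \<xi>"
  shows "norm (matrix_inv A *v \<xi>) \<le> 1 / a * norm \<xi>" 
    and "(matrix_inv A *v \<xi>) \<bullet> \<zeta> = (matrix_inv A *v \<zeta>) \<bullet> \<xi>"
    and "a / M\<^sup>2 * (norm \<xi>)\<^sup>2 \<le> (matrix_inv A *v \<xi>) \<bullet> \<xi>"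
    and "det A \<noteq> 0"
proof -
  have inj: "\<forall>x. A *v x = 0 \<longrightarrow> x = 0"
  proof safe
    fix x assume "A *v x = 0"
    then have "a * (norm x)\<^sup>2 \<le> 0" using a(2)[of x] by simp
    then show "x = 0" using a(1) by (simp add: mult_le_0_iff)
  qed
  then have inv: "invertible A"
    using matrix_left_invertible_ker[of A] invertible_left_inverse by blast
  then show "det A \<noteq> 0" by (simp add: invertible_det_nz)
  have AB: "A *v (matrix_inv A *v x) = x" for x
    using matrix_mult_matrix_inv[OF inv] by (simp add: matrix_vector_mul_assoc)
  have symA: "(A *v x) \<bullet> y = x \<bullet> (A *v y)" for x y
    using dot_lmul_matrix[of x A y] sym by (metis transpose_matrix_vector)
  show bound: "norm (matrix_inv A *v \<xi>) \<le> 1 / a * norm \<xi>" for \<xi>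
  proof -
    define y where "y = matrix_inv A *v \<xi>"
    have "a * (norm y)\<^sup>2 \<le> y \<bullet> \<xi>" using a(2)[of y] AB by (simp add: y_def)
    also have "\<dots> \<le> norm y * norm \<xi>" by (rule norm_cauchy_schwarz)
    finally have "(a * norm y) * norm y \<le> norm \<xi> * norm y" by (simp add: power2_eq_square mult_ac)
    then have "a * norm y \<le> norm \<xi>" by (cases "y = 0") auto
    then show ?thesis using a(1) by (simp add: y_def field_simps)
  qed
  show "(matrix_inv A *v \<xi>) \<bullet> \<zeta> = (matrix_inv A *v \<zeta>) \<bullet> \<xi>"
    using symA[of "matrix_inv A *v \<xi>" "matrix_inv A *v \<zeta>"] unfolding AB by (simp add: inner_commute)
  define y where "y = matrix_inv A *v \<xi>"
  have "norm \<xi> \<le> M * norm y" using M(2)[of y] AB by (simp add: y_def)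
  then have "(norm \<xi>)\<^sup>2 \<le> M\<^sup>2 * (norm y)\<^sup>2" by (metis norm_ge_zero power_mono power_mult_distrib)
  then have "a / M\<^sup>2 * (norm \<xi>)\<^sup>2 \<le> a / M\<^sup>2 * (M\<^sup>2 * (norm y)\<^sup>2)" using a(1) by (intro mult_left_mono) auto
  also have "\<dots> = a * (norm y)\<^sup>2" using M(1) by simp
  also have "\<dots> \<le> y \<bullet> \<xi>" using a(2)[of y] AB by (simp add: y_def)
  finally show "a / M\<^sup>2 * (norm \<xi>)\<^sup>2 \<le> (matrix_inv A *v \<xi>) \<bullet> \<xi>" by (simp add: y_def)
qed

text \<open>Cramer's rule exhibits the entries of the inverse as measurable functions of the entries of the matrix.\<close>
lemma matrix_inv_entry:
  fixes A :: "real ^ 'd ^ 'd"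
  assumes "det A \<noteq> 0"
  shows "matrix_inv A $ i $ j = det (\<chi> k l. if l = i then axis j 1 $ k else A $ k $ l) / det A"
proof -
  have inv: "invertible A" using assms by (simp add: invertible_det_nz)
  have "A *v (matrix_inv A *v axis j 1) = axis j 1"
    using matrix_mult_matrix_inv[OF inv] by (simp add: matrix_vector_mul_assoc)
  then have "matrix_inv A *v axis j 1 = (\<chi> i. det (\<chi> k l. if l = i then axis j 1 $ k else A $ k $ l) / det A)"
    using cramer[OF assms] by blast
  moreover have "(matrix_inv A *v axis j 1) $ i = matrix_inv A $ i $ j"
    by (simp add: matrix_vector_mult_basis column_def)
  ultimately show ?thesis by simp
qed

lemma measurable_det:
  assumes "\<And>i j. (\<lambda>x. A x $ i $ j) \<in> borel_measurable M"
  shows "(\<lambda>x. det (A x :: real ^ 'd ^ 'd)) \<in> borel_measurable M"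
  unfolding det_def using assms
  by (intro borel_measurable_sum borel_measurable_times borel_measurable_const borel_measurable_prod)

lemma measurable_nth_nth:
  fixes \<alpha> :: "_ \<Rightarrow> real ^ 'd ^ 'd"
  assumes "\<alpha> \<in> borel_measurable M"
  shows "(\<lambda>x. \<alpha> x $ i $ j) \<in> borel_measurable M"
  by (rule measurable_compose[OF assms]) (intro borel_measurable_continuous_onI continuous_intros)

lemma measurable_inverse_coefficient:
  fixes \<alpha> :: "real ^ 'd \<Rightarrow> real ^ 'd ^ 'd"
  assumes \<alpha>: "\<alpha> \<in> borel_measurable (lebesgue_on \<Omega>)" and det: "\<And>x. x \<in> \<Omega> \<Longrightarrow> det (\<alpha> x) \<noteq> 0"
    and \<Omega>: "open \<Omega>"
  shows "(\<lambda>x. if x \<in> \<Omega> then matrix_inv (\<alpha> x) $ i $ j else 0) \<in> borel_measurable lebesgue"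
proof -
  have "(\<lambda>x. det (\<chi> k l. if l = i then axis j 1 $ k else \<alpha> x $ k $ l) / det (\<alpha> x)) \<in> borel_measurable (lebesgue_on \<Omega>)"
  proof (intro borel_measurable_divide measurable_det)
    fix k l
    show "(\<lambda>x. (\<chi> k l. if l = i then axis j 1 $ k else \<alpha> x $ k $ l) $ k $ l) \<in> borel_measurable (lebesgue_on \<Omega>)"
      by (cases "l = i") (simp_all add: measurable_nth_nth[OF \<alpha>])
    show "(\<lambda>x. \<alpha> x $ k $ l) \<in> borel_measurable (lebesgue_on \<Omega>)" by (rule measurable_nth_nth[OF \<alpha>])
  qed
  then have "(\<lambda>x. matrix_inv (\<alpha> x) $ i $ j) \<in> borel_measurable (lebesgue_on \<Omega>)"
    by (subst measurable_cong[where g="\<lambda>x. det (\<chi> k l. if l = i then axis j 1 $ k else \<alpha> x $ k $ l) / det (\<alpha> x)"])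
       (auto simp: matrix_inv_entry det)
  then show ?thesis using \<Omega> by (intro borel_measurable_if_I) auto
qed

section \<open>The mixed discontinuous Galerkin forms\<close>

locale mdg_mesh = regular_mesh T s for T :: "(real ^ 'd) set set" and s +
  fixes \<Omega> :: "(real ^ 'd) set" and \<alpha> :: "real ^ 'd \<Rightarrow> real ^ 'd ^ 'd" and \<eta> :: "(real ^ 'd) set \<Rightarrow> real"
    and a0 M \<eta>0 :: real
  assumes \<Omega>: "open \<Omega>" "\<And>K. K \<in> T \<Longrightarrow> interior K \<subseteq> \<Omega>" and nonempty: "T \<noteq> {}"
    and \<alpha>: "\<alpha> \<in> borel_measurable (lebesgue_on \<Omega>)" "\<And>x. x \<in> \<Omega> \<Longrightarrow> transpose (\<alpha> x) = \<alpha> x"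
    and a0: "a0 > 0" "\<And>x \<xi>. x \<in> \<Omega> \<Longrightarrow> a0 * (norm \<xi>)\<^sup>2 \<le> \<xi> \<bullet> (\<alpha> x *v \<xi>)"
    and M: "M > 0" "\<And>x \<xi>. x \<in> \<Omega> \<Longrightarrow> norm (\<alpha> x *v \<xi>) \<le> M * norm \<xi>"
    and \<eta>: "\<eta>0 > 0" "\<And>e. e \<in> interior_faces T \<Longrightarrow> \<eta>0 \<le> \<eta> e"
begin

text \<open>Outside the domain the coefficient is unrestricted, but all discrete functions vanish there. So its inverse
  may be replaced by a function that is measurable and bounded everywhere.\<close>
definition c0 :: "real ^ 'd \<Rightarrow> real ^ 'd ^ 'd" where
  "c0 x = (if x \<in> \<Omega> then matrix_inv (\<alpha> x) else 0)"

lemmas coefficient = inverse_coefficient[OF \<alpha>(2) a0(1) a0(2) M(1) M(2)]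

lemma c0_bound: "norm (c0 x *v \<xi>) \<le> 1 / a0 * norm \<xi>"
  using coefficient(1) a0(1) by (simp add: c0_def)

lemma c0_sym: "(c0 x *v \<xi>) \<bullet> \<zeta> = (c0 x *v \<zeta>) \<bullet> \<xi>"
  using coefficient(2) by (simp add: c0_def)

lemma c0_low: "x \<in> \<Omega> \<Longrightarrow> a0 / M\<^sup>2 * (norm \<xi>)\<^sup>2 \<le> (c0 x *v \<xi>) \<bullet> \<xi>"
  using coefficient(3) by (simp add: c0_def)

lemma c0_measurable: "(\<lambda>x. c0 x $ i $ j) \<in> borel_measurable lebesgue"
proof -
  have "(\<lambda>x. c0 x $ i $ j) = (\<lambda>x. if x \<in> \<Omega> then matrix_inv (\<alpha> x) $ i $ j else 0)" by (auto simp: c0_def)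
  then show ?thesis using measurable_inverse_coefficient[OF \<alpha>(1) coefficient(4) \<Omega>(1)] by simp
qed

lemma Q_h_outside_domain: "q \<in> Q_h T k \<Longrightarrow> x \<notin> \<Omega> \<Longrightarrow> q x = 0"
  using Q_h_outside[of q k x] \<Omega>(2) by blast

lemma V_h_outside_domain: "q \<in> V_h T k \<Longrightarrow> x \<notin> \<Omega> \<Longrightarrow> q x = 0"
  using V_h_outside[of q k x] \<Omega>(2) by blast

lemma inv_coefficient_mult: "p \<in> Q_h T k \<Longrightarrow> matrix_inv (\<alpha> x) *v p x = c0 x *v p x"
  using Q_h_outside_domain[of p k x] by (cases "x \<in> \<Omega>") (simp_all add: c0_def)

lemma zero_off_interior:
  assumes K: "K \<in> T" "x \<in> K" "x \<notin> interior K"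
  shows "q \<in> Q_h T k \<Longrightarrow> q x = 0" and "v \<in> V_h T l \<Longrightarrow> v x = 0"
proof -
  have "x \<notin> (\<Union>K\<in>T. interior K)"
  proof
    assume "x \<in> (\<Union>K\<in>T. interior K)"
    then obtain K' where "K' \<in> T" "x \<in> interior K'" by blast
    then show False using K disjoint_interior[of K K'] by (cases "K = K'") blast+
  qed
  then show "q \<in> Q_h T k \<Longrightarrow> q x = 0" "v \<in> V_h T l \<Longrightarrow> v x = 0" using Q_h_outside V_h_outside by blast+
qed

lemma Q_h_bounded: 
  assumes q: "q \<in> Q_h T k" and K: "K \<in> T"
  obtains B where "B \<ge> 0" "\<And>x. x \<in> K \<Longrightarrow> norm (q x) \<le> B"
proof -
  have "bounded (vpiece K q ` K)"
    using compactT[OF K] continuous_vpiece[OF q K] by (intro compact_imp_bounded compact_continuous_image)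
  then obtain B where B: "B > 0" "\<And>x. x \<in> K \<Longrightarrow> norm (vpiece K q x) \<le> B" unfolding bounded_pos by auto
  have "norm (q x) \<le> B" if "x \<in> K" for x
    using B that vpiece_props(2)[OF q K, of x] zero_off_interior(1)[OF K that _ q] by (cases "x \<in> interior K") auto
  then show ?thesis using that[of B] B(1) by simp
qed

lemma Q_h_measurable: "q \<in> Q_h T k \<Longrightarrow> (\<lambda>x. q x $ i) \<in> borel_measurable borel"
  using measurable_V_h unfolding Q_h_def by blast

lemma integrable_coefficient:
  assumes p: "p \<in> Q_h T k" and q: "q \<in> Q_h T k" and K: "K \<in> T"
  shows "integrable (lebesgue_on K) (\<lambda>x. (c0 x *v p x) \<bullet> q x)"
proof -
  interpret finite_measure "lebesgue_on K"
    using lmeasurable_compact[OF compactT[OF K]] by (rule finite_measure_lebesgue_on)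
  obtain B1 where B1: "B1 \<ge> 0" "\<And>x. x \<in> K \<Longrightarrow> norm (p x) \<le> B1" using Q_h_bounded[OF p K] by blast
  obtain B2 where B2: "B2 \<ge> 0" "\<And>x. x \<in> K \<Longrightarrow> norm (q x) \<le> B2" using Q_h_bounded[OF q K] by blast
  have pm: "(\<lambda>x. p x $ i) \<in> borel_measurable lebesgue" "(\<lambda>x. q x $ i) \<in> borel_measurable lebesgue" for i
    using Q_h_measurable[OF p] Q_h_measurable[OF q] by (auto intro!: measurable_completion)
  have "(\<lambda>x. \<Sum>i\<in>UNIV. (\<Sum>j\<in>UNIV. c0 x $ i $ j * p x $ j) * q x $ i) \<in> borel_measurable lebesgue"
    by (intro borel_measurable_sum borel_measurable_times c0_measurable pm)
  then have meas: "(\<lambda>x. (c0 x *v p x) \<bullet> q x) \<in> borel_measurable (lebesgue_on K)"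
    unfolding inner_vec_def matrix_vector_mult_def by (auto intro: measurable_restrict_space1)
  show ?thesis
  proof (rule integrable_const_bound[OF _ meas])
    have "norm ((c0 x *v p x) \<bullet> q x) \<le> 1 / a0 * B1 * B2" if x: "x \<in> K" for x
    proof -
      have "norm ((c0 x *v p x) \<bullet> q x) \<le> norm (c0 x *v p x) * norm (q x)" using Cauchy_Schwarz_ineq2 by simp
      also have "\<dots> \<le> (1 / a0 * norm (p x)) * norm (q x)" by (intro mult_right_mono c0_bound) simp
      also have "\<dots> \<le> (1 / a0 * B1) * B2"
        using B1 B2 x a0(1) by (intro mult_mono) (auto simp: divide_right_mono)
      finally show ?thesis .
    qed
    then show "AE x in lebesgue_on K. norm ((c0 x *v p x) \<bullet> q x) \<le> 1 / a0 * B1 * B2"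
      by (intro AE_I2) simp
  qed
qed

definition psq :: "(real ^ 'd \<Rightarrow> real ^ 'd) \<Rightarrow> real" where
  "psq q = (\<Sum>K\<in>T. LINT x:K|lborel. (norm (vpiece K q x))\<^sup>2)"

abbreviation cform :: "(real ^ 'd \<Rightarrow> real ^ 'd) \<Rightarrow> (real ^ 'd \<Rightarrow> real ^ 'd) \<Rightarrow> real" where
  "cform p q \<equiv> mesh_inner T (\<lambda>x. matrix_inv (\<alpha> x) *v p x) q"

lemma cform_eq: "p \<in> Q_h T k \<Longrightarrow> cform p q = (\<Sum>K\<in>T. LINT x|lebesgue_on K. (c0 x *v p x) \<bullet> q x)"
  unfolding mesh_inner_def using inv_coefficient_mult by simp

lemma cform_compare:
  assumes q: "q \<in> Q_h T k"
  shows "cform q q \<le> 1 / a0 * psq q" "a0 / M\<^sup>2 * psq q \<le> cform q q"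
proof -
  have nsq: "(norm (q x))\<^sup>2 = (\<Sum>i\<in>UNIV. (q x $ i)\<^sup>2)" for x
    unfolding power2_norm_eq_inner inner_vec_def by (simp add: power2_eq_square)
  have meas: "(\<lambda>x. (norm (q x))\<^sup>2) \<in> borel_measurable borel"
    unfolding nsq by (intro borel_measurable_sum borel_measurable_power Q_h_measurable[OF q])
  have int: "integrable (lebesgue_on K) (\<lambda>x. (norm (q x))\<^sup>2)" if K: "K \<in> T" for K
  proof -
    interpret finite_measure "lebesgue_on K"
      using lmeasurable_compact[OF compactT[OF K]] by (rule finite_measure_lebesgue_on)
    obtain B where B: "B \<ge> 0" "\<And>x. x \<in> K \<Longrightarrow> norm (q x) \<le> B" using Q_h_bounded[OF q K] by blast
    show ?thesis
    proof (rule integrable_const_bound[of _ "B\<^sup>2"])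
      show "(\<lambda>x. (norm (q x))\<^sup>2) \<in> borel_measurable (lebesgue_on K)"
        using meas by (intro measurable_restrict_space1 measurable_completion) simp
      show "AE x in lebesgue_on K. norm ((norm (q x))\<^sup>2) \<le> B\<^sup>2"
        using B by (intro AE_I2) (simp add: power_mono)
    qed
  qed
  have el: "(LINT x|lebesgue_on K. (norm (q x))\<^sup>2) = (LINT x:K|lborel. (norm (vpiece K q x))\<^sup>2)" if K: "K \<in> T" for K
    using vpiece_props(2)[OF q K] by (intro integral_element K meas continuous_intros continuous_vpiece[OF q K]) simp
  have "cform q q \<le> (\<Sum>K\<in>T. LINT x|lebesgue_on K. 1 / a0 * (norm (q x))\<^sup>2)"
    unfolding cform_eq[OF q]
  proof (intro sum_mono integral_mono integrable_coefficient[OF q q] integrable_mult_right int)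
    fix x
    have "(c0 x *v q x) \<bullet> q x \<le> norm (c0 x *v q x) * norm (q x)" by (rule norm_cauchy_schwarz)
    also have "\<dots> \<le> (1 / a0 * norm (q x)) * norm (q x)" by (intro mult_right_mono c0_bound) simp
    finally show "(c0 x *v q x) \<bullet> q x \<le> 1 / a0 * (norm (q x))\<^sup>2" by (simp add: power2_eq_square)
  qed
  also have "\<dots> = 1 / a0 * psq q" unfolding psq_def by (simp add: el sum_distrib_left)
  finally show "cform q q \<le> 1 / a0 * psq q" .
  have "a0 / M\<^sup>2 * psq q = (\<Sum>K\<in>T. LINT x|lebesgue_on K. a0 / M\<^sup>2 * (norm (q x))\<^sup>2)"
    unfolding psq_def by (simp add: el sum_distrib_left)
  also have "\<dots> \<le> cform q q"
    unfolding cform_eq[OF q]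
  proof (intro sum_mono integral_mono integrable_coefficient[OF q q] integrable_mult_right int)
    fix x show "a0 / M\<^sup>2 * (norm (q x))\<^sup>2 \<le> (c0 x *v q x) \<bullet> q x"
      using c0_low Q_h_outside_domain[OF q] by (cases "x \<in> \<Omega>") auto
  qed
  finally show "a0 / M\<^sup>2 * psq q \<le> cform q q" .
qed

lemma psq_nonneg: "0 \<le> psq q"
  unfolding psq_def by (intro sum_nonneg set_integral_cont_nonneg) simp

lemma weighted_jumps_nonneg: "q \<in> Q_h T k \<Longrightarrow> 0 \<le> weighted_jumps T \<eta> q q"
  unfolding weighted_jumps_eq using \<eta> face_diameter_pos[OF interior_faces_sub]
  by (intro sum_nonneg mult_nonneg_nonneg[OF _ fint_nonneg[OF zero_le_square]]) (force simp: less_imp_le)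

lemma njump_add: "p \<in> Q_h T k \<Longrightarrow> q \<in> Q_h T k \<Longrightarrow> njump e (p + q) = (\<lambda>x. njump e p x + njump e q x)"
  unfolding njump_def by (auto simp: fun_eq_iff vpiece_add sides_sub inner_add_left sum.distrib cong: sum.cong)

lemma njump_scaleR: "p \<in> Q_h T k \<Longrightarrow> njump e (r *\<^sub>R p) = (\<lambda>x. r * njump e p x)"
  unfolding njump_def by (auto simp: fun_eq_iff vpiece_scaleR sides_sub sum_distrib_left cong: sum.cong)

lemma avg_add: "v \<in> V_h T k \<Longrightarrow> w \<in> V_h T k \<Longrightarrow> avg e (v + w) = (\<lambda>x. avg e v x + avg e w x)"
  unfolding avg_def by (auto simp: fun_eq_iff piece_add sides_sub sum.distrib distrib_left cong: sum.cong)

lemma avg_scaleR: "v \<in> V_h T k \<Longrightarrow> avg e (r *\<^sub>R v) = (\<lambda>x. r * avg e v x)"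
  unfolding avg_def by (auto simp: fun_eq_iff piece_scaleR sides_sub sum_distrib_left cong: sum.cong)

lemma psd_a: "psd_form_on (Q_h T k) (a_MDG \<alpha> T \<eta>)"
  unfolding psd_form_on_def a_MDG_def
proof (intro conjI ballI allI)
  fix p q assume p: "p \<in> Q_h T k" and q: "q \<in> Q_h T k"
  show "cform p q + weighted_jumps T \<eta> p q = cform q p + weighted_jumps T \<eta> q p"
    unfolding cform_eq[OF p] cform_eq[OF q] weighted_jumps_eq[OF p q] weighted_jumps_eq[OF q p]
    by (intro arg_cong2[of _ _ _ _ "(+)"] sum.cong refl) (simp_all add: c0_sym[of _ "p _"] mult.commute)
next
  fix p q u assume p: "p \<in> Q_h T k" and q: "q \<in> Q_h T k" and u: "u \<in> Q_h T k"
  have pq: "p + q \<in> Q_h T k" using subspace_add[OF subspace_Q_h p q] .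
  have "cform (p + q) u = cform p u + cform q u"
    unfolding cform_eq[OF p] cform_eq[OF q] cform_eq[OF pq] sum.distrib[symmetric]
    by (intro sum.cong refl)
       (simp add: matrix_vector_right_distrib inner_add_left Bochner_Integration.integral_add integrable_coefficient[OF p u] integrable_coefficient[OF q u])
  moreover have "weighted_jumps T \<eta> (p + q) u = weighted_jumps T \<eta> p u + weighted_jumps T \<eta> q u"
    unfolding weighted_jumps_eq[OF p u] weighted_jumps_eq[OF q u] weighted_jumps_eq[OF pq u] sum.distrib[symmetric]
  proof (intro sum.cong refl)
    fix e assume e: "e \<in> interior_faces T"
    have "fint e (\<lambda>x. njump e (p + q) x * njump e u x) =
        fint e (\<lambda>x. njump e p x * njump e u x) + fint e (\<lambda>x. njump e q x * njump e u x)"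
      unfolding njump_add[OF p q] distrib_right
      by (intro fint_add interior_faces_sub[OF e] continuous_intros continuous_njump[OF p] continuous_njump[OF q] continuous_njump[OF u])
    then show "\<eta> e * inverse (diameter e) * fint e (\<lambda>x. njump e (p + q) x * njump e u x) =
       \<eta> e * inverse (diameter e) * fint e (\<lambda>x. njump e p x * njump e u x) + \<eta> e * inverse (diameter e) * fint e (\<lambda>x. njump e q x * njump e u x)"
      by (simp add: distrib_left)
  qed
  ultimately show "cform (p + q) u + weighted_jumps T \<eta> (p + q) u =
      (cform p u + weighted_jumps T \<eta> p u) + (cform q u + weighted_jumps T \<eta> q u)" by simp
next
  fix r p q assume p: "p \<in> Q_h T k" and q: "q \<in> Q_h T k"
  have rp: "r *\<^sub>R p \<in> Q_h T k" using subspace_scale[OF subspace_Q_h p] .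
  have "cform (r *\<^sub>R p) q = r * cform p q"
    unfolding cform_eq[OF p] cform_eq[OF rp] sum_distrib_left
    by (intro sum.cong refl) (simp add: matrix_vector_mult_scaleR)
  moreover have "weighted_jumps T \<eta> (r *\<^sub>R p) q = r * weighted_jumps T \<eta> p q"
    unfolding weighted_jumps_eq[OF p q] weighted_jumps_eq[OF rp q] sum_distrib_left njump_scaleR[OF p]
    by (intro sum.cong refl) (simp add: mult.assoc)
  ultimately show "cform (r *\<^sub>R p) q + weighted_jumps T \<eta> (r *\<^sub>R p) q = r * (cform p q + weighted_jumps T \<eta> p q)"
    by (simp add: distrib_left)
next
  fix p assume p: "p \<in> Q_h T k"
  have "0 \<le> a0 / M\<^sup>2 * psq p" using a0(1) psq_nonneg by simp
  then show "0 \<le> cform p p + weighted_jumps T \<eta> p p"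
    using cform_compare(2)[OF p] weighted_jumps_nonneg[OF p] by linarith
qed

lemma definite_a: "definite_on (Q_h T k) (a_MDG \<alpha> T \<eta>)"
  unfolding definite_on_def
proof safe
  fix p assume p: "p \<in> Q_h T k" and 0: "a_MDG \<alpha> T \<eta> p p = 0"
  have "a0 / M\<^sup>2 * psq p \<le> 0"
    using 0 cform_compare(2)[OF p] weighted_jumps_nonneg[OF p] unfolding a_MDG_def by linarith
  moreover have "a0 / M\<^sup>2 > 0" using a0(1) M(1) by simp
  ultimately have "psq p \<le> 0" by (metis mult_le_cancel_left_pos mult_zero_right)
  then have z: "psq p = 0" using psq_nonneg[of p] by linarith
  have "p x = 0" for x
  proof (cases "x \<in> (\<Union>K\<in>T. interior K)")
    case True
    then obtain K where K: "K \<in> T" "x \<in> interior K" by blast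
    have nn: "0 \<le> (LINT x:K|lborel. (norm (vpiece K p x))\<^sup>2)" for K by (intro set_integral_cont_nonneg) simp
    have I0: "(LINT x:K|lborel. (norm (vpiece K p x))\<^sup>2) = 0"
      using z K(1) nn unfolding psq_def by (subst (asm) sum_nonneg_eq_0_iff) auto
    have "continuous_on K (\<lambda>x. (norm (vpiece K p x))\<^sup>2)" by (intro continuous_intros continuous_vpiece[OF p K(1)])
    then have "(norm (vpiece K p x))\<^sup>2 = 0"
      by (rule integral_0_imp_0_interior[OF compactT[OF K(1)] _ _ I0 K(2)]) simp
    then show ?thesis using vpiece_props(2)[OF p K] by simp
  next
    case False
    then show ?thesis using Q_h_outside[OF p] by simp
  qed
  then show "p = 0" by (simp add: fun_eq_iff)
qed

lemma mass_eq: "v \<in> V_h T k \<Longrightarrow> mesh_inner T v v = mass v"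
  unfolding mass_def by (simp add: mesh_inner_V_h power2_eq_square)

lemma psd_m: "psd_form_on (V_h T k) (mesh_inner T)"
  unfolding psd_form_on_def
proof (intro conjI ballI allI)
  fix v w show "mesh_inner T v w = mesh_inner T w v"
    unfolding mesh_inner_def by (simp only: inner_commute[of "v _" "w _"])
next
  fix u v w assume u: "u \<in> V_h T k" and v: "v \<in> V_h T k" and w: "w \<in> V_h T k"
  have uv: "u + v \<in> V_h T k" using subspace_add[OF subspace_V_h u v] .
  show "mesh_inner T (u + v) w = mesh_inner T u w + mesh_inner T v w"
    unfolding mesh_inner_V_h[OF uv w] mesh_inner_V_h[OF u w] mesh_inner_V_h[OF v w] sum.distrib[symmetric]
  proof (intro sum.cong refl)
    fix K assume K: "K \<in> T"
    show "(LINT x:K|lborel. piece K (u + v) x * piece K w x) = (LINT x:K|lborel. piece K u x * piece K w x) + (LINT x:K|lborel. piece K v x * piece K w x)"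
      unfolding piece_add[OF u v K] distrib_right
      by (intro set_integral_cont_add compactT K continuous_intros continuous_piece[OF u K] continuous_piece[OF v K] continuous_piece[OF w K])
  qed
next
  fix r v w assume v: "v \<in> V_h T k" and w: "w \<in> V_h T k"
  have rv: "r *\<^sub>R v \<in> V_h T k" using subspace_scale[OF subspace_V_h v] .
  show "mesh_inner T (r *\<^sub>R v) w = r * mesh_inner T v w"
    unfolding mesh_inner_V_h[OF rv w] mesh_inner_V_h[OF v w] sum_distrib_left
    by (intro sum.cong refl) (simp add: piece_scaleR[OF v] mult.assoc)
next
  fix v assume "v \<in> V_h T k"
  then show "0 \<le> mesh_inner T v v" using mass_eq mass_nonneg by simp
qed

lemma definite_m: "definite_on (V_h T k) (mesh_inner T)"
  unfolding definite_on_def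
proof safe
  fix p assume p: "p \<in> V_h T k" and 0: "mesh_inner T p p = 0"
  then have z: "mass p = 0" using mass_eq by simp
  have "p x = 0" for x
  proof (cases "x \<in> (\<Union>K\<in>T. interior K)")
    case True
    then obtain K where K: "K \<in> T" "x \<in> interior K" by blast
    have nn: "0 \<le> (LINT x:K|lborel. (piece K p x)\<^sup>2)" for K by (intro set_integral_cont_nonneg) simp
    have I0: "(LINT x:K|lborel. (piece K p x)\<^sup>2) = 0"
      using z K(1) nn unfolding mass_def by (subst (asm) sum_nonneg_eq_0_iff) auto
    have "continuous_on K (\<lambda>x. (piece K p x)\<^sup>2)" by (intro continuous_intros continuous_piece[OF p K(1)])
    then have "(piece K p x)\<^sup>2 = 0"
      by (rule integral_0_imp_0_interior[OF compactT[OF K(1)] _ _ I0 K(2)]) simp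
    then show ?thesis using piece_props(2)[OF p K] by simp
  next
    case False
    then show ?thesis using V_h_outside[OF p] by simp
  qed
  then show "p = 0" by (simp add: fun_eq_iff)
qed

lemma div_h_add: 
  assumes p: "p \<in> Q_h T k" and q: "q \<in> Q_h T k"
  shows "div_h T (p + q) = div_h T p + div_h T q"
proof -
  have pq: "p + q \<in> Q_h T k" using subspace_add[OF subspace_Q_h p q] .
  have *: "dvg (vpiece K (p + q)) x = dvg (vpiece K p) x + dvg (vpiece K q) x" if "K \<in> T" for K x
    unfolding vpiece_add[OF p q that] by (rule dvg_add[OF vpiece_props(1)[OF p that] vpiece_props(1)[OF q that]])
  show ?thesis
  proof
    fix x
    have "div_h T (p + q) x = (\<Sum>K\<in>T. indicator (interior K) x *\<^sub>R dvg (vpiece K (p + q)) x)"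
      by (subst div_h_eq_glue[OF pq]) (rule glue_def)
    also have "\<dots> = (\<Sum>K\<in>T. indicator (interior K) x *\<^sub>R (dvg (vpiece K p) x + dvg (vpiece K q) x))"
      by (rule sum.cong) (simp_all only: *)
    also have "\<dots> = (div_h T p + div_h T q) x"
      by (simp only: plus_fun_apply div_h_eq_glue[OF p] div_h_eq_glue[OF q] glue_def scaleR_add_right sum.distrib)
    finally show "div_h T (p + q) x = (div_h T p + div_h T q) x" .
  qed
qed

lemma div_h_scaleR: 
  assumes p: "p \<in> Q_h T k"
  shows "div_h T (r *\<^sub>R p) = r *\<^sub>R div_h T p"
proof -
  have rp: "r *\<^sub>R p \<in> Q_h T k" using subspace_scale[OF subspace_Q_h p] .
  have *: "dvg (vpiece K (r *\<^sub>R p)) x = r * dvg (vpiece K p) x" if "K \<in> T" for K x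
    unfolding vpiece_scaleR[OF p that] by (rule dvg_scaleR[OF vpiece_props(1)[OF p that]])
  show ?thesis
  proof
    fix x
    have "div_h T (r *\<^sub>R p) x = (\<Sum>K\<in>T. indicator (interior K) x *\<^sub>R dvg (vpiece K (r *\<^sub>R p)) x)"
      by (subst div_h_eq_glue[OF rp]) (rule glue_def)
    also have "\<dots> = (\<Sum>K\<in>T. r *\<^sub>R (indicator (interior K) x *\<^sub>R dvg (vpiece K p) x))"
      by (rule sum.cong) (simp_all only: * real_scaleR_def mult.left_commute)
    also have "\<dots> = (r *\<^sub>R div_h T p) x"
      by (simp only: scaleR_fun_apply div_h_eq_glue[OF p] glue_def scaleR_sum_right)
    finally show "div_h T (r *\<^sub>R p) x = (r *\<^sub>R div_h T p) x" .
  qed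
qed

lemma b_jump: 
  assumes "q \<in> Q_h T (k + 1)" "v \<in> V_h T k"
  shows "b_MDG T q v = - mesh_inner T (div_h T q) v + (\<Sum>e\<in>interior_faces T. fint e (\<lambda>x. njump e q x * avg e v x))"
  unfolding b_MDG_def using face_inner_jump_average[OF interior_faces_sub assms] by simp

lemma b_linear_left:
  assumes v: "v \<in> V_h T k"
  shows "linear_on_subspace (Q_h T (k + 1)) (\<lambda>q. b_MDG T q v)"
  unfolding linear_on_subspace_def
proof (intro conjI ballI allI)
  fix p q assume p: "p \<in> Q_h T (k + 1)" and q: "q \<in> Q_h T (k + 1)"
  have pq: "p + q \<in> Q_h T (k + 1)" using subspace_add[OF subspace_Q_h p q] .
  have "fint e (\<lambda>x. njump e (p + q) x * avg e v x) = fint e (\<lambda>x. njump e p x * avg e v x) + fint e (\<lambda>x. njump e q x * avg e v x)"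
    if e: "e \<in> interior_faces T" for e
    unfolding njump_add[OF p q] distrib_right
    by (intro fint_add interior_faces_sub[OF e] continuous_intros continuous_njump[OF p] continuous_njump[OF q] continuous_avg[OF v])
  moreover have "mesh_inner T (div_h T (p + q)) v = mesh_inner T (div_h T p) v + mesh_inner T (div_h T q) v"
    using psd_m[of k] div_h_in[OF p] div_h_in[OF q] v unfolding psd_form_on_def div_h_add[OF p q] by blast
  ultimately show "b_MDG T (p + q) v = b_MDG T p v + b_MDG T q v"
    unfolding b_jump[OF p v] b_jump[OF q v] b_jump[OF pq v] by (simp add: sum.distrib)
next
  fix r p assume p: "p \<in> Q_h T (k + 1)"
  have rp: "r *\<^sub>R p \<in> Q_h T (k + 1)" using subspace_scale[OF subspace_Q_h p] .
  have "mesh_inner T (div_h T (r *\<^sub>R p)) v = r * mesh_inner T (div_h T p) v"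
    using psd_m[of k] div_h_in[OF p] v unfolding psd_form_on_def div_h_scaleR[OF p] by blast
  then show "b_MDG T (r *\<^sub>R p) v = r *\<^sub>R b_MDG T p v"
    unfolding b_jump[OF p v] b_jump[OF rp v] njump_scaleR[OF p]
    by (simp add: sum_distrib_left mult.assoc right_diff_distrib)
qed

lemma b_linear_right:
  assumes q: "q \<in> Q_h T (k + 1)"
  shows "linear_on_subspace (V_h T k) (b_MDG T q)"
  unfolding linear_on_subspace_def
proof (intro conjI ballI allI)
  fix v w assume v: "v \<in> V_h T k" and w: "w \<in> V_h T k"
  have vw: "v + w \<in> V_h T k" using subspace_add[OF subspace_V_h v w] .
  have "fint e (\<lambda>x. njump e q x * avg e (v + w) x) = fint e (\<lambda>x. njump e q x * avg e v x) + fint e (\<lambda>x. njump e q x * avg e w x)"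
    if e: "e \<in> interior_faces T" for e
    unfolding avg_add[OF v w] distrib_left
    by (intro fint_add interior_faces_sub[OF e] continuous_intros continuous_njump[OF q] continuous_avg[OF w] continuous_avg[OF v])
  moreover have "mesh_inner T (div_h T q) (v + w) = mesh_inner T (div_h T q) v + mesh_inner T (div_h T q) w"
    using psd_form_linear_right[OF subspace_V_h psd_m div_h_in[OF q]] v w unfolding linear_on_subspace_def by blast
  ultimately show "b_MDG T q (v + w) = b_MDG T q v + b_MDG T q w"
    unfolding b_jump[OF q v] b_jump[OF q w] b_jump[OF q vw] by (simp add: sum.distrib)
next
  fix r v assume v: "v \<in> V_h T k"
  have rv: "r *\<^sub>R v \<in> V_h T k" using subspace_scale[OF subspace_V_h v] .
  have "mesh_inner T (div_h T q) (r *\<^sub>R v) = r *\<^sub>R mesh_inner T (div_h T q) v"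
    using psd_form_linear_right[OF subspace_V_h psd_m div_h_in[OF q]] v unfolding linear_on_subspace_def by blast
  then show "b_MDG T q (r *\<^sub>R v) = r *\<^sub>R b_MDG T q v"
    unfolding b_jump[OF q v] b_jump[OF q rv] avg_scaleR[OF v]
    by (simp add: sum_distrib_left mult.left_commute right_diff_distrib)
qed

text \<open>The interiors of the elements lie in the domain and discrete functions vanish elsewhere, so that the norm on
  the domain is the sum over the elements.\<close>
lemma V_h_square_integral:
  assumes v: "v \<in> V_h T k"
  shows "integrable lborel (\<lambda>x. (v x)\<^sup>2)" "L2_norm_on \<Omega> v = sqrt (mesh_inner T v v)"
proof -
  have mv: "v \<in> borel_measurable borel" using measurable_V_h[OF v] .
  have sq: "(v x)\<^sup>2 = (\<Sum>K\<in>T. indicator (interior K) x *\<^sub>R (piece K v x)\<^sup>2)" for x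
  proof (cases "x \<in> (\<Union>K\<in>T. interior K)")
    case True
    then obtain K where K: "K \<in> T" "x \<in> interior K" by blast
    have "(\<Sum>K\<in>T. indicator (interior K) x *\<^sub>R (piece K v x)\<^sup>2) = (piece K v x)\<^sup>2"
      using glue_interior[OF K, of "\<lambda>K x. (piece K v x)\<^sup>2"] by (simp add: glue_def)
    then show ?thesis using piece_props(2)[OF v K] by simp
  next
    case False
    then show ?thesis using V_h_outside[OF v False] glue_outside[OF False, of "\<lambda>K x. (piece K v x)\<^sup>2"] by (simp add: glue_def)
  qed
  have int: "integrable lborel (\<lambda>x. indicator (interior K) x *\<^sub>R (piece K v x)\<^sup>2)" if K: "K \<in> T" for K
  proof (rule Bochner_Integration.integrable_bound)
    show "integrable lborel (\<lambda>x. indicator K x *\<^sub>R (piece K v x)\<^sup>2)"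
      by (intro borel_integrable_compact compactT K continuous_intros continuous_piece[OF v K])
    have "piece K v \<in> borel_measurable borel"
      using continuous_piece[OF v K] by (rule borel_measurable_continuous_onI)
    then show "(\<lambda>x. indicator (interior K) x *\<^sub>R (piece K v x)\<^sup>2) \<in> borel_measurable lborel" by measurable
    show "AE x in lborel. norm (indicator (interior K) x *\<^sub>R (piece K v x)\<^sup>2) \<le> norm (indicator K x *\<^sub>R (piece K v x)\<^sup>2)"
      using interior_subset[of K] by (intro AE_I2) (auto simp: indicator_def)
  qed
  show "integrable lborel (\<lambda>x. (v x)\<^sup>2)" unfolding sq by (intro Bochner_Integration.integrable_sum int)
  have \<Omega>s: "\<Omega> \<in> sets borel" using \<Omega>(1) by simp
  have "(LINT x|lebesgue_on \<Omega>. (v x)\<^sup>2) = (LINT x|lebesgue. indicator \<Omega> x *\<^sub>R (v x)\<^sup>2)"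
    using \<Omega>s by (subst integral_restrict_space) auto
  also have "(\<lambda>x. indicator \<Omega> x *\<^sub>R (v x)\<^sup>2) = (\<lambda>x. (v x)\<^sup>2)"
    using V_h_outside_domain[OF v] by (auto simp: fun_eq_iff indicator_def)
  also have "(LINT x|lebesgue. (v x)\<^sup>2) = (LINT x|lborel. (v x)\<^sup>2)"
    using mv by (intro integral_completion) simp
  also have "\<dots> = (\<Sum>K\<in>T. LINT x|lborel. indicator (interior K) x *\<^sub>R (piece K v x)\<^sup>2)"
    unfolding sq by (intro Bochner_Integration.integral_sum int)
  also have "\<dots> = (\<Sum>K\<in>T. LINT x|lebesgue_on K. v x * v x)"
  proof (intro sum.cong refl)
    fix K assume K: "K \<in> T"
    have Ks: "K \<in> sets borel" using borel_compact[OF compactT[OF K]] .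
    have "(LINT x|lebesgue_on K. v x * v x) = (LINT x|lebesgue. indicator K x *\<^sub>R (v x * v x))"
      using Ks by (subst integral_restrict_space) auto
    also have "(\<lambda>x. indicator K x *\<^sub>R (v x * v x)) = (\<lambda>x. indicator (interior K) x *\<^sub>R (piece K v x)\<^sup>2)"
    proof
      fix x show "indicator K x *\<^sub>R (v x * v x) = indicator (interior K) x *\<^sub>R (piece K v x)\<^sup>2"
      proof (cases "x \<in> interior K")
        case True
        then show ?thesis using piece_props(2)[OF v K True] interior_subset[of K] by (auto simp: power2_eq_square)
      next
        case False
        then show ?thesis using zero_off_interior(2)[OF K _ False v] by (auto simp: indicator_def)
      qed
    qed
    also have "(LINT x|lebesgue. indicator (interior K) x *\<^sub>R (piece K v x)\<^sup>2) = (LINT x|lborel. indicator (interior K) x *\<^sub>R (piece K v x)\<^sup>2)"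
      using borel_measurable_integrable[OF int[OF K]] by (rule integral_completion)
    finally show "(LINT x|lborel. indicator (interior K) x *\<^sub>R (piece K v x)\<^sup>2) = (LINT x|lebesgue_on K. v x * v x)" ..
  qed
  finally show "L2_norm_on \<Omega> v = sqrt (mesh_inner T v v)"
    unfolding L2_norm_on_def mesh_inner_def by simp
qed

lemma nontrivial_spaces: "\<exists>v\<in>V_h T k. v \<noteq> 0" "\<exists>q\<in>Q_h T k. q \<noteq> 0"
proof -
  obtain K x where K: "K \<in> T" "x \<in> interior K" using nonempty interiorT by blast
  have "glue T (\<lambda>K x. 1 :: real) \<in> V_h T k" by (intro glue_in_V_h polynomial_deg_le_const)
  moreover have "glue T (\<lambda>K x. 1 :: real) \<noteq> 0" using glue_interior[OF K, of "\<lambda>K x. 1 :: real"]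
    by (auto simp: fun_eq_iff intro!: exI[of _ x])
  ultimately show "\<exists>v\<in>V_h T k. v \<noteq> 0" by blast
  obtain u :: "real ^ 'd" where u: "norm u = 1" using vector_choose_size[of 1] by auto
  have "glue T (\<lambda>K x. u) \<in> Q_h T k"
    by (intro glue_in_Q_h) (simp add: poly_field_def polynomial_deg_le_const)
  moreover have "glue T (\<lambda>K x. u) \<noteq> 0" using glue_interior[OF K, of "\<lambda>K x. u"] u
    by (auto simp: fun_eq_iff intro!: exI[of _ x])
  ultimately show "\<exists>q\<in>Q_h T k. q \<noteq> 0" by blast
qed

end

section \<open>Uniform well-posedness\<close>

text \<open>The optimal weight is \<open>t = sqrt (B / A)\<close>. If \<open>A\<close> or \<open>B\<close> vanishes it is approached by letting \<open>t\<close> tend to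
  infinity or to zero.\<close>
lemma Young_optimal:
  fixes X A B :: real
  assumes "A \<ge> 0" "B \<ge> 0" and X: "\<And>t. t > 0 \<Longrightarrow> X \<le> t * A + B / t"
  shows "X \<le> 2 * (sqrt A * sqrt B)"
proof (cases "A = 0 \<or> B = 0")
  case True
  have le: "X \<le> e" if e: "e > 0" for e
  proof (cases "A = 0")
    case True
    have "X \<le> B / ((B + 1) / e)" using X[of "(B + 1) / e"] assms e True by simp
    also have "\<dots> \<le> e" using assms e by (simp add: field_simps)
    finally show ?thesis .
  next
    case False
    then have "A > 0" "B = 0" using assms \<open>A = 0 \<or> B = 0\<close> by auto
    then show ?thesis using X[of "e / A"] e by simp
  qed
  have "X \<le> 0"
  proof (rule field_le_epsilon)
    fix e :: real assume "0 < e"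
    from le[OF this] show "X \<le> 0 + e" by simp
  qed
  then show ?thesis using True by auto
next
  case False
  then have AB: "A > 0" "B > 0" using assms by auto
  define a b where "a = sqrt A" and "b = sqrt B"
  have ab: "a > 0" "b > 0" "A = a * a" "B = b * b" using AB by (auto simp: a_def b_def)
  have "X \<le> (b / a) * A + B / (b / a)" using ab by (intro X) simp
  also have "\<dots> = 2 * (a * b)" using ab by (simp add: field_simps)
  finally show ?thesis by (simp add: a_def b_def)
qed

context mdg_mesh
begin

text \<open>The constants of the trace inequality, of the local construction and of the domain are parameters which do
  not refer to the mesh. \<open>Cstab\<close> dominates the constants of all estimates below, so it is uniform in the
  mesh as well.\<close>
context
  fixes Ct Cf R Cstab :: real and k :: nat and x0 :: "real ^ 'd"
  assumes Ct: "Ct \<ge> 0" "\<And>(K :: (real ^ 'd) set) a P. regular s K \<Longrightarrow> a \<in> verts K \<Longrightarrow> polynomial_deg_le k P \<Longrightarrow>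
    diameter K * (LINT x|face_measure (opp_face K a). (P x)\<^sup>2) \<le> Ct * (LINT x:K|lborel. (P x)\<^sup>2)"
  and Cf: "Cf \<ge> 0" "\<And>(K :: (real ^ 'd) set) w \<rho>. regular s K \<Longrightarrow> polynomial_deg_le k w \<Longrightarrow>
     (\<forall>a\<in>verts K. polynomial_deg_le k (\<rho> a)) \<Longrightarrow>
     (\<exists>q. poly_field (k + 1) q \<and>
        (\<forall>a\<in>verts K. \<forall>x\<in>opp_face K a. q x \<bullet> nrm K a = \<rho> a x) \<and>
        (LINT x:K|lborel. (norm (q x))\<^sup>2) \<le> Cf * ((LINT x:K|lborel. (norm (grad w x))\<^sup>2) +
            (\<Sum>a\<in>verts K. diameter K * (LINT x|face_measure (opp_face K a). (\<rho> a x)\<^sup>2))) \<and>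
        (LINT x:K|lborel. (norm (grad w x))\<^sup>2)
          - (\<Sum>a\<in>verts K. LINT x|face_measure (opp_face K a). \<rho> a x * w x)
          - 1 / (4 * s) * (\<Sum>a\<in>verts K. diameter K * (LINT x|face_measure (opp_face K a). (\<rho> a x)\<^sup>2))
        \<le> - (LINT x:K|lborel. dvg q x * w x))"
  and R: "R \<ge> 0" "\<And>K. K \<in> T \<Longrightarrow> K \<subseteq> cball x0 R"
  and Cstab: "1 \<le> Cstab" "4 * s * Cf / a0 \<le> Cstab" "32 * R\<^sup>2 * (real (CARD('d) + 1) * Ct + 1) \<le> Cstab"
    "2 * sqrt (real (CARD('d) + 1) * Ct / \<eta>0) \<le> Cstab"
begin

text \<open>For the field of \<open>stable_field\<close> all normal jumps vanish, so that \<open>b\<close> reduces to the divergence term and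
  \<open>a\<close> to the weighted mean square.\<close>
lemma inf_sup:
  assumes w: "w \<in> V_h T k"
  shows "\<exists>q\<in>Q_h T (k + 1). a_MDG \<alpha> T \<eta> q q \<le> Cstab * b_MDG T q w \<and> mesh_inner T w w \<le> Cstab * b_MDG T q w"
proof -
  obtain q where q: "q \<in> Q_h T (k + 1)" and nj: "\<And>e x. e \<in> interior_faces T \<Longrightarrow> x \<in> e \<Longrightarrow> njump e q x = 0"
    and bound: "psq q \<le> 2 * s * Cf * (gsq w + jsq w)"
    and low: "1/2 * (gsq w + jsq w) \<le> - (\<Sum>K\<in>T. LINT x:K|lborel. dvg (vpiece K q) x * piece K w x)"
    using stable_field[OF w Cf] unfolding psq_def by blast
  have zero: "fint e (\<lambda>x. njump e q x * g x) = 0" if e: "e \<in> interior_faces T" and g: "continuous_on UNIV g" for e g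
  proof -
    have "fint e (\<lambda>x. njump e q x * g x) = fint e (\<lambda>x. 0)"
      using nj[OF e] by (intro fint_cong interior_faces_sub[OF e] borel_measurable_continuous_onI continuous_intros continuous_njump[OF q] g) auto
    then show ?thesis by simp
  qed
  define \<beta> where "\<beta> = b_MDG T q w"
  have "\<beta> = - (\<Sum>K\<in>T. LINT x:K|lborel. dvg (vpiece K q) x * piece K w x)"
    unfolding \<beta>_def b_MDG_eq[OF q w] using zero continuous_avg[OF w] by simp
  then have "1/2 * (gsq w + jsq w) \<le> \<beta>" using low by simp
  then have \<beta>: "gsq w + jsq w \<le> 2 * \<beta>" by simp
  have \<beta>0: "0 \<le> \<beta>" using \<beta> gsq_nonneg[of w] jsq_nonneg[of w] by linarith
  have wj: "weighted_jumps T \<eta> q q = 0"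
    unfolding weighted_jumps_eq[OF q q] using zero continuous_njump[OF q] by simp
  have "a_MDG \<alpha> T \<eta> q q \<le> 1 / a0 * psq q" unfolding a_MDG_def wj using cform_compare(1)[OF q] by simp
  also have "\<dots> \<le> 1 / a0 * (2 * s * Cf * (2 * \<beta>))"
  proof -
    have le: "2 * s * Cf * (gsq w + jsq w) \<le> 2 * s * Cf * (2 * \<beta>)" using \<beta> s1 Cf(1) by (intro mult_left_mono) auto
    show ?thesis by (rule mult_left_mono[OF order_trans[OF bound le]]) (use a0(1) in simp)
  qed
  also have "\<dots> = (4 * s * Cf / a0) * \<beta>" by simp
  also have "\<dots> \<le> Cstab * \<beta>" using Cstab(2) \<beta>0 by (intro mult_right_mono)
  finally have 1: "a_MDG \<alpha> T \<eta> q q \<le> Cstab * \<beta>" .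
  have "mesh_inner T w w \<le> 16 * R\<^sup>2 * (N * Ct + 1) * (gsq w + jsq w)"
    unfolding mass_eq[OF w] by (rule discrete_Poincare[OF Ct w R(2,1)])
  also have "\<dots> \<le> 16 * R\<^sup>2 * (N * Ct + 1) * (2 * \<beta>)"
    using \<beta> Ct(1) by (intro mult_left_mono mult_nonneg_nonneg add_nonneg_nonneg) (auto simp: N_def)
  also have "\<dots> = (32 * R\<^sup>2 * (real (CARD('d) + 1) * Ct + 1)) * \<beta>" by (simp add: N_def)
  also have "\<dots> \<le> Cstab * \<beta>" using Cstab(3) \<beta>0 by (intro mult_right_mono)
  finally show ?thesis using q 1 unfolding \<beta>_def by blast
qed

lemma jump_term_bound:
  assumes q: "q \<in> Q_h T (k + 1)" and v: "v \<in> V_h T k"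
  shows "\<bar>b_MDG T q v + mesh_inner T (div_h T q) v\<bar> \<le> Cstab * (sqrt (a_MDG \<alpha> T \<eta> q q) * sqrt (mesh_inner T v v))"
proof -
  define B where "B = real (CARD('d) + 1) * Ct / \<eta>0"
  have B: "0 \<le> B" using Ct(1) \<eta>(1) by (simp add: B_def)
  have W: "0 \<le> weighted_jumps T \<eta> q q" "weighted_jumps T \<eta> q q \<le> a_MDG \<alpha> T \<eta> q q"
  proof -
    have "0 \<le> a0 / M\<^sup>2 * psq q" using a0(1) psq_nonneg by simp
    then show "weighted_jumps T \<eta> q q \<le> a_MDG \<alpha> T \<eta> q q"
      using cform_compare(2)[OF q] unfolding a_MDG_def by linarith
  qed (rule weighted_jumps_nonneg[OF q])
  have "\<bar>b_MDG T q v + mesh_inner T (div_h T q) v\<bar> \<le> 2 * (sqrt (weighted_jumps T \<eta> q q) * sqrt (B * mass v))"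
  proof (rule Young_optimal)
    fix t :: real assume t: "t > 0"
    show "\<bar>b_MDG T q v + mesh_inner T (div_h T q) v\<bar> \<le> t * weighted_jumps T \<eta> q q + B * mass v / t"
      using jump_average_bound[OF Ct q v \<eta>(2,1) t] unfolding b_jump[OF q v] B_def N_def by simp
  qed (use W B mass_nonneg in auto)
  also have "\<dots> \<le> 2 * (sqrt (a_MDG \<alpha> T \<eta> q q) * sqrt (B * mass v))"
    using W B mass_nonneg by (intro mult_left_mono mult_right_mono) auto
  also have "\<dots> = (2 * sqrt B) * (sqrt (a_MDG \<alpha> T \<eta> q q) * sqrt (mass v))" by (simp add: real_sqrt_mult)
  also have "\<dots> \<le> Cstab * (sqrt (a_MDG \<alpha> T \<eta> q q) * sqrt (mass v))"
    using Cstab(4) W mass_nonneg unfolding B_def by (intro mult_right_mono mult_nonneg_nonneg) auto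
  finally show ?thesis unfolding mass_eq[OF v] .
qed

lemma saddle: "\<exists>BQ BV. saddle_point (Q_h T (k + 1)) (V_h T k) (a_MDG \<alpha> T \<eta>) (mesh_inner T) (div_h T) (b_MDG T) BQ BV Cstab"
proof -
  obtain BQ BV where B: "finite BQ" "Q_h T (k + 1) \<subseteq> span BQ" "finite BV" "V_h T k \<subseteq> span BV"
    using Q_h_finite_dim[of "k + 1"] V_h_finite_dim[of k] by blast
  have "saddle_point (Q_h T (k + 1)) (V_h T k) (a_MDG \<alpha> T \<eta>) (mesh_inner T) (div_h T) (b_MDG T) BQ BV Cstab"
    by (rule saddle_point.intro)
       (rule subspace_Q_h subspace_V_h B psd_a definite_a psd_m definite_m Cstab(1)
        | (erule div_h_in b_linear_left b_linear_right inf_sup)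
        | (erule jump_term_bound, assumption))+
  then show ?thesis by blast
qed

lemma graph_form:
  "psd_form_on (Q_h T (k + 1)) (\<lambda>p q. a_MDG \<alpha> T \<eta> p q + mesh_inner T (div_h T p) (div_h T q))" (is "psd_form_on ?Q ?n")
  "definite_on (Q_h T (k + 1)) (\<lambda>p q. a_MDG \<alpha> T \<eta> p q + mesh_inner T (div_h T p) (div_h T q))"
proof -
  note a = psd_a[of "k + 1", unfolded psd_form_on_def] and m = psd_m[of k, unfolded psd_form_on_def]
  show "psd_form_on ?Q ?n"
    unfolding psd_form_on_def
  proof (intro conjI ballI allI)
    fix p q assume "p \<in> ?Q" "q \<in> ?Q"
    then show "?n p q = ?n q p" using a m div_h_in by metis
  next
    fix p q u assume pqu: "p \<in> ?Q" "q \<in> ?Q" "u \<in> ?Q"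
    have "a_MDG \<alpha> T \<eta> (p + q) u = a_MDG \<alpha> T \<eta> p u + a_MDG \<alpha> T \<eta> q u" using a pqu by blast
    moreover have "mesh_inner T (div_h T p + div_h T q) (div_h T u) = mesh_inner T (div_h T p) (div_h T u) + mesh_inner T (div_h T q) (div_h T u)"
      using m div_h_in pqu by blast
    ultimately show "?n (p + q) u = ?n p u + ?n q u" unfolding div_h_add[OF pqu(1,2)] by linarith
  next
    fix r p q assume pq: "p \<in> ?Q" "q \<in> ?Q"
    have "a_MDG \<alpha> T \<eta> (r *\<^sub>R p) q = r * a_MDG \<alpha> T \<eta> p q" using a pq by blast
    moreover have "mesh_inner T (r *\<^sub>R div_h T p) (div_h T q) = r * mesh_inner T (div_h T p) (div_h T q)"
      using m div_h_in pq by blast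
    ultimately show "?n (r *\<^sub>R p) q = r * ?n p q" unfolding div_h_scaleR[OF pq(1)] by (simp add: distrib_left)
  next
    fix p assume p: "p \<in> ?Q"
    then show "0 \<le> ?n p p" using a m div_h_in[OF p] by (meson add_nonneg_nonneg)
  qed
  show "definite_on ?Q ?n"
    unfolding definite_on_def
  proof safe
    fix p assume p: "p \<in> ?Q" and 0: "?n p p = 0"
    have "0 \<le> a_MDG \<alpha> T \<eta> p p" "0 \<le> mesh_inner T (div_h T p) (div_h T p)" using a m div_h_in[OF p] p by blast+
    then have "a_MDG \<alpha> T \<eta> p p = 0" using 0 by linarith
    then show "p = 0" using definite_a p unfolding definite_on_def by blast
  qed
qed

lemma linear_functional_on_subspace: "linear_functional_on S F \<Longrightarrow> linear_on_subspace S F"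
  unfolding linear_functional_on_def linear_on_subspace_def plus_fun_def scaleR_fun_def by simp

text \<open>The dual norms of \<open>F\<close> and \<open>G\<close> are those of the graph norm and of the \<open>L\<^sup>2\<close>-norm, which are the norms of
  the abstract problem.\<close>
theorem MDG_well_posed:
  assumes F: "linear_functional_on (Q_h T (k + 1)) F" and G: "linear_functional_on (V_h T k) G"
  shows "\<exists>!w. MDG_solution \<alpha> T \<eta> k F G (fst w) (snd w)"
    and "MDG_solution \<alpha> T \<eta> k F G p u \<Longrightarrow> norm_MDG \<alpha> T \<eta> p + L2_norm_on \<Omega> u
      \<le> 100 * Cstab ^ 6 * (dual_norm (Q_h T (k + 1)) (norm_MDG \<alpha> T \<eta>) F + dual_norm (V_h T k) (L2_norm_on \<Omega>) G)"
proof -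
  obtain BQ BV where "saddle_point (Q_h T (k + 1)) (V_h T k) (a_MDG \<alpha> T \<eta>) (mesh_inner T) (div_h T) (b_MDG T) BQ BV Cstab"
    using saddle by blast
  then interpret S: saddle_point "Q_h T (k + 1)" "V_h T k" "a_MDG \<alpha> T \<eta>" "mesh_inner T" "div_h T" "b_MDG T" BQ BV Cstab .
  note F' = linear_functional_on_subspace[OF F] and G' = linear_functional_on_subspace[OF G]
  have sol: "MDG_solution \<alpha> T \<eta> k F G p u \<longleftrightarrow> p \<in> Q_h T (k + 1) \<and> u \<in> V_h T k \<and>
     (\<forall>q \<in> Q_h T (k + 1). a_MDG \<alpha> T \<eta> p q + b_MDG T q u = F q) \<and> (\<forall>v \<in> V_h T k. b_MDG T p v = G v)" for p u
    unfolding MDG_solution_def ..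
  obtain p0 u0 where s0: "MDG_solution \<alpha> T \<eta> k F G p0 u0" using S.solve[OF F' G'] unfolding sol by blast
  show "\<exists>!w. MDG_solution \<alpha> T \<eta> k F G (fst w) (snd w)"
  proof (rule ex1I[of _ "(p0, u0)"])
    fix w assume w: "MDG_solution \<alpha> T \<eta> k F G (fst w) (snd w)"
    have "fst w = p0 \<and> snd w = u0"
      using w s0 unfolding sol by (intro S.uniqueness[of _ _ _ _ F G]) auto
    then show "w = (p0, u0)" by (simp add: prod_eq_iff)
  qed (use s0 in simp)
  have Nn: "norm_MDG \<alpha> T \<eta> q = S.N q" for q
    unfolding norm_MDG_def S.N_def a_MDG_def by (simp add: add_ac)
  have Mn: "L2_norm_on \<Omega> v = S.M v" if "v \<in> V_h T k" for v
    unfolding S.M_def by (rule V_h_square_integral(2)[OF that])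
  define Fn where "Fn = dual_norm (Q_h T (k + 1)) (norm_MDG \<alpha> T \<eta>) F"
  define Gn where "Gn = dual_norm (V_h T k) (L2_norm_on \<Omega>) G"
  have NF: "norm_MDG \<alpha> T \<eta> q = sqrt (a_MDG \<alpha> T \<eta> q q + mesh_inner T (div_h T q) (div_h T q))" for q
    unfolding Nn S.N_def ..
  note dF = dual_norm_bound[OF S.Q graph_form F' NF nontrivial_spaces(2), folded Fn_def]
  have dG1: "\<bar>G v\<bar> \<le> Gn * L2_norm_on \<Omega> v" if v: "v \<in> V_h T k" for v
    unfolding Gn_def by (rule dual_norm_bound(1)[OF S.V psd_m definite_m G' V_h_square_integral(2) nontrivial_spaces(1) v])
  have dG2: "0 \<le> Gn"
    unfolding Gn_def by (rule dual_norm_bound(2)[OF S.V psd_m definite_m G' V_h_square_integral(2) nontrivial_spaces(1)])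
  assume "MDG_solution \<alpha> T \<eta> k F G p u"
  then have pu: "p \<in> Q_h T (k + 1)" "u \<in> V_h T k"
    "\<And>q. q \<in> Q_h T (k + 1) \<Longrightarrow> a_MDG \<alpha> T \<eta> p q + b_MDG T q u = F q" "\<And>v. v \<in> V_h T k \<Longrightarrow> b_MDG T p v = G v"
    unfolding sol by blast+
  have "S.N p + S.M u \<le> 100 * Cstab ^ 6 * (Fn + Gn)"
  proof (rule S.a_priori_bound[OF pu])
    show "\<bar>F q\<bar> \<le> Fn * S.N q" if "q \<in> Q_h T (k + 1)" for q using dF(1)[OF that] unfolding Nn .
    show "\<bar>G v\<bar> \<le> Gn * S.M v" if "v \<in> V_h T k" for v using dG1[OF that] unfolding Mn[OF that] .
  qed (assumption | rule dF(2) dG2)+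
  then show "norm_MDG \<alpha> T \<eta> p + L2_norm_on \<Omega> u \<le> 100 * Cstab ^ 6 * (dual_norm (Q_h T (k + 1)) (norm_MDG \<alpha> T \<eta>) F + dual_norm (V_h T k) (L2_norm_on \<Omega>) G)"
    unfolding Nn Mn[OF pu(2)] Fn_def Gn_def .
qed

end

text \<open>By the inequality \<open>\<bar>f v\<bar> \<le> f\<^sup>2 + v\<^sup>2\<close> the load is integrable against discrete functions, so that its
  integral is additive.\<close>
lemma linear_functional_load:
  assumes f: "square_integrable_on \<Omega> f"
  shows "linear_functional_on (V_h T k) (\<lambda>v. - (LINT x|lebesgue_on \<Omega>. f x * v x))"
proof -
  have fm: "f \<in> borel_measurable (lebesgue_on \<Omega>)" and f2: "integrable (lebesgue_on \<Omega>) (\<lambda>x. (f x)\<^sup>2)"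
    using f by (auto simp: square_integrable_on_def)
  have int: "integrable (lebesgue_on \<Omega>) (\<lambda>x. f x * v x)" if v: "v \<in> V_h T k" for v
  proof (rule Bochner_Integration.integrable_bound)
    have vl: "integrable lebesgue (\<lambda>x. (v x)\<^sup>2)" 
      using V_h_square_integral(1)[OF v] borel_measurable_integrable[OF V_h_square_integral(1)[OF v]]
      by (simp add: integrable_completion)
    have "\<Omega> \<in> sets lebesgue" using \<Omega>(1) by simp
    then have "integrable (lebesgue_on \<Omega>) (\<lambda>x. (v x)\<^sup>2)"
      using integrable_mult_indicator[OF _ vl, of \<Omega>] by (simp add: integrable_restrict_space)
    then show "integrable (lebesgue_on \<Omega>) (\<lambda>x. (f x)\<^sup>2 + (v x)\<^sup>2)"
      by (rule Bochner_Integration.integrable_add[OF f2])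
    have "v \<in> borel_measurable (lebesgue_on \<Omega>)"
      using measurable_V_h[OF v] by (intro measurable_restrict_space1 measurable_completion) simp
    then show "(\<lambda>x. f x * v x) \<in> borel_measurable (lebesgue_on \<Omega>)" using fm by (rule borel_measurable_times[rotated])
    have "\<bar>f x * v x\<bar> \<le> (f x)\<^sup>2 + (v x)\<^sup>2" for x
    proof -
      have "0 \<le> \<bar>f x\<bar> * \<bar>v x\<bar>" by simp
      moreover have "2 * (\<bar>f x\<bar> * \<bar>v x\<bar>) \<le> (f x)\<^sup>2 + (v x)\<^sup>2"
        using sum_squares_bound[of "\<bar>f x\<bar>" "\<bar>v x\<bar>"] by (simp only: mult.assoc power2_abs)
      ultimately show ?thesis unfolding abs_mult by linarith
    qed
    then show "AE x in lebesgue_on \<Omega>. norm (f x * v x) \<le> norm ((f x)\<^sup>2 + (v x)\<^sup>2)" by (intro AE_I2) simp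
  qed
  show ?thesis
    unfolding linear_functional_on_def
  proof (intro conjI ballI allI)
    fix g h assume gh: "g \<in> V_h T k" "h \<in> V_h T k"
    show "- (LINT x|lebesgue_on \<Omega>. f x * (g x + h x)) = - (LINT x|lebesgue_on \<Omega>. f x * g x) + - (LINT x|lebesgue_on \<Omega>. f x * h x)"
      unfolding distrib_left by (simp add: Bochner_Integration.integral_add int gh)
  next
    fix r g
    show "- (LINT x|lebesgue_on \<Omega>. f x * (r *\<^sub>R g x)) = r * - (LINT x|lebesgue_on \<Omega>. f x * g x)"
      by (simp add: mult.left_commute)
  qed
qed

end

theorem theorem6p4:
  fixes \<Omega> :: "(real ^ 'd) set" and \<alpha> :: "real ^ 'd \<Rightarrow> real ^ 'd ^ 'd"
    and k :: nat and \<sigma> \<eta>\<^sub>0 \<eta>\<^sub>1 :: real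
  assumes "CARD('d) \<ge> 2"
    and "polytopal_lipschitz_domain \<Omega>"
    and "admissible_coefficient \<Omega> \<alpha>"
    and "0 < \<eta>\<^sub>0"
  shows "\<exists>C>0. \<forall>T \<eta>.
    conforming_mesh \<Omega> T \<and> shape_regular \<sigma> T \<and>
    (\<forall>e \<in> interior_faces T. \<eta>\<^sub>0 \<le> \<eta> e \<and> \<eta> e \<le> \<eta>\<^sub>1) \<longrightarrow>
      (\<forall>F G. linear_functional_on (Q_h T (k + 1)) F \<and> linear_functional_on (V_h T k) G \<longrightarrow>
        (\<exists>!w. MDG_solution \<alpha> T \<eta> k F G (fst w) (snd w)) \<and>
        (\<forall>p u. MDG_solution \<alpha> T \<eta> k F G p u \<longrightarrow>
          norm_MDG \<alpha> T \<eta> p + L2_norm_on \<Omega> u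
            \<le> C * (dual_norm (Q_h T (k + 1)) (norm_MDG \<alpha> T \<eta>) F
                   + dual_norm (V_h T k) (L2_norm_on \<Omega>) G))) \<and>
      (\<forall>f. square_integrable_on \<Omega> f \<longrightarrow>
        (\<exists>!w. MDG_solution \<alpha> T \<eta> k (\<lambda>q. 0) (\<lambda>v. - (LINT x|lebesgue_on \<Omega>. f x * v x))
                (fst w) (snd w)))"
proof -
  define s where "s = 4 * \<bar>\<sigma>\<bar> + 1"
  have s1: "s \<ge> 1" by (simp add: s_def)
  have \<Omega>: "open \<Omega>" "\<Omega> \<noteq> {}" "bounded \<Omega>" "lipschitz_boundary \<Omega>"
    using assms(2) by (auto simp: polytopal_lipschitz_domain_def)
  obtain a0 where a0: "a0 > 0" "\<And>x \<xi>. x \<in> \<Omega> \<Longrightarrow> a0 * (norm \<xi>)\<^sup>2 \<le> \<xi> \<bullet> (\<alpha> x *v \<xi>)"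
    using assms(3) unfolding admissible_coefficient_def by blast
  obtain B where B: "B > 0" "\<And>x. x \<in> \<Omega> \<Longrightarrow> norm (\<alpha> x) \<le> B"
    using assms(3) unfolding admissible_coefficient_def bounded_pos by auto
  define M where "M = CARD('d) * B"
  have M: "M > 0" using B(1) by (simp add: M_def)
  have \<alpha>M: "norm (\<alpha> x *v \<xi>) \<le> M * norm \<xi>" if "x \<in> \<Omega>" for x \<xi>
  proof -
    have "norm (\<alpha> x *v \<xi>) \<le> CARD('d) * norm (\<alpha> x) * norm \<xi>" by (rule norm_matrix_vector_le)
    also have "\<dots> \<le> CARD('d) * B * norm \<xi>" using B(2)[OF that] by (intro mult_right_mono mult_left_mono) auto
    finally show ?thesis by (simp add: M_def)
  qed
  have "bounded (closure \<Omega>)" using \<Omega>(3) by (rule bounded_closure)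
  then obtain R where R: "R > 0" "closure \<Omega> \<subseteq> cball 0 R" unfolding bounded_pos by (auto simp: subset_iff)
  obtain Ct where Ct: "Ct \<ge> 0" "\<And>(K :: (real ^ 'd) set) a P. regular s K \<Longrightarrow> a \<in> verts K \<Longrightarrow> polynomial_deg_le k P \<Longrightarrow>
    diameter K * (LINT x|face_measure (opp_face K a). (P x)\<^sup>2) \<le> Ct * (LINT x:K|lborel. (P x)\<^sup>2)"
    using trace_inequality[of s k] by blast
  \<comment> \<open>The weight that \<open>stable_field\<close> requires of the local construction.\<close>
  have "1 / (4 * s) > 0" using s1 by simp
  from element_field[where 'd='d and k=k, OF this s1] obtain Cf where Cf: "Cf \<ge> 0"
     "\<And>(K :: (real ^ 'd) set) w \<rho>. regular s K \<Longrightarrow> polynomial_deg_le k w \<Longrightarrow>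
     (\<forall>a\<in>verts K. polynomial_deg_le k (\<rho> a)) \<Longrightarrow>
     (\<exists>q. poly_field (k + 1) q \<and>
        (\<forall>a\<in>verts K. \<forall>x\<in>opp_face K a. q x \<bullet> nrm K a = \<rho> a x) \<and>
        (LINT x:K|lborel. (norm (q x))\<^sup>2) \<le> Cf * ((LINT x:K|lborel. (norm (grad w x))\<^sup>2) +
            (\<Sum>a\<in>verts K. diameter K * (LINT x|face_measure (opp_face K a). (\<rho> a x)\<^sup>2))) \<and>
        (LINT x:K|lborel. (norm (grad w x))\<^sup>2)
          - (\<Sum>a\<in>verts K. LINT x|face_measure (opp_face K a). \<rho> a x * w x)
          - 1 / (4 * s) * (\<Sum>a\<in>verts K. diameter K * (LINT x|face_measure (opp_face K a). (\<rho> a x)\<^sup>2))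
        \<le> - (LINT x:K|lborel. dvg q x * w x))"
    by blast
  define C where "C = 1 + 4 * s * Cf / a0 + 32 * R\<^sup>2 * (real (CARD('d) + 1) * Ct + 1) + 2 * sqrt (real (CARD('d) + 1) * Ct / \<eta>\<^sub>0)"
  have "0 \<le> 4 * s * Cf / a0" "0 \<le> 32 * R\<^sup>2 * (real (CARD('d) + 1) * Ct + 1)" "0 \<le> 2 * sqrt (real (CARD('d) + 1) * Ct / \<eta>\<^sub>0)"
    using s1 Cf(1) a0(1) Ct(1) assms(4) by (auto intro!: mult_nonneg_nonneg divide_nonneg_nonneg add_nonneg_nonneg)
  then have C: "1 \<le> C" "4 * s * Cf / a0 \<le> C" "32 * R\<^sup>2 * (real (CARD('d) + 1) * Ct + 1) \<le> C"
    "2 * sqrt (real (CARD('d) + 1) * Ct / \<eta>\<^sub>0) \<le> C" unfolding C_def by linarith+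
  show ?thesis
  proof (rule exI[of _ "100 * C ^ 6"], intro conjI allI impI)
    show "0 < 100 * C ^ 6" using C(1) by simp
  next
    fix T :: "(real ^ 'd) set set" and \<eta> :: "(real ^ 'd) set \<Rightarrow> real"
    assume *: "conforming_mesh \<Omega> T \<and> shape_regular \<sigma> T \<and> (\<forall>e \<in> interior_faces T. \<eta>\<^sub>0 \<le> \<eta> e \<and> \<eta> e \<le> \<eta>\<^sub>1)"
    have mesh: "triangulation T" "\<And>K. K \<in> T \<Longrightarrow> int CARD('d) simplex K" "\<Union>T = closure \<Omega>"
      using * by (auto simp: conforming_mesh_def)
    have reg: "regular s K" if "K \<in> T" for K
      unfolding s_def using * that by (intro shape_regular_imp_regular mesh(2)) (auto simp: shape_regular_def)
    have sub: "interior K \<subseteq> \<Omega>" if "K \<in> T" for K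
      using interior_mono[of K "closure \<Omega>"] mesh(3) that interior_closure_lipschitz[OF \<Omega>(1,4)] by blast
    have nonempty: "T \<noteq> {}"
    proof
      assume "T = {}"
      then have "closure \<Omega> = {}" using mesh(3) by simp
      then show False using \<Omega>(2) by simp
    qed
    have \<eta>: "\<eta>\<^sub>0 \<le> \<eta> e" if "e \<in> interior_faces T" for e using * that by blast
    have \<alpha>: "\<alpha> \<in> borel_measurable (lebesgue_on \<Omega>)" "transpose (\<alpha> x) = \<alpha> x" if "x \<in> \<Omega>" for x
      using assms(3) that unfolding admissible_coefficient_def by blast+
    have \<alpha>m: "\<alpha> \<in> borel_measurable (lebesgue_on \<Omega>)"
      using assms(3) unfolding admissible_coefficient_def by blast
    interpret X: mdg_mesh T s \<Omega> \<alpha> \<eta> a0 M \<eta>\<^sub>0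
      by (rule mdg_mesh.intro, rule regular_mesh.intro[OF mesh(1) reg assms(1) s1], assumption,
          rule mdg_mesh_axioms.intro[OF \<Omega>(1) sub nonempty \<alpha>m \<alpha>(2) a0 M \<alpha>M assms(4) \<eta>])
    have RT: "K \<subseteq> cball 0 R" if "K \<in> T" for K using that mesh(3) R(2) by blast
    have R0: "R \<ge> 0" using R(1) by simp
    note WP = X.MDG_well_posed[OF Ct Cf R0 RT C]
    {
      fix F G assume FG: "linear_functional_on (Q_h T (k + 1)) F \<and> linear_functional_on (V_h T k) G"
      show "\<exists>!w. MDG_solution \<alpha> T \<eta> k F G (fst w) (snd w)" using WP(1) FG by blast
      fix p u assume "MDG_solution \<alpha> T \<eta> k F G p u"
      then show "norm_MDG \<alpha> T \<eta> p + L2_norm_on \<Omega> u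
            \<le> 100 * C ^ 6 * (dual_norm (Q_h T (k + 1)) (norm_MDG \<alpha> T \<eta>) F
                   + dual_norm (V_h T k) (L2_norm_on \<Omega>) G)" using WP(2) FG by blast
    }
    fix f assume "square_integrable_on \<Omega> f"
    then show "\<exists>!w. MDG_solution \<alpha> T \<eta> k (\<lambda>q. 0) (\<lambda>v. - (LINT x|lebesgue_on \<Omega>. f x * v x)) (fst w) (snd w)"
      by (intro WP(1) X.linear_functional_load) (simp_all add: linear_functional_on_def)
  qed
qed

end
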